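(* Let $\alpha\in(0,1)$, $b_1,b_2\in(0,\infty)$, $d>b_1+b_2$, and $\gamma_1\in\mathbb{R}$. Let $F=(F_1,F_2)$ be the functional defined in the context. Then there exists $\varepsilon_0>0$ such that the following hold. (1) There is a unique $C^1$ function $g=(U,\gamma_2,f_1,f_2):[-\varepsilon_0,\varepsilon_0]\to\mathbb{R}\times\mathbb{R}\times B_1$ such that $$F\big(\varepsilon,U(\varepsilon),\gamma_2(\varepsilon),f_1(\varepsilon),f_2(\varepsilon)\big)=0\quad\text{for all }\varepsilon\in[-\varepsilon_0,\varepsilon_0],\qquad \big(U(0),\gamma_2(0),f_1(0),f_2(0)\big)=\Big(\frac{\gamma_1}{2d},\gamma_1,0,0\Big).$$ (2) If $(\varepsilon,f_1,f_2)$ is a solution (that is, $F(\varepsilon,U,\gamma_2,f_1,f_2)=0$), then $(-\varepsilon,\tilde f_1,\tilde f_2)$ is also a solution (that is, $F(-\varepsilon,U,\gamma_2,\tilde f_1,\tilde f_2)=0$, with the same $U,\gamma_2$), where $\tilde f_j(w)=f_j(-w)$ for all $w\in\mathbb{T}$, $j=1,2$. (3) For all $\varepsilon\in[-\varepsilon_0,\varepsilon_0]\setminus\{0\}$, the domains $D_1^\varepsilon$ and $D_2^\varepsilon$ are strictly convex, where $D_j^\varepsilon$ is the bounded domain enclosed by the Jordan curve $\phi_j(\mathbb{T})$, $\phi_j(w)=w+\varepsilon b_jf_j(\varepsilon)(w)$.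
   Context: $\mathbb{T}$ is the unit circle and $\fint_{\mathbb{T}}h(\tau)\,d\tau=\frac{1}{2i\pi}\int_{\mathbb{T}}h(\tau)\,d\tau$ (complex line integral). $C^{\alpha}(\mathbb{T})$ and $C^{1+\alpha}(\mathbb{T})$ are the usual Hölder spaces, with $\|f\|_{C^{1+\alpha}}=\|f\|_{L^\infty}+\|f'\|_{C^\alpha}$, where $f'=\frac{df}{dw}$. Let $$X=\Big\{f=(f_1,f_2)\in (C^{1+\alpha}(\mathbb{T}))^2:\ f(w)=\sum_{n\ge1}A_n\overline w^n,\ A_n\in\mathbb{R}^2\Big\},$$ $$Y=\Big\{g\in(C^\alpha(\mathbb{T}))^2:\ g(w)=\sum_{n\ge1}C_n\,\mathrm{Im}\{w^n\},\ C_n\in\mathbb{R}^2\Big\},$$ and let $B_1$ be the open unit ball of $X$ centered at zero. The functional $F=(F_1,F_2)$ takes values in $Y$. For $\varepsilon\in(-\frac12,\frac12)$, $U,\gamma_2\in\mathbb{R}$, $(f_1,f_2)\in B_1$, $w\in\mathbb{T}$ and $j\in\{1,2\}$, set $A=\tau-w$, $B_j=f_j(\tau)-f_j(w)$ and $$F_j(\varepsilon,U,\gamma_2,f_1,f_2)(w)=\mathrm{Im}\Big\{2Uw(1+\varepsilon b_jf_j'(w))-\gamma_jf_j'(w)$$ $$+\varepsilon b_j\gamma_jw(1+\varepsilon b_jf_j'(w))\fint_{\mathbb{T}}\frac{A\overline{B_j}-\overline AB_j}{A(A+\varepsilon b_jB_j)}\Big[f_j'(\tau)-\frac{B_j}{A}\Big]d\tau$$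 $$+\gamma_{3-j}w(1+\varepsilon b_jf_j'(w))\fint_{\mathbb{T}}\frac{(\overline\tau+\varepsilon b_{3-j}\overline{f_{3-j}(\tau)})(1+\varepsilon b_{3-j}f_{3-j}'(\tau))}{\varepsilon(b_{3-j}\tau+b_jw)+\varepsilon^2(b_{3-j}^2f_{3-j}(\tau)+b_j^2f_j(w))-d}\,d\tau\Big\}.$$ (The equation $F=0$ expresses that the vorticity $\frac{\gamma_1}{\varepsilon^2b_1^2}\chi_{\varepsilon b_1D_1^\varepsilon}-\frac{\gamma_2}{\varepsilon^2b_2^2}\chi_{-\varepsilon b_2D_2^\varepsilon+d}$ translates rigidly for the 2D Euler equations in the vertical direction with speed $U$.)
   Formalization: Uniqueness in (1) is asserted only for γ₁≠0: for γ₁=0 it is false, as F(ε,0,0,f₁,f₂)=0 for all f₁,f₂, so any C¹ curve in B₁ with f(0)=0 qualifies; existence and (2) hold for all γ₁, and (3) is stated for the branch found. *)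

theory Defs
  imports "HOL-Complex_Analysis.Complex_Analysis"
begin

abbreviation circ :: "complex set" where
  "circ \<equiv> sphere 0 1"

(* The derivative df/dw along the unit circle: no point of the circle is isolated, so the
   limit of difference quotients taken within the circle is unique whenever it exists.  Only the
   values of f on the circle matter. *)
definition circle_deriv :: "(complex \<Rightarrow> complex) \<Rightarrow> complex \<Rightarrow> complex" where
  "circle_deriv f w = (THE D. (f has_field_derivative D) (at w within circ))"

definition circle_mean :: "(complex \<Rightarrow> complex) \<Rightarrow> complex" where
  "circle_mean h = contour_integral (circlepath 0 1) h / (2 * of_real pi * \<i>)"


definition holder_quotients :: "real \<Rightarrow> (complex \<Rightarrow> complex) \<Rightarrow> real set" where
  "holder_quotients \<alpha> f =
     {norm (f x - f y) / norm (x - y) powr \<alpha> | x y. x \<in> circ \<and> y \<in> circ \<and> x \<noteq> y}"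

definition holder_space :: "real \<Rightarrow> (complex \<Rightarrow> complex) set" where
  "holder_space \<alpha> = {f. continuous_on circ f \<and> bdd_above (holder_quotients \<alpha> f)}"

definition sup_norm :: "(complex \<Rightarrow> complex) \<Rightarrow> real" where
  "sup_norm f = (SUP w\<in>circ. norm (f w))"

definition holder_norm :: "real \<Rightarrow> (complex \<Rightarrow> complex) \<Rightarrow> real" where
  "holder_norm \<alpha> f = sup_norm f + Sup (holder_quotients \<alpha> f)"

definition holder1_space :: "real \<Rightarrow> (complex \<Rightarrow> complex) set" where
  "holder1_space \<alpha> =
     {f. (\<forall>w\<in>circ. f field_differentiable (at w within circ)) \<and> circle_deriv f \<in> holder_space \<alpha>}"

definition holder1_norm :: "real \<Rightarrow> (complex \<Rightarrow> complex) \<Rightarrow> real" where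
  "holder1_norm \<alpha> f = sup_norm f + holder_norm \<alpha> (circle_deriv f)"


(* Functions are defined on all of the complex plane, but only their restrictions to the circle
   are meant; elements of the space that agree on the circle are to be identified. *)
definition X_component :: "real \<Rightarrow> (complex \<Rightarrow> complex) set" where
  "X_component \<alpha> = {f \<in> holder1_space \<alpha>. \<exists>A :: nat \<Rightarrow> real. \<forall>w\<in>circ.
     (\<lambda>n. of_real (A (Suc n)) * cnj w ^ Suc n) sums f w}"

definition X_space :: "real \<Rightarrow> ((complex \<Rightarrow> complex) \<times> (complex \<Rightarrow> complex)) set" where
  "X_space \<alpha> = X_component \<alpha> \<times> X_component \<alpha>"

(* The product carries the maximum norm. *)
definition X_norm :: "real \<Rightarrow> (complex \<Rightarrow> complex) \<times> (complex \<Rightarrow> complex) \<Rightarrow> real" where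
  "X_norm \<alpha> f = max (holder1_norm \<alpha> (fst f)) (holder1_norm \<alpha> (snd f))"

definition X_unit_ball :: "real \<Rightarrow> ((complex \<Rightarrow> complex) \<times> (complex \<Rightarrow> complex)) set" where
  "X_unit_ball \<alpha> = {f \<in> X_space \<alpha>. X_norm \<alpha> f < 1}"

definition pair_diff ::
  "(complex \<Rightarrow> complex) \<times> (complex \<Rightarrow> complex) \<Rightarrow> (complex \<Rightarrow> complex) \<times> (complex \<Rightarrow> complex)
    \<Rightarrow> (complex \<Rightarrow> complex) \<times> (complex \<Rightarrow> complex)" where
  "pair_diff f g = (\<lambda>w. fst f w - fst g w, \<lambda>w. snd f w - snd g w)"

definition pair_scale ::
  "real \<Rightarrow> (complex \<Rightarrow> complex) \<times> (complex \<Rightarrow> complex) \<Rightarrow> (complex \<Rightarrow> complex) \<times> (complex \<Rightarrow> complex)"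
  where
  "pair_scale c f = (\<lambda>w. of_real c * fst f w, \<lambda>w. of_real c * snd f w)"

(* Continuously differentiable curves; at the end points of I the derivatives are one-sided. *)
definition C1_real_on :: "real set \<Rightarrow> (real \<Rightarrow> real) \<Rightarrow> bool" where
  "C1_real_on I u \<longleftrightarrow>
     (\<exists>u'. (\<forall>s\<in>I. (u has_real_derivative u' s) (at s within I)) \<and> continuous_on I u')"

definition C1_X_on ::
  "real \<Rightarrow> real set \<Rightarrow> (real \<Rightarrow> (complex \<Rightarrow> complex) \<times> (complex \<Rightarrow> complex)) \<Rightarrow> bool" where
  "C1_X_on \<alpha> I f \<longleftrightarrow> (\<forall>s\<in>I. f s \<in> X_space \<alpha>) \<and>
     (\<exists>f'. (\<forall>s\<in>I. f' s \<in> X_space \<alpha>) \<and>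
        (\<forall>s\<in>I. ((\<lambda>t. X_norm \<alpha>
            (pair_diff (pair_scale (1 / (t - s)) (pair_diff (f t) (f s))) (f' s))) \<longlongrightarrow> 0)
            (at s within I)) \<and>
        (\<forall>s\<in>I. ((\<lambda>t. X_norm \<alpha> (pair_diff (f' t) (f' s))) \<longlongrightarrow> 0) (at s within I)))"


(* The component F_j.  The parameters with suffix j belong to the index j, those with suffix k to
   the other index 3 - j.  At t = w the first integrand is irrelevant. *)
definition F_component ::
  "real \<Rightarrow> real \<Rightarrow> real \<Rightarrow> real \<Rightarrow> real \<Rightarrow> real \<Rightarrow> real
    \<Rightarrow> (complex \<Rightarrow> complex) \<Rightarrow> (complex \<Rightarrow> complex) \<Rightarrow> complex \<Rightarrow> real" where
  "F_component d \<epsilon> U bj bk \<gamma>j \<gamma>k fj fk w = Im (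
     2 * of_real U * w * (1 + of_real \<epsilon> * of_real bj * circle_deriv fj w)
       - of_real \<gamma>j * circle_deriv fj w
     + of_real \<epsilon> * of_real bj * of_real \<gamma>j * w
         * (1 + of_real \<epsilon> * of_real bj * circle_deriv fj w)
         * circle_mean (\<lambda>t. let A = t - w; B = fj t - fj w in
             (A * cnj B - cnj A * B) / (A * (A + of_real \<epsilon> * of_real bj * B))
               * (circle_deriv fj t - B / A))
     + of_real \<gamma>k * w * (1 + of_real \<epsilon> * of_real bj * circle_deriv fj w)
         * circle_mean (\<lambda>t.
             (cnj t + of_real \<epsilon> * of_real bk * cnj (fk t))
               * (1 + of_real \<epsilon> * of_real bk * circle_deriv fk t)
             / (of_real \<epsilon> * (of_real bk * t + of_real bj * w)
                + of_real \<epsilon> ^ 2 * (of_real bk ^ 2 * fk t + of_real bj ^ 2 * fj w)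
                - of_real d)))"

definition F1 ::
  "real \<Rightarrow> real \<Rightarrow> real \<Rightarrow> real \<Rightarrow> real \<Rightarrow> real \<Rightarrow> real
    \<Rightarrow> (complex \<Rightarrow> complex) \<times> (complex \<Rightarrow> complex) \<Rightarrow> complex \<Rightarrow> real" where
  "F1 d b1 b2 \<gamma>1 \<epsilon> U \<gamma>2 f = F_component d \<epsilon> U b1 b2 \<gamma>1 \<gamma>2 (fst f) (snd f)"

definition F2 ::
  "real \<Rightarrow> real \<Rightarrow> real \<Rightarrow> real \<Rightarrow> real \<Rightarrow> real \<Rightarrow> real
    \<Rightarrow> (complex \<Rightarrow> complex) \<times> (complex \<Rightarrow> complex) \<Rightarrow> complex \<Rightarrow> real" where
  "F2 d b1 b2 \<gamma>1 \<epsilon> U \<gamma>2 f = F_component d \<epsilon> U b2 b1 \<gamma>2 \<gamma>1 (snd f) (fst f)"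

definition F_zero ::
  "real \<Rightarrow> real \<Rightarrow> real \<Rightarrow> real \<Rightarrow> real \<Rightarrow> real \<Rightarrow> real
    \<Rightarrow> (complex \<Rightarrow> complex) \<times> (complex \<Rightarrow> complex) \<Rightarrow> bool" where
  "F_zero d b1 b2 \<gamma>1 \<epsilon> U \<gamma>2 f \<longleftrightarrow>
     (\<forall>w\<in>circ. F1 d b1 b2 \<gamma>1 \<epsilon> U \<gamma>2 f w = 0 \<and> F2 d b1 b2 \<gamma>1 \<epsilon> U \<gamma>2 f w = 0)"

definition solution_branch ::
  "real \<Rightarrow> real \<Rightarrow> real \<Rightarrow> real \<Rightarrow> real \<Rightarrow> real set
    \<Rightarrow> (real \<Rightarrow> real) \<Rightarrow> (real \<Rightarrow> real) \<Rightarrow> (real \<Rightarrow> (complex \<Rightarrow> complex) \<times> (complex \<Rightarrow> complex)) \<Rightarrow> bool" where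
  "solution_branch \<alpha> d b1 b2 \<gamma>1 I U \<gamma>2 f \<longleftrightarrow>
     C1_real_on I U \<and> C1_real_on I \<gamma>2 \<and> C1_X_on \<alpha> I f \<and>
     (\<forall>\<epsilon>\<in>I. f \<epsilon> \<in> X_unit_ball \<alpha>) \<and>
     (\<forall>\<epsilon>\<in>I. F_zero d b1 b2 \<gamma>1 \<epsilon> (U \<epsilon>) (\<gamma>2 \<epsilon>) (f \<epsilon>)) \<and>
     U 0 = \<gamma>1 / (2 * d) \<and> \<gamma>2 0 = \<gamma>1 \<and> (\<forall>w\<in>circ. fst (f 0) w = 0 \<and> snd (f 0) w = 0)"


definition boundary_map :: "real \<Rightarrow> real \<Rightarrow> (complex \<Rightarrow> complex) \<Rightarrow> complex \<Rightarrow> complex" where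
  "boundary_map \<epsilon> b f w = w + of_real \<epsilon> * of_real b * f w"

definition strictly_convex :: "complex set \<Rightarrow> bool" where
  "strictly_convex D \<longleftrightarrow>
     (\<forall>x\<in>closure D. \<forall>y\<in>closure D. x \<noteq> y \<longrightarrow> open_segment x y \<subseteq> interior D)"

(* The bounded domain enclosed by a Jordan curve J is inside J; the first two conjuncts state that
   the image of the circle is indeed a Jordan curve. *)
definition encloses_strictly_convex :: "(complex \<Rightarrow> complex) \<Rightarrow> bool" where
  "encloses_strictly_convex \<phi> \<longleftrightarrow>
     continuous_on circ \<phi> \<and> inj_on \<phi> circ \<and> strictly_convex (inside (\<phi> ` circ))"

end

theory Submission
  imports Defs
begin

text \<open>
  \<^emph>\<open>Existence.\<close>  Since $F$ is homogeneous in $(U, \gamma_1, \gamma_2)$, take $\gamma_1 = 1$.  The unknowns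
  are power series in the parameter whose coefficients are trigonometric series in $w$, that is, elements of
  exponentially weighted $\ell^1$ convolution algebras.  There the Cauchy integral is the extraction of a residue,
  division is a Neumann series, and $\overline A / A = -1/(\tau w)$ on the circle, so that $F$ is a small
  perturbation of an explicitly invertible linear map plus the quadratic term $(1 - \gamma_2) f_2'$, and a quasi-Newton
  iteration contracts.

  \<^emph>\<open>Uniqueness\<close> holds for each fixed small parameter in the whole unit ball.  Up to a remainder of size
  $\varepsilon$ that is Lipschitz in the $L^2$ norm of $(f_1', f_2')$, the equation reads
  $\mathrm{Im}\{(2U - \gamma_{3-j}/d) w - \gamma_j f_j'\} = 0$.  The mode $\sin\theta$ determines $U$ and $\gamma_2$,
  because $f_j'$ has only the modes $\overline w^n$ with $n \ge 2$, and for the same reason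
  $\int (\mathrm{Im} f_j')^2 = \frac12 \int |f_j'|^2$.  As the expansion of $f_j$ is only known to converge
  pointwise, its coefficients are identified with Fourier coefficients by Riemann's summation method.

  \<^emph>\<open>Convexity.\<close>  The boundary map extends to the closed disc as a small perturbation of the identity.  The image
  of a point of a chord from $a$ to $b$ misses the chord between the images by a small multiple of
  $t(1-t)|a-b|^2$, while the disc contains a ball of radius $t(1-t)|a-b|^2/2$ around that point.
\<close>

text \<open>An implicit function theorem for F between X and Y would need differentiability of
  singular integrals in Hoelder spaces. Existence is obtained in a smaller algebra instead: its
  elements are analytic across the circle, and the power of the parameter variable s is one of the
  indices. One fixed point is then a whole curve, and its C^1 dependence on the parameter is
  termwise differentiation of a power series.

  The price is that a contraction in this algebra says nothing about competitors, which are merely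
  points of the ball of X for each parameter and whose U and gamma_2 are arbitrary reals. Hence
  uniqueness needs its own argument, with an a priori bound on U and gamma_2. The L^2 norm of f' is
  the right weak norm: difference quotients of a function with derivative in L^2 have an integrable
  majorant, so the singular kernel is Lipschitz in it, and the leading part of the equation controls
  it through an exact identity. Uniqueness at parameter 0 also identifies the initial value of the
  constructed branch.\<close>

section \<open>Weighted l^1 spaces over commutative monoids\<close>

class weighted_monoid = comm_monoid_add +
  fixes wt :: "'a \<Rightarrow> real"
  assumes wt_zero [simp]: "wt 0 = 1"
    and wt_ge_1: "1 \<le> wt a"
    and wt_add: "wt (a + b) \<le> wt a * wt b"
begin

lemma wt_pos [simp]: "0 < wt a" and wt_nonneg [simp]: "0 \<le> wt a" and wt_neq_0 [simp]: "wt a \<noteq> 0"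
  using wt_ge_1[of a] by linarith+

end

text \<open>Exponential growth pays for the polynomial factors that derivatives produce: k^2 for
  second order remainders in the parameter (\<open>square_le_two_power\<close>), n + 2 for the
  Lipschitz bound of f' (\<open>norm_dser_diff\<close>), n + 1 for the convexity defect
  (\<open>disc_ext_defect\<close>).\<close>

instantiation nat :: weighted_monoid
begin
definition wt_nat :: "nat \<Rightarrow> real" where "wt_nat n = 2 ^ n"
instance by standard (simp_all add: wt_nat_def power_add)
end

instantiation int :: weighted_monoid
begin
definition wt_int :: "int \<Rightarrow> real" where "wt_int n = 2 ^ nat \<bar>n\<bar>"
instance
proof
  fix a b :: int
  have "nat \<bar>a + b\<bar> \<le> nat \<bar>a\<bar> + nat \<bar>b\<bar>" by linarith
  then show "wt (a + b) \<le> wt a * wt b"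
    unfolding wt_int_def power_add[symmetric] by (intro power_increasing) auto
qed (simp_all add: wt_int_def)
end

instantiation prod :: (weighted_monoid, weighted_monoid) weighted_monoid
begin
definition wt_prod :: "'a \<times> 'b \<Rightarrow> real" where "wt_prod p = wt (fst p) * wt (snd p)"
instance
proof
  fix a b :: "'a \<times> 'b"
  show "1 \<le> wt a"
    using mult_mono[of 1 "wt (fst a)" 1 "wt (snd a)"] by (simp add: wt_prod_def wt_ge_1)
  have "wt (fst a + fst b) * wt (snd a + snd b) \<le> (wt (fst a) * wt (fst b)) * (wt (snd a) * wt (snd b))"
    by (intro mult_mono wt_add) auto
  then show "wt (a + b) \<le> wt a * wt b"
    by (simp add: wt_prod_def algebra_simps)
qed (simp add: wt_prod_def)
end

lemma wt_Pair: "wt (a, b) = wt a * wt b"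
  by (simp add: wt_prod_def)

text \<open>A Beurling algebra: submultiplicativity of \<open>wt\<close> makes it closed under
  convolution. Entries are real because the A_n are; a series in w with real coefficients has an
  imaginary part on the circle that sees only the part odd in the exponent.\<close>

typedef (overloaded) 'g wl1 =
  "{f :: 'g::weighted_monoid \<Rightarrow> real. (\<lambda>g. wt g * \<bar>f g\<bar>) summable_on UNIV}"
  morphisms entry Abs_wl1
  by (rule exI[of _ "\<lambda>_. 0"]) simp

setup_lifting type_definition_wl1

lemma entry_summable: "(\<lambda>g. wt g * \<bar>entry a g\<bar>) summable_on UNIV"
  using entry[of a] by simp

lemma wl1_eqI: "(\<And>g. entry a g = entry b g) \<Longrightarrow> a = b"
  by (meson entry_inject ext)

instantiation wl1 :: (weighted_monoid) real_vector
begin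

lift_definition zero_wl1 :: "'a wl1" is "\<lambda>_. 0" by simp

lift_definition plus_wl1 :: "'a wl1 \<Rightarrow> 'a wl1 \<Rightarrow> 'a wl1" is "\<lambda>a b g. a g + b g"
proof -
  fix a b :: "'a \<Rightarrow> real"
  assume "(\<lambda>g. wt g * \<bar>a g\<bar>) summable_on UNIV" "(\<lambda>g. wt g * \<bar>b g\<bar>) summable_on UNIV"
  from summable_on_add[OF this]
  show "(\<lambda>g. wt g * \<bar>a g + b g\<bar>) summable_on UNIV"
    by (rule summable_on_comparison_test)
       (auto simp flip: distrib_left intro!: mult_left_mono)
qed

lift_definition scaleR_wl1 :: "real \<Rightarrow> 'a wl1 \<Rightarrow> 'a wl1" is "\<lambda>r a g. r * a g"
proof -
  fix r and a :: "'a \<Rightarrow> real"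
  assume "(\<lambda>g. wt g * \<bar>a g\<bar>) summable_on UNIV"
  from summable_on_cmult_right[OF this, of "\<bar>r\<bar>"]
  show "(\<lambda>g. wt g * \<bar>r * a g\<bar>) summable_on UNIV"
    by (simp add: abs_mult mult_ac)
qed

definition uminus_wl1 :: "'a wl1 \<Rightarrow> 'a wl1" where "uminus_wl1 a = (-1) *\<^sub>R a"
definition minus_wl1 :: "'a wl1 \<Rightarrow> 'a wl1 \<Rightarrow> 'a wl1" where "minus_wl1 a b = a + (-1) *\<^sub>R b"

lemma entry_simps [simp]:
  "entry 0 g = 0" "entry (a + b) g = entry a g + entry b g"
  "entry (r *\<^sub>R a) g = r * entry a g"
  "entry (- a) g = - entry a g" "entry (a - b) g = entry a g - entry b g"
  by (simp_all add: plus_wl1.rep_eq scaleR_wl1.rep_eq zero_wl1.rep_eq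
      uminus_wl1_def minus_wl1_def)

instance
  by standard (rule wl1_eqI; simp only: entry_simps; simp add: algebra_simps)+

end

instantiation wl1 :: (weighted_monoid) real_normed_vector
begin

definition norm_wl1 :: "'a wl1 \<Rightarrow> real" where "norm_wl1 a = (\<Sum>\<^sub>\<infinity>g. wt g * \<bar>entry a g\<bar>)"
definition dist_wl1 :: "'a wl1 \<Rightarrow> 'a wl1 \<Rightarrow> real" where "dist_wl1 a b = norm (a - b)"
definition sgn_wl1 :: "'a wl1 \<Rightarrow> 'a wl1" where "sgn_wl1 a = a /\<^sub>R norm a"
definition uniformity_wl1 :: "('a wl1 \<times> 'a wl1) filter" where
  "uniformity_wl1 = (INF e\<in>{0<..}. principal {(x, y). dist x y < e})"
definition open_wl1 :: "'a wl1 set \<Rightarrow> bool" where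
  "open_wl1 U = (\<forall>x\<in>U. \<forall>\<^sub>F (x', y) in uniformity. x' = x \<longrightarrow> y \<in> U)"

instance
proof
  fix a b :: "'a wl1" and r :: real
  show "norm a = 0 \<longleftrightarrow> a = 0"
  proof
    assume "norm a = 0"
    then have "wt g * \<bar>entry a g\<bar> = 0" for g
      using nonneg_infsum_le_0D[of "\<lambda>g. wt g * \<bar>entry a g\<bar>" UNIV g] entry_summable[of a]
      by (simp add: norm_wl1_def)
    then show "a = 0"
      by (intro wl1_eqI) simp
  qed (simp add: norm_wl1_def)
  show "norm (a + b) \<le> norm a + norm b"
    unfolding norm_wl1_def infsum_add[OF entry_summable entry_summable, symmetric]
    by (intro infsum_mono entry_summable summable_on_add)
       (auto simp flip: distrib_left intro!: mult_left_mono)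
  show "norm (r *\<^sub>R a) = \<bar>r\<bar> * norm a"
    unfolding norm_wl1_def infsum_cmult_right'[symmetric]
    by (simp add: abs_mult mult_ac)
qed (simp_all add: dist_wl1_def sgn_wl1_def uniformity_wl1_def open_wl1_def)

end

lemma sum_le_norm_wl1: "finite F \<Longrightarrow> (\<Sum>g\<in>F. wt g * \<bar>entry a g\<bar>) \<le> norm a"
  unfolding norm_wl1_def by (rule finite_sum_le_infsum[OF entry_summable]) auto

lemma entry_le_norm: "wt g * \<bar>entry a g\<bar> \<le> norm a"
  using sum_le_norm_wl1[of "{g}" a] by simp

lemma abs_entry_le_norm: "\<bar>entry a g\<bar> \<le> norm a"
  using entry_le_norm[of g a] mult_right_mono[OF wt_ge_1[of g], of "\<bar>entry a g\<bar>"] by simp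

lemma wl1_bounded_sums:
  assumes "\<And>F. finite F \<Longrightarrow> (\<Sum>g\<in>F. wt g * \<bar>c g\<bar>) \<le> C"
  shows "(\<lambda>g. wt g * \<bar>c g\<bar>) summable_on UNIV" and "(\<Sum>\<^sub>\<infinity>g. wt g * \<bar>c g\<bar>) \<le> C"
proof -
  show *: "(\<lambda>g. wt g * \<bar>c g\<bar>) summable_on UNIV"
    by (rule nonneg_bdd_above_summable_on) (auto intro!: bdd_aboveI2[where M=C] assms)
  show "(\<Sum>\<^sub>\<infinity>g. wt g * \<bar>c g\<bar>) \<le> C"
    by (rule infsum_le_finite_sums[OF *]) (auto intro: assms)
qed

text \<open>The limit is formed entry by entry; bounds on finite weighted sums survive it, as in
  Fatou's lemma, and control the infinite ones.\<close>

instance wl1 :: (weighted_monoid) banach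
proof
  fix X :: "nat \<Rightarrow> 'a wl1"
  assume X: "Cauchy X"
  have "Cauchy (\<lambda>n. entry (X n) g)" for g
  proof (rule CauchyI)
    fix e :: real assume "e > 0"
    then obtain M where "\<forall>m\<ge>M. \<forall>n\<ge>M. norm (X m - X n) < e" using CauchyD[OF X] by blast
    moreover have "norm (entry (X m) g - entry (X n) g) \<le> norm (X m - X n)" for m n
      using abs_entry_le_norm[of "X m - X n" g] by simp
    ultimately show "\<exists>M. \<forall>m\<ge>M. \<forall>n\<ge>M. norm (entry (X m) g - entry (X n) g) < e"
      by (meson le_less_trans)
  qed
  then obtain c where c: "\<And>g. (\<lambda>n. entry (X n) g) \<longlonglongrightarrow> c g"
    unfolding Cauchy_convergent_iff convergent_def by metis
  have close: "(\<Sum>g\<in>F. wt g * \<bar>entry (X m) g - c g\<bar>) \<le> e"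
    if M: "\<And>m n. m \<ge> M \<Longrightarrow> n \<ge> M \<Longrightarrow> norm (X m - X n) < e" and "m \<ge> M" "finite F" for e m M F
  proof (rule tendsto_upperbound[where F = sequentially])
    show "(\<lambda>n. \<Sum>g\<in>F. wt g * \<bar>entry (X m) g - entry (X n) g\<bar>)
        \<longlonglongrightarrow> (\<Sum>g\<in>F. wt g * \<bar>entry (X m) g - c g\<bar>)"
      by (intro tendsto_intros c)
    show "\<forall>\<^sub>F n in sequentially. (\<Sum>g\<in>F. wt g * \<bar>entry (X m) g - entry (X n) g\<bar>) \<le> e"
      using eventually_ge_at_top[of M]
    proof eventually_elim
      case (elim n)
      show ?case
        using sum_le_norm_wl1[OF \<open>finite F\<close>, of "X m - X n"] M[OF \<open>m \<ge> M\<close> elim] by simp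
    qed
  qed simp
  obtain M where M: "\<And>m n. m \<ge> M \<Longrightarrow> n \<ge> M \<Longrightarrow> norm (X m - X n) < 1"
    using CauchyD[OF X, of 1] by auto
  have diff: "(\<lambda>g. wt g * \<bar>entry (X M) g - c g\<bar>) summable_on UNIV"
    by (rule wl1_bounded_sums(1)[OF close[OF M order_refl]])
  \<comment> \<open>Summability is known for the difference between \<open>X M\<close> and the
    entrywise limit \<open>c\<close>, not yet for \<open>c\<close> itself, so the limit is presented
    as \<open>X M\<close> minus an element.\<close>
  define L where "L = X M - Abs_wl1 (\<lambda>g. entry (X M) g - c g)"
  have L: "entry L g = c g" for g
    using Abs_wl1_inverse[of "\<lambda>g. entry (X M) g - c g"] diff by (simp add: L_def)
  have "X \<longlonglongrightarrow> L"
  proof (rule LIMSEQ_I)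
    fix e :: real assume "e > 0"
    then obtain M where M: "\<And>m n. m \<ge> M \<Longrightarrow> n \<ge> M \<Longrightarrow> norm (X m - X n) < e / 2"
      using CauchyD[OF X, of "e / 2"] by auto
    have "norm (X m - L) < e" if "m \<ge> M" for m
    proof -
      have "norm (X m - L) \<le> e / 2"
        unfolding norm_wl1_def using close[OF M that]
        by (intro wl1_bounded_sums(2)) (simp add: L)
      then show ?thesis using \<open>e > 0\<close> by simp
    qed
    then show "\<exists>no. \<forall>n\<ge>no. norm (X n - L) < e" by blast
  qed
  then show "convergent X" by (auto simp: convergent_def)
qed

lift_definition delta :: "'g::weighted_monoid \<Rightarrow> 'g wl1" is "\<lambda>g h. if h = g then 1 else 0"
proof -
  fix g :: 'g
  show "(\<lambda>h. wt h * \<bar>if h = g then 1 else 0\<bar>) summable_on UNIV"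
    by (rule summable_on_cong_neutral[where S = "{g}", THEN iffD1]) auto
qed

lemma entry_delta: "entry (delta g) h = (if h = g then 1 else 0)"
  by (simp add: delta.rep_eq)

lemma norm_delta [simp]: "norm (delta g) = wt g"
proof -
  have "norm (delta g) = (\<Sum>\<^sub>\<infinity>h\<in>{g}. wt h * \<bar>entry (delta g) h\<bar>)"
    unfolding norm_wl1_def by (rule infsum_cong_neutral) (auto simp: entry_delta)
  then show ?thesis by (simp add: entry_delta)
qed

subsection \<open>Synthesis operators\<close>

definition wbounded :: "('g::weighted_monoid \<Rightarrow> 'b::banach) \<Rightarrow> bool" where
  "wbounded v \<longleftrightarrow> (\<exists>C. \<forall>g. norm (v g) \<le> C * wt g)"

text \<open>The linear extension of \<open>v\<close> from the monomials \<open>delta g\<close>.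
  Every bounded operator into a Banach space has this form (\<open>bounded_linear_eq_synth\<close>),
  so operators are given below by their action on monomials together with a weight bound.\<close>

definition synth :: "('g::weighted_monoid \<Rightarrow> 'b::banach) \<Rightarrow> 'g wl1 \<Rightarrow> 'b" where
  "synth v a = (\<Sum>\<^sub>\<infinity>g. entry a g *\<^sub>R v g)"

lemma wboundedI: "(\<And>g. norm (v g) \<le> C * wt g) \<Longrightarrow> wbounded v"
  by (auto simp: wbounded_def)

lemma wboundedD:
  assumes "wbounded v"
  shows "\<exists>C\<ge>0. \<forall>g. norm (v g) \<le> C * wt g"
proof -
  obtain C where C: "\<forall>g. norm (v g) \<le> C * wt g" using assms unfolding wbounded_def ..
  have "norm (v g) \<le> max C 0 * wt g" for g
    using C mult_right_mono[of C "max C 0" "wt g"] by (force intro: order_trans)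
  then show ?thesis by (intro exI[of _ "max C 0"]) auto
qed

lemma synth_abs_summable:
  assumes "\<And>g. norm (v g) \<le> C * wt g"
  shows "(\<lambda>g. norm (entry a g *\<^sub>R v g)) summable_on UNIV"
    and "(\<Sum>\<^sub>\<infinity>g. norm (entry a g *\<^sub>R v g)) \<le> C * norm a"
proof -
  have s: "(\<lambda>g. C * (wt g * \<bar>entry a g\<bar>)) summable_on UNIV"
    by (intro summable_on_cmult_right entry_summable)
  have le: "norm (entry a g *\<^sub>R v g) \<le> C * (wt g * \<bar>entry a g\<bar>)" for g
    using mult_right_mono[OF assms[of g], of "\<bar>entry a g\<bar>"] by (simp add: mult_ac)
  show *: "(\<lambda>g. norm (entry a g *\<^sub>R v g)) summable_on UNIV"
    by (rule summable_on_comparison_test[OF s]) (use le in auto)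
  show "(\<Sum>\<^sub>\<infinity>g. norm (entry a g *\<^sub>R v g)) \<le> C * norm a"
    unfolding norm_wl1_def infsum_cmult_right'[symmetric]
    by (rule infsum_mono[OF * s le])
qed

lemma synth_has_sum:
  assumes "wbounded v"
  shows "((\<lambda>g. entry a g *\<^sub>R v g) has_sum synth v a) UNIV"
proof -
  obtain C where C: "C \<ge> 0" "\<And>g. norm (v g) \<le> C * wt g" using wboundedD[OF assms] by auto
  from synth_abs_summable(1)[OF C(2)] show ?thesis
    unfolding synth_def by (rule has_sum_infsum[OF abs_summable_summable])
qed

lemma synth_eqI: "((\<lambda>g. entry a g *\<^sub>R v g) has_sum y) UNIV \<Longrightarrow> synth v a = y"
  unfolding synth_def by (rule infsumI)

lemma norm_synth:
  assumes "\<And>g. norm (v g) \<le> C * wt g"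
  shows "norm (synth v a) \<le> C * norm a"
  unfolding synth_def
  by (rule order_trans[OF norm_infsum_bound[OF synth_abs_summable(1)[OF assms]] synth_abs_summable(2)[OF assms]])

lemma bounded_linear_synth:
  assumes "wbounded v"
  shows "bounded_linear (synth v)"
proof -
  obtain C where C0: "C \<ge> 0" and C: "\<And>g. norm (v g) \<le> C * wt g" using wboundedD[OF assms] by auto
  show ?thesis
  proof
    show "synth v (a + b) = synth v a + synth v b" for a b
    proof (rule synth_eqI)
      show "((\<lambda>g. entry (a + b) g *\<^sub>R v g) has_sum synth v a + synth v b) UNIV"
        using has_sum_add[OF synth_has_sum synth_has_sum, OF assms assms]
        by (simp add: scaleR_left_distrib)
    qed
    show "synth v (r *\<^sub>R a) = r *\<^sub>R synth v a" for r a
    proof (rule synth_eqI)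
      show "((\<lambda>g. entry (r *\<^sub>R a) g *\<^sub>R v g) has_sum r *\<^sub>R synth v a) UNIV"
        using has_sum_scaleR[OF synth_has_sum[OF assms], of r a] by simp
    qed
    show "\<exists>K. \<forall>x. norm (synth v x) \<le> norm x * K"
      using norm_synth[of v, OF C] by (intro exI[of _ C]) (simp add: mult.commute)
  qed
qed

lemma synth_delta [simp]: "synth v (delta g) = v g"
proof -
  have "synth v (delta g) = (\<Sum>\<^sub>\<infinity>h\<in>{g}. entry (delta g) h *\<^sub>R v h)"
    unfolding synth_def by (rule infsum_cong_neutral) (auto simp: entry_delta)
  then show ?thesis by (simp add: entry_delta)
qed

lemma wbounded_delta: "wbounded (delta :: 'g::weighted_monoid \<Rightarrow> _)"
  by (rule wboundedI[of _ 1]) simp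

lemma bounded_linear_entry: "bounded_linear (\<lambda>a. entry a g)"
  by (rule bounded_linear_intro[of _ 1]) (simp_all add: abs_entry_le_norm)

lemma delta_has_sum: "((\<lambda>g. entry a g *\<^sub>R delta g) has_sum a) UNIV"
proof -
  have "synth delta a = a"
  proof (rule wl1_eqI)
    fix h
    have "((\<lambda>g. entry (entry a g *\<^sub>R delta g) h) has_sum entry (synth delta a) h) UNIV"
      using has_sum_bounded_linear[OF bounded_linear_entry synth_has_sum[OF wbounded_delta]]
      by (simp add: o_def)
    moreover have "((\<lambda>g. entry (entry a g *\<^sub>R delta g) h) has_sum (\<Sum>g\<in>{h}. entry a g)) UNIV"
      by (rule has_sum_finite_neutralI[of "{h}"]) (auto simp: entry_delta)
    ultimately show "entry (synth delta a) h = entry a h"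
      using has_sum_unique by force
  qed
  then show ?thesis using synth_has_sum[OF wbounded_delta, of a] by simp
qed

lemma bounded_linear_eq_synth:
  fixes T :: "'g::weighted_monoid wl1 \<Rightarrow> 'b::banach"
  assumes "bounded_linear T"
  shows "T a = synth (\<lambda>g. T (delta g)) a"
  unfolding synth_def
  using has_sum_bounded_linear[OF assms delta_has_sum[of a]]
  by (simp add: o_def linear_scale[OF bounded_linear.linear[OF assms]] infsumI)

text \<open>Finite combinations of monomials are dense. Most identities below between operators or
  evaluations of series are reduced in this way to identities between powers.\<close>

lemma bounded_linear_eqI:
  fixes S T :: "'g::weighted_monoid wl1 \<Rightarrow> 'b::banach"
  assumes "bounded_linear S" "bounded_linear T" "\<And>g. S (delta g) = T (delta g)"
  shows "S a = T a"
proof -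
  have "S a = synth (\<lambda>g. S (delta g)) a" by (rule bounded_linear_eq_synth[OF assms(1)])
  also have "\<dots> = T a" unfolding assms(3) by (rule bounded_linear_eq_synth[OF assms(2), symmetric])
  finally show ?thesis .
qed

subsection \<open>The convolution product\<close>

text \<open>Convolution as an iterated linear extension of \<open>delta (g + h)\<close>, first in h,
  then in g. The norm bound and bilinearity come from those of \<open>synth\<close>, without
  rearranging double series.\<close>

instantiation wl1 :: (weighted_monoid) "{times, one}"
begin
definition one_wl1 :: "'a wl1" where "one_wl1 = delta 0"
definition times_wl1 :: "'a wl1 \<Rightarrow> 'a wl1 \<Rightarrow> 'a wl1" where
  "times_wl1 a b = synth (\<lambda>g. synth (\<lambda>h. delta (g + h)) b) a"
instance ..
end

lemma norm_shift: "norm (synth (\<lambda>h. delta (g + h)) b) \<le> norm b * wt g" for g :: "'g::weighted_monoid"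
proof -
  have "norm (synth (\<lambda>h. delta (g + h)) b) \<le> wt g * norm b"
    by (rule norm_synth) (simp add: wt_add)
  then show ?thesis by (simp add: mult.commute)
qed

lemma wbounded_shift: "wbounded (\<lambda>h. delta (g + h))" for g :: "'g::weighted_monoid"
  by (rule wboundedI[of _ "wt g"]) (simp add: wt_add)

lemma norm_times_wl1: "norm (a * b) \<le> norm a * norm b" for a b :: "'g::weighted_monoid wl1"
proof -
  have "norm (a * b) \<le> norm b * norm a"
    unfolding times_wl1_def by (rule norm_synth) (rule norm_shift)
  then show ?thesis by (simp add: mult.commute)
qed

lemma bounded_linear_times_left: "bounded_linear (\<lambda>a. a * b)" for b :: "'g::weighted_monoid wl1"
  unfolding times_wl1_def
  by (intro bounded_linear_synth wboundedI[of _ "norm b"] norm_shift)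

lemma delta_times: "delta g * delta h = delta (g + h)"
  by (simp add: times_wl1_def)

lemma bounded_linear_times_right: "bounded_linear (\<lambda>b. a * b)" for a :: "'g::weighted_monoid wl1"
proof -
  have sh: "linear (synth (\<lambda>h. delta (g + h)))" for g :: 'g
    by (intro bounded_linear.linear bounded_linear_synth wbounded_shift)
  have wb: "wbounded (\<lambda>g. synth (\<lambda>h. delta (g + h)) b)" for b :: "'g wl1"
    by (intro wboundedI[of _ "norm b"] norm_shift)
  show ?thesis
  proof (rule bounded_linear_intro[where K = "norm a"])
    fix x y :: "'g wl1" and r :: real
    show "a * (x + y) = a * x + a * y"
      unfolding times_wl1_def
      by (rule synth_eqI) (use has_sum_add[OF synth_has_sum[OF wb[of x], of a] synth_has_sum[OF wb[of y], of a]]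
      in \<open>simp add: linear_add[OF sh] scaleR_right_distrib\<close>)
    show "a * (r *\<^sub>R x) = r *\<^sub>R (a * x)"
      unfolding times_wl1_def
      by (rule synth_eqI) (use has_sum_scaleR[OF synth_has_sum[OF wb[of x], of a], of r]
      in \<open>simp add: linear_scale[OF sh] mult.commute\<close>)
    show "norm (a * x) \<le> norm x * norm a"
      using norm_times_wl1[of a x] by (simp add: mult.commute)
  qed
qed

lemmas times_left_bl = bounded_linear_compose[OF bounded_linear_times_left]
lemmas times_right_bl = bounded_linear_compose[OF bounded_linear_times_right]

instance wl1 :: (weighted_monoid) comm_ring_1
proof
  fix a b c :: "'a wl1"
  have 1: "delta g * delta h * c = delta g * (delta h * c)" for g h
    by (rule bounded_linear_eqI[of "\<lambda>c. delta g * delta h * c" "\<lambda>c. delta g * (delta h * c)"])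
       (rule bounded_linear_times_right, rule times_right_bl[OF bounded_linear_times_right],
        simp add: delta_times add.assoc)
  have 2: "delta g * b * c = delta g * (b * c)" for g
    by (rule bounded_linear_eqI[of "\<lambda>b. delta g * b * c" "\<lambda>b. delta g * (b * c)"])
       (rule times_left_bl[OF bounded_linear_times_right], rule times_right_bl[OF bounded_linear_times_left],
        simp add: 1)
  show "a * b * c = a * (b * c)"
    by (rule bounded_linear_eqI[of "\<lambda>a. a * b * c" "\<lambda>a. a * (b * c)"])
       (rule times_left_bl[OF bounded_linear_times_left], rule bounded_linear_times_left, simp add: 2)
  have 3: "delta g * b = b * delta g" for g
    by (rule bounded_linear_eqI[of "\<lambda>b. delta g * b" "\<lambda>b. b * delta g"])
       (rule bounded_linear_times_right, rule bounded_linear_times_left, simp add: delta_times add.commute)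
  show "a * b = b * a"
    by (rule bounded_linear_eqI[of "\<lambda>a. a * b" "\<lambda>a. b * a"])
       (rule bounded_linear_times_left, rule bounded_linear_times_right, simp add: 3)
  show "1 * a = a"
    unfolding one_wl1_def
    by (rule bounded_linear_eqI[of "\<lambda>a. delta 0 * a" "\<lambda>a. a"])
       (rule bounded_linear_times_right, rule bounded_linear_ident, simp add: delta_times)
  show "(a + b) * c = a * c + b * c"
    by (rule linear_add[OF bounded_linear.linear[OF bounded_linear_times_left]])
  show "(0 :: 'a wl1) \<noteq> 1"
    using norm_delta[of "0::'a"] by (metis norm_zero one_wl1_def wt_zero zero_neq_one)
qed

instance wl1 :: (weighted_monoid) real_normed_algebra_1
proof
  fix a b :: "'a wl1" and r :: real
  show "r *\<^sub>R a * b = r *\<^sub>R (a * b)"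
    by (rule linear_scale[OF bounded_linear.linear[OF bounded_linear_times_left]])
  show "a * r *\<^sub>R b = r *\<^sub>R (a * b)"
    by (rule linear_scale[OF bounded_linear.linear[OF bounded_linear_times_right]])
  show "norm (a * b) \<le> norm a * norm b"
    by (rule norm_times_wl1)
  show "norm (1 :: 'a wl1) = 1" by (simp add: one_wl1_def)
qed

subsection \<open>Evaluation at characters\<close>

text \<open>Evaluations at points of the circle are of this kind. Multiplicativity carries products
  and Neumann series of formal series to products and reciprocals of numbers.\<close>

definition character :: "('g::weighted_monoid \<Rightarrow> complex) \<Rightarrow> bool" where
  "character \<rho> \<longleftrightarrow> \<rho> 0 = 1 \<and> (\<forall>g h. \<rho> (g + h) = \<rho> g * \<rho> h) \<and> (\<forall>g. norm (\<rho> g) \<le> wt g)"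

lemma character_wbounded: "character \<rho> \<Longrightarrow> wbounded \<rho>"
  by (auto simp: character_def intro!: wboundedI[of _ 1])

lemma synth_character_one: "character \<rho> \<Longrightarrow> synth \<rho> 1 = 1"
  by (simp add: one_wl1_def character_def)

lemma synth_character_mult:
  assumes "character \<rho>"
  shows "synth \<rho> (a * b) = synth \<rho> a * synth \<rho> b"
proof -
  note bl = bounded_linear_synth[OF character_wbounded[OF assms]]
  have 1: "synth \<rho> (delta g * b) = \<rho> g * synth \<rho> b" for g
    by (rule bounded_linear_eqI[of "\<lambda>b. synth \<rho> (delta g * b)" "\<lambda>b. \<rho> g * synth \<rho> b"])
       (use assms in \<open>auto intro!: bounded_linear_compose[OF bl] bounded_linear_times_right
          bounded_linear_mult_right bounded_linear_compose[OF bounded_linear_mult_right bl]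
          simp: delta_times character_def\<close>)
  show ?thesis
    by (rule bounded_linear_eqI[of "\<lambda>a. synth \<rho> (a * b)" "\<lambda>a. synth \<rho> a * synth \<rho> b"])
       (auto intro!: bounded_linear_compose[OF bl] bounded_linear_times_left
          bounded_linear_compose[OF bounded_linear_mult_left bl] simp: 1)
qed

subsection \<open>The Neumann series\<close>

definition neumann :: "'a::{real_normed_algebra_1, banach} \<Rightarrow> 'a" where
  "neumann x = (\<Sum>n. x ^ n)"

lemma neumann:
  fixes x :: "'a::{real_normed_algebra_1, banach}"
  assumes "norm x < 1"
  shows "(1 - x) * neumann x = 1" and "neumann x * (1 - x) = 1"
    and "norm (neumann x) \<le> 1 / (1 - norm x)"
proof -
  have s: "summable (\<lambda>n. x ^ n)" by (rule complete_algebra_summable_geometric[OF assms])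
  have "neumann x = 1 + (\<Sum>n. x ^ Suc n)"
    unfolding neumann_def by (subst suminf_split_head[OF s]) simp
  moreover have "(\<Sum>n. x ^ Suc n) = x * neumann x"
    unfolding neumann_def by (subst suminf_mult[OF s, symmetric]) simp
  moreover have "(\<Sum>n. x ^ Suc n) = neumann x * x"
    unfolding neumann_def by (subst suminf_mult2[OF s]) (simp add: power_Suc2 del: power_Suc)
  ultimately show "(1 - x) * neumann x = 1" "neumann x * (1 - x) = 1"
    by (simp_all add: algebra_simps)
  show "norm (neumann x) \<le> 1 / (1 - norm x)"
  proof -
    have s': "summable (\<lambda>n. norm (x ^ n))"
      by (rule summable_comparison_test'[of "\<lambda>n. norm x ^ n" 0])
         (use assms in \<open>auto intro: norm_power_ineq summable_geometric\<close>)
    have "norm (neumann x) \<le> (\<Sum>n. norm (x ^ n))"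
      unfolding neumann_def by (rule summable_norm[OF s'])
    also have "\<dots> \<le> (\<Sum>n. norm x ^ n)"
      by (rule suminf_le[OF _ s']) (use assms in \<open>auto intro: norm_power_ineq summable_geometric\<close>)
    also have "\<dots> = 1 / (1 - norm x)" using assms by (simp add: suminf_geometric)
    finally show ?thesis .
  qed
qed

subsection \<open>Perturbation calculus\<close>

(* H e = c + O(e) in the Lipschitz norm on the unit ball, uniformly in e. *)
definition near ::
  "('e::real_normed_vector \<Rightarrow> 'b::real_normed_vector) \<Rightarrow> (real \<Rightarrow> 'e \<Rightarrow> 'b) \<Rightarrow> bool" where
  "near c H \<longleftrightarrow> (\<exists>C r. 0 < r \<and> r \<le> 1 \<and> 0 \<le> C \<and>
     (\<forall>x y. norm x \<le> 1 \<longrightarrow> norm y \<le> 1 \<longrightarrow> norm (c x) \<le> C \<and> norm (c x - c y) \<le> C * norm (x - y)) \<and>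
     (\<forall>e x y. \<bar>e\<bar> \<le> r \<longrightarrow> norm x \<le> 1 \<longrightarrow> norm y \<le> 1 \<longrightarrow>
        norm (H e x - c x) \<le> C * \<bar>e\<bar> \<and>
        norm ((H e x - c x) - (H e y - c y)) \<le> C * \<bar>e\<bar> * norm (x - y)))"

definition lip_on_ball :: "real \<Rightarrow> real \<Rightarrow> ('e::real_normed_vector \<Rightarrow> 'b::real_normed_vector) \<Rightarrow> bool" where
  "lip_on_ball B L f \<longleftrightarrow> (\<forall>x y. norm x \<le> 1 \<longrightarrow> norm y \<le> 1 \<longrightarrow>
     norm (f x) \<le> B \<and> norm (f x - f y) \<le> L * norm (x - y))"

lemma lip_on_ballD:
  assumes "lip_on_ball B L f" "norm x \<le> 1" "norm y \<le> 1"
  shows "norm (f x) \<le> B" "norm (f x - f y) \<le> L * norm (x - y)"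
  using assms by (auto simp: lip_on_ball_def)

lemma near_iff: "near c H \<longleftrightarrow> (\<exists>C r. 0 < r \<and> r \<le> 1 \<and> 0 \<le> C \<and> lip_on_ball C C c \<and>
    (\<forall>e. \<bar>e\<bar> \<le> r \<longrightarrow> lip_on_ball (C * \<bar>e\<bar>) (C * \<bar>e\<bar>) (\<lambda>x. H e x - c x)))"
  unfolding near_def lip_on_ball_def by blast

lemma lip_on_ball_mono:
  assumes "lip_on_ball B L f" "B \<le> B'" "L \<le> L'"
  shows "lip_on_ball B' L' f"
  unfolding lip_on_ball_def
  by (meson assms lip_on_ballD mult_right_mono norm_ge_zero order_trans)

lemma lip_on_ball_add:
  fixes f g :: "'e::real_normed_vector \<Rightarrow> 'b::real_normed_vector"
  assumes "lip_on_ball B L f" "lip_on_ball B' L' g"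
  shows "lip_on_ball (B + B') (L + L') (\<lambda>x. f x + g x)"
  unfolding lip_on_ball_def
proof (intro allI impI conjI)
  fix x y :: 'e assume xy: "norm x \<le> 1" "norm y \<le> 1"
  show "norm (f x + g x) \<le> B + B'"
    using norm_triangle_ineq[of "f x" "g x"] lip_on_ballD[OF assms(1) xy] lip_on_ballD[OF assms(2) xy] by linarith
  have "norm (f x + g x - (f y + g y)) \<le> norm (f x - f y) + norm (g x - g y)"
    using norm_triangle_ineq[of "f x - f y" "g x - g y"] by (simp add: algebra_simps)
  then show "norm (f x + g x - (f y + g y)) \<le> (L + L') * norm (x - y)"
    using lip_on_ballD[OF assms(1) xy] lip_on_ballD[OF assms(2) xy] by (simp add: algebra_simps)
qed

lemma lip_on_ball_bounded_linear:
  fixes f :: "'e::real_normed_vector \<Rightarrow> 'b::real_normed_vector"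
  assumes "bounded_linear T" "\<And>z. norm (T z) \<le> K * norm z" "lip_on_ball B L f" "0 \<le> K"
  shows "lip_on_ball (K * B) (K * L) (\<lambda>x. T (f x))"
  unfolding lip_on_ball_def
proof (intro allI impI conjI)
  fix x y :: 'e assume xy: "norm x \<le> 1" "norm y \<le> 1"
  show "norm (T (f x)) \<le> K * B"
    using assms(2)[of "f x"] mult_left_mono[OF lip_on_ballD(1)[OF assms(3) xy] assms(4)] by linarith
  have "norm (T (f x - f y)) \<le> K * (L * norm (x - y))"
    using assms(2)[of "f x - f y"] mult_left_mono[OF lip_on_ballD(2)[OF assms(3) xy] assms(4)] by linarith
  then show "norm (T (f x) - T (f y)) \<le> K * L * norm (x - y)"
    by (simp add: linear_diff[OF bounded_linear.linear[OF assms(1)]] mult.assoc)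
qed

lemma lip_on_ball_mult:
  fixes f g :: "'e::real_normed_vector \<Rightarrow> 'b::real_normed_algebra"
  assumes "lip_on_ball B L f" "lip_on_ball B' L' g" "0 \<le> B" "0 \<le> L" "0 \<le> B'"
  shows "lip_on_ball (B * B') (L * B' + B * L') (\<lambda>x. f x * g x)"
  unfolding lip_on_ball_def
proof (intro allI impI conjI)
  fix x y :: 'e assume xy: "norm x \<le> 1" "norm y \<le> 1"
  note F = lip_on_ballD[OF assms(1) xy] lip_on_ballD[OF assms(1) xy(2) xy(1)]
  note G = lip_on_ballD[OF assms(2) xy] lip_on_ballD[OF assms(2) xy(2) xy(1)]
  show "norm (f x * g x) \<le> B * B'"
    by (rule order_trans[OF norm_mult_ineq]) (intro mult_mono F G assms norm_ge_zero)
  have "f x * g x - f y * g y = (f x - f y) * g x + f y * (g x - g y)" by (simp add: algebra_simps)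
  then have "norm (f x * g x - f y * g y) \<le> norm (f x - f y) * norm (g x) + norm (f y) * norm (g x - g y)"
    by (simp only:) (intro norm_triangle_le add_mono norm_mult_ineq)
  also have "\<dots> \<le> (L * norm (x - y)) * B' + B * (L' * norm (x - y))"
    using assms by (intro add_mono mult_mono F G) auto
  finally show "norm (f x * g x - f y * g y) \<le> (L * B' + B * L') * norm (x - y)"
    by (simp add: algebra_simps)
qed

lemma nearI:
  assumes "0 < r" "0 \<le> C" "lip_on_ball C C c"
    and "\<And>e. \<bar>e\<bar> \<le> r \<Longrightarrow> \<bar>e\<bar> \<le> 1 \<Longrightarrow> lip_on_ball (C * \<bar>e\<bar>) (C * \<bar>e\<bar>) (\<lambda>x. H e x - c x)"
  shows "near c H"
  unfolding near_iff using assms by (intro exI[of _ C] exI[of _ "min r 1"]) auto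

lemma nearE:
  assumes "near c H"
  obtains C r where "0 < r" "r \<le> 1" "0 \<le> C" "lip_on_ball C C c"
    "\<And>e. \<bar>e\<bar> \<le> r \<Longrightarrow> lip_on_ball (C * \<bar>e\<bar>) (C * \<bar>e\<bar>) (\<lambda>x. H e x - c x)"
    "\<And>e. \<bar>e\<bar> \<le> r \<Longrightarrow> lip_on_ball (2 * C) (2 * C) (H e)"
proof -
  obtain C r where C: "0 < r" "r \<le> 1" "0 \<le> C" "lip_on_ball C C c"
    "\<And>e. \<bar>e\<bar> \<le> r \<Longrightarrow> lip_on_ball (C * \<bar>e\<bar>) (C * \<bar>e\<bar>) (\<lambda>x. H e x - c x)"
    using assms unfolding near_iff by blast
  have "lip_on_ball (2 * C) (2 * C) (H e)" if "\<bar>e\<bar> \<le> r" for e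
  proof -
    have "C * \<bar>e\<bar> \<le> C" using that C by (simp add: mult_left_le)
    then show ?thesis
      using lip_on_ball_mono[OF lip_on_ball_add[OF C(4) C(5)[OF that]], of "2*C" "2*C"] by simp
  qed
  with C that show ?thesis by blast
qed

lemma near_indep:
  assumes "lip_on_ball C C c" "0 \<le> C"
  shows "near c (\<lambda>e. c)"
  using assms by (intro nearI[of 1 C]) (auto simp: lip_on_ball_def)

lemma near_const: "near (\<lambda>x. c) (\<lambda>e x. c)"
  by (rule near_indep[of "norm c"]) (auto simp: lip_on_ball_def)

lemma near_linear:
  fixes T :: "'a::real_normed_vector \<Rightarrow> 'b::real_normed_vector"
  assumes "bounded_linear T"
  shows "near T (\<lambda>e. T)"
proof -
  obtain K where K: "0 < K" "\<And>x. norm (T x) \<le> norm x * K" using bounded_linear.pos_bounded[OF assms] by blast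
  show ?thesis
  proof (rule near_indep)
    show "lip_on_ball K K T"
      unfolding lip_on_ball_def linear_diff[OF bounded_linear.linear[OF assms], symmetric]
    proof (intro allI impI conjI)
      fix x y :: 'a assume "norm x \<le> 1"
      then have "norm x * K \<le> 1 * K" using K(1) by (intro mult_right_mono) auto
      then show "norm (T x) \<le> K" using K(2)[of x] by linarith
      show "norm (T (x - y)) \<le> K * norm (x - y)" using K(2)[of "x - y"] by (simp add: mult.commute)
    qed
  qed (use K in auto)
qed

lemma near_compose:
  assumes "bounded_linear T" "near c H"
  shows "near (\<lambda>x. T (c x)) (\<lambda>e x. T (H e x))"
proof -
  obtain K where K: "0 < K" "\<And>x. norm (T x) \<le> norm x * K" using bounded_linear.pos_bounded[OF assms(1)] by blast
  have K': "norm (T x) \<le> K * norm x" "0 \<le> K" for x using K by (auto simp: mult.commute)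
  obtain C r where C: "0 < r" "r \<le> 1" "0 \<le> C" "lip_on_ball C C c"
    "\<And>e. \<bar>e\<bar> \<le> r \<Longrightarrow> lip_on_ball (C * \<bar>e\<bar>) (C * \<bar>e\<bar>) (\<lambda>x. H e x - c x)"
    using nearE[OF assms(2)] by metis
  show ?thesis
  proof (rule nearI[of r "K * C"])
    show "lip_on_ball (K * C) (K * C) (\<lambda>x. T (c x))"
      by (rule lip_on_ball_bounded_linear[OF assms(1) K'(1) C(4) K'(2)])
    show "lip_on_ball (K * C * \<bar>e\<bar>) (K * C * \<bar>e\<bar>) (\<lambda>x. T (H e x) - T (c x))" if "\<bar>e\<bar> \<le> r" for e
      using lip_on_ball_bounded_linear[OF assms(1) K'(1) C(5)[OF that] K'(2)]
      by (simp add: linear_diff[OF bounded_linear.linear[OF assms(1)]] mult.assoc)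
  qed (use C K in auto)
qed

lemma near_add:
  assumes "near c H" "near c' H'"
  shows "near (\<lambda>x. c x + c' x) (\<lambda>e x. H e x + H' e x)"
proof -
  obtain C r where C: "0 < r" "r \<le> 1" "0 \<le> C" "lip_on_ball C C c"
    "\<And>e. \<bar>e\<bar> \<le> r \<Longrightarrow> lip_on_ball (C * \<bar>e\<bar>) (C * \<bar>e\<bar>) (\<lambda>x. H e x - c x)"
    using nearE[OF assms(1)] by metis
  obtain D r' where D: "0 < r'" "r' \<le> 1" "0 \<le> D" "lip_on_ball D D c'"
    "\<And>e. \<bar>e\<bar> \<le> r' \<Longrightarrow> lip_on_ball (D * \<bar>e\<bar>) (D * \<bar>e\<bar>) (\<lambda>x. H' e x - c' x)"
    using nearE[OF assms(2)] by metis
  show ?thesis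
  proof (rule nearI[of "min r r'" "C + D"])
    show "lip_on_ball (C + D) (C + D) (\<lambda>x. c x + c' x)" by (rule lip_on_ball_add[OF C(4) D(4)])
    show "lip_on_ball ((C + D) * \<bar>e\<bar>) ((C + D) * \<bar>e\<bar>) (\<lambda>x. H e x + H' e x - (c x + c' x))"
      if "\<bar>e\<bar> \<le> min r r'" for e
      using lip_on_ball_add[OF C(5) D(5), of e e] that by (simp add: algebra_simps)
  qed (use C D in auto)
qed

lemma near_minus: "near c H \<Longrightarrow> near (\<lambda>x. - c x) (\<lambda>e x. - H e x)"
  by (rule near_compose[OF bounded_linear_minus[OF bounded_linear_ident]])

lemma near_diff:
  assumes "near c H" "near c' H'"
  shows "near (\<lambda>x. c x - c' x) (\<lambda>e x. H e x - H' e x)"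
  using near_add[OF assms(1) near_minus[OF assms(2)]] by simp

lemma near_scaleR: "near c H \<Longrightarrow> near (\<lambda>x. k *\<^sub>R c x) (\<lambda>e x. k *\<^sub>R H e x)"
  by (rule near_compose[OF bounded_linear_scaleR_right])

lemma near_mult:
  fixes c :: "'e::real_normed_vector \<Rightarrow> 'b::real_normed_algebra"
  assumes "near c H" "near c' H'"
  shows "near (\<lambda>x. c x * c' x) (\<lambda>e x. H e x * H' e x)"
proof -
  obtain C r where C: "0 < r" "r \<le> 1" "0 \<le> C" "lip_on_ball C C c"
    "\<And>e. \<bar>e\<bar> \<le> r \<Longrightarrow> lip_on_ball (C * \<bar>e\<bar>) (C * \<bar>e\<bar>) (\<lambda>x. H e x - c x)"
    using nearE[OF assms(1)] by metis
  obtain D r' where D: "0 < r'" "r' \<le> 1" "0 \<le> D" "lip_on_ball D D c'"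
    "\<And>e. \<bar>e\<bar> \<le> r' \<Longrightarrow> lip_on_ball (D * \<bar>e\<bar>) (D * \<bar>e\<bar>) (\<lambda>x. H' e x - c' x)"
    "\<And>e. \<bar>e\<bar> \<le> r' \<Longrightarrow> lip_on_ball (2 * D) (2 * D) (H' e)"
    using nearE[OF assms(2)] by metis
  show ?thesis
  \<comment> \<open>In the splitting \<open>eq\<close> the factor \<open>H' e\<close> is only known
    to be bounded by 2 D; the two products then have Lipschitz constants 4 C D and 2 C D times |e|,
    which add up to 6 C D |e|.\<close>
  proof (rule nearI[of "min r r'" "6 * (C * D)"])
    show "lip_on_ball (6 * (C * D)) (6 * (C * D)) (\<lambda>x. c x * c' x)"
      using C D by (intro lip_on_ball_mono[OF lip_on_ball_mult[OF C(4) D(4)]]) auto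
    fix e assume e: "\<bar>e\<bar> \<le> min r r'"
    have eq: "H e x * H' e x - c x * c' x = (H e x - c x) * H' e x + c x * (H' e x - c' x)" for x
      by (simp add: algebra_simps)
    show "lip_on_ball (6 * (C * D) * \<bar>e\<bar>) (6 * (C * D) * \<bar>e\<bar>) (\<lambda>x. H e x * H' e x - c x * c' x)"
      unfolding eq using C D e
      by (intro lip_on_ball_mono[OF lip_on_ball_add[OF lip_on_ball_mult[OF C(5) D(6)] lip_on_ball_mult[OF C(4) D(5)]]])
         (auto simp: algebra_simps)
  qed (use C D in auto)
qed

text \<open>The factor e is the whole gain: only the bound of \<open>H e\<close> on the ball enters.
  Terms of F that carry a factor e therefore need no computed limit.\<close>

lemma near_eps:
  assumes "near c H"
  shows "near (\<lambda>x. 0) (\<lambda>e x. e *\<^sub>R H e x)"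
proof -
  obtain C r where C: "0 < r" "0 \<le> C" "\<And>e. \<bar>e\<bar> \<le> r \<Longrightarrow> lip_on_ball (2 * C) (2 * C) (H e)"
    using nearE[OF assms] by metis
  show ?thesis
  proof (rule nearI[of r "2 * C"])
    show "lip_on_ball (2 * C * \<bar>e\<bar>) (2 * C * \<bar>e\<bar>) (\<lambda>x. e *\<^sub>R H e x - 0)" if "\<bar>e\<bar> \<le> r" for e
      using lip_on_ball_bounded_linear[OF bounded_linear_scaleR_right _ C(3)[OF that], of e "\<bar>e\<bar>"]
      by (simp add: mult_ac)
  qed (use C in \<open>auto simp: lip_on_ball_def\<close>)
qed

text \<open>With N the Neumann series, N - 1 = e H N, and the resolvent identity N(x) - N(y) = e
  N(x) (H(x) - H(y)) N(y) gives the Lipschitz bound.\<close>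

lemma near_neumann:
  fixes H :: "real \<Rightarrow> 'e::real_normed_vector \<Rightarrow> 'b::{real_normed_algebra_1, banach}"
  assumes "near c H"
  shows "near (\<lambda>x. 1) (\<lambda>e x. neumann (e *\<^sub>R H e x))"
    and "\<exists>r>0. \<forall>e x. \<bar>e\<bar> \<le> r \<longrightarrow> norm x \<le> 1 \<longrightarrow> norm (e *\<^sub>R H e x) < 1"
proof -
  obtain C r where C: "0 < r" "0 \<le> C" "\<And>e. \<bar>e\<bar> \<le> r \<Longrightarrow> lip_on_ball (2 * C) (2 * C) (H e)"
    using nearE[OF assms] by metis
  \<comment> \<open>Ensures 2 C s <= 1/2, so that the Neumann series is bounded by 2; C + 1 avoids a
    division by 0.\<close>
  define s where "s = min r (1 / (4 * (C + 1)))"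
  have s: "0 < s" "s \<le> r" using C by (auto simp: s_def)
  have "s * (4 * (C + 1)) \<le> 1"
    using C(2) by (simp add: s_def min_def field_simps split: if_splits)
  moreover have "s * (4 * C) \<le> s * (4 * (C + 1))" using s by (intro mult_left_mono) auto
  ultimately have sC: "2 * C * s \<le> 1 / 2" by (simp add: algebra_simps)
  have half: "norm (e *\<^sub>R H e x) \<le> 1 / 2" if "\<bar>e\<bar> \<le> s" "norm x \<le> 1" for e x
  proof -
    have "norm (e *\<^sub>R H e x) \<le> s * (2 * C)"
      unfolding norm_scaleR using that s lip_on_ballD(1)[OF C(3) that(2) that(2), of e] C(2)
      by (intro mult_mono) auto
    then show ?thesis using sC by (simp add: mult_ac)
  qed
  then show "\<exists>r>0. \<forall>e x. \<bar>e\<bar> \<le> r \<longrightarrow> norm x \<le> 1 \<longrightarrow> norm (e *\<^sub>R H e x) < 1"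
    using s(1) by (intro exI[of _ s]) fastforce
  define N where "N e x = neumann (e *\<^sub>R H e x)" for e x
  have N2: "norm (N e x) \<le> 2" and N1: "(1 - e *\<^sub>R H e x) * N e x = 1" "N e x * (1 - e *\<^sub>R H e x) = 1"
    if "\<bar>e\<bar> \<le> s" "norm x \<le> 1" for e x
  proof -
    note h = half[OF that]
    have "1 / (1 - norm (e *\<^sub>R H e x)) \<le> 1 / (1 / 2)" using h by (intro divide_left_mono) auto
    then show "norm (N e x) \<le> 2" using neumann(3)[of "e *\<^sub>R H e x"] h by (simp add: N_def)
    show "(1 - e *\<^sub>R H e x) * N e x = 1" "N e x * (1 - e *\<^sub>R H e x) = 1"
      using neumann(1,2)[of "e *\<^sub>R H e x"] h by (simp_all add: N_def)
  qed
  show "near (\<lambda>x. 1) (\<lambda>e x. neumann (e *\<^sub>R H e x))"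
    unfolding N_def[symmetric]
  \<comment> \<open>4 C bounds the difference from 1, 8 C is its Lipschitz constant, and the summand
    1 bounds the limit.\<close>
  proof (rule nearI[of s "8 * C + 1"])
    show "lip_on_ball (8 * C + 1) (8 * C + 1) (\<lambda>x::'e. 1::'b)"
      using C by (auto simp: lip_on_ball_def)
    fix e :: real assume e: "\<bar>e\<bar> \<le> s"
    show "lip_on_ball ((8 * C + 1) * \<bar>e\<bar>) ((8 * C + 1) * \<bar>e\<bar>) (\<lambda>x. N e x - 1)"
      unfolding lip_on_ball_def
    proof (intro allI impI conjI)
      fix x y :: 'e assume x: "norm x \<le> 1" and y: "norm y \<le> 1"
      have er: "\<bar>e\<bar> \<le> r" using e s by simp
      note Hx = lip_on_ballD[OF C(3)[OF er] x y]
      have "N e x - 1 = e *\<^sub>R (H e x * N e x)" using N1(1)[OF e x] by (simp add: algebra_simps)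
      then have "norm (N e x - 1) = \<bar>e\<bar> * norm (H e x * N e x)" by simp
      also have "\<dots> \<le> \<bar>e\<bar> * (2 * C * 2)"
        by (intro mult_left_mono order_trans[OF norm_mult_ineq] mult_mono Hx N2[OF e x]) (use C in auto)
      also have "\<dots> \<le> (8 * C + 1) * \<bar>e\<bar>" using C(2) by (simp add: algebra_simps)
      finally show "norm (N e x - 1) \<le> (8 * C + 1) * \<bar>e\<bar>" .
      have "N e x - N e y = N e x * ((1 - e *\<^sub>R H e y) * N e y) - (N e x * (1 - e *\<^sub>R H e x)) * N e y"
        using N1(1)[OF e y] N1(2)[OF e x] by simp
      also have "\<dots> = e *\<^sub>R (N e x * (H e x - H e y) * N e y)" by (simp add: algebra_simps)
      finally have "norm (N e x - N e y) = \<bar>e\<bar> * norm (N e x * (H e x - H e y) * N e y)" by simp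
      also have "\<dots> \<le> \<bar>e\<bar> * (2 * (2 * C * norm (x - y)) * 2)"
        by (intro mult_left_mono order_trans[OF norm_mult_ineq] mult_mono Hx N2[OF e x] N2[OF e y])
           (use C in auto)
      also have "\<dots> \<le> (8 * C + 1) * \<bar>e\<bar> * norm (x - y)" by (simp add: algebra_simps)
      finally show "norm (N e x - 1 - (N e y - 1)) \<le> (8 * C + 1) * \<bar>e\<bar> * norm (x - y)" by simp
    qed
  qed (use C s in auto)
qed

lemma near_Pair:
  assumes "near c H" "near c' H'"
  shows "near (\<lambda>x. (c x, c' x)) (\<lambda>e x. (H e x, H' e x))"
proof -
  have bl: "bounded_linear (\<lambda>z::'b. (z, 0::'c))" "bounded_linear (\<lambda>z::'c. (0::'b, z))"
    by (auto intro!: bounded_linear_Pair bounded_linear_ident bounded_linear_zero)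
  show ?thesis
    using near_add[OF near_compose[OF bl(1) assms(1)] near_compose[OF bl(2) assms(2)]] by simp
qed

text \<open>As the limit map vanishes to second order at 0, it contracts a small ball by 1/4. The
  perturbation of size |e| adds at most 1/4 to the ratio and moves the centre by at most a quarter
  of the radius, so Banach's theorem applies.\<close>

lemma near_fixed_point:
  fixes \<phi> :: "'e::banach \<Rightarrow> 'e"
  assumes near: "near \<phi> \<Phi>" and "\<phi> 0 = 0" and "0 \<le> Q"
    and quad: "\<And>x y \<rho>. norm x \<le> \<rho> \<Longrightarrow> norm y \<le> \<rho> \<Longrightarrow> norm (\<phi> x - \<phi> y) \<le> Q * \<rho> * norm (x - y)"
    and "0 < \<delta>"
  shows "\<exists>r>0. \<forall>e. \<bar>e\<bar> \<le> r \<longrightarrow> (\<exists>x. norm x \<le> \<delta> \<and> \<Phi> e x = x)"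
proof -
  obtain C r where C: "0 < r" "r \<le> 1" "0 \<le> C"
    "\<And>e. \<bar>e\<bar> \<le> r \<Longrightarrow> lip_on_ball (C * \<bar>e\<bar>) (C * \<bar>e\<bar>) (\<lambda>x. \<Phi> e x - \<phi> x)"
    using nearE[OF near] by metis
  \<comment> \<open>Makes Q times this radius at most 1/4, and keeps the ball inside the unit ball,
    where \<open>near\<close> gives estimates.\<close>
  define \<rho> where "\<rho> = min (min \<delta> 1) (1 / (4 * (Q + 1)))"
  have \<rho>: "0 < \<rho>" "\<rho> \<le> \<delta>" "\<rho> \<le> 1" using assms by (auto simp: \<rho>_def)
  have "\<rho> * (4 * (Q + 1)) \<le> 1"
    using assms(3) by (auto simp: \<rho>_def min_def field_simps split: if_splits)
  then have Q\<rho>: "Q * \<rho> \<le> 1 / 4" using \<rho> by (simp add: algebra_simps)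
  \<comment> \<open>Makes C |e| at most a quarter of the radius; this serves as displacement of the
    centre and, the radius being at most 1, as Lipschitz constant.\<close>
  define s where "s = min r (\<rho> / (4 * (C + 1)))"
  have s: "0 < s" "s \<le> r" using C \<rho> by (auto simp: s_def)
  have "s \<le> \<rho> / (4 * (C + 1))" by (simp add: s_def)
  then have "s * (4 * (C + 1)) \<le> \<rho>"
    using C(3) by (simp add: pos_le_divide_eq)
  then have Cs: "C * s \<le> \<rho> / 4" using s by (simp add: algebra_simps)
  have "\<exists>x. norm x \<le> \<delta> \<and> \<Phi> e x = x" if e: "\<bar>e\<bar> \<le> s" for e
  proof -
    have er: "\<bar>e\<bar> \<le> r" using e s by simp
    have Ce: "C * \<bar>e\<bar> \<le> \<rho> / 4" using Cs mult_left_mono[OF e C(3)] by linarith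
    have lip: "norm (\<Phi> e x - \<Phi> e y) \<le> 1/2 * norm (x - y)" if "norm x \<le> \<rho>" "norm y \<le> \<rho>" for x y
    proof -
      have 1: "norm x \<le> 1" "norm y \<le> 1" using that \<rho> by auto
      have "norm ((\<Phi> e x - \<phi> x) - (\<Phi> e y - \<phi> y)) \<le> C * \<bar>e\<bar> * norm (x - y)"
        by (rule lip_on_ballD(2)[OF C(4)[OF er] 1])
      also have "\<dots> \<le> 1/4 * norm (x - y)" using Ce \<rho> by (intro mult_right_mono) auto
      finally have a: "norm ((\<Phi> e x - \<phi> x) - (\<Phi> e y - \<phi> y)) \<le> 1/4 * norm (x - y)" .
      have "norm (\<phi> x - \<phi> y) \<le> 1/4 * norm (x - y)"
        using quad[OF that] mult_right_mono[OF Q\<rho>, of "norm (x - y)"] by simp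
      with a show ?thesis
        using norm_triangle_ineq[of "(\<Phi> e x - \<phi> x) - (\<Phi> e y - \<phi> y)" "\<phi> x - \<phi> y"] by (simp add: algebra_simps)
    qed
    have z: "norm (\<Phi> e 0) \<le> \<rho> / 4"
      using lip_on_ballD(1)[OF C(4)[OF er], of 0 0] Ce assms(2) by simp
    have "\<exists>!x\<in>cball 0 \<rho>. \<Phi> e x = x"
    proof (rule Banach_fix)
      show "complete (cball 0 \<rho> :: 'e set)" by (simp add: complete_eq_closed)
      show "cball 0 \<rho> \<noteq> ({} :: 'e set)" using \<rho> by simp
      show "\<Phi> e ` cball 0 \<rho> \<subseteq> cball 0 \<rho>"
      proof clarsimp
        fix x :: 'e assume x: "norm x \<le> \<rho>"
        have "norm (\<Phi> e x) \<le> norm (\<Phi> e x - \<Phi> e 0) + norm (\<Phi> e 0)"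
          using norm_triangle_ineq[of "\<Phi> e x - \<Phi> e 0" "\<Phi> e 0"] by simp
        also have "\<dots> \<le> \<rho>" using lip[OF x, of 0] z x \<rho> by simp
        finally show "norm (\<Phi> e x) \<le> \<rho>" .
      qed
      show "dist (\<Phi> e x) (\<Phi> e y) \<le> 1/2 * dist x y" if "x \<in> cball 0 \<rho>" "y \<in> cball 0 \<rho>" for x y
        using lip[of x y] that by (simp add: dist_norm)
    qed auto
    then obtain x where "x \<in> cball 0 \<rho>" "\<Phi> e x = x" by (elim ex1E conjE)
    then show ?thesis using \<rho>(2) by (intro exI[of _ x]) simp
  qed
  then show ?thesis using s(1) by blast
qed

subsection \<open>The functional as a power series\<close>

(* The indices (k, n), (k, m) and (k, m, l) stand for s^k cnj(w)^(n+1) / (n+1), s^k w^m and s^k w^m t^l.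
   The functional is taken at the parameter e * s with |s| at most 1, so that e carries the smallness while
   the dependence on the parameter is that on s; the factor 1 / (n+1) makes differentiation bounded. *)
type_synonym time_ser = "nat wl1"
type_synonym coeff_ser = "(nat \<times> nat) wl1"
type_synonym circle_ser = "(nat \<times> int) wl1"
type_synonym torus_ser = "(nat \<times> int \<times> int) wl1"

lemma wt_nat: "wt (n::nat) = 2 ^ n" and wt_int: "wt (m::int) = 2 ^ nat \<bar>m\<bar>"
  by (simp_all add: wt_nat_def wt_int_def)

definition lift_time :: "time_ser \<Rightarrow> circle_ser" where
  "lift_time = synth (\<lambda>k. delta (k, 0))"
definition ser_deriv :: "coeff_ser \<Rightarrow> circle_ser" where
  "ser_deriv = synth (\<lambda>(k, n). - delta (k, - (int n + 2)))"
definition ser_deriv_t :: "coeff_ser \<Rightarrow> torus_ser" where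
  "ser_deriv_t = synth (\<lambda>(k, n). - delta (k, 0, - (int n + 2)))"
definition ser_w :: "coeff_ser \<Rightarrow> torus_ser" where
  "ser_w = synth (\<lambda>(k, n). (1 / real (Suc n)) *\<^sub>R delta (k, - (int n + 1), 0))"
definition ser_t :: "coeff_ser \<Rightarrow> torus_ser" where
  "ser_t = synth (\<lambda>(k, n). (1 / real (Suc n)) *\<^sub>R delta (k, 0, - (int n + 1)))"
definition ser_cnj_t :: "coeff_ser \<Rightarrow> torus_ser" where
  "ser_cnj_t = synth (\<lambda>(k, n). (1 / real (Suc n)) *\<^sub>R delta (k, 0, int n + 1))"
text \<open>The divided difference (f(t) - f(w)) / (t - w) for f = w^-(n+1) / (n+1), written as a
  finite geometric sum, so that the singularity on the diagonal disappears. The factor 1 / (n+1)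
  turns its n + 1 terms into an average.\<close>

definition ser_quot :: "coeff_ser \<Rightarrow> torus_ser" where
  "ser_quot = synth (\<lambda>(k, n). (- 1 / real (Suc n)) *\<^sub>R
     (\<Sum>i<Suc n. delta (k, - (int i + 1), - (int n + 1 - int i))))"
text \<open>The conjugate of f(t) - f(w), divided by t - w. On the circle conjugation turns w^-(n+1)
  into w^(n+1), which gives the ordinary geometric sum.\<close>

definition ser_cnj_quot :: "coeff_ser \<Rightarrow> torus_ser" where
  "ser_cnj_quot = synth (\<lambda>(k, n). (1 / real (Suc n)) *\<^sub>R
     (\<Sum>i<Suc n. delta (k, int n - int i, int i)))"
definition residue_t :: "torus_ser \<Rightarrow> circle_ser" where
  "residue_t = synth (\<lambda>(k, m, l). if l = - 1 then delta (k, m) else 0)"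
(* The part that is odd in m, which determines the imaginary part on the circle. *)
definition asym :: "circle_ser \<Rightarrow> coeff_ser" where
  "asym = synth (\<lambda>(k, m). if m < 0 then delta (k, nat (- m) - 1)
     else if m = 0 then 0 else - delta (k, nat m - 1))"
text \<open>Index n of an \<open>asym\<close> series belongs to mode n + 1, whereas differentiation
  takes the basis element n to mode n + 2. So f' never reaches index 0, which is left to U and
  gamma_2, and \<open>shift_mode\<close> inverts the derivative up to sign on the remaining
  indices.\<close>

definition first_mode :: "coeff_ser \<Rightarrow> time_ser" where
  "first_mode = synth (\<lambda>(k, n). if n = 0 then delta k else 0)"
definition shift_mode :: "coeff_ser \<Rightarrow> coeff_ser" where
  "shift_mode = synth (\<lambda>(k, n). if n = 0 then 0 else delta (k, n - 1))"

lemma wbounded_pairI: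
  assumes "\<And>k n. norm (v (k, n)) \<le> C * (wt k * wt n)"
  shows "wbounded v"
  by (rule wboundedI[of _ C]) (use assms in \<open>auto simp: wt_Pair\<close>)

lemma norm_scaled_sum_le:
  fixes f :: "nat \<Rightarrow> 'a::real_normed_vector"
  assumes "\<And>i. i < Suc n \<Longrightarrow> norm (f i) \<le> C" and "\<bar>c\<bar> = 1 / real (Suc n)"
  shows "norm (c *\<^sub>R (\<Sum>i<Suc n. f i)) \<le> C"
proof -
  have "norm (\<Sum>i<Suc n. f i) \<le> real (Suc n) * C"
    using sum_norm_bound[of "{..<Suc n}" f C] assms(1) by simp
  then have "1 / real (Suc n) * norm (\<Sum>i<Suc n. f i) \<le> 1 / real (Suc n) * (real (Suc n) * C)"
    by (intro mult_left_mono) auto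
  then show ?thesis using assms(2) by simp
qed

lemma norm_recip_scaleR_le: "norm ((1 / real (Suc n)) *\<^sub>R z) \<le> norm z"
proof -
  have "1 / real (Suc n) * norm z \<le> 1 * norm z" by (intro mult_right_mono) auto
  then show ?thesis by simp
qed

lemma wb_lift_time: "wbounded (\<lambda>k::nat. delta (k, 0::int))"
  by (rule wboundedI[of _ 1]) (simp add: wt_Pair)
lemma wb_ser_deriv: "wbounded (\<lambda>(k::nat, n::nat). - delta (k, - (int n + 2)))"
  by (rule wbounded_pairI[of _ 4])
     (simp add: wt_Pair wt_nat wt_int nat_add_distrib power_add)
lemma wb_ser_deriv_t: "wbounded (\<lambda>(k::nat, n::nat). - delta (k, 0::int, - (int n + 2)))"
  by (rule wbounded_pairI[of _ 4])
     (simp add: wt_Pair wt_nat wt_int nat_add_distrib power_add)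
lemma wb_ser_w: "wbounded (\<lambda>(k::nat, n::nat). (1 / real (Suc n)) *\<^sub>R delta (k, - (int n + 1), 0::int))"
  by (rule wbounded_pairI[of _ 2])
     (auto intro!: order_trans[OF norm_recip_scaleR_le] simp del: of_nat_Suc norm_scaleR
       simp: wt_Pair wt_nat wt_int nat_add_distrib power_add)
lemma wb_ser_t: "wbounded (\<lambda>(k::nat, n::nat). (1 / real (Suc n)) *\<^sub>R delta (k, 0::int, - (int n + 1)))"
  by (rule wbounded_pairI[of _ 2])
     (auto intro!: order_trans[OF norm_recip_scaleR_le] simp del: of_nat_Suc norm_scaleR
       simp: wt_Pair wt_nat wt_int nat_add_distrib power_add)
lemma wb_ser_cnj_t: "wbounded (\<lambda>(k::nat, n::nat). (1 / real (Suc n)) *\<^sub>R delta (k, 0::int, int n + 1))"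
  by (rule wbounded_pairI[of _ 2])
     (auto intro!: order_trans[OF norm_recip_scaleR_le] simp del: of_nat_Suc norm_scaleR
       simp: wt_Pair wt_nat wt_int nat_add_distrib power_add)
lemma wb_ser_quot: "wbounded (\<lambda>(k::nat, n::nat). (- 1 / real (Suc n)) *\<^sub>R
     (\<Sum>i<Suc n. delta (k, - (int i + 1), - (int n + 1 - int i))))"
proof (rule wbounded_pairI[of _ 4], unfold prod.case, rule norm_scaled_sum_le)
  fix k n i :: nat assume "i < Suc n"
  \<comment> \<open>The exponents of w and t have absolute values adding up to n + 2 for every i,
    and 2^(n+2) = 4 * 2^n.\<close>
  then have e: "nat \<bar>- (int i + 1)\<bar> + nat \<bar>- (int n + 1 - int i)\<bar> = n + 2" by linarith
  show "norm (delta (k, - (int i + 1), - (int n + 1 - int i))) \<le> 4 * (wt k * wt n)"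
    unfolding norm_delta wt_Pair wt_nat wt_int power_add[symmetric] e by (simp add: power_add)
qed simp
lemma wb_ser_cnj_quot: "wbounded (\<lambda>(k::nat, n::nat). (1 / real (Suc n)) *\<^sub>R
     (\<Sum>i<Suc n. delta (k, int n - int i, int i)))"
proof (rule wbounded_pairI[of _ 1], unfold prod.case, rule norm_scaled_sum_le)
  fix k n i :: nat assume "i < Suc n"
  then have "nat \<bar>int n - int i\<bar> + nat \<bar>int i\<bar> = n" by linarith
  then show "norm (delta (k, int n - int i, int i)) \<le> 1 * (wt k * wt n)"
    unfolding norm_delta wt_Pair wt_nat wt_int power_add[symmetric] by simp
qed simp
lemma wb_residue_t: "wbounded (\<lambda>(k::nat, m::int, l::int). if l = - 1 then delta (k, m) else 0)"
  by (rule wboundedI[of _ 1]) (auto simp: wt_Pair wt_int wt_nat)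
lemma wb_asym: "wbounded (\<lambda>(k::nat, m::int). if m < 0 then delta (k, nat (- m) - 1)
     else if m = 0 then 0 else - delta (k, nat m - 1))"
  by (rule wbounded_pairI[of _ 1]) (auto simp: wt_Pair wt_int wt_nat intro!: power_increasing)
lemma wb_first_mode: "wbounded (\<lambda>(k::nat, n::nat). if n = 0 then delta k else 0)"
  by (rule wbounded_pairI[of _ 1]) (auto simp: wt_nat)
lemma wb_shift_mode: "wbounded (\<lambda>(k::nat, n::nat). if n = 0 then 0 else delta (k, n - 1))"
  by (rule wbounded_pairI[of _ 1]) (auto simp: wt_Pair wt_nat intro!: power_increasing)

lemmas bl_ops =
  bounded_linear_synth[OF wb_lift_time, folded lift_time_def]
  bounded_linear_synth[OF wb_ser_deriv, folded ser_deriv_def]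
  bounded_linear_synth[OF wb_ser_deriv_t, folded ser_deriv_t_def]
  bounded_linear_synth[OF wb_ser_w, folded ser_w_def]
  bounded_linear_synth[OF wb_ser_t, folded ser_t_def]
  bounded_linear_synth[OF wb_ser_cnj_t, folded ser_cnj_t_def]
  bounded_linear_synth[OF wb_ser_quot, folded ser_quot_def]
  bounded_linear_synth[OF wb_ser_cnj_quot, folded ser_cnj_quot_def]
  bounded_linear_synth[OF wb_residue_t, folded residue_t_def]
  bounded_linear_synth[OF wb_asym, folded asym_def]
  bounded_linear_synth[OF wb_first_mode, folded first_mode_def]
  bounded_linear_synth[OF wb_shift_mode, folded shift_mode_def]

lemmas bl_comp = bl_ops[THEN bounded_linear_compose]

lemma op_delta:
  "lift_time (delta k) = delta (k, 0)"
  "ser_deriv (delta (k, n)) = - delta (k, - (int n + 2))"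
  "ser_deriv_t (delta (k, n)) = - delta (k, 0, - (int n + 2))"
  "ser_w (delta (k, n)) = (1 / real (Suc n)) *\<^sub>R delta (k, - (int n + 1), 0)"
  "ser_t (delta (k, n)) = (1 / real (Suc n)) *\<^sub>R delta (k, 0, - (int n + 1))"
  "ser_cnj_t (delta (k, n)) = (1 / real (Suc n)) *\<^sub>R delta (k, 0, int n + 1)"
  "ser_quot (delta (k, n)) = (- 1 / real (Suc n)) *\<^sub>R
     (\<Sum>i<Suc n. delta (k, - (int i + 1), - (int n + 1 - int i)))"
  "ser_cnj_quot (delta (k, n)) = (1 / real (Suc n)) *\<^sub>R (\<Sum>i<Suc n. delta (k, int n - int i, int i))"
  "residue_t (delta (k, m, l)) = (if l = - 1 then delta (k, m) else 0)"
  "asym (delta (k, m)) = (if m < 0 then delta (k, nat (- m) - 1)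
     else if m = 0 then 0 else - delta (k, nat m - 1))"
  "first_mode (delta (k, n)) = (if n = 0 then delta k else 0)"
  "shift_mode (delta (k, n)) = (if n = 0 then 0 else delta (k, n - 1))"
  by (simp_all only: lift_time_def ser_deriv_def ser_deriv_t_def ser_w_def ser_t_def ser_cnj_t_def
      ser_quot_def ser_cnj_quot_def residue_t_def asym_def first_mode_def shift_mode_def synth_delta prod.case)

lemmas lin_ops = bl_ops[THEN bounded_linear.linear]
lemmas op_add = lin_ops[THEN linear_add]
lemmas op_diff = lin_ops[THEN linear_diff]
lemmas op_neg = lin_ops[THEN linear_neg]
lemmas op_scale = lin_ops[THEN linear_scale]
lemmas op_zero = lin_ops[THEN linear_0]

abbreviation "S2 \<equiv> delta (1::nat, 0::int)"
abbreviation "W2 \<equiv> delta (0::nat, 1::int)"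
abbreviation "S3 \<equiv> delta (1::nat, 0::int, 0::int)"
abbreviation "W3 \<equiv> delta (0::nat, 1::int, 0::int)"
abbreviation "T3 \<equiv> delta (0::nat, 0::int, 1::int)"
abbreviation "T3i \<equiv> delta (0::nat, 0::int, - 1::int)"
abbreviation "V3 \<equiv> delta (0::nat, - 1::int, - 1::int)"

(* ker1 uses cnj A / A = - 1 / (t w) on the circle; ker2 has the factor - 1 / d of the
   denominator pulled out. *)
definition ker1 :: "real \<Rightarrow> real \<Rightarrow> coeff_ser \<Rightarrow> torus_ser" where
  "ker1 b e a = (ser_cnj_quot a + V3 * ser_quot a)
     * neumann (e *\<^sub>R ((- b) *\<^sub>R (S3 * ser_quot a))) * (ser_deriv_t a - ser_quot a)"

definition ker2_den :: "real \<Rightarrow> real \<Rightarrow> real \<Rightarrow> real \<Rightarrow> coeff_ser \<Rightarrow> coeff_ser \<Rightarrow> torus_ser" where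
  "ker2_den d bj bk e aj ak = (1 / d) *\<^sub>R (S3 * (bk *\<^sub>R T3 + bj *\<^sub>R W3)
     + e *\<^sub>R (S3 * S3 * (bk\<^sup>2 *\<^sub>R ser_t ak + bj\<^sup>2 *\<^sub>R ser_w aj)))"

definition ker2 :: "real \<Rightarrow> real \<Rightarrow> real \<Rightarrow> real \<Rightarrow> coeff_ser \<Rightarrow> coeff_ser \<Rightarrow> torus_ser" where
  "ker2 d bj bk e aj ak = (T3i + e *\<^sub>R (bk *\<^sub>R (S3 * ser_cnj_t ak)))
     * (1 + e *\<^sub>R (bk *\<^sub>R (S3 * ser_deriv_t ak)))
     * ((- 1 / d) *\<^sub>R neumann (e *\<^sub>R ker2_den d bj bk e aj ak))"

text \<open>w times the derivative of the boundary map; i times its value is the tangent vector of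
  the boundary curve.\<close>

definition tangent_ser :: "real \<Rightarrow> real \<Rightarrow> coeff_ser \<Rightarrow> circle_ser" where
  "tangent_ser b e a = W2 * (1 + e *\<^sub>R (b *\<^sub>R (S2 * ser_deriv a)))"

text \<open>U, gj and gk are series too, since U and gamma_2 vary along the branch. Every factor
  epsilon of the functional appears as e times the monomial s.\<close>

definition F_ser :: "real \<Rightarrow> real \<Rightarrow> real \<Rightarrow> real \<Rightarrow> circle_ser \<Rightarrow> circle_ser \<Rightarrow> circle_ser
    \<Rightarrow> coeff_ser \<Rightarrow> coeff_ser \<Rightarrow> circle_ser" where
  "F_ser d bj bk e U gj gk aj ak = 2 *\<^sub>R (U * tangent_ser bj e aj) - gj * ser_deriv aj
     + e *\<^sub>R (bj *\<^sub>R (S2 * gj * tangent_ser bj e aj * residue_t (ker1 bj e aj)))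
     + gk * tangent_ser bj e aj * residue_t (ker2 d bj bk e aj ak)"

text \<open>Mere existence of a limit suffices, because F contains this kernel only with a factor
  e.\<close>

lemma near_ker1:
  assumes "bounded_linear A"
  shows "\<exists>c. near c (\<lambda>e x. ker1 b e (A x))"
  unfolding ker1_def
  by (rule exI)
     (rule near_const near_neumann(1) near_mult near_add near_diff near_scaleR near_linear bl_comp assms)+

lemma near_ker2_den:
  assumes "bounded_linear A" "bounded_linear B"
  shows "\<exists>c. near c (\<lambda>e x. ker2_den d bj bk e (A x) (B x))"
  unfolding ker2_den_def
  by (rule exI)
     (rule near_const near_mult near_add near_eps near_scaleR near_linear bl_comp assms)+

lemma near_ker2:
  assumes "bounded_linear A" "bounded_linear B"
  shows "near (\<lambda>x. (- 1 / d) *\<^sub>R T3i) (\<lambda>e x. ker2 d bj bk e (A x) (B x))"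
proof -
  obtain c where c: "near c (\<lambda>e x. ker2_den d bj bk e (A x) (B x))"
    using near_ker2_den[OF assms] by blast
  have "near (\<lambda>x. (T3i + 0) * (1 + 0) * ((- 1 / d) *\<^sub>R 1)) (\<lambda>e x. ker2 d bj bk e (A x) (B x))"
    unfolding ker2_def
    by (rule near_const near_neumann(1)[OF c] near_mult near_add near_eps near_scaleR
        near_linear bl_comp assms)+
  then show ?thesis by simp
qed

lemma near_tangent:
  assumes "bounded_linear A"
  shows "near (\<lambda>x. W2) (\<lambda>e x. tangent_ser b e (A x))"
proof -
  have "near (\<lambda>x. W2 * (1 + 0)) (\<lambda>e x. tangent_ser b e (A x))"
    unfolding tangent_ser_def
    by (rule near_const near_mult near_add near_eps near_scaleR near_linear bl_comp assms)+
  then show ?thesis by simp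
qed

text \<open>At e = 0 the interaction kernel is -1 / (d t), with residue -1 / d, and the
  self-interaction drops out.\<close>

lemma near_F_ser:
  assumes "bounded_linear A" "bounded_linear B" "near cU U" "near cj Gj" "near ck Gk"
  shows "near (\<lambda>x. 2 *\<^sub>R (cU x * W2) - cj x * ser_deriv (A x) - (1 / d) *\<^sub>R (ck x * W2))
     (\<lambda>e x. F_ser d bj bk e (U e x) (Gj e x) (Gk e x) (A x) (B x))"
proof -
  obtain c where c: "near c (\<lambda>e x. ker1 bj e (A x))" using near_ker1[OF assms(1)] by blast
  have "near (\<lambda>x. 2 *\<^sub>R (cU x * W2) - cj x * ser_deriv (A x) + 0
        + ck x * W2 * residue_t ((- 1 / d) *\<^sub>R T3i))
     (\<lambda>e x. F_ser d bj bk e (U e x) (Gj e x) (Gk e x) (A x) (B x))"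
    unfolding F_ser_def
    by (rule near_const near_tangent[OF assms(1)] assms(3-5) near_compose[OF bl_ops(9)] c
        near_ker2[OF assms(1,2)] near_add near_diff near_mult near_eps near_scaleR
        near_linear bl_comp assms(1,2))+
  moreover have "residue_t T3i = 1" by (simp add: op_delta one_wl1_def zero_prod_def)
  ultimately show ?thesis by (simp add: op_scale op_neg)
qed

section \<open>The quasi-Newton map and its fixed point\<close>

type_synonym branch_ser = "time_ser \<times> time_ser \<times> coeff_ser \<times> coeff_ser"

text \<open>The unknowns are corrections to the values 1 / (2 d) and 1 that U and gamma_2 take at
  parameter 0 when gamma_1 = 1.\<close>

definition U_ser :: "real \<Rightarrow> branch_ser \<Rightarrow> circle_ser" where
  "U_ser d x = (1 / (2 * d)) *\<^sub>R 1 + lift_time (fst x)"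
definition G_ser :: "branch_ser \<Rightarrow> circle_ser" where
  "G_ser x = 1 + lift_time (fst (snd x))"
abbreviation A_ser :: "branch_ser \<Rightarrow> coeff_ser" where "A_ser x \<equiv> fst (snd (snd x))"
abbreviation B_ser :: "branch_ser \<Rightarrow> coeff_ser" where "B_ser x \<equiv> snd (snd (snd x))"

definition res1 :: "real \<Rightarrow> real \<Rightarrow> real \<Rightarrow> real \<Rightarrow> branch_ser \<Rightarrow> circle_ser" where
  "res1 d b1 b2 e x = F_ser d b1 b2 e (U_ser d x) 1 (G_ser x) (A_ser x) (B_ser x)"
definition res2 :: "real \<Rightarrow> real \<Rightarrow> real \<Rightarrow> real \<Rightarrow> branch_ser \<Rightarrow> circle_ser" where
  "res2 d b1 b2 e x = F_ser d b2 b1 e (U_ser d x) (G_ser x) 1 (B_ser x) (A_ser x)"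

(* A quasi-Newton step: at e = 0 and x = 0 the added terms are minus the identity. *)
definition newton_map :: "real \<Rightarrow> real \<Rightarrow> real \<Rightarrow> real \<Rightarrow> branch_ser \<Rightarrow> branch_ser" where
  "newton_map d b1 b2 e x =
    (fst x + (1/2) *\<^sub>R first_mode (asym (res2 d b1 b2 e x)),
     fst (snd x) + d *\<^sub>R first_mode (asym (res2 d b1 b2 e x - res1 d b1 b2 e x)),
     A_ser x - shift_mode (asym (res1 d b1 b2 e x)),
     B_ser x - shift_mode (asym (res2 d b1 b2 e x)))"

lemma first_mode_lift_time: "first_mode (asym (lift_time u * W2)) = - u"
  by (rule bounded_linear_eqI[of "\<lambda>u. first_mode (asym (lift_time u * W2))" "uminus"])
     (rule bl_comp times_left_bl bl_ops bounded_linear_ident bounded_linear_minus[OF bounded_linear_ident]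
       | simp add: op_delta delta_times op_neg)+

lemma shift_mode_lift_time: "shift_mode (asym (lift_time u * W2)) = 0"
  by (rule bounded_linear_eqI[of "\<lambda>u. shift_mode (asym (lift_time u * W2))" "\<lambda>u. 0"])
     (rule bl_comp times_left_bl bl_ops bounded_linear_ident bounded_linear_zero
       | simp add: op_delta delta_times op_neg)+

lemma first_mode_deriv: "first_mode (asym (ser_deriv a)) = 0"
  by (rule bounded_linear_eqI[of "\<lambda>a. first_mode (asym (ser_deriv a))" "\<lambda>u. 0"])
     (rule bl_comp bl_ops bounded_linear_zero | (clarify, simp add: op_delta op_neg nat_add_distrib))+

lemma shift_mode_deriv: "shift_mode (asym (ser_deriv a)) = - a"
  by (rule bounded_linear_eqI[of "\<lambda>a. shift_mode (asym (ser_deriv a))" "uminus"])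
     (rule bl_comp bl_ops bounded_linear_minus[OF bounded_linear_ident] | (clarify, simp add: op_delta op_neg nat_add_distrib))+

lemma bl_components:
  "bounded_linear (fst :: branch_ser \<Rightarrow> _)" "bounded_linear (\<lambda>x :: branch_ser. fst (snd x))"
  "bounded_linear A_ser" "bounded_linear B_ser"
  by (auto intro!: bounded_linear_intros)

text \<open>What the quasi-Newton step retains at e = 0: all linear parts cancel, and
  \<open>z\<close> stands for the one nonlinear term left, the product of the correction of gamma_2
  with f_2'.\<close>

definition quad_part :: "real \<Rightarrow> circle_ser \<Rightarrow> branch_ser" where
  "quad_part d z = ((- 1/2) *\<^sub>R first_mode (asym z), (- d) *\<^sub>R first_mode (asym z), 0, shift_mode (asym z))"

lemma bl_quad_part: "bounded_linear (quad_part d)"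
  unfolding quad_part_def
  by (intro bounded_linear_Pair bounded_linear_compose[OF bounded_linear_scaleR_right]
      bounded_linear_compose[OF bl_ops(11)] bounded_linear_compose[OF bl_ops(12)] bl_ops bounded_linear_zero)

lemma near_newton_map:
  assumes "d \<noteq> 0"
  shows "near (\<lambda>x. quad_part d (lift_time (fst (snd x)) * ser_deriv (B_ser x))) (newton_map d b1 b2)"
proof -
  have nU: "near (U_ser d) (\<lambda>e. U_ser d)" and nG: "near G_ser (\<lambda>e. G_ser)"
    unfolding U_ser_def G_ser_def
    by (intro near_add near_const near_linear bounded_linear_compose[OF bl_ops(1)] bl_components)+
  define c1 where "c1 x = 2 *\<^sub>R (U_ser d x * W2) - 1 * ser_deriv (A_ser x) - (1 / d) *\<^sub>R (G_ser x * W2)" for x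
  define c2 where "c2 x = 2 *\<^sub>R (U_ser d x * W2) - G_ser x * ser_deriv (B_ser x) - (1 / d) *\<^sub>R (1 * W2)" for x
  have n1: "near c1 (res1 d b1 b2)"
    unfolding c1_def res1_def
    by (intro near_F_ser nU nG near_const bl_components)
  have n2: "near c2 (res2 d b1 b2)"
    unfolding c2_def res2_def
    by (intro near_F_ser nU nG near_const bl_components)
  \<comment> \<open>The contributions of 2 U w and -w / d at the base point cancel, by the choice of
    the values 1 / (2 d) and 1.\<close>
  have c1: "c1 x = 2 *\<^sub>R (lift_time (fst x) * W2) - ser_deriv (A_ser x)
      - (1 / d) *\<^sub>R (lift_time (fst (snd x)) * W2)" for x
    using assms by (simp add: c1_def U_ser_def G_ser_def algebra_simps)
  have c2: "c2 x = 2 *\<^sub>R (lift_time (fst x) * W2) - ser_deriv (B_ser x)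
      - lift_time (fst (snd x)) * ser_deriv (B_ser x)" for x
    using assms by (simp add: c2_def U_ser_def G_ser_def algebra_simps)
  have "near (\<lambda>x. (fst x + (1/2) *\<^sub>R first_mode (asym (c2 x)),
     fst (snd x) + d *\<^sub>R first_mode (asym (c2 x - c1 x)),
     A_ser x - shift_mode (asym (c1 x)), B_ser x - shift_mode (asym (c2 x)))) (newton_map d b1 b2)"
    unfolding newton_map_def
    by (intro near_Pair near_add near_diff near_scaleR near_compose[OF bl_ops(11)]
        near_compose[OF bl_ops(12)] near_compose[OF bl_ops(10)] n1 n2 near_linear bl_components)
  moreover have "(fst x + (1/2) *\<^sub>R first_mode (asym (c2 x)),
     fst (snd x) + d *\<^sub>R first_mode (asym (c2 x - c1 x)),
     A_ser x - shift_mode (asym (c1 x)), B_ser x - shift_mode (asym (c2 x)))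
     = quad_part d (lift_time (fst (snd x)) * ser_deriv (B_ser x))" for x
    unfolding c1 c2 quad_part_def
    using assms
    by (simp add: op_add op_diff op_scale first_mode_lift_time shift_mode_lift_time
        first_mode_lift_time[unfolded mult.commute[of _ W2]]
        shift_mode_lift_time[unfolded mult.commute[of _ W2]]
        first_mode_deriv shift_mode_deriv algebra_simps)
  ultimately show ?thesis by simp
qed

text \<open>The map at e = 0 is bilinear in the correction of gamma_2 and in f_2', so on a ball its
  Lipschitz constant is proportional to the radius, as \<open>near_fixed_point\<close>
  demands.\<close>

lemma exists_branch_ser:
  assumes "d \<noteq> 0" and "0 < \<delta>"
  shows "\<exists>r>0. \<forall>e. \<bar>e\<bar> \<le> r \<longrightarrow> (\<exists>x. norm x \<le> \<delta> \<and> newton_map d b1 b2 e x = x)"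
proof -
  obtain K1 where K1: "0 < K1" "\<And>z. norm (quad_part d z) \<le> norm z * K1"
    using bounded_linear.pos_bounded[OF bl_quad_part] by blast
  have bl2: "bounded_linear (\<lambda>x :: branch_ser. lift_time (fst (snd x)))"
    by (intro bounded_linear_compose[OF bl_ops(1)] bl_components)
  have bl3: "bounded_linear (\<lambda>x. ser_deriv (B_ser x))"
    by (intro bounded_linear_compose[OF bl_ops(2)] bl_components)
  obtain K2 where K2: "0 < K2" "\<And>x :: branch_ser. norm (lift_time (fst (snd x))) \<le> norm x * K2"
    using bounded_linear.pos_bounded[OF bl2] by blast
  obtain K3 where K3: "0 < K3" "\<And>x. norm (ser_deriv (B_ser x)) \<le> norm x * K3"
    using bounded_linear.pos_bounded[OF bl3] by blast
  show ?thesis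
  proof (rule near_fixed_point[OF near_newton_map[OF assms(1)]])
    show "quad_part d (lift_time (fst (snd 0)) * ser_deriv (B_ser 0)) = 0"
      by (simp add: op_zero quad_part_def zero_prod_def)
    show "0 \<le> 2 * K1 * K2 * K3" using K1 K2 K3 by simp
    fix x y :: branch_ser and \<rho> :: real
    assume x: "norm x \<le> \<rho>" and y: "norm y \<le> \<rho>"
    define p q where "p z = lift_time (fst (snd z))" and "q z = ser_deriv (B_ser z)" for z :: branch_ser
    have lp: "p x - p y = p (x - y)" "q x - q y = q (x - y)"
      by (simp_all add: p_def q_def op_diff)
    have "p x * q x - p y * q y = (p x - p y) * q x + p y * (q x - q y)" by (simp add: algebra_simps)
    then have "norm (p x * q x - p y * q y) \<le> norm (p (x - y)) * norm (q x) + norm (p y) * norm (q (x - y))"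
      unfolding lp by (simp only:) (intro norm_triangle_le add_mono norm_mult_ineq)
    also have "\<dots> \<le> (norm (x - y) * K2) * (\<rho> * K3) + (\<rho> * K2) * (norm (x - y) * K3)"
    proof -
      have "norm (q x) \<le> \<rho> * K3" "norm (p y) \<le> \<rho> * K2"
        unfolding p_def q_def
        using order_trans[OF K3(2)[of x] mult_right_mono[OF x, of K3]]
          order_trans[OF K2(2)[of y] mult_right_mono[OF y, of K2]] K2(1) K3(1) by simp_all
      moreover have "norm (p (x - y)) \<le> norm (x - y) * K2" "norm (q (x - y)) \<le> norm (x - y) * K3"
        using K2(2)[of "x - y"] K3(2)[of "x - y"] by (simp_all add: p_def q_def)
      moreover have "0 \<le> \<rho>" using x norm_ge_zero[of x] by linarith
      ultimately show ?thesis using K2(1) K3(1) by (intro add_mono mult_mono) auto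
    qed
    finally have n: "norm (p x * q x - p y * q y) \<le> 2 * K2 * K3 * \<rho> * norm (x - y)" by (simp add: algebra_simps)
    have "norm (quad_part d (p x * q x) - quad_part d (p y * q y)) = norm (quad_part d (p x * q x - p y * q y))"
      by (simp add: linear_diff[OF bounded_linear.linear[OF bl_quad_part]])
    also have "\<dots> \<le> (2 * K2 * K3 * \<rho> * norm (x - y)) * K1"
      using K1(2)[of "p x * q x - p y * q y"] mult_right_mono[OF n, of K1] K1(1) by linarith
    finally show "norm (quad_part d (lift_time (fst (snd x)) * ser_deriv (B_ser x))
        - quad_part d (lift_time (fst (snd y)) * ser_deriv (B_ser y))) \<le> 2 * K1 * K2 * K3 * \<rho> * norm (x - y)"
      unfolding p_def q_def by (simp add: mult_ac)
  qed (use assms in auto)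
qed

lemma entry_first_mode: "entry (first_mode z) k = entry z (k, 0)"
  by (rule bounded_linear_eqI[of "\<lambda>z. entry (first_mode z) k" "\<lambda>z. entry z (k, 0)"])
     (rule bounded_linear_compose[OF bounded_linear_entry] bl_ops bounded_linear_entry
       | (clarify, simp add: op_delta entry_delta))+

lemma entry_shift_mode: "entry (shift_mode z) (k, n) = entry z (k, Suc n)"
  by (rule bounded_linear_eqI[of "\<lambda>z. entry (shift_mode z) (k, n)" "\<lambda>z. entry z (k, Suc n)"])
     (rule bounded_linear_compose[OF bounded_linear_entry] bl_ops bounded_linear_entry
       | (clarify, auto simp: op_delta entry_delta))+

lemma entry_asym: "entry (asym z) (k, n) = entry z (k, - (int n + 1)) - entry z (k, int n + 1)"
proof (rule bounded_linear_eqI[of "\<lambda>z. entry (asym z) (k, n)"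
        "\<lambda>z. entry z (k, - (int n + 1)) - entry z (k, int n + 1)"])
  show "entry (asym (delta g)) (k, n) = entry (delta g) (k, - (int n + 1)) - entry (delta g) (k, int n + 1)" for g
  proof (cases g)
    case (Pair i m)
    then show ?thesis by (auto simp: op_delta entry_delta)
  qed
qed (rule bounded_linear_compose[OF bounded_linear_entry] bounded_linear_sub bl_ops bounded_linear_entry)+

lemma coeff_ser_eq_0I:
  assumes "first_mode z = 0" "shift_mode z = 0"
  shows "z = 0"
proof (rule wl1_eqI)
  fix g :: "nat \<times> nat"
  obtain k n where g: "g = (k, n)" by (cases g)
  show "entry z g = entry 0 g"
    using entry_first_mode[of z k] entry_shift_mode[of z k "n - 1"] assms
    by (cases n) (auto simp: g)
qed

text \<open>All increments vanish at a fixed point. The increment of U yields the first mode of the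
  second residual, that of gamma_2 then the first mode of the first one, and the last two yield the
  higher modes.\<close>

lemma newton_map_fixed:
  assumes "newton_map d b1 b2 e x = x" and "d \<noteq> 0"
  shows "asym (res1 d b1 b2 e x) = 0" "asym (res2 d b1 b2 e x) = 0"
proof -
  from arg_cong[OF assms(1), of fst] have 1: "first_mode (asym (res2 d b1 b2 e x)) = 0"
    by (simp add: newton_map_def)
  from arg_cong[OF assms(1), of "\<lambda>x. fst (snd x)"] 1 assms(2)
  have 2: "first_mode (asym (res1 d b1 b2 e x)) = 0"
    by (simp add: newton_map_def op_diff)
  from arg_cong[OF assms(1), of A_ser] have 3: "shift_mode (asym (res1 d b1 b2 e x)) = 0"
    by (simp add: newton_map_def)
  from arg_cong[OF assms(1), of B_ser] have 4: "shift_mode (asym (res2 d b1 b2 e x)) = 0"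
    by (simp add: newton_map_def)
  show "asym (res1 d b1 b2 e x) = 0" "asym (res2 d b1 b2 e x) = 0"
    using 1 2 3 4 by (auto intro: coeff_ser_eq_0I)
qed

subsection \<open>Evaluation on the unit circle\<close>

definition ev1 :: "real \<Rightarrow> time_ser \<Rightarrow> real" where
  "ev1 s = synth (\<lambda>k. s ^ k)"
definition ev2 :: "real \<Rightarrow> complex \<Rightarrow> circle_ser \<Rightarrow> complex" where
  "ev2 s w = synth (\<lambda>(k, m). of_real s ^ k * w powi m)"
definition ev3 :: "real \<Rightarrow> complex \<Rightarrow> complex \<Rightarrow> torus_ser \<Rightarrow> complex" where
  "ev3 s w t = synth (\<lambda>(k, m, l). of_real s ^ k * w powi m * t powi l)"
text \<open>The boundary function with coefficients \<open>a\<close> at time s; \<open>dser\<close>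
  is its derivative, the term cnj(w)^(n+1) / (n+1) being w^-(n+1) / (n+1) on the circle.\<close>

definition cser :: "real \<Rightarrow> coeff_ser \<Rightarrow> complex \<Rightarrow> complex" where
  "cser s a w = synth (\<lambda>(k, n). of_real (s ^ k / real (Suc n)) * cnj w ^ Suc n) a"
definition dser :: "real \<Rightarrow> coeff_ser \<Rightarrow> complex \<Rightarrow> complex" where
  "dser s a w = synth (\<lambda>(k, n). - of_real (s ^ k) * cnj w ^ (n + 2)) a"

lemma characterD: "character \<rho> \<Longrightarrow> norm (\<rho> g) \<le> wt g"
  by (simp add: character_def)

lemma abs_power_le_wt: "\<bar>s\<bar> \<le> 1 \<Longrightarrow> \<bar>s\<bar> ^ k \<le> (1::real)"
  by (simp add: power_le_one)

lemma wbounded_ev1: "\<bar>s\<bar> \<le> 1 \<Longrightarrow> wbounded (\<lambda>k::nat. s ^ k :: real)"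
  by (rule wboundedI[of _ 1])
     (auto simp: power_abs intro: order_trans[OF abs_power_le_wt wt_ge_1])

lemma norm_cser_term: "\<bar>s\<bar> \<le> 1 \<Longrightarrow> norm w = 1 \<Longrightarrow>
    norm (case g of (k, n) \<Rightarrow> of_real (s ^ k / real (Suc n)) * cnj w ^ Suc n) \<le> 1 * wt g"
proof (cases g)
  case (Pair k n)
  assume s: "\<bar>s\<bar> \<le> 1" and w: "norm w = 1"
  have "\<bar>s\<bar> ^ k / real (Suc n) \<le> 1" using abs_power_le_wt[OF s, of k] by (simp add: divide_le_eq)
  moreover have "norm (of_real (s ^ k / real (Suc n)) * cnj w ^ Suc n) = \<bar>s\<bar> ^ k / real (Suc n)"
    unfolding norm_mult norm_of_real norm_power complex_mod_cnj w abs_divide power_abs by simp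
  ultimately show ?thesis using wt_ge_1[of "(k, n)"] unfolding Pair prod.case by linarith
qed

lemma wbounded_cser: "\<bar>s\<bar> \<le> 1 \<Longrightarrow> norm w = 1 \<Longrightarrow>
    wbounded (\<lambda>(k, n). of_real (s ^ k / real (Suc n)) * cnj w ^ Suc n)"
  by (rule wboundedI[OF norm_cser_term])

lemma norm_dser_term: "\<bar>s\<bar> \<le> 1 \<Longrightarrow> norm w = 1 \<Longrightarrow>
    norm (case g of (k, n) \<Rightarrow> - of_real (s ^ k) * cnj w ^ (n + 2)) \<le> 1 * wt g"
  using wt_ge_1[of g] order_trans[OF abs_power_le_wt]
  by (auto simp: norm_mult norm_power power_abs split: prod.splits)

lemma wbounded_dser: "\<bar>s\<bar> \<le> 1 \<Longrightarrow> norm w = 1 \<Longrightarrow>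
    wbounded (\<lambda>(k, n). - of_real (s ^ k) * cnj w ^ (n + 2))"
  by (rule wboundedI[OF norm_dser_term])

lemma norm_powi_1: "norm w = 1 \<Longrightarrow> norm (w powi m) = (1::real)" for w :: complex
  by (simp add: norm_power_int)

lemma character_ev2: 
  assumes "\<bar>s\<bar> \<le> 1" "norm w = 1"
  shows "character (\<lambda>(k, m). of_real s ^ k * w powi m)"
  unfolding character_def
proof (intro conjI allI)
  have "w \<noteq> 0" using assms(2) by auto
  then show "(case g + h of (k, m) \<Rightarrow> of_real s ^ k * w powi m) =
     (case g of (k, m) \<Rightarrow> of_real s ^ k * w powi m) * (case h of (k, m) \<Rightarrow> of_real s ^ k * w powi m)" for g h
    by (auto simp: power_add power_int_add split: prod.splits)
  show "norm (case g of (k, m) \<Rightarrow> of_real s ^ k * w powi m) \<le> wt g" for g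
    using order_trans[OF abs_power_le_wt[OF assms(1)] wt_ge_1]
    by (auto simp: norm_mult norm_power norm_powi_1[OF assms(2)] split: prod.splits)
qed (auto simp: zero_prod_def)

lemma character_ev3:
  assumes "\<bar>s\<bar> \<le> 1" "norm w = 1" "norm t = 1"
  shows "character (\<lambda>(k, m, l). of_real s ^ k * w powi m * t powi l)"
  unfolding character_def
proof (intro conjI allI)
  have "w \<noteq> 0" "t \<noteq> 0" using assms by auto
  then show "(case g + h of (k, m, l) \<Rightarrow> of_real s ^ k * w powi m * t powi l) =
     (case g of (k, m, l) \<Rightarrow> of_real s ^ k * w powi m * t powi l)
     * (case h of (k, m, l) \<Rightarrow> of_real s ^ k * w powi m * t powi l)" for g h
    by (auto simp: power_add power_int_add split: prod.splits)
  show "norm (case g of (k, m, l) \<Rightarrow> of_real s ^ k * w powi m * t powi l) \<le> wt g" for g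
    using order_trans[OF abs_power_le_wt[OF assms(1)] wt_ge_1]
    by (auto simp: norm_mult norm_power norm_powi_1[OF assms(2)] norm_powi_1[OF assms(3)] split: prod.splits)
qed (auto simp: zero_prod_def)

lemma ev_delta [simp]:
  "ev2 s w (delta (k, m)) = of_real s ^ k * w powi m"
  "ev3 s w t (delta (k, m, l)) = of_real s ^ k * w powi m * t powi l"
  "cser s (delta (k, n)) w = of_real (s ^ k / real (Suc n)) * cnj w ^ Suc n"
  "dser s (delta (k, n)) w = - of_real (s ^ k) * cnj w ^ (n + 2)"
  "ev1 s (delta k) = s ^ k"
  by (simp_all add: ev1_def ev2_def ev3_def cser_def dser_def)

context
  fixes s :: real
  assumes s: "\<bar>s\<bar> \<le> 1"
begin

lemma bl_ev1: "bounded_linear (ev1 s)"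
  unfolding ev1_def by (rule bounded_linear_synth[OF wbounded_ev1[OF s]])
lemma bl_cser: "norm w = 1 \<Longrightarrow> bounded_linear (\<lambda>a. cser s a w)"
  unfolding cser_def by (rule bounded_linear_synth[OF wbounded_cser[OF s]])
lemma bl_dser: "norm w = 1 \<Longrightarrow> bounded_linear (\<lambda>a. dser s a w)"
  unfolding dser_def by (rule bounded_linear_synth[OF wbounded_dser[OF s]])
lemma bl_ev2: "norm w = 1 \<Longrightarrow> bounded_linear (ev2 s w)"
  unfolding ev2_def by (rule bounded_linear_synth[OF character_wbounded[OF character_ev2[OF s]]])
lemma bl_ev3: "norm w = 1 \<Longrightarrow> norm t = 1 \<Longrightarrow> bounded_linear (ev3 s w t)"
  unfolding ev3_def by (rule bounded_linear_synth[OF character_wbounded[OF character_ev3[OF s]]])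

lemma ev2_ring:
  assumes "norm w = 1"
  shows "ev2 s w (x * y) = ev2 s w x * ev2 s w y" "ev2 s w 1 = 1"
    "ev2 s w (x + y) = ev2 s w x + ev2 s w y" "ev2 s w (x - y) = ev2 s w x - ev2 s w y"
    "ev2 s w (r *\<^sub>R x) = of_real r * ev2 s w x" "ev2 s w (- x) = - ev2 s w x" "ev2 s w 0 = 0"
  using linear_add[OF bounded_linear.linear[OF bl_ev2[OF assms]]]
    linear_diff[OF bounded_linear.linear[OF bl_ev2[OF assms]]]
    linear_scale[OF bounded_linear.linear[OF bl_ev2[OF assms]]]
    linear_neg[OF bounded_linear.linear[OF bl_ev2[OF assms]]]
    linear_0[OF bounded_linear.linear[OF bl_ev2[OF assms]]]
    synth_character_mult[OF character_ev2[OF s assms]] synth_character_one[OF character_ev2[OF s assms]]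
  by (simp_all add: ev2_def scaleR_conv_of_real)

lemma ev3_ring:
  assumes "norm w = 1" "norm t = 1"
  shows "ev3 s w t (x * y) = ev3 s w t x * ev3 s w t y" "ev3 s w t 1 = 1"
    "ev3 s w t (x + y) = ev3 s w t x + ev3 s w t y" "ev3 s w t (x - y) = ev3 s w t x - ev3 s w t y"
    "ev3 s w t (r *\<^sub>R x) = of_real r * ev3 s w t x" "ev3 s w t (- x) = - ev3 s w t x" "ev3 s w t 0 = 0"
    "ev3 s w t (sum f F) = (\<Sum>i\<in>F. ev3 s w t (f i))"
  using linear_add[OF bounded_linear.linear[OF bl_ev3[OF assms]]]
    linear_diff[OF bounded_linear.linear[OF bl_ev3[OF assms]]]
    linear_scale[OF bounded_linear.linear[OF bl_ev3[OF assms]]]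
    linear_neg[OF bounded_linear.linear[OF bl_ev3[OF assms]]]
    linear_0[OF bounded_linear.linear[OF bl_ev3[OF assms]]]
    linear_sum[OF bounded_linear.linear[OF bl_ev3[OF assms]]]
    synth_character_mult[OF character_ev3[OF s assms]] synth_character_one[OF character_ev3[OF s assms]]
  by (simp_all add: ev3_def scaleR_conv_of_real)

text \<open>Evaluating (1 - x) \<open>neumann x\<close> = 1 gives both the nonvanishing of the
  denominator and the reciprocal.\<close>

lemma ev3_neumann:
  assumes "norm w = 1" "norm t = 1" "norm x < 1"
  shows "ev3 s w t x \<noteq> 1" "ev3 s w t (neumann x) = 1 / (1 - ev3 s w t x)"
proof -
  have "ev3 s w t ((1 - x) * neumann x) = 1"
    by (simp add: neumann(1)[OF assms(3)] ev3_ring[OF assms(1,2)])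
  then have *: "(1 - ev3 s w t x) * ev3 s w t (neumann x) = 1"
    by (simp add: ev3_ring[OF assms(1,2)])
  then show "ev3 s w t x \<noteq> 1" by auto
  with * show "ev3 s w t (neumann x) = 1 / (1 - ev3 s w t x)" by (simp add: field_simps)
qed

end

lemma cnj_circ: "norm w = 1 \<Longrightarrow> cnj w = inverse w"
  by (rule inverse_unique[symmetric]) (simp flip: complex_norm_square)

lemma powi_neg_circ: "norm w = 1 \<Longrightarrow> w powi (- int n) = cnj w ^ n"
  by (simp add: power_int_minus cnj_circ power_inverse)

lemma ev_ops:
  assumes s: "\<bar>s\<bar> \<le> 1" and w: "norm w = 1" and t: "norm t = 1"
  shows "ev2 s w (lift_time u) = of_real (ev1 s u)"
    and "ev2 s w (ser_deriv a) = dser s a w"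
    and "ev3 s w t (ser_deriv_t a) = dser s a t"
    and "ev3 s w t (ser_w a) = cser s a w"
    and "ev3 s w t (ser_t a) = cser s a t"
    and "ev3 s w t (ser_cnj_t a) = cnj (cser s a t)"
    and "(t - w) * ev3 s w t (ser_quot a) = cser s a t - cser s a w"
    and "(t - w) * ev3 s w t (ser_cnj_quot a) = cnj (cser s a t - cser s a w)"
    and "ev3 s w w (ser_quot a) = dser s a w"
proof -
  note R2 = ev2_ring[OF s w] and R3 = ev3_ring[OF s w t] and R3' = ev3_ring[OF s w w]
  note B = bl_ev1[OF s] bl_cser[OF s w] bl_cser[OF s t] bl_dser[OF s w] bl_dser[OF s t]
    bounded_linear_compose[OF bl_ev2[OF s w]] bounded_linear_compose[OF bl_ev3[OF s w t]]
    bounded_linear_compose[OF bl_ev3[OF s w w]] bounded_linear_compose[OF bounded_linear_of_real]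
    bounded_linear_compose[OF bounded_linear_cnj] bounded_linear_sub bounded_linear_mult_right
    bounded_linear_compose[OF bounded_linear_mult_right] bl_ops
  have pw: "w powi (- int n - 2) = cnj w ^ (n + 2)" "w powi (- int n - 1) = cnj w ^ (n + 1)"
    "t powi (- int n - 2) = cnj t ^ (n + 2)" "t powi (- int n - 1) = cnj t ^ (n + 1)"
    "t powi (int n + 1) = t ^ (n + 1)" for n
  proof -
    have "- int n - 2 = - int (n + 2)" "- int n - 1 = - int (n + 1)" "int n + 1 = int (n + 1)" by auto
    then show "w powi (- int n - 2) = cnj w ^ (n + 2)" "w powi (- int n - 1) = cnj w ^ (n + 1)"
      "t powi (- int n - 2) = cnj t ^ (n + 2)" "t powi (- int n - 1) = cnj t ^ (n + 1)"
      "t powi (int n + 1) = t ^ (n + 1)"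
      by (simp_all only: powi_neg_circ[OF w] powi_neg_circ[OF t] power_int_of_nat)
  qed
  show "ev2 s w (lift_time u) = of_real (ev1 s u)"
    by (rule bounded_linear_eqI[of "\<lambda>u. ev2 s w (lift_time u)" "\<lambda>u. of_real (ev1 s u)"])
       (rule B | simp add: op_delta)+
  show "ev2 s w (ser_deriv a) = dser s a w"
    by (rule bounded_linear_eqI[of "\<lambda>a. ev2 s w (ser_deriv a)" "\<lambda>a. dser s a w"])
       (rule B | (clarify, simp add: op_delta R2 pw del: power_Suc))+
  show "ev3 s w t (ser_deriv_t a) = dser s a t"
    by (rule bounded_linear_eqI[of "\<lambda>a. ev3 s w t (ser_deriv_t a)" "\<lambda>a. dser s a t"])
       (rule B | (clarify, simp add: op_delta R3 pw del: power_Suc))+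
  show "ev3 s w t (ser_w a) = cser s a w"
    by (rule bounded_linear_eqI[of "\<lambda>a. ev3 s w t (ser_w a)" "\<lambda>a. cser s a w"])
       (rule B | (clarify, simp add: op_delta R3 pw))+
  show "ev3 s w t (ser_t a) = cser s a t"
    by (rule bounded_linear_eqI[of "\<lambda>a. ev3 s w t (ser_t a)" "\<lambda>a. cser s a t"])
       (rule B | (clarify, simp add: op_delta R3 pw))+
  show "ev3 s w t (ser_cnj_t a) = cnj (cser s a t)"
    by (rule bounded_linear_eqI[of "\<lambda>a. ev3 s w t (ser_cnj_t a)" "\<lambda>a. cnj (cser s a t)"])
       (rule B | (clarify, simp add: op_delta R3 pw))+
  have w0: "w \<noteq> 0" and t0: "t \<noteq> 0" using w t by auto
  have ww: "w * cnj w = 1" and tt: "t * cnj t = 1"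
    using w t by (simp_all flip: complex_norm_square)
  have quot: "(t - w) * ev3 s w t (ser_quot (delta (k, n))) = cser s (delta (k, n)) t - cser s (delta (k, n)) w" for k n
  proof -
    define x y where "x = cnj t" and "y = cnj w"
    have tx: "t * x = 1" "w * y = 1" using ww tt by (simp_all add: x_def y_def)
    have summand: "w powi (- (int i + 1)) * t powi (- (int n + 1 - int i)) = y ^ Suc i * x ^ Suc (n - i)" if "i < Suc n" for i
    proof -
      have "- (int n + 1 - int i) = - int (Suc (n - i))" "- (int i + 1) = - int (Suc i)" using that by auto
      then show ?thesis by (simp only: powi_neg_circ[OF w] powi_neg_circ[OF t] x_def y_def)
    qed
    \<comment> \<open>With x = 1/t and y = 1/w, (t - w) x y = y - x; what remains is the geometric
      sum for y^(n+1) - x^(n+1).\<close>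
    have "(t - w) * (\<Sum>i<Suc n. y ^ Suc i * x ^ Suc (n - i))
        = (\<Sum>i<Suc n. ((t * x) * y - (w * y) * x) * (y ^ i * x ^ (n - i)))"
      unfolding sum_distrib_left by (intro sum.cong refl) (simp add: algebra_simps)
    also have "\<dots> = (y - x) * (\<Sum>i<Suc n. y ^ i * x ^ (n - i))"
      unfolding tx sum_distrib_left by simp
    also have "\<dots> = y ^ Suc n - x ^ Suc n"
      by (rule diff_power_eq_sum[symmetric])
    finally have e: "(t - w) * (\<Sum>i<Suc n. y ^ Suc i * x ^ Suc (n - i)) = y ^ Suc n - x ^ Suc n" .
    have "ev3 s w t (ser_quot (delta (k, n)))
        = of_real (- 1 / real (Suc n)) * (of_real s ^ k * (\<Sum>i<Suc n. w powi (- (int i + 1)) * t powi (- (int n + 1 - int i))))"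
      unfolding op_delta R3 ev_delta sum_distrib_left by (simp only: mult.assoc)
    also have "(\<Sum>i<Suc n. w powi (- (int i + 1)) * t powi (- (int n + 1 - int i)))
        = (\<Sum>i<Suc n. y ^ Suc i * x ^ Suc (n - i))"
      by (intro sum.cong refl) (simp only: summand lessThan_iff)
    finally have "(t - w) * ev3 s w t (ser_quot (delta (k, n)))
        = of_real (- 1 / real (Suc n)) * of_real s ^ k * ((t - w) * (\<Sum>i<Suc n. y ^ Suc i * x ^ Suc (n - i)))"
      by (simp only: mult_ac)
    then show ?thesis
      unfolding e ev_delta x_def[symmetric] y_def[symmetric] by (simp add: algebra_simps diff_divide_distrib add_divide_distrib)
  qed
  show "(t - w) * ev3 s w t (ser_quot a) = cser s a t - cser s a w"
    by (rule bounded_linear_eqI[of "\<lambda>a. (t - w) * ev3 s w t (ser_quot a)" "\<lambda>a. cser s a t - cser s a w"])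
       (rule B | (clarify, rule quot))+
  have cquot: "(t - w) * ev3 s w t (ser_cnj_quot (delta (k, n))) = cnj (cser s (delta (k, n)) t - cser s (delta (k, n)) w)" for k n
  proof -
    have summand: "w powi (int n - int i) * t powi (int i) = t ^ i * w ^ (n - i)" if "i < Suc n" for i
    proof -
      have "int n - int i = int (n - i)" using that by auto
      then show ?thesis by (simp only: power_int_of_nat mult.commute)
    qed
    have e: "(t - w) * (\<Sum>i<Suc n. t ^ i * w ^ (n - i)) = t ^ Suc n - w ^ Suc n"
      by (rule diff_power_eq_sum[symmetric])
    have "ev3 s w t (ser_cnj_quot (delta (k, n)))
        = of_real (1 / real (Suc n)) * (of_real s ^ k * (\<Sum>i<Suc n. w powi (int n - int i) * t powi (int i)))"
      unfolding op_delta R3 ev_delta sum_distrib_left by (simp only: mult.assoc)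
    also have "(\<Sum>i<Suc n. w powi (int n - int i) * t powi (int i)) = (\<Sum>i<Suc n. t ^ i * w ^ (n - i))"
      by (intro sum.cong refl) (simp only: summand lessThan_iff)
    finally have "(t - w) * ev3 s w t (ser_cnj_quot (delta (k, n)))
        = of_real (1 / real (Suc n)) * of_real s ^ k * ((t - w) * (\<Sum>i<Suc n. t ^ i * w ^ (n - i)))"
      by (simp only: mult_ac)
    then show ?thesis
      unfolding e ev_delta by (simp add: algebra_simps diff_divide_distrib add_divide_distrib)
  qed
  show "(t - w) * ev3 s w t (ser_cnj_quot a) = cnj (cser s a t - cser s a w)"
    by (rule bounded_linear_eqI[of "\<lambda>a. (t - w) * ev3 s w t (ser_cnj_quot a)" "\<lambda>a. cnj (cser s a t - cser s a w)"])
       (rule B | (clarify, rule cquot))+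
  \<comment> \<open>On the diagonal all n + 1 terms of the divided difference coincide, and their
    average is the derivative.\<close>
  have dquot: "ev3 s w w (ser_quot (delta (k, n))) = dser s (delta (k, n)) w" for k n
  proof -
    have summand: "w powi (- (int i + 1)) * w powi (- (int n + 1 - int i)) = cnj w ^ (n + 2)" if "i < Suc n" for i
    proof -
      have "w powi (- (int i + 1)) * w powi (- (int n + 1 - int i)) = w powi (- int (n + 2))"
        using w0 by (subst power_int_add[symmetric]) (auto simp: algebra_simps)
      then show ?thesis by (simp only: powi_neg_circ[OF w])
    qed
    have "ev3 s w w (ser_quot (delta (k, n)))
        = of_real (- 1 / real (Suc n)) * (of_real s ^ k * (\<Sum>i<Suc n. w powi (- (int i + 1)) * w powi (- (int n + 1 - int i))))"
      unfolding op_delta R3' ev_delta sum_distrib_left by (simp only: mult.assoc)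
    also have "(\<Sum>i<Suc n. w powi (- (int i + 1)) * w powi (- (int n + 1 - int i)))
        = (\<Sum>i<Suc n. cnj w ^ (n + 2))"
      by (intro sum.cong refl) (simp only: summand lessThan_iff)
    also have "\<dots> = of_nat (Suc n) * cnj w ^ (n + 2)" by simp
    finally show ?thesis
      by (simp del: of_nat_Suc power_Suc)
  qed
  show "ev3 s w w (ser_quot a) = dser s a w"
    by (rule bounded_linear_eqI[of "\<lambda>a. ev3 s w w (ser_quot a)" "\<lambda>a. dser s a w"])
       (rule B | (clarify, rule dquot))+
qed

section \<open>Continuity, derivatives and mean values of evaluated series\<close>

text \<open>Finite sums of monomials converge to \<open>a\<close> in norm, and the bound
  \<open>C\<close>, uniform in t, makes their evaluations converge uniformly in t.\<close>

lemma continuous_on_synth: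
  fixes v :: "'t::topological_space \<Rightarrow> 'g::weighted_monoid \<Rightarrow> 'b::banach"
  assumes bd: "\<And>t g. t \<in> T \<Longrightarrow> norm (v t g) \<le> C * wt g"
    and cont: "\<And>g. continuous_on T (\<lambda>t. v t g)"
  shows "continuous_on T (\<lambda>t. synth (v t) a)"
proof -
  define P where "P F = (\<Sum>g\<in>F. entry a g *\<^sub>R delta g)" for F
  have lim: "(P \<longlongrightarrow> a) (finite_subsets_at_top UNIV)"
    using delta_has_sum[of a] by (simp add: has_sum_def P_def[abs_def])
  have bl: "bounded_linear (synth (v t))" if "t \<in> T" for t
    by (rule bounded_linear_synth[OF wboundedI[OF bd[OF that]]])
  have "continuous_on T (\<lambda>t. synth (v t) (P F))" for F
  proof -
    have "continuous_on T (\<lambda>t. \<Sum>g\<in>F. entry a g *\<^sub>R v t g)" by (intro continuous_intros cont)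
    then show ?thesis
      by (rule continuous_on_eq)
         (simp add: P_def linear_sum[OF bounded_linear.linear[OF bl]] linear_scale[OF bounded_linear.linear[OF bl]])
  qed
  moreover have "uniform_limit T (\<lambda>F t. synth (v t) (P F)) (\<lambda>t. synth (v t) a) (finite_subsets_at_top UNIV)"
  proof (rule uniform_limitI)
    fix e :: real assume "e > 0"
    then have "e / (\<bar>C\<bar> + 1) > 0" by simp
    from tendstoD[OF lim this]
    show "\<forall>\<^sub>F F in finite_subsets_at_top UNIV. \<forall>t\<in>T. dist (synth (v t) (P F)) (synth (v t) a) < e"
    proof eventually_elim
      case (elim F)
      show ?case
      proof
        fix t assume t: "t \<in> T"
        have "dist (synth (v t) (P F)) (synth (v t) a) = norm (synth (v t) (P F - a))"
          by (simp add: dist_norm linear_diff[OF bounded_linear.linear[OF bl[OF t]]])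
        also have "\<dots> \<le> C * norm (P F - a)" by (rule norm_synth[OF bd[OF t]])
        also have "\<dots> \<le> (\<bar>C\<bar> + 1) * norm (P F - a)" by (intro mult_right_mono) auto
        also have "\<dots> < (\<bar>C\<bar> + 1) * (e / (\<bar>C\<bar> + 1))"
          using elim by (intro mult_strict_left_mono) (auto simp: dist_norm)
        finally show "dist (synth (v t) (P F)) (synth (v t) a) < e" by simp
      qed
    qed
  qed
  ultimately show ?thesis
    by (intro uniform_limit_theorem[of _ "\<lambda>F t. synth (v t) (P F)"]) auto
qed

lemma continuous_ev3:
  assumes "\<bar>s\<bar> \<le> 1" "norm w = 1"
  shows "continuous_on circ (\<lambda>t. ev3 s w t X)"
  unfolding ev3_def
proof (rule continuous_on_synth[where C = 1])
  show "norm (case g of (k, m, l) \<Rightarrow> of_real s ^ k * w powi m * t powi l) \<le> 1 * wt g" if "t \<in> circ" for t g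
    using characterD[OF character_ev3[OF assms, of t]] that by simp
  show "continuous_on circ (\<lambda>t. case g of (k, m, l) \<Rightarrow> of_real s ^ k * w powi m * t powi l)" for g
    by (cases g) (auto intro!: continuous_intros)
qed

lemma continuous_dser:
  assumes "\<bar>s\<bar> \<le> 1"
  shows "continuous_on circ (dser s a)"
  unfolding dser_def
proof (rule continuous_on_synth[where C = 1])
  show "norm (case g of (k, n) \<Rightarrow> - of_real (s ^ k) * cnj t ^ (n + 2)) \<le> 1 * wt g" if "t \<in> circ" for t g
    using norm_dser_term[OF assms, of t g] that by simp
  show "continuous_on circ (\<lambda>t. case g of (k, n) \<Rightarrow> - of_real (s ^ k) * cnj t ^ (n + 2))" for g
    by (cases g) (auto intro!: continuous_intros)
qed

text \<open>A connected set with two points has no isolated point; uniqueness of derivatives along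
  the circle rests on this.\<close>

lemma circ_limit_point:
  assumes "w \<in> circ"
  shows "at w within circ \<noteq> bot"
proof -
  have "circ \<noteq> {x}" for x
  proof
    assume "circ = {x}"
    moreover have "- w \<in> circ" using assms by simp
    ultimately have "- w = w" using assms by (metis singletonD)
    then show False using assms by auto
  qed
  then have "w islimpt circ"
    using assms by (intro connected_imp_perfect connected_sphere) auto
  then show ?thesis by (simp add: trivial_limit_within)
qed

lemma circle_deriv_eq:
  assumes "(f has_field_derivative D) (at w within circ)" "w \<in> circ"
  shows "circle_deriv f w = D"
  unfolding circle_deriv_def
proof (rule the_equality)
  fix D' assume "(f has_field_derivative D') (at w within circ)"
  then show "D' = D"
    using assms(1) tendsto_unique[OF circ_limit_point[OF assms(2)]]
    unfolding has_field_derivative_iff by blast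
qed (rule assms(1))

text \<open>Off the diagonal the difference quotient is the value of \<open>ser_quot\<close>, which
  is continuous in t and equals \<open>dser\<close> at t = w.\<close>

lemma cser_deriv:
  assumes "\<bar>s\<bar> \<le> 1" "w \<in> circ"
  shows "(cser s a has_field_derivative dser s a w) (at w within circ)"
  unfolding has_field_derivative_iff
proof -
  have w: "norm w = 1" using assms(2) by simp
  have "((\<lambda>t. ev3 s w t (ser_quot a)) \<longlongrightarrow> ev3 s w w (ser_quot a)) (at w within circ)"
    using continuous_ev3[OF assms(1) w, of "ser_quot a"] assms(2)
    by (auto simp: continuous_on_def)
  then have "((\<lambda>t. ev3 s w t (ser_quot a)) \<longlongrightarrow> dser s a w) (at w within circ)"
    by (simp add: ev_ops(9)[OF assms(1) w w])
  then show "((\<lambda>y. (cser s a y - cser s a w) / (y - w)) \<longlongrightarrow> dser s a w) (at w within circ)"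
  proof (rule Lim_transform_within[where d = 1])
    fix t assume t: "t \<in> circ" "0 < dist t w" "dist t w < 1"
    then show "ev3 s w t (ser_quot a) = (cser s a t - cser s a w) / (t - w)"
      using ev_ops(7)[OF assms(1) w, of t a] by (simp add: field_simps)
  qed simp
qed

lemma circle_deriv_cser: "\<bar>s\<bar> \<le> 1 \<Longrightarrow> w \<in> circ \<Longrightarrow> circle_deriv (cser s a) w = dser s a w"
  by (rule circle_deriv_eq[OF cser_deriv])

lemma circle_mean_powi: "circle_mean (\<lambda>t. c * t powi l) = (if l = - 1 then c else 0)"
proof (cases "l = -1")
  case True
  have "contour_integral (circlepath 0 1) (\<lambda>t. c * t powi l) = contour_integral (circlepath 0 1) (\<lambda>t. c * (1 / (t - 0)))"
    by (rule contour_integral_eq) (simp add: True power_int_minus inverse_eq_divide)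
  also have "\<dots> = c * contour_integral (circlepath 0 1) (\<lambda>t. 1 / (t - 0))"
    by (rule contour_integral_lmul) (auto intro!: contour_integrable_continuous_circlepath continuous_intros)
  also have "\<dots> = c * (2 * of_real pi * \<i>)" by (subst contour_integral_circlepath) auto
  finally show ?thesis using True by (simp add: circle_mean_def)
next
  case False
  then have l: "of_int (l + 1) \<noteq> (0 :: complex)" by (simp only: of_int_eq_0_iff)
  have "((\<lambda>t. c * t powi l) has_contour_integral 0) (circlepath 0 1)"
  proof (rule Cauchy_theorem_primitive)
    show "((\<lambda>t. c * t powi (l + 1) / of_int (l + 1)) has_field_derivative c * t powi l) (at t within - {0})"
      if "t \<in> - {0}" for t
      using that l by (auto intro!: derivative_eq_intros)
  qed auto
  then show ?thesis using False by (simp add: circle_mean_def contour_integral_unique)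
qed

lemma norm_circle_mean_le:
  assumes "continuous_on circ h" "\<And>t. t \<in> circ \<Longrightarrow> norm (h t) \<le> B" "0 \<le> B"
  shows "norm (circle_mean h) \<le> B"
proof -
  have "h contour_integrable_on circlepath 0 1"
    by (rule contour_integrable_continuous_circlepath) (use assms in simp)
  then have "norm (contour_integral (circlepath 0 1) h) \<le> B * (2 * pi * 1)"
    by (intro has_contour_integral_bound_circlepath[OF has_contour_integral_integral]) (use assms in auto)
  then show ?thesis by (simp add: circle_mean_def norm_divide norm_mult field_simps)
qed

lemma circle_mean_ev3:
  assumes s: "\<bar>s\<bar> \<le> 1" and w: "norm w = 1"
  shows "circle_mean (\<lambda>t. ev3 s w t X) = ev2 s w (residue_t X)"
proof (rule bounded_linear_eqI[of "\<lambda>X. circle_mean (\<lambda>t. ev3 s w t X)" "\<lambda>X. ev2 s w (residue_t X)"])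
  have int: "(\<lambda>t. ev3 s w t X) contour_integrable_on circlepath 0 1" for X
    by (rule contour_integrable_continuous_circlepath) (use continuous_ev3[OF assms] in simp)
  show "bounded_linear (\<lambda>X. circle_mean (\<lambda>t. ev3 s w t X))"
  proof (rule bounded_linear_intro[where K = 1])
    fix X Y :: torus_ser and r :: real
    have "contour_integral (circlepath 0 1) (\<lambda>t. ev3 s w t (X + Y))
        = contour_integral (circlepath 0 1) (\<lambda>t. ev3 s w t X + ev3 s w t Y)"
      by (rule contour_integral_eq) (simp add: ev3_ring[OF assms])
    then show "circle_mean (\<lambda>t. ev3 s w t (X + Y)) = circle_mean (\<lambda>t. ev3 s w t X) + circle_mean (\<lambda>t. ev3 s w t Y)"
      using contour_integral_add[OF int int] by (simp add: circle_mean_def add_divide_distrib)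
    have "contour_integral (circlepath 0 1) (\<lambda>t. ev3 s w t (r *\<^sub>R X))
        = contour_integral (circlepath 0 1) (\<lambda>t. of_real r * ev3 s w t X)"
      by (rule contour_integral_eq) (simp add: ev3_ring[OF assms])
    then show "circle_mean (\<lambda>t. ev3 s w t (r *\<^sub>R X)) = r *\<^sub>R circle_mean (\<lambda>t. ev3 s w t X)"
      using contour_integral_lmul[OF int] by (simp add: circle_mean_def scaleR_conv_of_real)
    show "norm (circle_mean (\<lambda>t. ev3 s w t X)) \<le> norm X * 1"
    proof (rule norm_circle_mean_le[OF continuous_ev3[OF assms]])
      fix t assume "t \<in> circ"
      then have "character (\<lambda>(k, m, l). of_real s ^ k * w powi m * t powi l)" by (intro character_ev3 assms) simp
      then have "norm (ev3 s w t X) \<le> 1 * norm X"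
        unfolding ev3_def by (intro norm_synth) (simp only: mult_1 characterD)
      then show "norm (ev3 s w t X) \<le> norm X * 1" by simp
    qed simp
  qed
  show "bounded_linear (\<lambda>X. ev2 s w (residue_t X))"
    by (rule bounded_linear_compose[OF bl_ev2[OF assms]]) (rule bl_ops)
  show "circle_mean (\<lambda>t. ev3 s w t (delta g)) = ev2 s w (residue_t (delta g))" for g
  proof (cases g)
    case (fields k m l)
    then show ?thesis
      using circle_mean_powi[of "of_real s ^ k * w powi m" l] by (simp add: op_delta ev2_ring[OF assms])
  qed
qed

text \<open>If \<open>asym z\<close> vanishes, the real entries are even in the exponent m.
  Conjugation replaces w^m by w^-m on the circle, so it fixes the value.\<close>

lemma Im_ev2_asym:
  assumes s: "\<bar>s\<bar> \<le> 1" and w: "norm w = 1" and "asym z = 0"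
  shows "Im (ev2 s w z) = 0"
proof -
  have sym: "entry z (k, - m) = entry z (k, m)" for k m
  proof -
    have e: "entry z (k, - (int n + 1)) = entry z (k, int n + 1)" for n
      using entry_asym[of z k n] assms(3) by simp
    consider "m = 0" | "m > 0" | "m < 0" by linarith
    then show ?thesis
    proof cases
      case 2
      then have "m = int (nat m - 1) + 1" by simp
      then show ?thesis using e[of "nat m - 1"] by simp
    next
      case 3
      then have "- m = int (nat (- m) - 1) + 1" by simp
      then show ?thesis using e[of "nat (- m) - 1"] by simp
    qed simp
  qed
  have hs: "((\<lambda>g. entry z g *\<^sub>R (case g of (k, m) \<Rightarrow> of_real s ^ k * w powi m)) has_sum ev2 s w z) UNIV"
    unfolding ev2_def by (rule synth_has_sum[OF character_wbounded[OF character_ev2[OF s w]]])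
  have "(\<lambda>g. cnj (entry z g *\<^sub>R (case g of (k, m) \<Rightarrow> of_real s ^ k * w powi m)))
      = (\<lambda>g. entry z g *\<^sub>R (case g of (k, m) \<Rightarrow> of_real s ^ k * w powi (- m)))"
    by (auto simp: fun_eq_iff power_int_minus cnj_circ[OF norm_powi_1[OF w]] simp del: complex_cnj_power_int)
  with has_sum_bounded_linear[OF bounded_linear_cnj hs]
  have "((\<lambda>g. entry z g *\<^sub>R (case g of (k, m) \<Rightarrow> of_real s ^ k * w powi (- m))) has_sum cnj (ev2 s w z)) UNIV"
    by (simp only:)
  moreover have "bij_betw (\<lambda>(k::nat, m::int). (k, - m)) UNIV UNIV"
    by (rule bij_betw_byWitness[where f' = "\<lambda>(k, m). (k, - m)"]) auto
  ultimately have "((\<lambda>g. entry z g *\<^sub>R (case g of (k, m) \<Rightarrow> of_real s ^ k * w powi m)) has_sum cnj (ev2 s w z)) UNIV"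
    by (subst (asm) has_sum_reindex_bij_betw[symmetric, of "\<lambda>(k, m). (k, - m)" UNIV])
       (auto simp: case_prod_unfold sym)
  then have "cnj (ev2 s w z) = ev2 s w z" using hs has_sum_unique by blast
  then show ?thesis by (metis complex_cnj_cancel_iff cnj.simps(2) equal_neg_zero)
qed

lemma circle_deriv_cong:
  assumes "\<And>t. t \<in> circ \<Longrightarrow> f t = g t" "w \<in> circ"
  shows "circle_deriv f w = circle_deriv g w"
proof -
  have "(f has_field_derivative D) (at w within circ) \<longleftrightarrow> (g has_field_derivative D) (at w within circ)" for D
    using assms by (intro has_field_derivative_cong_ev[OF refl] eventually_at_topological[THEN iffD2]
      | auto simp: has_field_derivative_iff intro!: Lim_cong_within)+
  then show ?thesis by (simp add: circle_deriv_def)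
qed

lemma circle_mean_cong: "(\<And>t. t \<in> circ \<Longrightarrow> f t = g t) \<Longrightarrow> circle_mean f = circle_mean g"
  unfolding circle_mean_def by (subst contour_integral_eq[of _ f g]) auto

lemma F_component_cong:
  assumes "\<And>t. t \<in> circ \<Longrightarrow> fj t = gj t" "\<And>t. t \<in> circ \<Longrightarrow> fk t = gk t" "w \<in> circ"
  shows "F_component d e U bj bk cj ck fj fk w = F_component d e U bj bk cj ck gj gk w"
proof -
  have [simp]: "circle_deriv fj t = circle_deriv gj t" "circle_deriv fk t = circle_deriv gk t"
    if "norm t = 1" for t
    by (rule circle_deriv_cong; use assms that in auto)+
  show ?thesis
    unfolding F_component_def
    using assms by (intro arg_cong[where f = Im] arg_cong2[where f = "(+)"] arg_cong2[where f = "(*)"]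
        arg_cong2[where f = "(-)"] circle_mean_cong) (simp_all add: Let_def)
qed

text \<open>\<open>n1\<close> and \<open>n2\<close> let the Neumann series represent the reciprocals
  in the two kernels. Since e always multiplies a power of s, the actual parameter is e * s.\<close>

lemma F_component_ev:
  assumes s: "\<bar>s\<bar> \<le> 1" and w: "w \<in> circ" and d: "d \<noteq> 0"
    and n1: "norm (e *\<^sub>R ((- bj) *\<^sub>R (S3 * ser_quot aj))) < 1"
    and n2: "norm (e *\<^sub>R ker2_den d bj bk e aj ak) < 1"
    and U: "ev2 s w Us = of_real U" and cj: "ev2 s w gj = of_real cj" and ck: "ev2 s w gk = of_real ck"
  shows "F_component d (e * s) U bj bk cj ck (cser s aj) (cser s ak) w
    = Im (ev2 s w (F_ser d bj bk e Us gj gk aj ak))"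
proof -
  have w': "norm w = 1" using w by simp
  note R2 = ev2_ring[OF s w']
  have d1: "circle_deriv (cser s a) t = dser s a t" if "t \<in> circ" for a t
    by (rule circle_deriv_cser[OF s that])
  have k1: "(let A = t - w; B = cser s aj t - cser s aj w in
             (A * cnj B - cnj A * B) / (A * (A + of_real (e * s) * of_real bj * B))
               * (circle_deriv (cser s aj) t - B / A)) = ev3 s w t (ker1 bj e aj)"
    if t: "t \<in> circ" for t
  proof -
    have t': "norm t = 1" using t by simp
    note R3 = ev3_ring[OF s w' t'] and O = ev_ops[OF s w' t']
    define q qc where "q = ev3 s w t (ser_quot aj)" and "qc = ev3 s w t (ser_cnj_quot aj)"
    have evq: "ev3 s w t (e *\<^sub>R ((- bj) *\<^sub>R (S3 * ser_quot aj))) = - (of_real (e * s) * of_real bj * q)"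
      by (simp add: R3 q_def mult_ac)
    have nz: "1 + of_real (e * s) * of_real bj * q \<noteq> 0"
    proof -
      show ?thesis
        using evq ev3_neumann(1)[OF s w' t' n1] by (metis add.inverse_inverse add_eq_0_iff)
    qed
    have K: "ev3 s w t (ker1 bj e aj)
        = (qc + inverse w * inverse t * q) / (1 + of_real (e * s) * of_real bj * q) * (dser s aj t - q)"
      unfolding ker1_def R3(1,3,4) ev3_neumann(2)[OF s w' t' n1] evq O(3) q_def[symmetric] qc_def[symmetric]
      by (simp add: power_int_minus)
    show ?thesis
    proof (cases "t = w")
      \<comment> \<open>Both sides are 0 here: the left one by division by 0, the right one because
        the difference quotient has become the derivative.\<close>
      case True
      have "q = dser s aj t" using ev_ops(9)[OF s w' w'] True by (simp add: q_def)
      then have "ev3 s w t (ker1 bj e aj) = 0" by (simp add: K)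
      then show ?thesis using True by simp
    next
      case False
      define A where "A = t - w"
      have A0: "A \<noteq> 0" using False by (simp add: A_def)
      have B: "cser s aj t - cser s aj w = A * q" "cnj (cser s aj t - cser s aj w) = A * qc"
        using O(7)[of aj] O(8)[of aj] by (simp_all add: A_def q_def qc_def)
      have "w \<noteq> 0" "t \<noteq> 0" using w' t' by auto
      then have cA: "cnj A = - A * (inverse w * inverse t)"
        unfolding A_def complex_cnj_diff cnj_circ[OF w'] cnj_circ[OF t'] by (simp add: field_simps)
      have "(A * (A * qc) - cnj A * (A * q)) / (A * (A + of_real (e * s) * of_real bj * (A * q)))
          = (A * A * (qc + inverse w * inverse t * q)) / (A * A * (1 + of_real (e * s) * of_real bj * q))"
        unfolding cA by (simp add: algebra_simps)
      also have "\<dots> = (qc + inverse w * inverse t * q) / (1 + of_real (e * s) * of_real bj * q)"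
        using A0 by simp
      finally have fin: "(A * (A * qc) - cnj A * (A * q)) / (A * (A + of_real (e * s) * of_real bj * (A * q)))
          = (qc + inverse w * inverse t * q) / (1 + of_real (e * s) * of_real bj * q)" .
      then show ?thesis
        unfolding Let_def A_def[symmetric] B(2) unfolding B(1) K d1[OF t] fin using A0 by simp
    qed
  qed
  have k2: "(cnj t + of_real (e * s) * of_real bk * cnj (cser s ak t))
               * (1 + of_real (e * s) * of_real bk * circle_deriv (cser s ak) t)
             / (of_real (e * s) * (of_real bk * t + of_real bj * w)
                + of_real (e * s) ^ 2 * (of_real bk ^ 2 * cser s ak t + of_real bj ^ 2 * cser s aj w)
                - of_real d) = ev3 s w t (ker2 d bj bk e aj ak)"
    if t: "t \<in> circ" for t
  proof -
    have t': "norm t = 1" using t by simp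
    note R3 = ev3_ring[OF s w' t'] and O = ev_ops[OF s w' t']
    define D where "D = ev3 s w t (e *\<^sub>R ker2_den d bj bk e aj ak)"
    have D_alt: "of_real e * ev3 s w t (ker2_den d bj bk e aj ak) = D" by (simp add: D_def R3)
    have D1: "D \<noteq> 1" using ev3_neumann(1)[OF s w' t' n2] by (simp add: D_def)
    have den: "of_real (e * s) * (of_real bk * t + of_real bj * w)
                + of_real (e * s) ^ 2 * (of_real bk ^ 2 * cser s ak t + of_real bj ^ 2 * cser s aj w)
                - of_real d = - of_real d * (1 - D)"
      using d by (simp add: D_def ker2_den_def R3 O field_simps power2_eq_square)
    have "ev3 s w t (ker2 d bj bk e aj ak) = (cnj t + of_real (e * s) * of_real bk * cnj (cser s ak t))
        * (1 + of_real (e * s) * of_real bk * dser s ak t) * (- 1 / of_real d * (1 / (1 - D)))"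
      by (simp add: ker2_def R3 O ev3_neumann(2)[OF s w' t' n2] D_def[symmetric] D_alt cnj_circ[OF t'] mult_ac power_int_minus)
    then show ?thesis
      unfolding den d1[OF t] using d D1 by (simp add: field_simps)
  qed
  note O2 = ev_ops[OF s w' w']
  have m1: "circle_mean (\<lambda>t. let A = t - w; B = cser s aj t - cser s aj w in
             (A * cnj B - cnj A * B) / (A * (A + of_real (e * s) * of_real bj * B))
               * (circle_deriv (cser s aj) t - B / A)) = ev2 s w (residue_t (ker1 bj e aj))"
    unfolding circle_mean_ev3[OF s w', symmetric] by (rule circle_mean_cong) (rule k1)
  have m2: "circle_mean (\<lambda>t. (cnj t + of_real (e * s) * of_real bk * cnj (cser s ak t))
               * (1 + of_real (e * s) * of_real bk * circle_deriv (cser s ak) t)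
             / (of_real (e * s) * (of_real bk * t + of_real bj * w)
                + of_real (e * s) ^ 2 * (of_real bk ^ 2 * cser s ak t + of_real bj ^ 2 * cser s aj w)
                - of_real d)) = ev2 s w (residue_t (ker2 d bj bk e aj ak))"
    unfolding circle_mean_ev3[OF s w', symmetric] by (rule circle_mean_cong) (rule k2)
  have tan: "ev2 s w (tangent_ser bj e aj) = w * (1 + of_real (e * s) * of_real bj * dser s aj w)"
    by (simp add: tangent_ser_def R2 O2 mult_ac)
  show ?thesis
    unfolding F_component_def m1 m2 d1[OF w] F_ser_def
    by (simp add: R2 tan O2 U cj ck mult_ac)
qed

subsection \<open>Curves given by power series\<close>

text \<open>\<open>\<kappa> g\<close> is the power of s carried by the index g. This covers scalar
  series, where the whole index is that power, and boundary functions, where it is the first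
  component.\<close>

definition tcurve :: "('g \<Rightarrow> nat) \<Rightarrow> ('g::weighted_monoid \<Rightarrow> 'b::banach) \<Rightarrow> 'g wl1 \<Rightarrow> real \<Rightarrow> 'b" where
  "tcurve \<kappa> v a s = synth (\<lambda>g. s ^ \<kappa> g *\<^sub>R v g) a"
definition tcurve' :: "('g \<Rightarrow> nat) \<Rightarrow> ('g::weighted_monoid \<Rightarrow> 'b::banach) \<Rightarrow> 'g wl1 \<Rightarrow> real \<Rightarrow> 'b" where
  "tcurve' \<kappa> v a s = synth (\<lambda>g. (real (\<kappa> g) * s ^ (\<kappa> g - 1)) *\<^sub>R v g) a"

text \<open>The crude constant k^2 is stable under the induction, as k^2 + k <= (k + 1)^2.\<close>

lemma power_taylor_bound:
  fixes s t :: real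
  assumes "\<bar>s\<bar> \<le> 1" "\<bar>t\<bar> \<le> 1"
  shows "\<bar>t ^ k - s ^ k - (t - s) * (real k * s ^ (k - 1))\<bar> \<le> (real k)\<^sup>2 * (t - s)\<^sup>2"
proof (induction k)
  case (Suc k)
  have sk: "\<bar>s ^ (k - 1)\<bar> \<le> 1" using assms by (simp add: power_abs power_le_one)
  define c where "c = real k * s ^ (k - 1)"
  have "real k * s ^ k = s * c" by (cases k) (auto simp: c_def)
  then have ks: "real (Suc k) * s ^ k = s ^ k + s * c" by (simp add: algebra_simps)
  have "t ^ Suc k - s ^ Suc k - (t - s) * (real (Suc k) * s ^ k)
      = t * (t ^ k - s ^ k - (t - s) * (real k * s ^ (k - 1))) + (t - s)\<^sup>2 * (real k * s ^ (k - 1))"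
    unfolding ks c_def[symmetric] by (simp add: algebra_simps power2_eq_square)
  also have "\<bar>\<dots>\<bar> \<le> 1 * ((real k)\<^sup>2 * (t - s)\<^sup>2) + (t - s)\<^sup>2 * (real k * 1)"
    by (rule order_trans[OF abs_triangle_ineq], unfold abs_mult)
       (intro add_mono mult_mono assms Suc.IH; use sk in \<open>simp add: mult_left_le\<close>)
  also have "\<dots> = ((real k)\<^sup>2 + real k) * (t - s)\<^sup>2" by (simp only: distrib_left mult_1 mult_1_right mult.commute)
  also have "\<dots> \<le> (real (Suc k))\<^sup>2 * (t - s)\<^sup>2"
    by (intro mult_right_mono zero_le_power2) (simp add: algebra_simps power2_eq_square)
  finally show ?case by simp
qed simp

lemma power_deriv_lipschitz:
  fixes s t :: real
  assumes "\<bar>s\<bar> \<le> 1" "\<bar>t\<bar> \<le> 1"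
  shows "\<bar>real k * t ^ (k - 1) - real k * s ^ (k - 1)\<bar> \<le> (real k)\<^sup>2 * \<bar>t - s\<bar>"
proof -
  have "\<bar>t ^ (k - 1) - s ^ (k - 1)\<bar> \<le> real (k - 1) * \<bar>t - s\<bar>"
    using norm_power_diff[of t s "k - 1"] assms by simp
  also have "\<dots> \<le> real k * \<bar>t - s\<bar>" by (intro mult_right_mono) auto
  finally have "real k * \<bar>t ^ (k - 1) - s ^ (k - 1)\<bar> \<le> real k * (real k * \<bar>t - s\<bar>)"
    by (intro mult_left_mono) auto
  then show ?thesis by (simp add: power2_eq_square abs_mult flip: right_diff_distrib)
qed

text \<open>Here the weight 2^k of the parameter variable pays for second order Taylor
  remainders.\<close>

lemma square_le_two_power: "(real k)\<^sup>2 \<le> 2 * 2 ^ k"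
proof (induction k)
  case (Suc k)
  \<comment> \<open>The induction step needs 2 k + 1 <= k^2, true from k = 3 on.\<close>
  consider "k = 0" | "k = 1" | "k = 2" | "k \<ge> 3" by linarith
  then show ?case
  proof cases
    case 4
    then have "2 * real k + 1 \<le> (real k)\<^sup>2"
    proof -
      have "3 * real k \<le> real k * real k" using 4 by (intro mult_right_mono) auto
      then show ?thesis using 4 unfolding power2_eq_square by linarith
    qed
    then show ?thesis using Suc by (simp add: power2_eq_square algebra_simps)
  qed (auto simp: power2_eq_square)
qed simp

lemma synth_lincomb:
  assumes "wbounded u" "wbounded v"
  shows "synth (\<lambda>g. u g - v g) a = synth u a - synth v a"
  by (rule synth_eqI) (use has_sum_add[OF synth_has_sum[OF assms(1), of a] has_sum_scaleR[OF synth_has_sum[OF assms(2), of a], of "- 1"]]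
    in \<open>simp add: scaleR_right_diff_distrib\<close>)

lemma synth_scaleR:
  assumes "wbounded u"
  shows "synth (\<lambda>g. r *\<^sub>R u g) a = r *\<^sub>R synth u a"
  by (rule synth_eqI) (use has_sum_scaleR[OF synth_has_sum[OF assms, of a], of r] in \<open>simp add: mult.commute\<close>)

text \<open>The hypothesis \<open>vb\<close> reserves the part \<open>2 ^ \<kappa> g\<close> of the
  weight for the powers of s, so that series can be differentiated termwise on the closed interval
  from -1 to 1.\<close>

context
  fixes \<kappa> :: "'g::weighted_monoid \<Rightarrow> nat" and v :: "'g \<Rightarrow> 'b::banach" and C :: real
  assumes vb: "\<And>g. 2 ^ \<kappa> g * norm (v g) \<le> C * wt g"
begin

lemma tcurve_term_bound: "\<bar>c\<bar> \<le> B * 2 ^ \<kappa> g \<Longrightarrow> 0 \<le> B \<Longrightarrow> norm (c *\<^sub>R v g) \<le> (B * C) * wt g"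
  using mult_left_mono[OF vb[of g], of B] mult_right_mono[of "\<bar>c\<bar>" "B * 2 ^ \<kappa> g" "norm (v g)"]
  by (simp add: mult_ac)

lemma wbounded_tcurve: "\<bar>s\<bar> \<le> 1 \<Longrightarrow> wbounded (\<lambda>g. s ^ \<kappa> g *\<^sub>R v g)"
  by (rule wboundedI[of _ "1 * C"], rule tcurve_term_bound)
     (auto simp: power_abs intro: order_trans[OF abs_power_le_wt])

lemma wbounded_tcurve': "\<bar>s\<bar> \<le> 1 \<Longrightarrow> wbounded (\<lambda>g. (real (\<kappa> g) * s ^ (\<kappa> g - 1)) *\<^sub>R v g)"
proof (rule wboundedI[of _ "2 * C"], rule tcurve_term_bound)
  fix g assume s: "\<bar>s\<bar> \<le> 1"
  have "real (\<kappa> g) * \<bar>s\<bar> ^ (\<kappa> g - 1) \<le> real (\<kappa> g) * 1"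
    using s by (intro mult_left_mono abs_power_le_wt) auto
  also have "\<dots> \<le> (real (\<kappa> g))\<^sup>2" using le_square[of "\<kappa> g"] by (simp add: power2_eq_square flip: of_nat_mult)
  also have "\<dots> \<le> 2 * 2 ^ \<kappa> g" by (rule square_le_two_power)
  finally show "\<bar>real (\<kappa> g) * s ^ (\<kappa> g - 1)\<bar> \<le> 2 * 2 ^ \<kappa> g" by (simp add: abs_mult power_abs)
qed simp

lemma norm_tcurve: "\<bar>s\<bar> \<le> 1 \<Longrightarrow> norm (tcurve \<kappa> v a s) \<le> C * norm a"
  unfolding tcurve_def
  by (rule order_trans[OF norm_synth[of _ "1 * C"]], rule tcurve_term_bound)
     (auto simp: power_abs intro: order_trans[OF abs_power_le_wt])

lemma tcurve_taylor:
  assumes "\<bar>s\<bar> \<le> 1" "\<bar>t\<bar> \<le> 1"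
  shows "norm (tcurve \<kappa> v a t - tcurve \<kappa> v a s - (t - s) *\<^sub>R tcurve' \<kappa> v a s) \<le> 2 * (t - s)\<^sup>2 * C * norm a"
proof -
  have "tcurve \<kappa> v a t - tcurve \<kappa> v a s - (t - s) *\<^sub>R tcurve' \<kappa> v a s =
    synth (\<lambda>g. (t ^ \<kappa> g - s ^ \<kappa> g - (t - s) * (real (\<kappa> g) * s ^ (\<kappa> g - 1))) *\<^sub>R v g) a"
    unfolding tcurve_def tcurve'_def
    apply (subst synth_lincomb[symmetric], (rule wbounded_tcurve assms)+)
    apply (subst synth_scaleR[symmetric], (rule wbounded_tcurve' assms)+)
    apply (subst synth_lincomb[symmetric])
    using wboundedD[OF wbounded_tcurve[OF assms(1)]] wboundedD[OF wbounded_tcurve[OF assms(2)]]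
    subgoal
    proof -
      have "bounded_linear (\<lambda>p. fst p - snd p :: 'b)" by (intro bounded_linear_intros)
      obtain C1 where C1: "\<forall>g. norm (s ^ \<kappa> g *\<^sub>R v g) \<le> C1 * wt g"
        using wboundedD[OF wbounded_tcurve[OF assms(1)]] by auto
      obtain C2 where C2: "\<forall>g. norm (t ^ \<kappa> g *\<^sub>R v g) \<le> C2 * wt g"
        using wboundedD[OF wbounded_tcurve[OF assms(2)]] by auto
      show ?thesis
        by (rule wboundedI[of _ "C2 + C1"], rule order_trans[OF norm_triangle_ineq4])
           (use C1 C2 in \<open>auto simp: distrib_right intro: add_mono\<close>)
    qed
    subgoal
    proof -
      obtain C1 where C1: "C1 \<ge> 0" "\<forall>g. norm ((real (\<kappa> g) * s ^ (\<kappa> g - 1)) *\<^sub>R v g) \<le> C1 * wt g"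
        using wboundedD[OF wbounded_tcurve'[OF assms(1)]] by auto
      show ?thesis
        by (rule wboundedI[of _ "\<bar>t - s\<bar> * C1"])
           (use C1 in \<open>auto simp: mult.assoc abs_mult intro!: mult_left_mono\<close>)
    qed
    by (simp add: algebra_simps)
  also have "norm \<dots> \<le> (2 * (t - s)\<^sup>2 * C) * norm a"
  proof (rule norm_synth, rule tcurve_term_bound)
    fix g
    have "(real (\<kappa> g))\<^sup>2 * (t - s)\<^sup>2 \<le> 2 * 2 ^ \<kappa> g * (t - s)\<^sup>2"
      by (intro mult_right_mono square_le_two_power) auto
    then show "\<bar>t ^ \<kappa> g - s ^ \<kappa> g - (t - s) * (real (\<kappa> g) * s ^ (\<kappa> g - 1))\<bar> \<le> 2 * (t - s)\<^sup>2 * 2 ^ \<kappa> g"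
      using power_taylor_bound[OF assms, of "\<kappa> g"] by (simp add: mult_ac)
  qed simp
  finally show ?thesis .
qed

lemma tcurve'_lipschitz:
  assumes "\<bar>s\<bar> \<le> 1" "\<bar>t\<bar> \<le> 1"
  shows "norm (tcurve' \<kappa> v a t - tcurve' \<kappa> v a s) \<le> 2 * \<bar>t - s\<bar> * C * norm a"
proof -
  have "tcurve' \<kappa> v a t - tcurve' \<kappa> v a s =
    synth (\<lambda>g. (real (\<kappa> g) * t ^ (\<kappa> g - 1) - real (\<kappa> g) * s ^ (\<kappa> g - 1)) *\<^sub>R v g) a"
    unfolding tcurve'_def
    by (subst synth_lincomb[symmetric], (rule wbounded_tcurve' assms)+) (simp add: scaleR_left_diff_distrib)
  also have "norm \<dots> \<le> (2 * \<bar>t - s\<bar> * C) * norm a"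
  proof (rule norm_synth, rule tcurve_term_bound)
    fix g
    have "(real (\<kappa> g))\<^sup>2 * \<bar>t - s\<bar> \<le> 2 * 2 ^ \<kappa> g * \<bar>t - s\<bar>"
      by (intro mult_right_mono square_le_two_power) auto
    then show "\<bar>real (\<kappa> g) * t ^ (\<kappa> g - 1) - real (\<kappa> g) * s ^ (\<kappa> g - 1)\<bar> \<le> 2 * \<bar>t - s\<bar> * 2 ^ \<kappa> g"
      using power_deriv_lipschitz[OF assms, of "\<kappa> g"] by (simp add: mult_ac)
  qed simp
  finally show ?thesis .
qed

lemma tcurve_has_vector_derivative:
  assumes "\<bar>s\<bar> \<le> 1"
  shows "(tcurve \<kappa> v a has_vector_derivative tcurve' \<kappa> v a s) (at s within {-1..1})"
  unfolding has_vector_derivative_def has_derivative_iff_norm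
proof (intro conjI bounded_linear_scaleR_left)
  show "((\<lambda>y. norm (tcurve \<kappa> v a y - tcurve \<kappa> v a s - (y - s) *\<^sub>R tcurve' \<kappa> v a s) / norm (y - s)) \<longlongrightarrow> 0)
      (at s within {-1..1})"
  proof (rule Lim_null_comparison)
    show "((\<lambda>y. 2 * \<bar>y - s\<bar> * C * norm a) \<longlongrightarrow> 0) (at s within {-1..1})"
      by (intro tendsto_eq_intros) auto
    show "\<forall>\<^sub>F y in at s within {-1..1}. norm (norm (tcurve \<kappa> v a y - tcurve \<kappa> v a s - (y - s) *\<^sub>R tcurve' \<kappa> v a s) / norm (y - s))
        \<le> 2 * \<bar>y - s\<bar> * C * norm a"
      unfolding eventually_at
    proof (intro exI[of _ 1] conjI ballI impI)
      fix y assume y: "y \<in> {-1..1}" "y \<noteq> s \<and> dist y s < 1"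
      then have "norm (tcurve \<kappa> v a y - tcurve \<kappa> v a s - (y - s) *\<^sub>R tcurve' \<kappa> v a s) \<le> (2 * \<bar>y - s\<bar> * C * norm a) * \<bar>y - s\<bar>"
        using tcurve_taylor[OF assms, of y a] by (simp add: power2_eq_square mult_ac abs_le_iff)
      then show "norm (norm (tcurve \<kappa> v a y - tcurve \<kappa> v a s - (y - s) *\<^sub>R tcurve' \<kappa> v a s) / norm (y - s))
        \<le> 2 * \<bar>y - s\<bar> * C * norm a"
        using y by (simp add: divide_le_eq)
    qed simp
  qed
qed

lemma continuous_tcurve': "continuous_on {-1..1} (tcurve' \<kappa> v a)"
proof -
  have "(2 * C * norm a)-lipschitz_on {-1..1} (tcurve' \<kappa> v a)"
  proof (rule lipschitz_onI)
    show "dist (tcurve' \<kappa> v a x) (tcurve' \<kappa> v a y) \<le> 2 * C * norm a * dist x y" if "x \<in> {-1..1}" "y \<in> {-1..1}" for x y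
      using tcurve'_lipschitz[of y x a] that by (simp add: dist_norm mult_ac abs_le_iff)
    have "0 \<le> C * wt (0::'g)" by (rule order_trans[OF _ vb]) simp
    then show "0 \<le> 2 * C * norm a" by simp
  qed
  then show ?thesis by (rule lipschitz_on_continuous_on)
qed

end

subsection \<open>Boundary functions with absolutely convergent expansions\<close>

text \<open>The type \<open>nat wl1\<close> also serves for coefficients of functions of w alone;
  the index is then the mode, and \<open>embed\<close> places it at power 0 of s.\<close>

definition embed :: "time_ser \<Rightarrow> coeff_ser" where
  "embed = synth (\<lambda>n. delta (0, n))"
text \<open>Putting the value 0 off the circle makes \<open>pser\<close> linear in y as a map into
  functions on the whole plane, so that identities of pairs hold as equalities.\<close>

definition pser :: "time_ser \<Rightarrow> complex \<Rightarrow> complex" where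
  "pser y w = (if w \<in> circ then cser 1 (embed y) w else 0)"
definition slice :: "real \<Rightarrow> coeff_ser \<Rightarrow> time_ser" where
  "slice s a = tcurve fst (\<lambda>(k, n). delta n) a s"
definition slice' :: "real \<Rightarrow> coeff_ser \<Rightarrow> time_ser" where
  "slice' s a = tcurve' fst (\<lambda>(k, n). delta n) a s"

lemma bl_embed: "bounded_linear embed"
  unfolding embed_def by (intro bounded_linear_synth wboundedI[of _ 1]) (simp add: wt_Pair)

lemma norm_embed: "norm (embed y) \<le> norm y"
  unfolding embed_def using norm_synth[of "\<lambda>n::nat. delta (0::nat, n)" 1 y] by (simp add: wt_Pair)

lemma embed_delta: "embed (delta n) = delta (0, n)"
  by (simp add: embed_def)

lemma slice_bound: "2 ^ fst g * norm ((case g of (k, n) \<Rightarrow> delta n) :: time_ser) \<le> 1 * wt (g :: nat \<times> nat)"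
  by (cases g) (simp add: wt_Pair wt_nat)

lemma norm_slice: "\<bar>s\<bar> \<le> 1 \<Longrightarrow> norm (slice s a) \<le> norm a"
  unfolding slice_def using norm_tcurve[OF slice_bound] by simp

lemma bl_slice: "\<bar>s\<bar> \<le> 1 \<Longrightarrow> bounded_linear (slice s)"
  unfolding slice_def tcurve_def by (rule bounded_linear_synth[OF wbounded_tcurve[OF slice_bound]])

lemma cser_slice:
  assumes "\<bar>s\<bar> \<le> 1" "w \<in> circ"
  shows "cser s a w = cser 1 (embed (slice s a)) w"
proof (rule bounded_linear_eqI[of "\<lambda>a. cser s a w" "\<lambda>a. cser 1 (embed (slice s a)) w"])
  have w: "norm w = 1" using assms(2) by simp
  show "bounded_linear (\<lambda>a. cser s a w)" by (rule bl_cser[OF assms(1) w])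
  show "bounded_linear (\<lambda>a. cser 1 (embed (slice s a)) w)"
    by (rule bounded_linear_compose[OF bl_cser[OF _ w]])
       (auto intro: bounded_linear_compose[OF bl_embed] bl_slice assms)
  show "cser s (delta g) w = cser 1 (embed (slice s (delta g))) w" for g
  proof (cases g)
    case (Pair k n)
    have "cser 1 (embed (slice s (delta g))) w = cser 1 (s ^ k *\<^sub>R delta (0, n)) w"
      using linear_scale[OF bounded_linear.linear[OF bl_embed]]
      by (simp add: slice_def tcurve_def Pair embed_delta)
    also have "\<dots> = s ^ k *\<^sub>R cser 1 (delta (0, n)) w"
      by (rule linear_scale[OF bounded_linear.linear[OF bl_cser[OF _ w]]]) simp
    finally show ?thesis by (simp add: Pair scaleR_conv_of_real)
  qed
qed

lemma pser_slice: "\<bar>s\<bar> \<le> 1 \<Longrightarrow> w \<in> circ \<Longrightarrow> pser (slice s a) w = cser s a w"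
  by (simp add: pser_def cser_slice[of s w a])

lemma pser_linear:
  "pser (x - y) w = pser x w - pser y w" "pser (r *\<^sub>R x) w = of_real r * pser x w"
proof -
  have *: "linear (\<lambda>y. pser y w)"
  proof (cases "w \<in> circ")
    case True
    then have "bounded_linear (\<lambda>y. cser 1 (embed y) w)"
      by (intro bounded_linear_compose[OF bl_cser bl_embed]) auto
    then show ?thesis using True by (simp add: pser_def bounded_linear.linear)
  qed (simp add: pser_def linear_zero)
  show "pser (x - y) w = pser x w - pser y w" by (rule linear_diff[OF *])
  show "pser (r *\<^sub>R x) w = of_real r * pser x w" using linear_scale[OF *] by (simp add: scaleR_conv_of_real)
qed

lemma pser_sums:
  assumes "w \<in> circ"
  shows "(\<lambda>n. of_real (entry y n / real (Suc n)) * cnj w ^ Suc n) sums pser y w"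
proof -
  have w: "norm w = 1" using assms by simp
  have bd: "norm (of_real (1 / real (Suc n)) * cnj w ^ Suc n) \<le> 1 * wt n" for n
  proof -
    have "norm (of_real (1 / real (Suc n)) * cnj w ^ Suc n) = 1 / real (Suc n)"
      unfolding norm_mult norm_of_real norm_power complex_mod_cnj w by simp
    also have "\<dots> \<le> 1" by simp
    finally show ?thesis using wt_ge_1[of n] by linarith
  qed
  have "cser 1 (embed y) w = synth (\<lambda>n. of_real (1 / real (Suc n)) * cnj w ^ Suc n) y"
    by (rule bounded_linear_eqI[of "\<lambda>y. cser 1 (embed y) w" "synth (\<lambda>n. of_real (1 / real (Suc n)) * cnj w ^ Suc n)"])
       (rule bounded_linear_compose[OF bl_cser bl_embed], simp, rule w,
        rule bounded_linear_synth[OF wboundedI[OF bd]], simp add: embed_delta)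
  then have "((\<lambda>n. entry y n *\<^sub>R (of_real (1 / real (Suc n)) * cnj w ^ Suc n)) has_sum pser y w) UNIV"
    using synth_has_sum[OF wboundedI[OF bd], of y] assms by (simp add: pser_def)
  then have "(\<lambda>n. entry y n *\<^sub>R (of_real (1 / real (Suc n)) * cnj w ^ Suc n)) sums pser y w"
    by (rule has_sum_imp_sums)
  then show ?thesis by (simp add: scaleR_conv_of_real mult_ac)
qed

lemma pser_deriv:
  assumes "w \<in> circ"
  shows "(pser y has_field_derivative dser 1 (embed y) w) (at w within circ)"
proof -
  have "(cser 1 (embed y) has_field_derivative dser 1 (embed y) w) (at w within circ)"
    by (rule cser_deriv) (use assms in auto)
  then show ?thesis
    by (rule has_field_derivative_transform_within[OF _ zero_less_one assms]) (simp add: pser_def)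
qed

lemma circle_deriv_pser: "w \<in> circ \<Longrightarrow> circle_deriv (pser y) w = dser 1 (embed y) w"
  by (rule circle_deriv_eq[OF pser_deriv])

lemma norm_dser_diff:
  assumes x: "norm x = 1" and y: "norm y = 1"
  shows "norm (dser 1 a x - dser 1 a y) \<le> 2 * norm (x - y) * norm a"
proof -
  define f where "f w = (\<lambda>(k::nat, n). - of_real (1 ^ k) * cnj w ^ (n + 2))" for w
  have wb: "wbounded (f x)" "wbounded (f y)" unfolding f_def by (rule wbounded_dser; use x y in simp)+
  have "dser 1 a x - dser 1 a y = synth (\<lambda>g. f x g - f y g) a"
    unfolding synth_lincomb[OF wb] by (simp add: dser_def f_def)
  also have "norm \<dots> \<le> (2 * norm (x - y)) * norm a"
  proof (rule norm_synth)
    fix g :: "nat \<times> nat"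
    obtain k n where g: "g = (k, n)" by (cases g)
    have n2: "real (n + 2) \<le> 2 * 2 ^ n" by (induction n) auto
    have "norm (f x g - f y g) = norm (cnj y ^ (n + 2) - cnj x ^ (n + 2))"
      by (simp add: f_def g)
    also have "\<dots> \<le> real (n + 2) * norm (cnj y - cnj x)"
      by (rule norm_power_diff) (use x y in auto)
    also have "norm (cnj y - cnj x) = norm (x - y)"
      by (metis complex_cnj_diff complex_mod_cnj norm_minus_commute)
    also have "real (n + 2) * norm (x - y) \<le> (2 * 2 ^ n) * norm (x - y)"
      by (intro mult_right_mono n2) auto
    also have "\<dots> \<le> 2 * norm (x - y) * (wt k * wt n)"
      using mult_right_mono[OF wt_ge_1[of k], of "2 * norm (x - y) * 2 ^ n"] by (simp add: wt_nat mult_ac)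
    finally show "norm (f x g - f y g) \<le> 2 * norm (x - y) * wt g" by (simp add: g wt_Pair)
  qed
  finally show ?thesis .
qed

lemma norm_dser_le: "norm w = 1 \<Longrightarrow> norm (dser 1 a w) \<le> norm a"
  unfolding dser_def by (rule order_trans[OF norm_synth[where C = 1]], rule norm_dser_term) simp_all

lemma norm_cser_le: "norm w = 1 \<Longrightarrow> norm (cser 1 a w) \<le> norm a"
  unfolding cser_def by (rule order_trans[OF norm_synth[where C = 1]], rule norm_cser_term) simp_all

text \<open>Distances on the circle are at most 2, so a Lipschitz bound implies a Hoelder bound at
  the cost of a factor 2^(1-\<alpha>) <= 2.\<close>

lemma norm_le_holder:
  fixes x y :: complex
  assumes "norm x = 1" "norm y = 1" "x \<noteq> y" "0 < \<alpha>" "\<alpha> < 1"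
  shows "norm (x - y) \<le> 2 * norm (x - y) powr \<alpha>"
proof -
  have le2: "norm (x - y) \<le> 2" using norm_triangle_ineq4[of x y] assms by simp
  have "norm (x - y) powr (1 - \<alpha>) \<le> 2 powr (1 - \<alpha>)"
    using le2 assms by (intro powr_mono2) auto
  also have "\<dots> \<le> 2 powr 1" using assms by (intro powr_mono) auto
  finally have "norm (x - y) powr (1 - \<alpha>) * norm (x - y) powr \<alpha> \<le> 2 * norm (x - y) powr \<alpha>"
    by (intro mult_right_mono) auto
  then show ?thesis using assms by (simp flip: powr_add)
qed

lemma circ_two_points: "(1::complex) \<in> circ" "(-1::complex) \<in> circ" "(1::complex) \<noteq> -1"
  by (auto simp: complex_eq_iff)

lemma holder_quotients_nonempty: "holder_quotients \<alpha> f \<noteq> {}"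
  using circ_two_points unfolding holder_quotients_def by blast

text \<open>6 = 1 + 1 + 4, for the sup norms of f and f' and the Hoelder quotients of f'; the 4 is
  the factor 2 of \<open>norm_dser_diff\<close> times the factor 2 of
  \<open>norm_le_holder\<close>.\<close>

lemma
  assumes "0 < \<alpha>" "\<alpha> < 1"
  shows pser_X_component: "pser y \<in> X_component \<alpha>"
    and holder1_norm_pser: "holder1_norm \<alpha> (pser y) \<le> 6 * norm y"
proof -
  define D where "D = circle_deriv (pser y)"
  have D: "D w = dser 1 (embed y) w" if "w \<in> circ" for w
    using circle_deriv_pser[OF that] by (simp add: D_def)
  have quot: "q \<le> 4 * norm y" if "q \<in> holder_quotients \<alpha> D" for q
  proof -
    obtain a b where q: "q = norm (D a - D b) / norm (a - b) powr \<alpha>" and ab: "a \<in> circ" "b \<in> circ" "a \<noteq> b"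
      using \<open>q \<in> _\<close> unfolding holder_quotients_def by blast
    then have n: "norm a = 1" "norm b = 1" by auto
    have "norm (D a - D b) \<le> 2 * norm (a - b) * norm (embed y)"
      unfolding D[OF ab(1)] D[OF ab(2)] by (rule norm_dser_diff[OF n])
    also have "\<dots> \<le> 2 * (2 * norm (a - b) powr \<alpha>) * norm y"
      by (intro mult_mono norm_embed norm_le_holder n ab assms) auto
    finally show ?thesis unfolding q using ab by (simp add: divide_le_eq mult_ac)
  qed
  have cont: "continuous_on circ D"
    using continuous_dser[of 1 "embed y"] continuous_on_cong[of circ circ D "dser 1 (embed y)"] D by simp
  have bdd: "bdd_above (holder_quotients \<alpha> D)" by (rule bdd_aboveI) (rule quot)
  have "pser y \<in> holder1_space \<alpha>"
    unfolding holder1_space_def holder_space_def mem_Collect_eq D_def[symmetric]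
    unfolding field_differentiable_def
    by (intro conjI ballI cont bdd) (rule exI, rule pser_deriv)
  moreover have "\<exists>A. \<forall>w\<in>circ. (\<lambda>n. of_real (A (Suc n)) * cnj w ^ Suc n) sums pser y w"
    by (rule exI[of _ "\<lambda>n. entry y (n - 1) / real n"]) (use pser_sums in auto)
  ultimately show "pser y \<in> X_component \<alpha>" by (simp add: X_component_def)
  have "sup_norm (pser y) \<le> norm y"
    unfolding sup_norm_def
  proof (rule cSUP_least)
    show "norm (pser y w) \<le> norm y" if "w \<in> circ" for w
      using norm_cser_le[of w "embed y"] norm_embed[of y] that by (simp add: pser_def)
  qed (use circ_two_points in blast)
  moreover have "sup_norm D \<le> norm y"
    unfolding sup_norm_def
  proof (rule cSUP_least)
    show "norm (D w) \<le> norm y" if "w \<in> circ" for w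
      using norm_dser_le[of w "embed y"] norm_embed[of y] that by (simp add: D)
  qed (use circ_two_points in blast)
  moreover have "Sup (holder_quotients \<alpha> D) \<le> 4 * norm y"
    by (rule cSup_least[OF holder_quotients_nonempty quot])
  ultimately show "holder1_norm \<alpha> (pser y) \<le> 6 * norm y"
    unfolding holder1_norm_def holder_norm_def D_def[symmetric] by linarith
qed

definition ppair :: "time_ser \<times> time_ser \<Rightarrow> (complex \<Rightarrow> complex) \<times> (complex \<Rightarrow> complex)" where
  "ppair y = (pser (fst y), pser (snd y))"

lemma ppair_linear:
  "pair_diff (ppair x) (ppair y) = ppair (x - y)" "pair_scale r (ppair x) = ppair (r *\<^sub>R x)"
  by (auto simp: pair_diff_def pair_scale_def ppair_def pser_linear fun_eq_iff)

lemma ppair_X: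
  assumes "0 < \<alpha>" "\<alpha> < 1"
  shows "ppair y \<in> X_space \<alpha>" "X_norm \<alpha> (ppair y) \<le> 6 * norm y"
proof -
  show "ppair y \<in> X_space \<alpha>" using pser_X_component[OF assms] by (simp add: ppair_def X_space_def)
  have "norm (fst y) \<le> norm y" "norm (snd y) \<le> norm y"
    using norm_fst_le[of "fst y" "snd y"] norm_snd_le[of "snd y" "fst y"] by simp_all
  then show "X_norm \<alpha> (ppair y) \<le> 6 * norm y"
    using holder1_norm_pser[OF assms, of "fst y"] holder1_norm_pser[OF assms, of "snd y"]
    by (auto simp: X_norm_def ppair_def)
qed

lemma norm_le_sup_norm:
  assumes "continuous_on circ f" "w \<in> circ"
  shows "norm (f w) \<le> sup_norm f"
  unfolding sup_norm_def
  using assms(1)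
  by (intro cSUP_upper[OF assms(2)] bounded_imp_bdd_above compact_imp_bounded
      compact_continuous_image continuous_intros compact_sphere)

lemma sup_norm_nonneg: "continuous_on circ f \<Longrightarrow> 0 \<le> sup_norm f"
  using norm_le_sup_norm[OF _ circ_two_points(1)] norm_ge_zero order_trans by blast

lemma X_component_nonneg:
  assumes "f \<in> X_component \<alpha>"
  shows "continuous_on circ f" "continuous_on circ (circle_deriv f)" "0 \<le> holder1_norm \<alpha> f"
    "sup_norm f \<le> holder1_norm \<alpha> f" "sup_norm (circle_deriv f) \<le> holder1_norm \<alpha> f"
proof -
  have f: "\<forall>w\<in>circ. f field_differentiable (at w within circ)" "continuous_on circ (circle_deriv f)"
    "bdd_above (holder_quotients \<alpha> (circle_deriv f))"
    using assms by (auto simp: X_component_def holder1_space_def holder_space_def)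
  show cf: "continuous_on circ f"
    using f(1) by (auto simp: continuous_on_eq_continuous_within field_differentiable_imp_continuous_at)
  show cd: "continuous_on circ (circle_deriv f)" by (rule f(2))
  obtain q where q: "q \<in> holder_quotients \<alpha> (circle_deriv f)"
    using holder_quotients_nonempty by blast
  then have "0 \<le> q" by (auto simp: holder_quotients_def)
  then have "0 \<le> Sup (holder_quotients \<alpha> (circle_deriv f))" using cSup_upper2[OF q _ f(3)] by simp
  then show "0 \<le> holder1_norm \<alpha> f" "sup_norm f \<le> holder1_norm \<alpha> f" "sup_norm (circle_deriv f) \<le> holder1_norm \<alpha> f"
    using sup_norm_nonneg[OF cf] sup_norm_nonneg[OF cd] by (simp_all add: holder1_norm_def holder_norm_def)
qed

text \<open>A bounded linear map carries C^1 curves to C^1 curves; for \<open>ppair\<close> the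
  bound is 6 by \<open>ppair_X\<close>.\<close>

lemma C1_X_on_ppair:
  assumes "0 < \<alpha>" "\<alpha> < 1"
    and der: "\<And>s. s \<in> I \<Longrightarrow> (z has_vector_derivative z' s) (at s within I)"
    and cont: "continuous_on I z'"
  shows "C1_X_on \<alpha> I (\<lambda>s. ppair (z s))"
  unfolding C1_X_on_def
proof (intro conjI exI[of _ "\<lambda>s. ppair (z' s)"] ballI)
  have X0: "0 \<le> X_norm \<alpha> (ppair y)" for y
    using X_component_nonneg(3)[OF pser_X_component[OF assms(1,2)], of "fst y"]
    by (auto simp: X_norm_def ppair_def)
  fix s assume s: "s \<in> I"
  show "((\<lambda>t. X_norm \<alpha> (pair_diff (pair_scale (1 / (t - s)) (pair_diff (ppair (z t)) (ppair (z s)))) (ppair (z' s)))) \<longlongrightarrow> 0)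
      (at s within I)"
    unfolding ppair_linear
  proof (rule Lim_null_comparison)
    have "((\<lambda>t. norm (z t - z s - (t - s) *\<^sub>R z' s) / norm (t - s)) \<longlongrightarrow> 0) (at s within I)"
      using der[OF s] by (simp add: has_vector_derivative_def has_derivative_iff_norm)
    then show "((\<lambda>t. 6 * (norm (z t - z s - (t - s) *\<^sub>R z' s) / norm (t - s))) \<longlongrightarrow> 0) (at s within I)"
      by (intro tendsto_mult_right_zero)
    show "\<forall>\<^sub>F t in at s within I. norm (X_norm \<alpha> (ppair ((1 / (t - s)) *\<^sub>R (z t - z s) - z' s)))
        \<le> 6 * (norm (z t - z s - (t - s) *\<^sub>R z' s) / norm (t - s))"
      unfolding eventually_at
    proof (intro exI[of _ 1] conjI ballI impI)
      fix t assume t: "t \<in> I" "t \<noteq> s \<and> dist t s < 1"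
      have "(1 / (t - s)) *\<^sub>R (z t - z s) - z' s = (1 / (t - s)) *\<^sub>R (z t - z s - (t - s) *\<^sub>R z' s)"
        using t by (simp add: scaleR_right_diff_distrib)
      then have "norm ((1 / (t - s)) *\<^sub>R (z t - z s) - z' s) = norm (z t - z s - (t - s) *\<^sub>R z' s) / norm (t - s)"
        by simp
      then show "norm (X_norm \<alpha> (ppair ((1 / (t - s)) *\<^sub>R (z t - z s) - z' s)))
        \<le> 6 * (norm (z t - z s - (t - s) *\<^sub>R z' s) / norm (t - s))"
        using ppair_X(2)[OF assms(1,2), of "(1 / (t - s)) *\<^sub>R (z t - z s) - z' s"] X0 by simp
    qed simp
  qed
  show "((\<lambda>t. X_norm \<alpha> (pair_diff (ppair (z' t)) (ppair (z' s)))) \<longlongrightarrow> 0) (at s within I)"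
    unfolding ppair_linear
  proof (rule Lim_null_comparison)
    have "((\<lambda>t. z' t - z' s) \<longlongrightarrow> 0) (at s within I)"
      using cont s by (intro LIM_zero) (auto simp: continuous_on_def)
    then show "((\<lambda>t. 6 * norm (z' t - z' s)) \<longlongrightarrow> 0) (at s within I)"
      by (intro tendsto_mult_right_zero tendsto_norm_zero)
    show "\<forall>\<^sub>F t in at s within I. norm (X_norm \<alpha> (ppair (z' t - z' s))) \<le> 6 * norm (z' t - z' s)"
      using ppair_X(2)[OF assms(1,2)] X0 by simp
  qed
qed (rule ppair_X(1)[OF assms(1,2)])+

subsection \<open>The analytic branch\<close>

lemma ev1_tcurve: "ev1 s u = tcurve (\<lambda>k. k) (\<lambda>k. 1) u s"
  by (simp add: ev1_def tcurve_def)

lemma ev1_bound: "2 ^ k * norm (1::real) \<le> 1 * wt (k::nat)"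
  by (simp add: wt_nat)

lemma tcurve_rescaled:
  assumes vb: "\<And>g. 2 ^ \<kappa> g * norm (v g) \<le> C * wt g" and e: "0 < e" and I: "I \<subseteq> {-e..e}"
  shows "x \<in> I \<Longrightarrow> ((\<lambda>x. tcurve \<kappa> v a (x / e)) has_vector_derivative (1 / e) *\<^sub>R tcurve' \<kappa> v a (x / e)) (at x within I)"
    and "continuous_on I (\<lambda>x. (1 / e) *\<^sub>R tcurve' \<kappa> v a (x / e))"
proof -
  have sub: "(\<lambda>x. x / e) ` I \<subseteq> {-1..1}" using e I by (auto simp: field_simps)
  show "continuous_on I (\<lambda>x. (1 / e) *\<^sub>R tcurve' \<kappa> v a (x / e))"
    using e by (intro continuous_intros continuous_on_compose2[OF continuous_tcurve'[OF vb] _ sub]) auto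
  assume x: "x \<in> I"
  then have "\<bar>x / e\<bar> \<le> 1" using sub by (fastforce simp: abs_le_iff)
  then have "(tcurve \<kappa> v a has_vector_derivative tcurve' \<kappa> v a (x / e)) (at (x / e) within (\<lambda>x. x / e) ` I)"
    by (intro has_vector_derivative_within_subset[OF tcurve_has_vector_derivative[OF vb] sub])
  moreover have "((\<lambda>x. x / e) has_vector_derivative 1 / e) (at x within I)"
    unfolding has_real_derivative_iff_has_vector_derivative[symmetric] using e by (auto intro!: derivative_eq_intros)
  ultimately show "((\<lambda>x. tcurve \<kappa> v a (x / e)) has_vector_derivative (1 / e) *\<^sub>R tcurve' \<kappa> v a (x / e)) (at x within I)"
    using vector_diff_chain_within[of "\<lambda>x. x / e" "1 / e" x I "tcurve \<kappa> v a"] by (simp add: o_def)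
qed

lemma C1_real_on_ev1:
  assumes "0 < e" "I \<subseteq> {-e..e}"
  shows "C1_real_on I (\<lambda>x. c + ev1 (x / e) u)"
proof -
  note t = tcurve_rescaled(1)[OF ev1_bound assms, of _ u] tcurve_rescaled(2)[OF ev1_bound assms, of u]
  show ?thesis
    unfolding C1_real_on_def ev1_tcurve
  proof (intro exI conjI ballI)
    fix x assume "x \<in> I"
    from has_vector_derivative_add[OF has_vector_derivative_const[of c] t(1)[OF this]]
    show "((\<lambda>x. c + tcurve (\<lambda>k. k) (\<lambda>k. 1) u (x / e)) has_real_derivative
        (1 / e) *\<^sub>R tcurve' (\<lambda>k. k) (\<lambda>k. 1) u (x / e)) (at x within I)"
      unfolding has_real_derivative_iff_has_vector_derivative by simp
  qed (rule t(2))
qed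

text \<open>One fixed point, taken at the single value e, is the whole branch: its evaluation at s =
  x / e solves the equation at parameter x, and regularity in x is that of a power series in
  s.\<close>

lemma analytic_branch:
  fixes d b1 b2 \<delta> :: real
  assumes d: "d \<noteq> 0" and \<delta>: "0 < \<delta>"
  obtains e U G z z' where "0 < e"
    "\<And>I. I \<subseteq> {-e..e} \<Longrightarrow> C1_real_on I U" "\<And>I. I \<subseteq> {-e..e} \<Longrightarrow> C1_real_on I G"
    "\<And>I x. I \<subseteq> {-e..e} \<Longrightarrow> x \<in> I \<Longrightarrow> (z has_vector_derivative z' x) (at x within I)"
    "\<And>I. I \<subseteq> {-e..e} \<Longrightarrow> continuous_on I z'"
    "\<And>x. \<bar>x\<bar> \<le> e \<Longrightarrow> norm (z x) \<le> \<delta>"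
    "\<And>x. \<bar>x\<bar> \<le> e \<Longrightarrow> F_zero d b1 b2 1 x (U x) (G x) (ppair (z x))"
proof -
  \<comment> \<open>Half of the bound, because the norm of the pair is estimated by the sum of the
    norms; at most 1, because the perturbation estimates hold on the unit ball.\<close>
  define \<delta>' where "\<delta>' = min (\<delta> / 2) 1"
  have \<delta>': "0 < \<delta>'" "\<delta>' \<le> 1" "2 * \<delta>' \<le> \<delta>" using \<delta> by (auto simp: \<delta>'_def)
  obtain r0 where r0: "r0 > 0" "\<And>e. \<bar>e\<bar> \<le> r0 \<Longrightarrow> \<exists>x. norm x \<le> \<delta>' \<and> newton_map d b1 b2 e x = x"
    using exists_branch_ser[OF d \<delta>'(1)] by blast
  have q: "\<exists>r>0. \<forall>e x. \<bar>e\<bar> \<le> r \<longrightarrow> norm x \<le> 1 \<longrightarrow> norm (e *\<^sub>R ((- b) *\<^sub>R (S3 * ser_quot (A x)))) < 1"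
    if "bounded_linear A" for b and A :: "branch_ser \<Rightarrow> coeff_ser"
    by (rule near_neumann(2)) (rule near_const near_mult near_scaleR near_linear bl_comp that)+
  obtain r1 where r1: "r1 > 0" "\<And>e x. \<bar>e\<bar> \<le> r1 \<Longrightarrow> norm x \<le> 1 \<Longrightarrow> norm (e *\<^sub>R ((- b1) *\<^sub>R (S3 * ser_quot (A_ser x)))) < 1"
    using q[OF bl_components(3), of b1] by blast
  obtain r2 where r2: "r2 > 0" "\<And>e x. \<bar>e\<bar> \<le> r2 \<Longrightarrow> norm x \<le> 1 \<Longrightarrow> norm (e *\<^sub>R ((- b2) *\<^sub>R (S3 * ser_quot (B_ser x)))) < 1"
    using q[OF bl_components(4), of b2] by blast
  have k: "\<exists>r>0. \<forall>e x. \<bar>e\<bar> \<le> r \<longrightarrow> norm x \<le> 1 \<longrightarrow> norm (e *\<^sub>R ker2_den d bj bk e (A x) (B x)) < 1"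
    if A: "bounded_linear A" and B: "bounded_linear B" for bj bk and A B :: "branch_ser \<Rightarrow> coeff_ser"
  proof -
    obtain c where "near c (\<lambda>e x. ker2_den d bj bk e (A x) (B x))" using near_ker2_den[OF A B] by blast
    then show ?thesis by (rule near_neumann(2))
  qed
  obtain r3 where r3: "r3 > 0" "\<And>e x. \<bar>e\<bar> \<le> r3 \<Longrightarrow> norm x \<le> 1 \<Longrightarrow> norm (e *\<^sub>R ker2_den d b1 b2 e (A_ser x) (B_ser x)) < 1"
    using k[OF bl_components(3,4), of b1 b2] by blast
  obtain r4 where r4: "r4 > 0" "\<And>e x. \<bar>e\<bar> \<le> r4 \<Longrightarrow> norm x \<le> 1 \<Longrightarrow> norm (e *\<^sub>R ker2_den d b2 b1 e (B_ser x) (A_ser x)) < 1"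
    using k[OF bl_components(4,3), of b2 b1] by blast
  \<comment> \<open>\<open>r0\<close> provides the fixed point; the other four radii make the
    Neumann series of the two kernels converge in each of the two equations.\<close>
  define e where "e = min (min r0 r1) (min r2 (min r3 r4))"
  have e: "0 < e" "\<bar>e\<bar> \<le> r0" "\<bar>e\<bar> \<le> r1" "\<bar>e\<bar> \<le> r2" "\<bar>e\<bar> \<le> r3" "\<bar>e\<bar> \<le> r4"
    using r0(1) r1(1) r2(1) r3(1) r4(1) by (auto simp: e_def)
  obtain x where x: "norm x \<le> \<delta>'" "newton_map d b1 b2 e x = x" using r0(2)[OF e(2)] by blast
  have x1: "norm x \<le> 1" using x(1) \<delta>' by simp
  define U where "U t = 1 / (2 * d) + ev1 (t / e) (fst x)" for t
  define G where "G t = 1 + ev1 (t / e) (fst (snd x))" for t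
  define z where "z t = (slice (t / e) (A_ser x), slice (t / e) (B_ser x))" for t
  define z' where "z' t = ((1 / e) *\<^sub>R slice' (t / e) (A_ser x), (1 / e) *\<^sub>R slice' (t / e) (B_ser x))" for t
  have AB: "norm (A_ser x) \<le> \<delta>'" "norm (B_ser x) \<le> \<delta>'"
  proof -
    have "norm (A_ser x) \<le> norm (snd (snd x))" "norm (B_ser x) \<le> norm (snd (snd x))"
      "norm (snd (snd x)) \<le> norm (snd x)" "norm (snd x) \<le> norm x"
      by (metis norm_fst_le norm_snd_le prod.collapse)+
    then show "norm (A_ser x) \<le> \<delta>'" "norm (B_ser x) \<le> \<delta>'" using x(1) by linarith+
  qed
  have le1: "\<bar>t / e\<bar> \<le> 1" if "\<bar>t\<bar> \<le> e" for t using that e by simp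
  show ?thesis
  proof (rule that[of e U G z z'])
    show "C1_real_on I U" "C1_real_on I G" if "I \<subseteq> {-e..e}" for I
      unfolding U_def G_def by (rule C1_real_on_ev1[OF e(1) that])+
    show "(z has_vector_derivative z' t) (at t within I)" if "I \<subseteq> {-e..e}" "t \<in> I" for I t
      unfolding z_def z'_def slice_def slice'_def
      by (intro has_vector_derivative_Pair tcurve_rescaled(1)[OF slice_bound e(1) that])
    show "continuous_on I z'" if "I \<subseteq> {-e..e}" for I
      unfolding z'_def slice'_def
      by (intro continuous_on_Pair tcurve_rescaled(2)[OF slice_bound e(1) that])
    fix t assume t: "\<bar>t\<bar> \<le> e"
    have "norm (z t) \<le> norm (slice (t / e) (A_ser x)) + norm (slice (t / e) (B_ser x))"
      unfolding z_def by (rule norm_Pair_le)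
    also have "\<dots> \<le> \<delta>' + \<delta>'"
      using norm_slice[OF le1[OF t], of "A_ser x"] norm_slice[OF le1[OF t], of "B_ser x"] AB by linarith
    finally show "norm (z t) \<le> \<delta>" using \<delta>' by simp
    define s where "s = t / e"
    have s: "\<bar>s\<bar> \<le> 1" "e * s = t" using le1[OF t] e(1) by (simp_all add: s_def)
    note fixed = newton_map_fixed[OF x(2) d]
    show "F_zero d b1 b2 1 t (U t) (G t) (ppair (z t))"
      unfolding F_zero_def
    proof (intro ballI conjI)
      fix w :: complex assume w: "w \<in> circ"
      then have w': "norm w = 1" by simp
      have evs: "ev2 s w (U_ser d x) = of_real (U t)" "ev2 s w (G_ser x) = of_real (G t)" "ev2 s w 1 = of_real 1"
        using ev_ops(1)[OF s(1) w' w'] unfolding U_def G_def s_def[symmetric]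
        by (simp_all add: U_ser_def G_ser_def ev2_ring[OF s(1) w'])
      have "F1 d b1 b2 1 t (U t) (G t) (ppair (z t)) w
          = F_component d (e * s) (U t) b1 b2 1 (G t) (cser s (A_ser x)) (cser s (B_ser x)) w"
        unfolding F1_def s(2) using pser_slice[OF s(1)]
        by (intro F_component_cong w) (simp_all add: ppair_def z_def s_def)
      also have "\<dots> = Im (ev2 s w (res1 d b1 b2 e x))"
        unfolding res1_def
        by (rule F_component_ev[OF s(1) w d r1(2)[OF e(3) x1] r3(2)[OF e(5) x1] evs(1) evs(3) evs(2)])
      finally show "F1 d b1 b2 1 t (U t) (G t) (ppair (z t)) w = 0"
        using Im_ev2_asym[OF s(1) w' fixed(1)] by simp
      have "F2 d b1 b2 1 t (U t) (G t) (ppair (z t)) w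
          = F_component d (e * s) (U t) b2 b1 (G t) 1 (cser s (B_ser x)) (cser s (A_ser x)) w"
        unfolding F2_def s(2) using pser_slice[OF s(1)]
        by (intro F_component_cong w) (simp_all add: ppair_def z_def s_def)
      also have "\<dots> = Im (ev2 s w (res2 d b1 b2 e x))"
        unfolding res2_def
        by (rule F_component_ev[OF s(1) w d r2(2)[OF e(4) x1] r4(2)[OF e(6) x1] evs(1) evs(2) evs(3)])
      finally show "F2 d b1 b2 1 t (U t) (G t) (ppair (z t)) w = 0"
        using Im_ev2_asym[OF s(1) w' fixed(2)] by simp
    qed
  qed (rule e(1))
qed

subsection \<open>Homogeneity\<close>

lemma F_component_scale:
  "F_component d e (c * U) bj bk (c * gj) (c * gk) fj fk w = c * F_component d e U bj bk gj gk fj fk w"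
  unfolding F_component_def by (simp add: algebra_simps)

lemma F_zero_scale:
  "F_zero d b1 b2 g1 e U g2 f \<Longrightarrow> F_zero d b1 b2 (c * g1) e (c * U) (c * g2) f"
  by (simp add: F_zero_def F1_def F2_def F_component_scale)

subsection \<open>Uniqueness of trigonometric expansions\<close>

text \<open>At an interior maximum every second difference is nonpositive, which contradicts L > 0;
  so the maximum is attained at an end point.\<close>

lemma max_principle_second_difference:
  fixes \<phi> :: "real \<Rightarrow> real"
  assumes "a < b" and cont: "continuous_on {a..b} \<phi>" and "\<phi> a = 0" "\<phi> b = 0"
    and lim: "\<And>x. a < x \<Longrightarrow> x < b \<Longrightarrow>
      ((\<lambda>h. (\<phi> (x + h) + \<phi> (x - h) - 2 * \<phi> x) / h\<^sup>2) \<longlongrightarrow> L) (at_right 0)"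
    and "0 < L" and "x \<in> {a..b}"
  shows "\<phi> x \<le> 0"
proof (rule ccontr)
  assume "\<not> \<phi> x \<le> 0"
  obtain m where m: "m \<in> {a..b}" "\<And>y. y \<in> {a..b} \<Longrightarrow> \<phi> y \<le> \<phi> m"
    using continuous_attains_sup[OF compact_Icc _ cont] assms(7) by blast
  have "\<phi> m > 0" using m(2)[OF assms(7)] \<open>\<not> \<phi> x \<le> 0\<close> by linarith
  then have ab: "a < m" "m < b" using m(1) assms(3,4) by (auto simp: less_le)
  have "\<forall>\<^sub>F h in at_right 0. (\<phi> (m + h) + \<phi> (m - h) - 2 * \<phi> m) / h\<^sup>2 \<le> 0"
    unfolding eventually_at_right_field
  proof (intro exI[of _ "min (m - a) (b - m)"] conjI allI impI)
    fix h assume h: "0 < h" "h < min (m - a) (b - m)"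
    have "\<phi> (m + h) \<le> \<phi> m" "\<phi> (m - h) \<le> \<phi> m" using h ab by (auto intro!: m(2))
    then show "(\<phi> (m + h) + \<phi> (m - h) - 2 * \<phi> m) / h\<^sup>2 \<le> 0"
      by (intro divide_nonpos_nonneg) auto
  qed (use ab in auto)
  then have "L \<le> 0" using tendsto_upperbound[OF lim[OF ab]] by simp
  then show False using \<open>0 < L\<close> by simp
qed

text \<open>Schwarz's theorem on symmetric second derivatives.\<close>

lemma affine_if_second_difference_zero:
  fixes D :: "real \<Rightarrow> real"
  assumes "a < b" and cont: "continuous_on {a..b} D"
    and lim: "\<And>x. a < x \<Longrightarrow> x < b \<Longrightarrow>
      ((\<lambda>h. (D (x + h) + D (x - h) - 2 * D x) / h\<^sup>2) \<longlongrightarrow> 0) (at_right 0)"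
    and x: "x \<in> {a..b}"
  shows "D x = D a + (x - a) * ((D b - D a) / (b - a))"
proof -
  define c where "c = (D b - D a) / (b - a)"
  define l where "l y = D a + (y - a) * c" for y
  have bound: "\<sigma> * (D x - l x) \<le> e * ((x - a) * (b - x))" if "0 < e" "\<sigma> = 1 \<or> \<sigma> = -1" for e \<sigma>
  proof -
    \<comment> \<open>Subtracting the chord makes both end values 0, and e (y - a) (y - b) raises
      the second derivative to 2 e > 0 without changing them. The sign \<open>\<sigma>\<close> gives
      both inequalities; e tends to 0 afterwards.\<close>
    define \<phi> where "\<phi> y = \<sigma> * (D y - l y) + e * ((y - a) * (y - b))" for y
    have "\<phi> x \<le> 0"
    proof (rule max_principle_second_difference[OF \<open>a < b\<close>, where \<phi> = \<phi> and x = x and L = "2 * e"])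
      show "continuous_on {a..b} \<phi>"
        unfolding \<phi>_def l_def by (intro continuous_intros cont) 
      show "\<phi> a = 0" "\<phi> b = 0" using \<open>a < b\<close> by (simp_all add: \<phi>_def l_def c_def)
      fix y assume y: "a < y" "y < b"
      have "((\<lambda>h. \<sigma> * ((D (y + h) + D (y - h) - 2 * D y) / h\<^sup>2) + 2 * e) \<longlongrightarrow> \<sigma> * 0 + 2 * e) (at_right 0)"
        by (intro tendsto_intros lim y)
      then have "((\<lambda>h. \<sigma> * ((D (y + h) + D (y - h) - 2 * D y) / h\<^sup>2) + 2 * e) \<longlongrightarrow> 2 * e) (at_right 0)"
        by simp
      then show "((\<lambda>h. (\<phi> (y + h) + \<phi> (y - h) - 2 * \<phi> y) / h\<^sup>2) \<longlongrightarrow> 2 * e) (at_right 0)"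
      proof (rule Lim_transform_eventually)
        show "\<forall>\<^sub>F h in at_right 0. \<sigma> * ((D (y + h) + D (y - h) - 2 * D y) / h\<^sup>2) + 2 * e
            = (\<phi> (y + h) + \<phi> (y - h) - 2 * \<phi> y) / h\<^sup>2"
          using eventually_at_right_less[of "0::real"]
        proof eventually_elim
          case (elim h)
          have "\<phi> (y + h) + \<phi> (y - h) - 2 * \<phi> y = \<sigma> * (D (y + h) + D (y - h) - 2 * D y) + 2 * e * h\<^sup>2"
            unfolding \<phi>_def l_def by (simp add: algebra_simps power2_eq_square)
          then show ?case using elim by (simp add: add_divide_distrib)
        qed
      qed
    qed (use that x in auto)
    then show ?thesis by (simp add: \<phi>_def algebra_simps)
  qed
  have zero: "\<sigma> * (D x - l x) \<le> 0" if "\<sigma> = 1 \<or> \<sigma> = -1" for \<sigma>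
  proof (rule field_le_epsilon)
    fix e :: real assume "0 < e"
    define M where "M = (x - a) * (b - x)"
    have "0 \<le> M" using x by (simp add: M_def)
    have "\<sigma> * (D x - l x) \<le> e / (M + 1) * M"
      using bound[of "e / (M + 1)" \<sigma>] that \<open>0 < e\<close> \<open>0 \<le> M\<close> by (simp add: M_def)
    also have "\<dots> \<le> e" using \<open>0 < e\<close> \<open>0 \<le> M\<close> by (simp add: field_simps)
    finally show "\<sigma> * (D x - l x) \<le> 0 + e" by simp
  qed
  show ?thesis using zero[of 1] zero[of "-1"] by (simp add: l_def c_def)
qed

text \<open>L'Hospital's rule reduces the quotient to the symmetric difference quotient of P, the
  average of two one-sided ones.\<close>

lemma second_difference_tendsto:
  fixes H P :: "real \<Rightarrow> real"
  assumes "a < x" "x < b"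
    and H: "\<And>y. a < y \<Longrightarrow> y < b \<Longrightarrow> (H has_real_derivative P y) (at y)"
    and P: "(P has_real_derivative Q) (at x)"
  shows "((\<lambda>h. (H (x + h) + H (x - h) - 2 * H x) / h\<^sup>2) \<longlongrightarrow> Q) (at_right 0)"
proof (rule lhopital_right_0)
  define r where "r = min (x - a) (b - x)"
  have r: "0 < r" using assms by (simp add: r_def)
  have ev: "\<forall>\<^sub>F h in at_right 0. 0 < h \<and> h < r"
    using eventually_at_right[OF r] r by auto
  have HC: "isCont H x" using H[OF assms(1,2)] by (rule DERIV_isCont)
  have "((\<lambda>h. H (x + h)) \<longlongrightarrow> H (x + 0)) (at 0)" "((\<lambda>h. H (x - h)) \<longlongrightarrow> H (x - 0)) (at 0)"
    by (rule isCont_tendsto_compose[of _ H], use HC in simp, intro tendsto_intros)+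
  then have "((\<lambda>h. H (x + h) + H (x - h) - 2 * H x) \<longlongrightarrow> H (x + 0) + H (x - 0) - 2 * H x) (at 0)"
    by (intro tendsto_intros)
  then show "((\<lambda>h. H (x + h) + H (x - h) - 2 * H x) \<longlongrightarrow> 0) (at_right 0)"
    by (simp add: filterlim_at_split)
  show "((\<lambda>h. h\<^sup>2) \<longlongrightarrow> (0::real)) (at_right 0)" by (auto intro!: tendsto_eq_intros)
  show "\<forall>\<^sub>F h in at_right 0. h\<^sup>2 \<noteq> (0::real)" using ev by eventually_elim auto
  show "\<forall>\<^sub>F h in at_right 0. 2 * h \<noteq> (0::real)" using ev by eventually_elim auto
  show "\<forall>\<^sub>F h in at_right 0. ((\<lambda>h. H (x + h) + H (x - h) - 2 * H x) has_real_derivative P (x + h) - P (x - h)) (at h)"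
    using ev
  proof eventually_elim
    case (elim h)
    have HP: "(H has_real_derivative P (x + h)) (at (x + h))" "(H has_real_derivative P (x - h)) (at (x - h))"
      using elim by (auto intro!: H simp: r_def)
    have "((\<lambda>h. H (x + h)) has_real_derivative P (x + h) * 1) (at h)"
      by (rule DERIV_chain2[where f = H and g = "\<lambda>h. x + h", OF HP(1)]) (auto intro!: derivative_eq_intros)
    moreover have "((\<lambda>h. H (x - h)) has_real_derivative P (x - h) * (-1)) (at h)"
      by (rule DERIV_chain2[where f = H and g = "\<lambda>h. x - h", OF HP(2)]) (auto intro!: derivative_eq_intros)
    ultimately have "((\<lambda>h. H (x + h)) has_real_derivative P (x + h) * 1) (at h)"
      "((\<lambda>h. H (x - h)) has_real_derivative P (x - h) * (-1)) (at h)" .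
    from DERIV_diff[OF DERIV_add[OF this] DERIV_const[of "2 * H x"]] show ?case by simp
  qed
  show "\<forall>\<^sub>F h in at_right 0. ((\<lambda>h. h\<^sup>2) has_real_derivative 2 * h) (at h)"
    by (auto intro!: derivative_eq_intros always_eventually)
  show "((\<lambda>h. (P (x + h) - P (x - h)) / (2 * h)) \<longlongrightarrow> Q) (at_right 0)"
  proof -
    have 1: "((\<lambda>h. (P (x + h) - P x) / h) \<longlongrightarrow> Q) (at 0)" using P by (simp add: DERIV_def)
    have "filterlim (\<lambda>h::real. - h) (at 0) (at 0)"
      by (auto simp: filterlim_at intro!: tendsto_eq_intros eventually_neq_at_within)
    from filterlim_compose[OF 1 this] have 2: "((\<lambda>h. (P (x - h) - P x) / (- h)) \<longlongrightarrow> Q) (at 0)" by simp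
    have "((\<lambda>h. ((P (x + h) - P x) / h + (P (x - h) - P x) / (- h)) / 2) \<longlongrightarrow> (Q + Q) / 2) (at 0)"
      by (intro tendsto_intros 1 2) auto
    then have "((\<lambda>h. ((P (x + h) - P x) / h + (P (x - h) - P x) / (- h)) / 2) \<longlongrightarrow> Q) (at_right 0)"
      by (simp add: filterlim_at_split)
    then show ?thesis
    proof (rule Lim_transform_eventually)
      show "\<forall>\<^sub>F h in at_right 0. ((P (x + h) - P x) / h + (P (x - h) - P x) / (- h)) / 2
          = (P (x + h) - P (x - h)) / (2 * h)"
        using ev by eventually_elim (simp add: field_simps)
    qed
  qed
qed

(* The kernel (sin x / x)^2 of Riemann's summation method; the value at 0 is the limit. *)
definition riemann_kernel :: "real \<Rightarrow> real" where
  "riemann_kernel x = (if x = 0 then 1 else (sin x / x)\<^sup>2)"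

lemma riemann_kernel_bounds: "0 \<le> riemann_kernel x" "riemann_kernel x \<le> 1" "x \<noteq> 0 \<Longrightarrow> riemann_kernel x \<le> 1 / x\<^sup>2"
proof -
  show "0 \<le> riemann_kernel x" by (simp add: riemann_kernel_def)
  have "\<bar>sin x\<bar> \<le> \<bar>x\<bar>" by (rule abs_sin_x_le_abs_x)
  then have "(sin x)\<^sup>2 \<le> x\<^sup>2" by (simp add: abs_le_square_iff)
  then show "riemann_kernel x \<le> 1" by (auto simp: riemann_kernel_def power_divide divide_le_eq)
  have "(sin x)\<^sup>2 \<le> 1" using abs_sin_le_one[of x] by (simp add: abs_square_le_1)
  then show "riemann_kernel x \<le> 1 / x\<^sup>2" if "x \<noteq> 0"
    using that by (simp add: riemann_kernel_def power_divide divide_right_mono)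
qed

lemma riemann_kernel_cont: "isCont riemann_kernel 0"
proof -
  have "((\<lambda>x. sin x / x) \<longlongrightarrow> (1::real)) (at 0)"
    using DERIV_sin[of "0::real"] by (simp add: DERIV_def)
  from tendsto_power[OF this, of 2]
  have "((\<lambda>x. (sin x / x)\<^sup>2) \<longlongrightarrow> (1::real)) (at 0)" by simp
  then have "(riemann_kernel \<longlongrightarrow> 1) (at 0)"
    by (rule Lim_transform_eventually) (auto simp: riemann_kernel_def eventually_at intro: exI[of _ 1])
  then show ?thesis by (simp add: isCont_def riemann_kernel_def)
qed

lemma abs_sin_minus_le:
  fixes x :: real
  assumes "0 < x"
  shows "\<bar>sin x - x * cos x\<bar> \<le> x\<^sup>2"
proof -
  have "\<exists>z. z > 0 \<and> z < x \<and> (sin x - x * cos x) - (sin 0 - 0 * cos 0) = (x - 0) * (z * sin z)"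
    by (rule MVT2[OF assms]) (auto intro!: derivative_eq_intros)
  then obtain z where z: "0 < z" "z < x" "sin x - x * cos x = x * (z * sin z)" by auto
  have "\<bar>z * sin z\<bar> \<le> x * 1" unfolding abs_mult using z by (intro mult_mono) auto
  then have "x * \<bar>z * sin z\<bar> \<le> x * x" using assms by (intro mult_left_mono) auto
  then show ?thesis using assms by (simp add: z(3) abs_mult power2_eq_square)
qed

text \<open>The majorant 8 / (1 + x^2) is chosen for its primitive 8 arctan, which bounds the total
  variation on the half line by 4 pi < 16.\<close>

lemma riemann_kernel_deriv:
  assumes "0 < x"
  shows "(riemann_kernel has_real_derivative - 2 * sin x * (sin x - x * cos x) / x ^ 3) (at x)"
    and "\<bar>- 2 * sin x * (sin x - x * cos x) / x ^ 3\<bar> \<le> 8 / (1 + x\<^sup>2)"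
proof -
  have "((\<lambda>x. (sin x / x)\<^sup>2) has_real_derivative - 2 * sin x * (sin x - x * cos x) / x ^ 3) (at x)"
    using assms by (auto intro!: derivative_eq_intros simp: field_simps power2_eq_square power3_eq_cube)
  then show "(riemann_kernel has_real_derivative - 2 * sin x * (sin x - x * cos x) / x ^ 3) (at x)"
    by (rule has_field_derivative_transform_within[of _ _ _ _ x]) (use assms in \<open>auto simp: riemann_kernel_def dist_real_def\<close>)
  have eq: "\<bar>- 2 * sin x * (sin x - x * cos x) / x ^ 3\<bar> = 2 * (\<bar>sin x\<bar> * \<bar>sin x - x * cos x\<bar>) / x ^ 3"
    using assms by (simp add: abs_mult)
  show "\<bar>- 2 * sin x * (sin x - x * cos x) / x ^ 3\<bar> \<le> 8 / (1 + x\<^sup>2)"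
  proof (cases "x \<le> 1")
    case True
    have "\<bar>sin x\<bar> * \<bar>sin x - x * cos x\<bar> \<le> x * x\<^sup>2"
      using abs_sin_x_le_abs_x[of x] abs_sin_minus_le[OF assms] assms by (intro mult_mono) auto
    then have "2 * (\<bar>sin x\<bar> * \<bar>sin x - x * cos x\<bar>) / x ^ 3 \<le> 2"
      using assms by (simp add: divide_le_eq power3_eq_cube power2_eq_square)
    also have "x\<^sup>2 \<le> 1" using True assms by (simp add: power_le_one)
    then have "2 \<le> 8 / (1 + x\<^sup>2)" by (simp add: le_divide_eq add_pos_nonneg)
    finally show ?thesis using eq by simp
  next
    case False
    have "\<bar>sin x - x * cos x\<bar> \<le> \<bar>sin x\<bar> + \<bar>x\<bar> * \<bar>cos x\<bar>" using abs_triangle_ineq4[of "sin x" "x * cos x"] by (simp add: abs_mult)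
    also have "\<dots> \<le> 1 + x * 1" using assms by (intro add_mono mult_mono) auto
    also have "\<dots> \<le> 2 * x" using False by simp
    finally have "\<bar>sin x\<bar> * \<bar>sin x - x * cos x\<bar> \<le> 1 * (2 * x)" by (intro mult_mono) auto
    then have "2 * (\<bar>sin x\<bar> * \<bar>sin x - x * cos x\<bar>) / x ^ 3 \<le> 4 / x\<^sup>2"
      using assms by (simp add: field_simps power3_eq_cube power2_eq_square)
    also have "1 \<le> x\<^sup>2" using False by (simp add: one_le_power)
    then have "4 / x\<^sup>2 \<le> 8 / (1 + x\<^sup>2)" using assms by (simp add: field_simps add_pos_nonneg)
    finally show ?thesis using eq by simp
  qed
qed

lemma riemann_kernel_variation:
  assumes "0 \<le> a" "a \<le> b"
  shows "\<bar>riemann_kernel b - riemann_kernel a\<bar> \<le> 8 * (arctan b - arctan a)"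
proof -
  have mono: "8 * arctan a + \<sigma> * riemann_kernel a \<le> 8 * arctan b + \<sigma> * riemann_kernel b"
    if "\<sigma> = 1 \<or> \<sigma> = -1" for \<sigma>
  proof (rule DERIV_nonneg_imp_increasing_open[OF assms(2)])
    fix x assume "a < x" "x < b"
    then have x: "0 < x" using assms by simp
    define k where "k = - 2 * sin x * (sin x - x * cos x) / x ^ 3"
    have "((\<lambda>x. 8 * arctan x + \<sigma> * riemann_kernel x) has_real_derivative 8 * inverse (1 + x\<^sup>2) + \<sigma> * k) (at x)"
      unfolding k_def by (intro DERIV_add DERIV_cmult DERIV_arctan riemann_kernel_deriv(1)[OF x])
    moreover have "0 \<le> 8 * inverse (1 + x\<^sup>2) + \<sigma> * k"
      using riemann_kernel_deriv(2)[OF x] that unfolding k_def[symmetric] by (auto simp: inverse_eq_divide)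
    ultimately show "\<exists>y. ((\<lambda>x. 8 * arctan x + \<sigma> * riemann_kernel x) has_real_derivative y) (at x) \<and> 0 \<le> y"
      by blast
  next
    have "isCont riemann_kernel x" if "0 \<le> x" for x
      using riemann_kernel_cont DERIV_isCont[OF riemann_kernel_deriv(1), of x] that by (cases "x = 0") auto
    then have "continuous_on {a..b} riemann_kernel"
      using assms by (intro continuous_at_imp_continuous_on) auto
    then show "continuous_on {a..b} (\<lambda>x. 8 * arctan x + \<sigma> * riemann_kernel x)"
      by (intro continuous_intros) 
  qed
  show ?thesis using mono[of 1] mono[of "-1"] by (simp add: abs_le_iff algebra_simps)
qed

text \<open>The bound does not depend on h: this is what makes the summation method regular.\<close>

lemma riemann_kernel_total_variation:
  assumes "0 < h"
  shows "(\<Sum>n<N. \<bar>riemann_kernel (real (Suc n) * h) - riemann_kernel (real n * h)\<bar>) \<le> 16"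
proof -
  have "(\<Sum>n<N. \<bar>riemann_kernel (real (Suc n) * h) - riemann_kernel (real n * h)\<bar>)
      \<le> (\<Sum>n<N. 8 * arctan (real (Suc n) * h) - 8 * arctan (real n * h))"
    using assms by (intro sum_mono order_trans[OF riemann_kernel_variation]) (auto simp: algebra_simps)
  also have "\<dots> = 8 * arctan (real N * h) - 8 * arctan (real 0 * h)"
    by (rule sum_lessThan_telescope)
  also have "\<dots> \<le> 16" using arctan_ubound[of "real N * h"] pi_less_4 by simp
  finally show ?thesis .
qed

text \<open>Summation by parts against the tails \<open>R n\<close>. Finitely many early terms
  vanish as h tends to 0, because the kernel tends to 1; in the others the tails are small and the
  kernel has bounded variation.\<close>

lemma riemann_summation:
  fixes u :: "nat \<Rightarrow> complex"
  assumes u: "u sums S"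
  shows "((\<lambda>h. \<Sum>n. u n * of_real (riemann_kernel (real (Suc n) * h))) \<longlongrightarrow> S) (at_right 0)"
    and "0 < h \<Longrightarrow> summable (\<lambda>n. u n * of_real (riemann_kernel (real (Suc n) * h)))"
proof -
  define \<kappa> where "\<kappa> = riemann_kernel"
  define R where "R n = S - (\<Sum>j<n. u j)" for n
  have R0: "R \<longlonglongrightarrow> 0"
    using tendsto_diff[OF tendsto_const[of S] u[unfolded sums_def]] by (simp add: R_def[abs_def])
  then have "Bseq R" by (intro convergent_imp_Bseq) (auto simp: convergent_def)
  then obtain M where M: "M > 0" "\<And>n. norm (R n) \<le> M" by (auto simp: Bseq_def)
  have uM: "norm (u n) \<le> 2 * M" for n
  proof -
    have "u n = R n - R (Suc n)" by (simp add: R_def)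
    then show ?thesis using norm_triangle_ineq4[of "R n" "R (Suc n)"] M(2)[of n] M(2)[of "Suc n"] by simp
  qed
  \<comment> \<open>With tails instead of partial sums the term S drops out: R 0 = S, and the kernel
    at 0 is 1.\<close>
  have abel: "(\<Sum>n<N. u n * of_real (\<kappa> (real (Suc n) * h))) - S
      = (\<Sum>n<N. R n * of_real (\<kappa> (real (Suc n) * h) - \<kappa> (real n * h))) - R N * of_real (\<kappa> (real N * h))" for N h
  proof -
    define c :: "nat \<Rightarrow> complex" where "c n = of_real (\<kappa> (real n * h))" for n
    have "(\<Sum>n<N. u n * c (Suc n)) - S = (\<Sum>n<N. R n * (c (Suc n) - c n)) - R N * c N"
    proof (induction N)
      case 0
      show ?case by (simp add: R_def c_def \<kappa>_def riemann_kernel_def)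
    next
      case (Suc N)
      have "(\<Sum>n<Suc N. u n * c (Suc n)) - S = ((\<Sum>n<N. u n * c (Suc n)) - S) + u N * c (Suc N)" by simp
      also have "\<dots> = (\<Sum>n<N. R n * (c (Suc n) - c n)) - R N * c N + u N * c (Suc N)" unfolding Suc.IH ..
      also have "u N = R N - R (Suc N)" by (simp add: R_def)
      finally show ?case by (simp add: left_diff_distrib right_diff_distrib)
    qed
    then show ?thesis by (simp only: c_def of_real_diff)
  qed
  have sm: "summable (\<lambda>n. u n * of_real (\<kappa> (real (Suc n) * h)))" if "0 < h" for h
  proof (rule summable_comparison_test')
    show "summable (\<lambda>n. 2 * M / h\<^sup>2 * (1 / (real (Suc n))\<^sup>2))"
      using inverse_squares_sums by (intro summable_mult) (auto simp: sums_iff)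
    show "norm (u n * of_real (\<kappa> (real (Suc n) * h))) \<le> 2 * M / h\<^sup>2 * (1 / (real (Suc n))\<^sup>2)" for n
    proof -
      have "\<kappa> (real (Suc n) * h) \<le> 1 / (real (Suc n) * h)\<^sup>2"
        unfolding \<kappa>_def using that by (intro riemann_kernel_bounds(3)) auto
      then have "norm (u n) * \<kappa> (real (Suc n) * h) \<le> 2 * M * (1 / (real (Suc n) * h)\<^sup>2)"
        using M(1) uM[of n] riemann_kernel_bounds(1) unfolding \<kappa>_def by (intro mult_mono) auto
      then show ?thesis
        using riemann_kernel_bounds(1)[of "real (Suc n) * h"]
        by (simp add: norm_mult \<kappa>_def power_mult_distrib mult_ac del: of_nat_Suc)
    qed
  qed
  then show "0 < h \<Longrightarrow> summable (\<lambda>n. u n * of_real (riemann_kernel (real (Suc n) * h)))" by (simp add: \<kappa>_def)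
  \<comment> \<open>17 = 16 + 1, from the total variation and the boundary term at N.\<close>
  have main: "norm ((\<Sum>n. u n * of_real (\<kappa> (real (Suc n) * h))) - S)
      \<le> M * (\<Sum>n<N0. \<bar>\<kappa> (real (Suc n) * h) - \<kappa> (real n * h)\<bar>) + \<eta> * 17"
    if h: "0 < h" and \<eta>: "0 < \<eta>" and N0: "\<And>n. n \<ge> N0 \<Longrightarrow> norm (R n) \<le> \<eta>" for h \<eta> N0
  proof (rule tendsto_upperbound[where F = sequentially])
    show "(\<lambda>N. norm ((\<Sum>n<N. u n * of_real (\<kappa> (real (Suc n) * h))) - S))
        \<longlonglongrightarrow> norm ((\<Sum>n. u n * of_real (\<kappa> (real (Suc n) * h))) - S)"
      using summable_LIMSEQ[OF sm[OF h]] by (intro tendsto_intros)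
    show "\<forall>\<^sub>F N in sequentially. norm ((\<Sum>n<N. u n * of_real (\<kappa> (real (Suc n) * h))) - S)
      \<le> M * (\<Sum>n<N0. \<bar>\<kappa> (real (Suc n) * h) - \<kappa> (real n * h)\<bar>) + \<eta> * 17"
      using eventually_ge_at_top[of N0]
    proof eventually_elim
      case (elim N)
      define v where "v n = \<bar>\<kappa> (real (Suc n) * h) - \<kappa> (real n * h)\<bar>" for n
      have "norm ((\<Sum>n<N. u n * of_real (\<kappa> (real (Suc n) * h))) - S)
          \<le> (\<Sum>n<N. norm (R n) * v n) + norm (R N) * \<kappa> (real N * h)"
        unfolding abel
        by (rule order_trans[OF norm_triangle_ineq4], intro add_mono order_trans[OF norm_sum] sum_mono)
           (auto simp: norm_mult v_def \<kappa>_def riemann_kernel_bounds simp del: of_real_diff of_nat_Suc)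
      also have "(\<Sum>n<N. norm (R n) * v n) \<le> (\<Sum>n<N. (if n < N0 then M * v n else 0) + \<eta> * v n)"
      proof (intro sum_mono)
        fix n
        have "0 \<le> v n" by (simp add: v_def)
        then show "norm (R n) * v n \<le> (if n < N0 then M * v n else 0) + \<eta> * v n"
          using mult_right_mono[OF M(2)[of n], of "v n"] mult_right_mono[OF N0[of n], of "v n"] \<eta> 
          by (auto simp: not_less intro: order_trans)
      qed
      also have "\<dots> = (\<Sum>n<N. if n < N0 then M * v n else 0) + \<eta> * (\<Sum>n<N. v n)"
        by (simp add: sum.distrib sum_distrib_left)
      also have "(\<Sum>n<N. if n < N0 then M * v n else 0) = M * (\<Sum>n<N0. v n)"
        unfolding sum_distrib_left using elim by (intro sum.mono_neutral_cong_right) auto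
      also have "\<eta> * (\<Sum>n<N. v n) \<le> \<eta> * 16"
        unfolding v_def \<kappa>_def using \<eta> by (intro mult_left_mono riemann_kernel_total_variation h) auto
      also have "norm (R N) * \<kappa> (real N * h) \<le> \<eta> * 1"
        unfolding \<kappa>_def using N0[OF elim] \<eta> riemann_kernel_bounds by (intro mult_mono) auto
      finally show ?case unfolding v_def by simp
    qed
  qed simp
  show "((\<lambda>h. \<Sum>n. u n * of_real (riemann_kernel (real (Suc n) * h))) \<longlongrightarrow> S) (at_right 0)"
    unfolding \<kappa>_def[symmetric]
  proof (rule tendstoI)
    fix e :: real assume e: "0 < e"
    define \<eta> where "\<eta> = e / 34"
    have \<eta>: "0 < \<eta>" using e by (simp add: \<eta>_def)
    obtain N0 where N0: "\<And>n. n \<ge> N0 \<Longrightarrow> norm (R n) \<le> \<eta>"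
      using LIMSEQ_D[OF R0 \<eta>] by (auto intro: less_imp_le)
    have k0: "((\<lambda>h. \<kappa> (c * h)) \<longlongrightarrow> 1) (at_right 0)" for c
    proof -
      have "((\<lambda>h. \<kappa> (c * h)) \<longlongrightarrow> \<kappa> 0) (at_right 0)"
        by (rule isCont_tendsto_compose[OF riemann_kernel_cont, folded \<kappa>_def]) (auto intro!: tendsto_eq_intros)
      then show ?thesis by (simp add: \<kappa>_def riemann_kernel_def)
    qed
    have "((\<lambda>h. M * (\<Sum>n<N0. \<bar>\<kappa> (real (Suc n) * h) - \<kappa> (real n * h)\<bar>)) \<longlongrightarrow> M * (\<Sum>n<N0. \<bar>1 - 1\<bar>)) (at_right 0)"
      by (intro tendsto_intros k0)
    then have "((\<lambda>h. M * (\<Sum>n<N0. \<bar>\<kappa> (real (Suc n) * h) - \<kappa> (real n * h)\<bar>)) \<longlongrightarrow> 0) (at_right 0)" by simp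
    from order_tendstoD(2)[OF this, of "e / 2"] e
    have "\<forall>\<^sub>F h in at_right 0. M * (\<Sum>n<N0. \<bar>\<kappa> (real (Suc n) * h) - \<kappa> (real n * h)\<bar>) < e / 2" by simp
    then show "\<forall>\<^sub>F h in at_right 0. dist (\<Sum>n. u n * of_real (\<kappa> (real (Suc n) * h))) S < e"
      using eventually_at_right_less[of "0::real"]
    proof eventually_elim
      case (elim h)
      have "17 * \<eta> = e / 2" by (simp add: \<eta>_def)
      with elim(1) show ?case
        using main[OF elim(2) \<eta>, of N0, OF N0] unfolding dist_norm by linarith
    qed
  qed
qed

section \<open>Functions on the circle with a pointwise convergent one-sided expansion\<close>

lemma shift_vd: "((\<lambda>x. c + x) has_vector_derivative 1) (at (x::real))" "((\<lambda>x. x + c) has_vector_derivative 1) (at x)"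
  unfolding has_real_derivative_iff_has_vector_derivative[symmetric] by (auto intro!: derivative_eq_intros)

text \<open>The expansion converges only pointwise, so its coefficients are not yet known to be
  Fourier coefficients. What is needed of that fact is derived in the form of orthogonality
  relations for f and f'.\<close>

locale neg_series =
  fixes f f' :: "complex \<Rightarrow> complex" and a :: "nat \<Rightarrow> complex"
  assumes deriv: "\<And>w. w \<in> circ \<Longrightarrow> (f has_field_derivative f' w) (at w within circ)"
    and cont': "continuous_on circ f'"
    and sums: "\<And>w. w \<in> circ \<Longrightarrow> (\<lambda>n. a n * cnj w ^ Suc n) sums f w"
begin

definition q :: "real \<Rightarrow> complex" where "q \<theta> = f (cis \<theta>)"
definition q' :: "real \<Rightarrow> complex" where "q' \<theta> = \<i> * cis \<theta> * f' (cis \<theta>)"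
definition mode :: "nat \<Rightarrow> real \<Rightarrow> complex" where "mode n \<theta> = cis (- (real (Suc n) * \<theta>))"
(* Riemann's twice integrated series. *)
definition G :: "real \<Rightarrow> complex" where "G \<theta> = (\<Sum>n. - a n / (real (Suc n))\<^sup>2 * mode n \<theta>)"

lemma q_deriv: "(q has_vector_derivative q' \<theta>) (at \<theta> within S)"
proof -
  have "(cis has_vector_derivative \<i> * cis \<theta>) (at \<theta> within S)"
    unfolding has_vector_derivative_def by (rule has_derivative_eq_rhs[OF has_derivative_cis[OF has_derivative_ident]]) auto
  moreover have "(f has_field_derivative f' (cis \<theta>)) (at (cis \<theta>) within cis ` S)"
    by (rule DERIV_subset[OF deriv]) auto
  ultimately show ?thesis
    using field_vector_diff_chain_within[of cis "\<i> * cis \<theta>" \<theta> S f "f' (cis \<theta>)"]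
    by (simp add: q_def[abs_def] q'_def o_def mult_ac)
qed

lemma q'_cont: "continuous_on S q'"
  unfolding q'_def by (intro continuous_intros continuous_on_compose2[OF cont']) auto

lemma q_cont: "continuous_on S q"
  using q_deriv by (auto intro: has_vector_derivative_continuous simp: continuous_on_eq_continuous_within)

lemma periodic: "q (\<theta> + 2 * pi) = q \<theta>" "q' (\<theta> + 2 * pi) = q' \<theta>" "G (\<theta> + 2 * pi) = G \<theta>"
proof -
  have c: "cis (\<theta> + 2 * pi) = cis \<theta>" by (simp add: cis_mult[symmetric])
  have "mode n (\<theta> + 2 * pi) = mode n \<theta>" for n
  proof -
    have "- (real (Suc n) * (\<theta> + 2 * pi)) = - (real (Suc n) * \<theta>) + 2 * pi * of_int (- int (Suc n))"
      by (simp add: algebra_simps)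
    then show ?thesis unfolding mode_def by (simp only: cis_mult[symmetric] cis_multiple_2pi Ints_of_int mult_1_right)
  qed
  then show "G (\<theta> + 2 * pi) = G \<theta>" by (simp add: G_def)
  show "q (\<theta> + 2 * pi) = q \<theta>" "q' (\<theta> + 2 * pi) = q' \<theta>" using c by (simp_all add: q_def q'_def)
qed

lemma a_bounded: "\<exists>M>0. \<forall>n. norm (a n) \<le> M"
proof -
  have "summable a" using sums[of 1] by (simp add: sums_iff)
  then have "Bseq a" by (intro convergent_imp_Bseq) (auto simp: convergent_def dest: summable_LIMSEQ_zero)
  then show ?thesis by (auto simp: Bseq_def)
qed

lemma mode_sums: "(\<lambda>n. a n * mode n \<theta>) sums q \<theta>"
proof -
  have "mode n \<theta> = cnj (cis \<theta>) ^ Suc n" for n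
    by (simp only: mode_def cis_cnj Complex.DeMoivre mult_minus_right)
  then show ?thesis using sums[of "cis \<theta>"] by (simp add: q_def del: power_Suc)
qed

lemma G_term_bound: "\<exists>M>0. \<forall>n \<theta>. norm (- a n / (real (Suc n))\<^sup>2 * mode n \<theta>) \<le> M * (1 / (real (Suc n))\<^sup>2)"
proof -
  obtain M where M: "M > 0" "\<And>n. norm (a n) \<le> M" using a_bounded by blast
  have "norm (- a n / (real (Suc n))\<^sup>2 * mode n \<theta>) \<le> M * (1 / (real (Suc n))\<^sup>2)" for n \<theta>
    using M(2)[of n] by (simp add: norm_mult norm_divide mode_def norm_power divide_right_mono del: of_nat_Suc)
  with M(1) show ?thesis by blast
qed

lemma summable_inverse_squares: "summable (\<lambda>n. M * (1 / (real (Suc n))\<^sup>2))"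
  using inverse_squares_sums by (intro summable_mult) (auto simp: sums_iff)

lemma G_summable: "summable (\<lambda>n. - a n / (real (Suc n))\<^sup>2 * mode n \<theta>)"
proof -
  obtain M where "\<And>n \<theta>. norm (- a n / (real (Suc n))\<^sup>2 * mode n \<theta>) \<le> M * (1 / (real (Suc n))\<^sup>2)"
    using G_term_bound by blast
  then show ?thesis by (intro summable_comparison_test'[OF summable_inverse_squares]) blast
qed

lemma G_uniform: "uniform_limit UNIV (\<lambda>N \<theta>. \<Sum>n<N. - a n / (real (Suc n))\<^sup>2 * mode n \<theta>) G sequentially"
proof -
  obtain M where "\<And>n \<theta>. norm (- a n / (real (Suc n))\<^sup>2 * mode n \<theta>) \<le> M * (1 / (real (Suc n))\<^sup>2)"
    using G_term_bound by blast
  then show ?thesis unfolding G_def[abs_def] by (intro Weierstrass_m_test[OF _ summable_inverse_squares]) blast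
qed

lemma mode_cont: "continuous_on S (mode n)"
  unfolding mode_def by (intro continuous_intros)

lemma G_cont: "continuous_on S G"
proof -
  have "continuous_on UNIV G"
    by (rule uniform_limit_theorem[OF _ G_uniform]) (auto intro!: always_eventually continuous_intros mode_cont simp del: of_nat_Suc)
  then show ?thesis by (rule continuous_on_subset) auto
qed

text \<open>The symmetric second difference multiplies exp(-i m x) by -4 sin(m h / 2)^2, and
  dividing by -(m h)^2 leaves the Riemann kernel at m h / 2. The quotients of G are thus the Riemann
  means of the series of q.\<close>

lemma G_second_difference: "((\<lambda>h. (G (\<theta> + h) + G (\<theta> - h) - 2 * G \<theta>) / of_real (h\<^sup>2)) \<longlongrightarrow> q \<theta>) (at_right 0)"
proof -
  have half: "filterlim (\<lambda>h::real. h / 2) (at_right 0) (at_right 0)"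
    by (auto simp: filterlim_at eventually_at_right_less intro!: tendsto_eq_intros eventually_mono[OF eventually_at_right_less])
  have "((\<lambda>h. \<Sum>n. a n * mode n \<theta> * of_real (riemann_kernel (real (Suc n) * (h / 2)))) \<longlongrightarrow> q \<theta>) (at_right 0)"
    using filterlim_compose[OF riemann_summation(1)[OF mode_sums] half] .
  then show ?thesis
  proof (rule Lim_transform_eventually)
    show "\<forall>\<^sub>F h in at_right 0. (\<Sum>n. a n * mode n \<theta> * of_real (riemann_kernel (real (Suc n) * (h / 2))))
        = (G (\<theta> + h) + G (\<theta> - h) - 2 * G \<theta>) / of_real (h\<^sup>2)"
      using eventually_at_right_less[of "0::real"]
    proof eventually_elim
      case (elim h)
      have "(\<lambda>n. (- a n / (real (Suc n))\<^sup>2 * mode n (\<theta> + h) + - a n / (real (Suc n))\<^sup>2 * mode n (\<theta> - h)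
          - 2 * (- a n / (real (Suc n))\<^sup>2 * mode n \<theta>)) / of_real (h\<^sup>2))
          sums ((G (\<theta> + h) + G (\<theta> - h) - 2 * G \<theta>) / of_real (h\<^sup>2))"
        unfolding G_def by (intro sums_divide sums_diff sums_add sums_mult summable_sums G_summable)
      moreover have "(- a n / (real (Suc n))\<^sup>2 * mode n (\<theta> + h) + - a n / (real (Suc n))\<^sup>2 * mode n (\<theta> - h)
          - 2 * (- a n / (real (Suc n))\<^sup>2 * mode n \<theta>)) / of_real (h\<^sup>2)
          = a n * mode n \<theta> * of_real (riemann_kernel (real (Suc n) * (h / 2)))" for n
      proof -
        define m where "m = real (Suc n)"
        have m: "m \<noteq> 0" by (simp add: m_def)
        have e: "mode n (\<theta> + h) = mode n \<theta> * cis (- (m * h))" "mode n (\<theta> - h) = mode n \<theta> * cis (m * h)"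
          by (simp_all add: mode_def m_def cis_mult algebra_simps)
        have c: "cis (- (m * h)) + cis (m * h) - 2 = of_real (- 4 * (sin (m * (h / 2)))\<^sup>2)"
        proof -
          have "cos (m * h) = 1 - 2 * (sin (m * (h / 2)))\<^sup>2"
            using cos_double_sin[of "m * (h / 2)"] by simp
          then show ?thesis by (simp add: complex_eq_iff)
        qed
        have k: "riemann_kernel (m * (h / 2)) = 4 * (sin (m * (h / 2)))\<^sup>2 / (m\<^sup>2 * h\<^sup>2)"
          using m elim by (simp add: riemann_kernel_def power_divide power_mult_distrib)
        have "- a n / of_real (m\<^sup>2) * mode n (\<theta> + h) + - a n / of_real (m\<^sup>2) * mode n (\<theta> - h)
            - 2 * (- a n / of_real (m\<^sup>2) * mode n \<theta>)
            = - a n / of_real (m\<^sup>2) * mode n \<theta> * (cis (- (m * h)) + cis (m * h) - 2)"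
          unfolding e by (simp add: algebra_simps add_divide_distrib)
        also have "\<dots> / of_real (h\<^sup>2) = a n * mode n \<theta> * of_real (riemann_kernel (m * (h / 2)))"
          unfolding c k using m elim by (simp add: field_simps)
        finally show ?thesis unfolding m_def by simp
      qed
      ultimately show ?case by (simp add: sums_iff)
    qed
  qed
qed

text \<open>If H is a second antiderivative of q, then G - H is continuous with symmetric second
  derivative 0, hence affine (in real and imaginary part), and G inherits its two derivatives from
  H.\<close>

lemma G_twice_differentiable:
  obtains T where "\<And>\<theta>. -1 < \<theta> \<Longrightarrow> \<theta> < 10 \<Longrightarrow> (G has_vector_derivative T \<theta>) (at \<theta>)"
    "\<And>\<theta>. -1 < \<theta> \<Longrightarrow> \<theta> < 10 \<Longrightarrow> (T has_vector_derivative q \<theta>) (at \<theta>)"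
proof -
  \<comment> \<open>[0, 2 pi] lies in (-1, 10), with room for translations by less than 1/2, and
    [-1, 10] in (-2, 11), where the antiderivatives are two-sided differentiable.\<close>
  obtain P where P: "\<And>x. x \<in> {-2..11} \<Longrightarrow> (P has_vector_derivative q x) (at x within {-2..11})"
    using antiderivative_continuous[OF q_cont] by blast
  have Pc: "continuous_on {-2..11} P" by (rule continuous_on_vector_derivative) (rule P)
  obtain H where H: "\<And>x. x \<in> {-2..11} \<Longrightarrow> (H has_vector_derivative P x) (at x within {-2..11})"
    using antiderivative_continuous[OF Pc] by blast
  have P': "(P has_vector_derivative q x) (at x)" and H': "(H has_vector_derivative P x) (at x)"
    if "-2 < x" "x < 11" for x
    using P[of x] H[of x] that by (auto simp: at_within_Icc_at)
  have affine: "L (G x - H x) = L (G (-1) - H (-1)) + (x - (-1)) * ((L (G 10 - H 10) - L (G (-1) - H (-1))) / (10 - (-1)))"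
    if L: "bounded_linear L" and x: "x \<in> {-1..10}" for L :: "complex \<Rightarrow> real" and x
  proof (rule affine_if_second_difference_zero[of "-1" 10 "\<lambda>x. L (G x - H x)" x])
    note lin = bounded_linear.linear[OF L]
    have "continuous_on {-1..10} H"
      by (rule continuous_on_subset[OF continuous_on_vector_derivative[OF H]]) auto
    then show "continuous_on {-1..10} (\<lambda>x. L (G x - H x))"
      by (intro bounded_linear.continuous_on[OF L] continuous_intros G_cont)
    fix y :: real assume y: "-1 < y" "y < 10"
    have 1: "((\<lambda>h. L ((G (y + h) + G (y - h) - 2 * G y) / of_real (h\<^sup>2))) \<longlongrightarrow> L (q y)) (at_right 0)"
      by (rule bounded_linear.tendsto[OF L G_second_difference])
    have 2: "((\<lambda>h. (L (H (y + h)) + L (H (y - h)) - 2 * L (H y)) / h\<^sup>2) \<longlongrightarrow> L (q y)) (at_right 0)"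
    proof (rule second_difference_tendsto[where a = "-2" and b = 11 and P = "\<lambda>x. L (P x)"])
      show "((\<lambda>x. L (H x)) has_real_derivative L (P z)) (at z)" if "-2 < z" "z < 11" for z
        unfolding has_real_derivative_iff_has_vector_derivative
        by (rule bounded_linear.has_vector_derivative[OF L H'[OF that]])
      show "((\<lambda>x. L (P x)) has_real_derivative L (q y)) (at y)"
        unfolding has_real_derivative_iff_has_vector_derivative
        by (rule bounded_linear.has_vector_derivative[OF L P']) (use y in auto)
    qed (use y in auto)
    have "L ((G (y + h) + G (y - h) - 2 * G y) / of_real (h\<^sup>2)) - (L (H (y + h)) + L (H (y - h)) - 2 * L (H y)) / h\<^sup>2
      = (L (G (y + h) - H (y + h)) + L (G (y - h) - H (y - h)) - 2 * L (G y - H y)) / h\<^sup>2" for h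
    proof -
      have "(G (y + h) + G (y - h) - 2 * G y) / of_real (h\<^sup>2) = (1 / h\<^sup>2) *\<^sub>R (G (y + h) + G (y - h) - 2 *\<^sub>R G y)"
        by (simp add: scaleR_conv_of_real)
      then show ?thesis
        by (simp only: linear_scale[OF lin] linear_add[OF lin] linear_diff[OF lin])
           (simp add: diff_divide_distrib add_divide_distrib right_diff_distrib)
    qed
    then show "((\<lambda>h. (L (G (y + h) - H (y + h)) + L (G (y - h) - H (y - h)) - 2 * L (G y - H y)) / h\<^sup>2) \<longlongrightarrow> 0) (at_right 0)"
      using tendsto_diff[OF 1 2] by simp
  qed (use x in auto)
  define \<beta> where "\<beta> = Complex ((Re (G 10 - H 10) - Re (G (-1) - H (-1))) / 11) ((Im (G 10 - H 10) - Im (G (-1) - H (-1))) / 11)"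
  define \<gamma> where "\<gamma> = G (-1) - H (-1) + \<beta>"
  have eq: "H x + (\<gamma> + x *\<^sub>R \<beta>) = G x" if "-1 < x" "x < 10" for x
    using affine[OF bounded_linear_Re, of x] affine[OF bounded_linear_Im, of x] that
    by (simp add: complex_eq_iff \<beta>_def \<gamma>_def algebra_simps add_divide_distrib diff_divide_distrib)
  show ?thesis
  proof (rule that[of "\<lambda>x. P x + \<beta>"])
    fix x :: real assume x: "-1 < x" "x < 10"
    have "((\<lambda>x. H x + (\<gamma> + x *\<^sub>R \<beta>)) has_vector_derivative P x + (0 + \<beta>)) (at x)"
      by (intro has_vector_derivative_add H' has_vector_derivative_const)
         (use x in \<open>auto intro!: derivative_eq_intros\<close>)
    then have "(G has_vector_derivative P x + (0 + \<beta>)) (at x)"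
      by (rule has_vector_derivative_transform_within_open[where S = "{-1<..<10}"]) (use x eq in auto)
    then show "(G has_vector_derivative P x + \<beta>) (at x)" by simp
    have "((\<lambda>x. P x + \<beta>) has_vector_derivative q x + 0) (at x)"
      by (intro has_vector_derivative_add P' has_vector_derivative_const) (use x in auto)
    then show "((\<lambda>x. P x + \<beta>) has_vector_derivative q x) (at x)" by simp
  qed
qed

text \<open>Translation multiplies a mode by a constant, so orthogonality to the modes is enough;
  the series of G converges uniformly and may be integrated term by term. The translation h is kept
  free in order to be differentiated later.\<close>

lemma integral_against_G:
  assumes \<psi>: "continuous_on {0..2*pi} \<psi>" and orth: "\<And>n. ((\<lambda>\<theta>. \<psi> \<theta> * mode n \<theta>) has_integral 0) {0..2*pi}"
  shows "((\<lambda>\<theta>. \<psi> \<theta> * G (\<theta> + h)) has_integral 0) {0..2*pi}"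
proof -
  obtain M where M: "M > 0" "\<And>n \<theta>. norm (- a n / (real (Suc n))\<^sup>2 * mode n \<theta>) \<le> M * (1 / (real (Suc n))\<^sup>2)"
    using G_term_bound by blast
  obtain B where B: "B > 0" "\<And>\<theta>. \<theta> \<in> {0..2*pi} \<Longrightarrow> norm (\<psi> \<theta>) \<le> B"
    using compact_imp_bounded[OF compact_continuous_image[OF \<psi> compact_Icc]]
    unfolding bounded_pos by auto
  define t where "t n \<theta> = \<psi> \<theta> * (- a n / (real (Suc n))\<^sup>2 * mode n (\<theta> + h))" for n \<theta>
  have "uniform_limit {0..2*pi} (\<lambda>N \<theta>. \<Sum>n<N. t n \<theta>) (\<lambda>\<theta>. \<Sum>n. t n \<theta>) sequentially"
  proof (rule Weierstrass_m_test[OF _ summable_inverse_squares[of "B * M"]])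
    show "norm (t n \<theta>) \<le> B * M * (1 / (real (Suc n))\<^sup>2)" if "\<theta> \<in> {0..2*pi}" for n \<theta>
      unfolding t_def norm_mult[of "\<psi> \<theta>"] mult.assoc
      using B(1) by (intro mult_mono[OF B(2)[OF that] M(2)[of n "\<theta> + h"]]) auto
  qed
  moreover have "(\<Sum>n. t n \<theta>) = \<psi> \<theta> * G (\<theta> + h)" for \<theta>
    unfolding t_def G_def by (rule suminf_mult[OF G_summable])
  ultimately have lim: "uniform_limit {0..2*pi} (\<lambda>N \<theta>. \<Sum>n<N. t n \<theta>) (\<lambda>\<theta>. \<psi> \<theta> * G (\<theta> + h)) sequentially" by simp
  have tc: "continuous_on {0..2*pi} (\<lambda>\<theta>. \<Sum>n<N. t n \<theta>)" for N
    unfolding t_def by (intro continuous_intros \<psi> continuous_on_compose2[OF mode_cont[of UNIV]]) (auto simp del: of_nat_Suc)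
  obtain I J where IJ: "\<And>N. ((\<lambda>\<theta>. \<Sum>n<N. t n \<theta>) has_integral I N) {0..2*pi}"
    "((\<lambda>\<theta>. \<psi> \<theta> * G (\<theta> + h)) has_integral J) {0..2*pi}" "I \<longlonglongrightarrow> J"
    using uniform_limit_integral[OF lim tc] by auto
  have "(t n has_integral 0) {0..2*pi}" for n
  proof -
    have e: "t n = (\<lambda>\<theta>. (- a n / (real (Suc n))\<^sup>2 * mode n h) * (\<psi> \<theta> * mode n \<theta>))"
      by (auto simp: t_def fun_eq_iff mode_def cis_mult algebra_simps)
    show ?thesis
      unfolding e using has_integral_mult_right[OF orth[of n], of "- a n / (real (Suc n))\<^sup>2 * mode n h"]
      by (simp only: mult_zero_right)
  qed
  then have "((\<lambda>\<theta>. \<Sum>n<N. t n \<theta>) has_integral (\<Sum>n<N. 0)) {0..2*pi}" for N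
    by (intro has_integral_sum) auto
  then have "I N = 0" for N using has_integral_unique[OF IJ(1)] by simp
  then have "I = (\<lambda>N. 0)" by (simp add: fun_eq_iff)
  then have "J = 0" using IJ(3) by (simp add: LIMSEQ_const_iff)
  then show ?thesis using IJ(2) by simp
qed

lemma integral_cis:
  assumes "k \<noteq> 0"
  shows "((\<lambda>\<theta>. cis (- (real k * \<theta>))) has_integral 0) {0..2*pi}"
proof -
  have "((\<lambda>\<theta>. cis (- (real k * \<theta>))) has_integral
      (\<i> / real k * cis (- (real k * (2*pi))) - \<i> / real k * cis (- (real k * 0)))) {0..2*pi}"
  proof (rule fundamental_theorem_of_calculus)
    fix x :: real
    show "((\<lambda>\<theta>. \<i> / real k * cis (- (real k * \<theta>))) has_vector_derivative cis (- (real k * x))) (at x within {0..2*pi})"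
      unfolding has_vector_derivative_def
      by (rule derivative_eq_intros refl)+ (use assms in \<open>auto simp: fun_eq_iff scaleR_conv_of_real complex_eq_iff\<close>)
  qed simp
  moreover have "cis (- (real k * (2*pi))) = 1"
    using cis_multiple_2pi[of "- real k"] by (simp add: mult.commute)
  ultimately show ?thesis by simp
qed

lemma cis_neg_vd: "((\<lambda>\<theta>. cis (- (c * \<theta>))) has_vector_derivative - \<i> * of_real c * cis (- (c * x))) (at x within S)"
  unfolding has_vector_derivative_def
  by (rule derivative_eq_intros refl)+ (auto simp: fun_eq_iff scaleR_conv_of_real)

text \<open>As G'' = q, two integrations by parts turn the Fourier coefficient of q into -k^2 times
  that of G, which vanishes because G is a uniformly convergent series of modes of negative
  frequency.\<close>

lemma q_orthogonal: "((\<lambda>\<theta>. q \<theta> * cis (- (real k * \<theta>))) has_integral 0) {0..2*pi}"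
proof -
  obtain T where T: "\<And>\<theta>. -1 < \<theta> \<Longrightarrow> \<theta> < 10 \<Longrightarrow> (G has_vector_derivative T \<theta>) (at \<theta>)"
    "\<And>\<theta>. -1 < \<theta> \<Longrightarrow> \<theta> < 10 \<Longrightarrow> (T has_vector_derivative q \<theta>) (at \<theta>)"
    using G_twice_differentiable by blast
  have bd: "-1 < x" "x < 10" if "x \<in> {0..2*pi}" for x using that pi_less_4 by auto
  have "((\<lambda>\<theta>. G (\<theta> + 2 * pi)) has_vector_derivative T (2 * pi)) (at 0)"
    using vector_diff_chain_at[OF shift_vd(2), of G "T (2 * pi)" 0 "2 * pi"] T(1)[of "2 * pi"] bd[of "2 * pi"]
    by (simp add: o_def)
  then have "(G has_vector_derivative T (2 * pi)) (at 0)" by (simp add: periodic)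
  \<comment> \<open>The derivative \<open>T\<close> is known only on (-1, 10); that it agrees at 0
    and 2 pi comes from periodicity of G and uniqueness of derivatives.\<close>
  then have Tp: "T (2 * pi) = T 0" using T(1)[of 0] by (auto intro: vector_derivative_unique_at)
  define e where "e \<theta> = cis (- (real k * \<theta>))" for \<theta>
  have ed: "(e has_vector_derivative - \<i> * of_real (real k) * e x) (at x within {0..2*pi})" for x
    unfolding e_def[abs_def] by (rule cis_neg_vd)
  have ep: "e (2 * pi) = e 0" using cis_multiple_2pi[of "- real k"] by (simp add: e_def mult.commute)
  have Gp: "G (2 * pi) = G 0" using periodic(3)[of 0] by simp
  \<comment> \<open>Both integrations by parts at once: the derivative of (T + i k G) e is (q + k^2
    G) e.\<close>
  have 1: "((\<lambda>\<theta>. (q \<theta> + (of_nat k)\<^sup>2 * G \<theta>) * e \<theta>) has_integral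
      ((T (2*pi) + \<i> * of_nat k * G (2*pi)) * e (2*pi) - (T 0 + \<i> * of_nat k * G 0) * e 0)) {0..2*pi}"
  proof (rule fundamental_theorem_of_calculus)
    fix x assume x: "x \<in> {0..2*pi}"
    have "((\<lambda>\<theta>. (T \<theta> + \<i> * of_nat k * G \<theta>) * e \<theta>) has_vector_derivative
        (T x + \<i> * of_nat k * G x) * (- \<i> * of_real (real k) * e x) + (q x + \<i> * of_nat k * T x) * e x) (at x within {0..2*pi})"
      by (intro has_vector_derivative_mult has_vector_derivative_add has_vector_derivative_mult_right ed
          has_vector_derivative_at_within[OF T(1)] has_vector_derivative_at_within[OF T(2)] bd x)
    then show "((\<lambda>\<theta>. (T \<theta> + \<i> * of_nat k * G \<theta>) * e \<theta>) has_vector_derivative (q x + (of_nat k)\<^sup>2 * G x) * e x) (at x within {0..2*pi})"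
      by (rule has_vector_derivative_eq_rhs) (simp add: algebra_simps power2_eq_square)
  qed simp
  have 2: "((\<lambda>\<theta>. e \<theta> * G (\<theta> + 0)) has_integral 0) {0..2*pi}"
  proof (rule integral_against_G)
    show "continuous_on {0..2*pi} e" unfolding e_def by (intro continuous_intros)
    show "((\<lambda>\<theta>. e \<theta> * mode n \<theta>) has_integral 0) {0..2*pi}" for n
    proof -
      have "(\<lambda>\<theta>. e \<theta> * mode n \<theta>) = (\<lambda>\<theta>. cis (- (real (k + Suc n) * \<theta>)))"
        by (auto simp: e_def mode_def cis_mult fun_eq_iff algebra_simps)
      then show ?thesis using integral_cis[of "k + Suc n"] by simp
    qed
  qed
  have "((\<lambda>\<theta>. (q \<theta> + (of_nat k)\<^sup>2 * G \<theta>) * e \<theta> - (of_nat k)\<^sup>2 * (e \<theta> * G (\<theta> + 0))) has_integral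
     ((T (2*pi) + \<i> * of_nat k * G (2*pi)) * e (2*pi) - (T 0 + \<i> * of_nat k * G 0) * e 0) - (of_nat k)\<^sup>2 * 0) {0..2*pi}"
    by (intro has_integral_diff 1 has_integral_mult_right 2)
  then show ?thesis unfolding Tp ep Gp by (simp add: algebra_simps e_def)
qed

lemma q'_orthogonal: "((\<lambda>\<theta>. q' \<theta> * cis (- (real k * \<theta>))) has_integral 0) {0..2*pi}"
proof -
  have 1: "((\<lambda>\<theta>. q \<theta> * (- \<i> * of_real (real k) * cis (- (real k * \<theta>))) + q' \<theta> * cis (- (real k * \<theta>))) has_integral
      (q (2*pi) * cis (- (real k * (2*pi))) - q 0 * cis (- (real k * 0)))) {0..2*pi}"
    by (rule fundamental_theorem_of_calculus, simp, intro has_vector_derivative_mult q_deriv cis_neg_vd)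
  have "q (2 * pi) = q 0" using periodic(1)[of 0] by simp
  moreover have "cis (- (real k * (2*pi))) = 1"
    using cis_multiple_2pi[of "- real k"] by (simp add: mult.commute)
  ultimately have 2: "((\<lambda>\<theta>. q \<theta> * (- \<i> * of_real (real k) * cis (- (real k * \<theta>))) + q' \<theta> * cis (- (real k * \<theta>))) has_integral 0) {0..2*pi}"
    using 1 by simp
  have "((\<lambda>\<theta>. (q \<theta> * (- \<i> * of_real (real k) * cis (- (real k * \<theta>))) + q' \<theta> * cis (- (real k * \<theta>)))
      - (- \<i> * of_real (real k)) * (q \<theta> * cis (- (real k * \<theta>)))) has_integral 0 - (- \<i> * of_real (real k)) * 0) {0..2*pi}"
    by (intro has_integral_diff 2 has_integral_mult_right q_orthogonal)
  then show ?thesis by (simp add: algebra_simps)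
qed

text \<open>Orthogonality to all small translates of g can be differentiated in the translation,
  under the integral sign.\<close>

lemma orthogonal_derivative:
  assumes \<psi>: "continuous_on {0..2*pi} \<psi>"
    and zero: "\<And>h. \<bar>h\<bar> < 1/2 \<Longrightarrow> integral {0..2*pi} (\<lambda>\<theta>. \<psi> \<theta> * g (\<theta> + h)) = 0"
    and g: "\<And>\<theta>. -1 < \<theta> \<Longrightarrow> \<theta> < 10 \<Longrightarrow> (g has_vector_derivative g' \<theta>) (at \<theta>)"
    and g': "continuous_on {-1<..<10} g'"
    and h: "\<bar>h\<bar> < 1/2"
  shows "integral {0..2*pi} (\<lambda>\<theta>. \<psi> \<theta> * g' (\<theta> + h)) = (0 :: complex)"
proof -
  have bd: "-1 < \<theta> + h" "\<theta> + h < 10" if "\<theta> \<in> {0..2*pi}" "\<bar>h\<bar> < 1/2" for \<theta> h using that pi_less_4 by auto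
  have gc: "continuous_on {-1<..<10} g"
    by (rule continuous_on_vector_derivative, rule has_vector_derivative_at_within[OF g]) auto
  define U where "U = {- 1/2<..<(1/2::real)}"
  have "((\<lambda>h. integral (cbox 0 (2*pi)) (\<lambda>\<theta>. \<psi> \<theta> * g (\<theta> + h))) has_vector_derivative
     integral (cbox 0 (2*pi)) (\<lambda>\<theta>. \<psi> \<theta> * g' (\<theta> + h))) (at h within U)"
  proof (rule leibniz_rule_vector_derivative[where U = U])
    fix x \<theta> assume x: "x \<in> U" "\<theta> \<in> cbox 0 (2*pi)"
    have "((\<lambda>x. g (\<theta> + x)) has_vector_derivative g' (\<theta> + x)) (at x)"
    proof -
      have "\<bar>x\<bar> < 1 / 2" "\<theta> \<in> {0..2*pi}" using x by (auto simp: U_def)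
      then show ?thesis
        using vector_diff_chain_at[OF shift_vd(1) g[OF bd]] by (simp add: o_def)
    qed
    then show "((\<lambda>x. \<psi> \<theta> * g (\<theta> + x)) has_vector_derivative \<psi> \<theta> * g' (\<theta> + x)) (at x within U)"
      by (rule has_vector_derivative_at_within[OF has_vector_derivative_mult_right])
  next
    fix x assume x: "x \<in> U"
    have "continuous_on {0..2*pi} (\<lambda>\<theta>. \<psi> \<theta> * g (\<theta> + x))"
    proof (intro continuous_intros \<psi> continuous_on_compose2[OF gc])
      have "\<bar>x\<bar> < 1 / 2" using x by (auto simp: U_def)
      then show "(\<lambda>\<theta>. \<theta> + x) ` {0..2*pi} \<subseteq> {-1<..<10}"
        using bd[of _ x] by (blast intro: greaterThanLessThan_iff[THEN iffD2])
    qed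
    then show "(\<lambda>\<theta>. \<psi> \<theta> * g (\<theta> + x)) integrable_on cbox 0 (2*pi)"
      unfolding cbox_interval by (rule integrable_continuous_real)
  next
    show "continuous_on (U \<times> cbox 0 (2*pi)) (\<lambda>(x, \<theta>). \<psi> \<theta> * g' (\<theta> + x))"
      unfolding case_prod_unfold
    proof (intro continuous_intros continuous_on_compose2[OF \<psi>] continuous_on_compose2[OF g'])
      show "snd ` (U \<times> cbox 0 (2 * pi)) \<subseteq> {0..2 * pi}" by auto
      show "(\<lambda>p. snd p + fst p) ` (U \<times> cbox 0 (2*pi)) \<subseteq> {-1<..<10}"
      proof (intro image_subsetI)
        fix p assume p: "p \<in> U \<times> cbox 0 (2*pi)"
        then have "\<bar>fst p\<bar> < 1 / 2" "snd p \<in> {0..2*pi}" by (auto simp: U_def)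
        from bd[OF this(2,1)] show "snd p + fst p \<in> {-1<..<10}" by simp
      qed
    qed
  qed (use h in \<open>auto simp: U_def\<close>)
  moreover have "((\<lambda>h. integral (cbox 0 (2*pi)) (\<lambda>\<theta>. \<psi> \<theta> * g (\<theta> + h))) has_vector_derivative 0) (at h)"
    by (rule has_vector_derivative_transform_within_open[OF has_vector_derivative_const[of 0], where S = U])
       (use h zero in \<open>auto simp: U_def\<close>)
  moreover have "at h within U = at h" using h by (intro at_within_open) (auto simp: U_def)
  ultimately show ?thesis using vector_derivative_unique_at by fastforce
qed

text \<open>On the circle f'^2 = - q' * (q' exp(-2 i x)). The second factor is orthogonal to all
  modes, hence to the translates of G, and three differentiations in the translation carry this over
  to T, q and q'. No convergent expansion of q' is required.\<close>

lemma q'_square: "((\<lambda>\<theta>. (f' (cis \<theta>))\<^sup>2) has_integral 0) {0..2*pi}"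
proof -
  obtain T where T: "\<And>\<theta>. -1 < \<theta> \<Longrightarrow> \<theta> < 10 \<Longrightarrow> (G has_vector_derivative T \<theta>) (at \<theta>)"
    "\<And>\<theta>. -1 < \<theta> \<Longrightarrow> \<theta> < 10 \<Longrightarrow> (T has_vector_derivative q \<theta>) (at \<theta>)"
    using G_twice_differentiable by blast
  define \<psi> where "\<psi> \<theta> = q' \<theta> * cis (- (real 2 * \<theta>))" for \<theta>
  have \<psi>c: "continuous_on {0..2*pi} \<psi>" unfolding \<psi>_def by (intro continuous_intros q'_cont)
  have "((\<lambda>\<theta>. \<psi> \<theta> * mode n \<theta>) has_integral 0) {0..2*pi}" for n
  proof -
    have "(\<lambda>\<theta>. \<psi> \<theta> * mode n \<theta>) = (\<lambda>\<theta>. q' \<theta> * cis (- (real (2 + Suc n) * \<theta>)))"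
    proof
      fix \<theta>
      have "- (real 2 * \<theta>) + - (real (Suc n) * \<theta>) = - (real (2 + Suc n) * \<theta>)" by (simp add: algebra_simps)
      then show "\<psi> \<theta> * mode n \<theta> = q' \<theta> * cis (- (real (2 + Suc n) * \<theta>))"
        by (simp only: \<psi>_def mode_def mult.assoc cis_mult)
    qed
    then show ?thesis using q'_orthogonal[of "2 + Suc n"] by simp
  qed
  from integral_against_G[OF \<psi>c this]
  have 0: "integral {0..2*pi} (\<lambda>\<theta>. \<psi> \<theta> * G (\<theta> + h)) = 0" for h by (rule integral_unique)
  have Tc: "continuous_on {-1<..<10} T"
    by (rule continuous_on_vector_derivative, rule has_vector_derivative_at_within[OF T(2)]) auto
  note 1 = orthogonal_derivative[OF \<psi>c 0 T(1) Tc]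
  note 2 = orthogonal_derivative[OF \<psi>c 1 T(2) q_cont]
  note 3 = orthogonal_derivative[OF \<psi>c 2 q_deriv q'_cont, of 0]
  have "((\<lambda>\<theta>. \<psi> \<theta> * q' \<theta>) has_integral 0) {0..2*pi}"
    using 3 integrable_integral[OF integrable_continuous_real, of 0 "2*pi" "\<lambda>\<theta>. \<psi> \<theta> * q' \<theta>"]
    by (simp add: \<psi>c q'_cont continuous_on_mult)
  then have "((\<lambda>\<theta>. - (\<psi> \<theta> * q' \<theta>)) has_integral - 0) {0..2*pi}" by (rule has_integral_neg)
  moreover have "- (\<psi> \<theta> * q' \<theta>) = (f' (cis \<theta>))\<^sup>2" for \<theta>
  proof -
    have "cis (- (real 2 * \<theta>)) * (cis \<theta> * cis \<theta>) = 1" by (simp add: cis_mult)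
    then show ?thesis by (simp add: \<psi>_def q'_def power2_eq_square algebra_simps)
  qed
  ultimately show ?thesis by simp
qed

end

section \<open>Integral inequalities on the circle\<close>

lemma periodic_integral:
  fixes p :: "real \<Rightarrow> 'b::banach"
  assumes p: "continuous_on UNIV p" "\<And>\<theta>. p (\<theta> + 2 * pi) = p \<theta>" and \<phi>: "\<phi> \<in> {0..2*pi}"
  shows "((\<lambda>\<theta>. p (\<phi> + \<theta>)) has_integral (integral {0..2*pi} p)) {0..2*pi}"
proof -
  obtain P where P: "\<And>x. x \<in> {-1..5*pi} \<Longrightarrow> (P has_vector_derivative p x) (at x within {-1..5*pi})"
    using antiderivative_continuous[OF continuous_on_subset[OF p(1)]] by blast
  have P': "(P has_vector_derivative p x) (at x)" if "0 \<le> x" "x \<le> 4 * pi" for x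
    using P[of x] at_within_Icc_at[of "-1" x "5*pi"] that pi_gt_zero by simp
  have sh: "((\<lambda>\<theta>. P (c + \<theta>)) has_vector_derivative p (c + x)) (at x within S)" if "0 \<le> c + x" "c + x \<le> 4 * pi" for c x S
    using vector_diff_chain_at[OF shift_vd(1) P'[OF that]]
    by (auto simp: o_def intro: has_vector_derivative_at_within)
  have int: "((\<lambda>\<theta>. p (c + \<theta>)) has_integral P (c + 2 * pi) - P (c + 0)) {0..2*pi}" if "c \<in> {0..2*pi}" for c
    by (rule fundamental_theorem_of_calculus) (use that in \<open>auto intro!: sh\<close>)
  have dv: "((\<lambda>c. P (2 * pi + c) - P (0 + c)) has_vector_derivative p (2 * pi + x) - p (0 + x)) (at x within {0..2*pi})"
    if "x \<in> {0..2*pi}" for x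
    by (intro has_vector_derivative_diff sh) (use that in auto)
  have "((\<lambda>c. P (2 * pi + c) - P (0 + c)) has_vector_derivative 0) (at x within {0..2*pi})"
    if "x \<in> {0..2*pi}" for x
  proof -
    have "p (2 * pi + x) - p (0 + x) = 0" using p(2)[of x] by (simp add: add.commute)
    then show ?thesis using dv[OF that] by (simp only:)
  qed
  then obtain k where k: "\<And>x. x \<in> {0..2*pi} \<Longrightarrow> P (2 * pi + x) - P (0 + x) = k"
    using has_vector_derivative_zero_constant[of "{0..2*pi}" "\<lambda>c. P (2 * pi + c) - P (0 + c)"] by auto
  have "integral {0..2*pi} p = P (2 * pi) - P 0" using integral_unique[OF int[of 0]] by simp
  then show ?thesis using int[OF \<phi>] k[OF \<phi>] k[of 0] by (simp add: add.commute)
qed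

text \<open>The Cauchy-Schwarz inequality against the constant 1, from |g| <= l/2 + |g|^2 / (2 l)
  with l close to the optimal value N / sqrt (b - a).\<close>

lemma norm_integral_le_sqrt:
  fixes g :: "real \<Rightarrow> complex"
  assumes "a \<le> b" and g: "continuous_on {a..b} g" and N: "0 \<le> N"
    and le: "integral {a..b} (\<lambda>x. (norm (g x))\<^sup>2) \<le> N\<^sup>2"
  shows "integral {a..b} (\<lambda>x. norm (g x)) \<le> sqrt (b - a) * N"
proof (cases "a = b")
  case False
  then have ab: "0 < sqrt (b - a)" using assms(1) by simp
  show ?thesis
  proof (rule field_le_epsilon)
    fix e :: real assume e: "0 < e"
    \<comment> \<open>Keeps l positive when N = 0; its contribution to the final bound is exactly
      e.\<close>
    define \<delta> where "\<delta> = 2 * e / sqrt (b - a)"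
    have \<delta>: "0 < \<delta>" using e ab by (simp add: \<delta>_def)
    define l where "l = (N + \<delta>) / sqrt (b - a)"
    have l: "0 < l" using \<delta> N ab by (simp add: l_def)
    then have l0: "l \<noteq> 0" by simp
    have "integral {a..b} (\<lambda>x. norm (g x)) \<le> integral {a..b} (\<lambda>x. l / 2 + (norm (g x))\<^sup>2 / (2 * l))"
    proof (rule integral_le)
      show "norm (g x) \<le> l / 2 + (norm (g x))\<^sup>2 / (2 * l)" for x
      proof -
        have "0 \<le> (norm (g x) - l)\<^sup>2" by simp
        then have "2 * l * norm (g x) \<le> l\<^sup>2 + (norm (g x))\<^sup>2" by (simp add: power2_eq_square algebra_simps)
        then show ?thesis using l by (simp add: field_simps power2_eq_square)
      qed
    qed (use l0 in \<open>auto intro!: integrable_continuous_real continuous_intros g\<close>)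
    also have "\<dots> = (b - a) * (l / 2) + integral {a..b} (\<lambda>x. (norm (g x))\<^sup>2) / (2 * l)"
      using assms(1) by (subst integral_add) (use l0 in \<open>auto intro!: integrable_continuous_real continuous_intros g\<close>)
    also have "integral {a..b} (\<lambda>x. (norm (g x))\<^sup>2) / (2 * l) \<le> N\<^sup>2 / (2 * l)"
      using le l by (intro divide_right_mono) auto
    also have "(b - a) * (l / 2) = sqrt (b - a) * (N + \<delta>) / 2"
    proof -
      have "r * r * ((N + \<delta>) / r / 2) = r * (N + \<delta>) / 2" if "r \<noteq> 0" for r by (simp add: that)
      from this[of "sqrt (b - a)"] show ?thesis using ab assms(1) by (simp add: l_def)
    qed
    also have "N\<^sup>2 / (2 * l) \<le> sqrt (b - a) * N / 2"
    proof -
      have "N\<^sup>2 / (2 * l) = sqrt (b - a) * (N * (N / (N + \<delta>))) / 2"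
        using ab \<delta> N by (simp add: l_def power2_eq_square algebra_simps)
      also have "N / (N + \<delta>) \<le> 1" using \<delta> N by (simp add: divide_le_eq)
      then have "sqrt (b - a) * (N * (N / (N + \<delta>))) / 2 \<le> sqrt (b - a) * (N * 1) / 2"
        using ab N by (intro divide_right_mono mult_left_mono) auto
      finally show ?thesis by simp
    qed
    finally have "integral {a..b} (\<lambda>x. norm (g x)) \<le> sqrt (b - a) * N + sqrt (b - a) * \<delta> / 2"
      by (simp add: algebra_simps add_divide_distrib)
    also have "sqrt (b - a) * \<delta> / 2 = e" using ab by (simp add: \<delta>_def)
    finally show "integral {a..b} (\<lambda>x. norm (g x)) \<le> sqrt (b - a) * N + e" by simp
  qed
qed simp

lemma half_le_sin:
  assumes "0 \<le> x" "x \<le> pi / 2"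
  shows "x / 2 \<le> sin x"
proof (cases "x \<le> pi / 3")
  case True
  have "sin 0 - 0 / 2 \<le> sin x - x / 2"
  proof (rule DERIV_nonneg_imp_nondecreasing[OF assms(1)])
    fix y assume y: "0 \<le> y" "y \<le> x"
    have "cos (pi / 3) \<le> cos y" by (rule cos_monotone_0_pi_le) (use y True pi_gt_zero in auto)
    then show "\<exists>z. ((\<lambda>y. sin y - y / 2) has_real_derivative z) (at y) \<and> 0 \<le> z"
      by (intro exI[of _ "cos y - 1 / 2"]) (auto intro!: derivative_eq_intros simp: cos_60)
  qed
  then show ?thesis by simp
next
  case False
  have "sin (pi / 3) \<le> sin x"
    by (rule sin_monotone_2pi_le) (use False assms pi_gt_zero in auto)
  \<comment> \<open>A rational lower bound for sqrt 3: here sin x >= sqrt 3 / 2 >= 17/20, while x /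
    2 <= pi / 4 < 17/20.\<close>
  moreover have "(17/10)\<^sup>2 \<le> (3::real)" by (simp add: power2_eq_square)
  then have "17 / 10 \<le> sqrt 3" by (rule real_le_rsqrt)
  ultimately show ?thesis using assms pi_approx(2) by (simp add: sin_60)
qed

lemma norm_cis_diff: "norm (cis (\<phi> + \<theta>) - cis \<phi>) = 2 * \<bar>sin (\<theta> / 2)\<bar>"
proof -
  have "cis (\<phi> + \<theta>) - cis \<phi> = cis (\<phi> + \<theta> / 2) * (cis (\<theta> / 2) - cis (- (\<theta> / 2)))"
    unfolding right_diff_distrib cis_mult by (simp add: add.assoc)
  also have "cis (\<theta> / 2) - cis (- (\<theta> / 2)) = \<i> * of_real (2 * sin (\<theta> / 2))" by (simp add: complex_eq_iff)
  finally show ?thesis by (simp add: norm_mult)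
qed

lemma chord_bound:
  assumes \<theta>: "\<theta> \<in> {0..2*pi}"
  shows "\<theta> \<le> pi \<Longrightarrow> \<theta> / 2 \<le> norm (cis (\<phi> + \<theta>) - cis \<phi>)"
    and "pi \<le> \<theta> \<Longrightarrow> (2 * pi - \<theta>) / 2 \<le> norm (cis (\<phi> + \<theta>) - cis \<phi>)"
proof -
  have s: "0 \<le> sin (\<theta> / 2)" using \<theta> by (intro sin_ge_zero) auto
  show "\<theta> / 2 \<le> norm (cis (\<phi> + \<theta>) - cis \<phi>)" if "\<theta> \<le> pi"
    unfolding norm_cis_diff using half_le_sin[of "\<theta> / 2"] that \<theta> s by simp
  have "sin (\<theta> / 2) = sin ((2 * pi - \<theta>) / 2)" by (simp add: sin_diff diff_divide_distrib)
  then show "(2 * pi - \<theta>) / 2 \<le> norm (cis (\<phi> + \<theta>) - cis \<phi>)" if "pi \<le> \<theta>"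
    unfolding norm_cis_diff using half_le_sin[of "(2 * pi - \<theta>) / 2"] that \<theta> s by simp
qed

(* By the Cauchy-Schwarz inequality |f(t) - f(w)| is at most |t - w|^(1/2) times the L2 norm of f', which
   makes this integrable function a majorant of the difference quotients. *)
definition sing :: "real \<Rightarrow> real" where
  "sing \<theta> = \<theta> powr (- 1/2) + (2 * pi - \<theta>) powr (- 1/2)"

lemma sing_integral: obtains s where "(sing has_integral s) {0..2*pi}" "0 \<le> s" "s \<le> 12"
proof -
  have 1: "((\<lambda>x. x powr (- 1/2)) has_integral (2 * pi) powr (- 1/2 + 1) / (- 1/2 + 1)) {0..2*pi}"
    by (rule has_integral_powr_from_0) auto
  have c: "(2 * pi) powr (- 1/2 + 1) / (- 1/2 + 1) = 2 * sqrt (2 * pi)" by (simp add: powr_half_sqrt)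
  have i1: "((\<lambda>x. x powr (- 1/2)) has_integral 2 * sqrt (2 * pi)) (cbox 0 (2 * pi))"
    using 1 by (simp only: c cbox_interval)
  have "((\<lambda>x. ((-1) *\<^sub>R x + 2 * pi) powr (- 1/2)) has_integral (1 / \<bar>-1\<bar> ^ DIM(real)) *\<^sub>R (2 * sqrt (2 * pi)))
     ((\<lambda>x. (1 / (-1)) *\<^sub>R x + - ((1 / (-1)) *\<^sub>R (2 * pi))) ` cbox 0 (2 * pi))"
    by (rule has_integral_affinity[OF i1]) simp
  moreover have "(\<lambda>x. (1 / (-1)) *\<^sub>R x + - ((1 / (-1)) *\<^sub>R (2 * pi))) ` cbox 0 (2 * pi) = {0..2*pi}"
  proof -
    have "x \<in> (\<lambda>x. 2 * pi - x) ` {0..2 * pi}" if "x \<in> {0..2*pi}" for x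
      using that by (intro image_eqI[of _ _ "2 * pi - x"]) auto
    then show ?thesis by auto
  qed
  ultimately have 2: "((\<lambda>x. (2 * pi - x) powr (- 1/2)) has_integral 2 * sqrt (2 * pi)) {0..2*pi}" by simp
  show ?thesis
  proof (rule that)
    show "(sing has_integral 2 * sqrt (2 * pi) + 2 * sqrt (2 * pi)) {0..2*pi}"
      unfolding sing_def[abs_def] using has_integral_add[OF i1[unfolded cbox_interval] 2] .
    have "sqrt (2 * pi) \<le> sqrt 9" using pi_less_4 pi_approx(2) by (intro real_sqrt_le_mono) simp
    also have "sqrt 9 = (3::real)" by (rule real_sqrt_unique) auto
    finally show "2 * sqrt (2 * pi) + 2 * sqrt (2 * pi) \<le> 12" by simp
  qed simp
qed

lemma circle_mean_integral: "circle_mean h = integral {0..2*pi} (\<lambda>\<theta>. h (cis \<theta>) * cis \<theta>) / of_real (2 * pi)"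
proof -
  have "contour_integral (circlepath 0 1) h = integral {0..2*pi} (\<lambda>t. h (0 + of_real 1 * cis t) * of_real 1 * \<i> * cis t)"
    unfolding circlepath_def by (subst contour_integral_part_circlepath_eq) auto
  also have "\<dots> = integral {0..2*pi} (\<lambda>t. \<i> * (h (cis t) * cis t))" by (simp add: mult_ac)
  also have "\<dots> = \<i> * integral {0..2*pi} (\<lambda>t. h (cis t) * cis t)" by simp
  finally show ?thesis by (simp add: circle_mean_def)
qed

lemma cis_periodic: "cis (\<theta> + 2 * pi) = cis \<theta>"
  by (simp add: cis_mult[symmetric])

text \<open>The rotation puts the point w, where kernels are singular, at the two ends of [0, 2 pi],
  as the majorant \<open>sing\<close> expects.\<close>

lemma circle_mean_rotated:
  assumes h: "continuous_on circ h" and \<phi>: "\<phi> \<in> {0..2*pi}"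
  shows "((\<lambda>\<theta>. h (cis (\<phi> + \<theta>)) * cis (\<phi> + \<theta>)) has_integral of_real (2 * pi) * circle_mean h) {0..2*pi}"
proof -
  have "continuous_on UNIV (\<lambda>\<theta>. h (cis \<theta>) * cis \<theta>)"
    by (intro continuous_intros continuous_on_compose2[OF h]) auto
  from periodic_integral[OF this _ \<phi>] show ?thesis by (simp add: circle_mean_integral cis_periodic)
qed

lemma norm_circle_mean_le_integral:
  assumes h: "continuous_on circ h" and \<phi>: "\<phi> \<in> {0..2*pi}" and B: "(B has_integral b) {0..2*pi}"
    and le: "\<And>\<theta>. \<theta> \<in> {0..2*pi} \<Longrightarrow> norm (h (cis (\<phi> + \<theta>))) \<le> B \<theta>"
  shows "norm (circle_mean h) \<le> b / (2 * pi)"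
proof -
  have "norm (of_real (2 * pi) * circle_mean h) \<le> b"
    using integral_norm_bound_integral[OF has_integral_integrable[OF circle_mean_rotated[OF h \<phi>]] has_integral_integrable[OF B]]
      le integral_unique[OF circle_mean_rotated[OF h \<phi>]] integral_unique[OF B]
    by (simp add: norm_mult)
  then show ?thesis by (simp add: norm_mult field_simps)
qed

lemma circ_cis:
  assumes "w \<in> circ"
  obtains \<phi> where "\<phi> \<in> {0..2*pi}" "w = cis \<phi>"
proof
  show "w = cis (Arg2pi w)"
    using Arg2pi[of w] assms by (simp add: cis_conv_exp mult.commute is_Arg_def)
  show "Arg2pi w \<in> {0..2*pi}" using Arg2pi[of w] by auto
qed

definition l2sq :: "(complex \<Rightarrow> complex) \<Rightarrow> real" where
  "l2sq h = integral {0..2*pi} (\<lambda>\<theta>. (norm (h (cis \<theta>)))\<^sup>2)"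

lemma l2sq_integrable:
  assumes "continuous_on circ h"
  shows "((\<lambda>\<theta>. (norm (h (cis \<theta>)))\<^sup>2) has_integral l2sq h) {0..2*pi}" "0 \<le> l2sq h"
proof -
  have "continuous_on {0..2*pi} (\<lambda>\<theta>. (norm (h (cis \<theta>)))\<^sup>2)"
    by (intro continuous_intros continuous_on_compose2[OF assms]) auto
  then show "((\<lambda>\<theta>. (norm (h (cis \<theta>)))\<^sup>2) has_integral l2sq h) {0..2*pi}"
    unfolding l2sq_def by (intro integrable_integral integrable_continuous_real)
  then show "0 \<le> l2sq h" by (rule has_integral_nonneg) auto
qed

lemma sqrt_2pi_le: "sqrt (2 * pi) \<le> 3"
proof -
  have "sqrt (2 * pi) \<le> sqrt 9" using pi_approx(2) by (intro real_sqrt_le_mono) simp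
  also have "sqrt 9 = (3::real)" by (rule real_sqrt_unique) auto
  finally show ?thesis .
qed

lemma l1_le_l2:
  assumes h: "continuous_on circ h" and \<phi>: "\<phi> \<in> {0..2*pi}" and ab: "0 \<le> a" "a \<le> b" "b \<le> 2 * pi"
  shows "integral {a..b} (\<lambda>\<theta>. norm (h (cis (\<phi> + \<theta>)))) \<le> sqrt (b - a) * sqrt (l2sq h)"
proof (rule norm_integral_le_sqrt[OF ab(2)])
  have c: "continuous_on S (\<lambda>\<theta>. h (cis (\<phi> + \<theta>)))" for S
    by (intro continuous_intros continuous_on_compose2[OF h]) auto
  show "continuous_on {a..b} (\<lambda>\<theta>. h (cis (\<phi> + \<theta>)))" by (rule c)
  have "continuous_on UNIV (\<lambda>\<theta>. (norm (h (cis \<theta>)))\<^sup>2)"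
    by (intro continuous_intros continuous_on_compose2[OF h]) auto
  from periodic_integral[OF this _ \<phi>]
  have full: "((\<lambda>\<theta>. (norm (h (cis (\<phi> + \<theta>))))\<^sup>2) has_integral l2sq h) {0..2*pi}"
    by (simp add: cis_periodic l2sq_def)
  have "integral {a..b} (\<lambda>\<theta>. (norm (h (cis (\<phi> + \<theta>))))\<^sup>2) \<le> integral {0..2*pi} (\<lambda>\<theta>. (norm (h (cis (\<phi> + \<theta>))))\<^sup>2)"
    by (rule integral_subset_le) (use ab in \<open>auto intro!: integrable_continuous_real continuous_intros c\<close>)
  then show "integral {a..b} (\<lambda>x. (norm (h (cis (\<phi> + x))))\<^sup>2) \<le> (sqrt (l2sq h))\<^sup>2"
    using integral_unique[OF full] l2sq_integrable(2)[OF h] by simp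
qed (use l2sq_integrable(2)[OF h] in simp)

lemma l1_le:
  assumes "continuous_on circ h"
  obtains I where "((\<lambda>\<theta>. norm (h (cis \<theta>))) has_integral I) {0..2*pi}" "0 \<le> I" "I \<le> 3 * sqrt (l2sq h)"
proof
  have "continuous_on {0..2*pi} (\<lambda>\<theta>. norm (h (cis \<theta>)))"
    by (intro continuous_intros continuous_on_compose2[OF assms]) auto
  then show *: "((\<lambda>\<theta>. norm (h (cis \<theta>))) has_integral integral {0..2*pi} (\<lambda>\<theta>. norm (h (cis \<theta>)))) {0..2*pi}"
    by (intro integrable_integral integrable_continuous_real)
  then show "0 \<le> integral {0..2*pi} (\<lambda>\<theta>. norm (h (cis \<theta>)))" by (rule has_integral_nonneg) auto
  have "integral {0..2*pi} (\<lambda>\<theta>. norm (h (cis \<theta>))) \<le> sqrt (2 * pi) * sqrt (l2sq h)"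
    using l1_le_l2[OF assms, of 0 0 "2 * pi"] by simp
  also have "\<dots> \<le> 3 * sqrt (l2sq h)"
    using l2sq_integrable(2)[OF assms] sqrt_2pi_le by (intro mult_right_mono) auto
  finally show "integral {0..2*pi} (\<lambda>\<theta>. norm (h (cis \<theta>))) \<le> 3 * sqrt (l2sq h)" .
qed

context neg_series
begin

text \<open>The two estimates run along the two arcs between the points; whichever is shorter is
  comparable to the chord.\<close>

lemma arc_integral:
  assumes \<phi>: "\<phi> \<in> {0..2*pi}" and \<theta>: "\<theta> \<in> {0..2*pi}"
  shows "norm (f (cis (\<phi> + \<theta>)) - f (cis \<phi>)) \<le> integral {0..\<theta>} (\<lambda>s. norm (f' (cis (\<phi> + s))))"
    and "norm (f (cis (\<phi> + \<theta>)) - f (cis \<phi>)) \<le> integral {\<theta>..2*pi} (\<lambda>s. norm (f' (cis (\<phi> + s))))"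
proof -
  have vd: "((\<lambda>s. q (\<phi> + s)) has_vector_derivative q' (\<phi> + x)) (at x within S)" for x S
    using vector_diff_chain_at[OF shift_vd(1), of q "q' (\<phi> + x)" \<phi> x] q_deriv[of "\<phi> + x" UNIV]
    by (auto simp: o_def intro: has_vector_derivative_at_within)
  have ftc: "norm (q (\<phi> + y) - q (\<phi> + x)) \<le> integral {x..y} (\<lambda>s. norm (f' (cis (\<phi> + s))))" if "x \<le> y" for x y
  proof -
    have I: "((\<lambda>s. q' (\<phi> + s)) has_integral q (\<phi> + y) - q (\<phi> + x)) {x..y}"
      by (rule fundamental_theorem_of_calculus[OF that]) (rule vd)
    have c: "continuous_on {x..y} (\<lambda>s. norm (f' (cis (\<phi> + s))))"
      by (intro continuous_intros continuous_on_compose2[OF cont']) auto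
    have "norm (integral {x..y} (\<lambda>s. q' (\<phi> + s))) \<le> integral {x..y} (\<lambda>s. norm (f' (cis (\<phi> + s))))"
      by (rule integral_norm_bound_integral[OF has_integral_integrable[OF I] integrable_continuous_real[OF c]])
         (simp add: q'_def norm_mult)
    then show ?thesis using integral_unique[OF I] by simp
  qed
  show "norm (f (cis (\<phi> + \<theta>)) - f (cis \<phi>)) \<le> integral {0..\<theta>} (\<lambda>s. norm (f' (cis (\<phi> + s))))"
    using ftc[of 0 \<theta>] \<theta> by (simp add: q_def)
  have "q (\<phi> + 2 * pi) = q \<phi>" by (rule periodic(1))
  then show "norm (f (cis (\<phi> + \<theta>)) - f (cis \<phi>)) \<le> integral {\<theta>..2*pi} (\<lambda>s. norm (f' (cis (\<phi> + s))))"
    using ftc[of \<theta> "2 * pi"] \<theta> by (simp add: q_def norm_minus_commute)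
qed

lemma quotient_l2:
  assumes \<phi>: "\<phi> \<in> {0..2*pi}" and \<theta>: "\<theta> \<in> {0..2*pi}"
  shows "norm ((f (cis (\<phi> + \<theta>)) - f (cis \<phi>)) / (cis (\<phi> + \<theta>) - cis \<phi>)) \<le> 2 * sqrt (l2sq f') * sing \<theta>"
proof -
  define N where "N = sqrt (l2sq f')"
  have N: "0 \<le> N" using l2sq_integrable(2)[OF cont'] by (simp add: N_def)
  have arc: "norm (f (cis (\<phi> + \<theta>)) - f (cis \<phi>)) \<le> sqrt \<theta> * N"
    "norm (f (cis (\<phi> + \<theta>)) - f (cis \<phi>)) \<le> sqrt (2 * pi - \<theta>) * N"
    using order_trans[OF arc_integral(1)[OF assms] l1_le_l2[OF cont' \<phi>, of 0 \<theta>]]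
      order_trans[OF arc_integral(2)[OF assms] l1_le_l2[OF cont' \<phi>, of \<theta> "2 * pi"]] \<theta>
    by (simp_all add: N_def)
  have key: "norm (B / A) \<le> 2 * N * y powr (- 1/2)" if "norm B \<le> sqrt y * N" "y / 2 \<le> norm A" "0 \<le> y" for A B :: complex and y
  proof (cases "y = 0")
    case True
    then show ?thesis using that by simp
  next
    case False
    then have y: "0 < y" using that by simp
    have "norm B / norm A \<le> (sqrt y * N) / (y / 2)" using that y N by (intro frac_le) auto
    also have "\<dots> = 2 * N * (sqrt y / y)" by simp
    also have "sqrt y / y = y powr (- 1/2)"
      using y by (simp add: powr_minus powr_half_sqrt field_simps real_sqrt_mult_self)
    finally show ?thesis by (simp add: norm_divide)
  qed
  show ?thesis
  proof (cases "\<theta> \<le> pi")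
    case True
    have "norm ((f (cis (\<phi> + \<theta>)) - f (cis \<phi>)) / (cis (\<phi> + \<theta>) - cis \<phi>)) \<le> 2 * N * \<theta> powr (- 1/2)"
      by (rule key[OF arc(1) chord_bound(1)[OF \<theta> True]]) (use \<theta> in auto)
    also have "\<dots> \<le> 2 * N * sing \<theta>" unfolding sing_def using N by (intro mult_left_mono) auto
    finally show ?thesis by (simp add: N_def)
  next
    case False
    have "norm ((f (cis (\<phi> + \<theta>)) - f (cis \<phi>)) / (cis (\<phi> + \<theta>) - cis \<phi>)) \<le> 2 * N * (2 * pi - \<theta>) powr (- 1/2)"
      by (rule key[OF arc(2) chord_bound(2)[OF \<theta>]]) (use \<theta> False in auto)
    also have "\<dots> \<le> 2 * N * sing \<theta>" unfolding sing_def using N by (intro mult_left_mono) auto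
    finally show ?thesis by (simp add: N_def)
  qed
qed

text \<open>The shorter arc is at most twice the chord (\<open>chord_bound\<close>), whence the
  2.\<close>

lemma quotient_sup:
  assumes le: "\<And>w. w \<in> circ \<Longrightarrow> norm (f' w) \<le> 1" and "w \<in> circ" "t \<in> circ"
  shows "norm ((f t - f w) / (t - w)) \<le> 2"
proof -
  obtain \<phi> where \<phi>: "\<phi> \<in> {0..2*pi}" "w = cis \<phi>" using circ_cis[OF assms(2)] .
  have wt: "cnj w * t \<in> circ" using assms(2,3) by (simp add: norm_mult)
  obtain \<theta> where \<theta>: "\<theta> \<in> {0..2*pi}" "cnj w * t = cis \<theta>" using circ_cis[OF wt] .
  have "w * cnj w = 1" using assms(2) by (simp flip: complex_norm_square)
  then have t: "t = cis (\<phi> + \<theta>)" using \<theta>(2) \<phi>(2) by (metis cis_mult mult.assoc mult_1)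
  have c: "continuous_on S (\<lambda>s. norm (f' (cis (\<phi> + s))))" for S
    by (intro continuous_intros continuous_on_compose2[OF cont']) auto
  have i: "integral {x..y} (\<lambda>s. norm (f' (cis (\<phi> + s)))) \<le> y - x" if "x \<le> y" for x y
  proof -
    have "integral {x..y} (\<lambda>s. norm (f' (cis (\<phi> + s)))) \<le> integral {x..y} (\<lambda>s. 1)"
      by (rule integral_le) (auto intro!: integrable_continuous_real c le)
    then show ?thesis using that by simp
  qed
  have "norm (f t - f w) \<le> 2 * norm (t - w)"
  proof (cases "\<theta> \<le> pi")
    case True
    then show ?thesis
      using arc_integral(1)[OF \<phi>(1) \<theta>(1)] i[of 0 \<theta>] chord_bound(1)[OF \<theta>(1) True, of \<phi>] \<theta>(1) by (simp add: t \<phi>(2))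
  next
    case False
    then show ?thesis
      using arc_integral(2)[OF \<phi>(1) \<theta>(1)] i[of \<theta> "2 * pi"] chord_bound(2)[OF \<theta>(1), of \<phi>] \<theta>(1) by (simp add: t \<phi>(2))
  qed
  then show ?thesis by (cases "t = w") (auto simp: norm_divide divide_le_eq)
qed

text \<open>f has mean 0, so f(w) is an average of the differences f(w) - f(t), each at most sqrt (2
  pi) <= 3 times the L^2 norm of f'.\<close>

lemma sup_le_l2:
  assumes "w \<in> circ"
  shows "norm (f w) \<le> 3 * sqrt (l2sq f')"
proof -
  obtain \<phi> where \<phi>: "\<phi> \<in> {0..2*pi}" "w = cis \<phi>" using circ_cis[OF assms] .
  have qi: "(q has_integral 0) {0..2*pi}" using q_orthogonal[of 0] by simp
  then have "integral {0..2*pi} q = 0" by (rule integral_unique)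
  then have q\<phi>: "((\<lambda>\<theta>. q (\<phi> + \<theta>)) has_integral 0) {0..2*pi}"
    using periodic_integral[OF q_cont periodic(1) \<phi>(1)] by simp
  have "((\<lambda>\<theta>. q (\<phi> + \<theta>) - q \<phi>) has_integral 0 - (2 * pi - 0) *\<^sub>R q \<phi>) {0..2*pi}"
    by (intro has_integral_diff q\<phi>) (use has_integral_const_real[of "q \<phi>" 0 "2 * pi"] in simp)
  then have I: "((\<lambda>\<theta>. q (\<phi> + \<theta>) - q \<phi>) has_integral - (2 * pi) *\<^sub>R q \<phi>) {0..2*pi}" by simp
  have "norm (q (\<phi> + \<theta>) - q \<phi>) \<le> 3 * sqrt (l2sq f')" if \<theta>: "\<theta> \<in> {0..2*pi}" for \<theta>
  proof -
    have "norm (q (\<phi> + \<theta>) - q \<phi>) \<le> sqrt \<theta> * sqrt (l2sq f')"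
      using order_trans[OF arc_integral(1)[OF \<phi>(1) \<theta>] l1_le_l2[OF cont' \<phi>(1), of 0 \<theta>]] \<theta> by (simp add: q_def)
    also have "\<dots> \<le> 3 * sqrt (l2sq f')"
    proof (intro mult_right_mono)
      have "sqrt \<theta> \<le> sqrt (2 * pi)" using \<theta> by (intro real_sqrt_le_mono) simp
      then show "sqrt \<theta> \<le> 3" using sqrt_2pi_le by linarith
    qed (use l2sq_integrable(2)[OF cont'] in simp)
    finally show ?thesis .
  qed
  then have "norm (- (2 * pi) *\<^sub>R q \<phi>) \<le> 3 * sqrt (l2sq f') * (2 * pi)"
    using has_integral_bound_real[OF _ finite.emptyI I, of "3 * sqrt (l2sq f')"] l2sq_integrable(2)[OF cont'] by simp
  then have "2 * pi * norm (q \<phi>) \<le> 2 * pi * (3 * sqrt (l2sq f'))" by (simp add: mult_ac)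
  then show ?thesis by (simp add: q_def \<phi>(2))
qed

text \<open>2 Im(z) sin x = Re(z exp(-i x) - z exp(i x)). Both integrals vanish for z = f', being
  the coefficients of q' at k = 2 and k = 0 up to a constant.\<close>

lemma Im_deriv_sin: "((\<lambda>\<theta>. Im (f' (cis \<theta>)) * sin \<theta>) has_integral 0) {0..2*pi}"
proof -
  have "((\<lambda>\<theta>. - \<i> * (q' \<theta> * cis (- (real 0 * \<theta>)))) has_integral - \<i> * 0) {0..2*pi}"
    by (intro has_integral_mult_right q'_orthogonal)
  then have "((\<lambda>\<theta>. f' (cis \<theta>) * cis \<theta>) has_integral 0) {0..2*pi}"
    by (simp add: q'_def mult_ac)
  moreover have "((\<lambda>\<theta>. - \<i> * (q' \<theta> * cis (- (real 2 * \<theta>)))) has_integral - \<i> * 0) {0..2*pi}"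
    by (intro has_integral_mult_right q'_orthogonal)
  then have "((\<lambda>\<theta>. f' (cis \<theta>) * cis (- \<theta>)) has_integral 0) {0..2*pi}"
  proof (rule has_integral_eq[rotated, OF has_integral_eq_rhs])
    fix \<theta>
    have "cis (- (real 2 * \<theta>)) * cis \<theta> = cis (- \<theta>)" by (simp add: cis_mult)
    then show "- \<i> * (q' \<theta> * cis (- (real 2 * \<theta>))) = f' (cis \<theta>) * cis (- \<theta>)"
      by (simp add: q'_def mult_ac)
  qed simp
  ultimately have "((\<lambda>\<theta>. f' (cis \<theta>) * cis (- \<theta>) - f' (cis \<theta>) * cis \<theta>) has_integral 0 - 0) {0..2*pi}"
    by (intro has_integral_diff)
  from has_integral_linear[OF this bounded_linear_Re]
  have "((\<lambda>\<theta>. Re (f' (cis \<theta>) * cis (- \<theta>) - f' (cis \<theta>) * cis \<theta>)) has_integral 0) {0..2*pi}" by (simp add: o_def)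
  from has_integral_mult_right[OF this, of "1/2"] show ?thesis by (simp add: algebra_simps)
qed

lemma Im_deriv_l2: "((\<lambda>\<theta>. (Im (f' (cis \<theta>)))\<^sup>2) has_integral l2sq f' / 2) {0..2*pi}"
proof -
  from has_integral_linear[OF q'_square bounded_linear_Re]
  have "((\<lambda>\<theta>. Re ((f' (cis \<theta>))\<^sup>2)) has_integral 0) {0..2*pi}" by (simp add: o_def)
  from has_integral_diff[OF l2sq_integrable(1)[OF cont'] this]
  have "((\<lambda>\<theta>. (norm (f' (cis \<theta>)))\<^sup>2 - Re ((f' (cis \<theta>))\<^sup>2)) has_integral l2sq f') {0..2*pi}" by simp
  moreover have "(norm z)\<^sup>2 - Re (z\<^sup>2) = 2 * (Im z)\<^sup>2" for z :: complex
    by (simp add: cmod_power2 Re_power2)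
  ultimately have "((\<lambda>\<theta>. 2 * (Im (f' (cis \<theta>)))\<^sup>2) has_integral l2sq f') {0..2*pi}" by simp
  from has_integral_mult_right[OF this, of "1/2"] show ?thesis by simp
qed

end

subsection \<open>Lipschitz bounds for the remainder\<close>

text \<open>All that the uniqueness proof retains of the unit ball of X: C^1 bounds and the
  pointwise expansion. The Hoelder exponent has disappeared.\<close>

definition admissible :: "(complex \<Rightarrow> complex) \<Rightarrow> bool" where
  "admissible f \<longleftrightarrow> (\<exists>a. neg_series f (circle_deriv f) a) \<and>
     (\<forall>w\<in>circ. norm (f w) \<le> 1 \<and> norm (circle_deriv f w) \<le> 1)"

lemma neg_series_X_component:
  assumes "f \<in> X_component \<alpha>"
  shows "\<exists>a. neg_series f (circle_deriv f) a"
proof -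
  obtain A where A: "\<forall>w\<in>circ. (\<lambda>n. of_real (A (Suc n)) * cnj w ^ Suc n) sums f w"
    using assms by (auto simp: X_component_def)
  have "neg_series f (circle_deriv f) (\<lambda>n. of_real (A (Suc n)))"
  proof
    fix w :: complex assume w: "w \<in> circ"
    obtain D where D: "(f has_field_derivative D) (at w within circ)"
    proof -
      have "f field_differentiable (at w within circ)"
        using assms w by (simp add: X_component_def holder1_space_def)
      then show ?thesis using that unfolding field_differentiable_def by blast
    qed
    then show "(f has_field_derivative circle_deriv f w) (at w within circ)"
      using circle_deriv_eq[OF D w] by simp
    show "(\<lambda>n. of_real (A (Suc n)) * cnj w ^ Suc n) sums f w" using A w by blast
  qed (rule X_component_nonneg(2)[OF assms])
  then show ?thesis by blast
qed

lemma admissible_X_component: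
  assumes "f \<in> X_component \<alpha>" "holder1_norm \<alpha> f < 1"
  shows "admissible f"
proof -
  note X = X_component_nonneg[OF assms(1)]
  have "norm (f w) \<le> 1" "norm (circle_deriv f w) \<le> 1" if "w \<in> circ" for w
    using norm_le_sup_norm[OF X(1) that] norm_le_sup_norm[OF X(2) that] X(4,5) assms(2) by linarith+
  with neg_series_X_component[OF assms(1)] show ?thesis by (simp add: admissible_def)
qed

lemma neg_series_diff:
  assumes "neg_series f f' a" "neg_series h h' b"
  shows "neg_series (\<lambda>w. f w - h w) (\<lambda>w. f' w - h' w) (\<lambda>n. a n - b n)"
proof -
  interpret f: neg_series f f' a by (rule assms(1))
  interpret h: neg_series h h' b by (rule assms(2))
  show ?thesis
  proof
    fix w :: complex assume w: "w \<in> circ"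
    show "((\<lambda>w. f w - h w) has_field_derivative f' w - h' w) (at w within circ)"
      by (intro DERIV_diff f.deriv h.deriv w)
    show "(\<lambda>n. (a n - b n) * cnj w ^ Suc n) sums (f w - h w)"
      using sums_diff[OF f.sums[OF w] h.sums[OF w]] by (simp add: algebra_simps)
  qed (intro continuous_intros f.cont' h.cont')
qed

definition deriv_diff :: "(complex \<Rightarrow> complex) \<Rightarrow> (complex \<Rightarrow> complex) \<Rightarrow> complex \<Rightarrow> complex" where
  "deriv_diff f h w = circle_deriv f w - circle_deriv h w"
definition deriv_dist :: "(complex \<Rightarrow> complex) \<Rightarrow> (complex \<Rightarrow> complex) \<Rightarrow> real" where
  "deriv_dist f h = sqrt (l2sq (deriv_diff f h))"

lemma admissible_diff:
  assumes "admissible f" "admissible h"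
  shows "\<exists>a. neg_series (\<lambda>w. f w - h w) (deriv_diff f h) a"
  using assms neg_series_diff unfolding admissible_def deriv_diff_def[abs_def] by blast

lemma deriv_dist_nonneg: "admissible f \<Longrightarrow> admissible h \<Longrightarrow> 0 \<le> deriv_dist f h"
  using admissible_diff[of f h] neg_series.cont' l2sq_integrable(2) by (auto simp: deriv_dist_def)

lemma admissible_cont:
  assumes "admissible f"
  shows "continuous_on circ f" "continuous_on circ (circle_deriv f)"
proof -
  obtain a where "neg_series f (circle_deriv f) a" using assms by (auto simp: admissible_def)
  then interpret neg_series f "circle_deriv f" a .
  show "continuous_on circ (circle_deriv f)" by (rule cont')
  show "continuous_on circ f"
    by (auto simp: continuous_on_eq_continuous_within intro: has_field_derivative_imp_has_derivative
        has_derivative_continuous dest!: deriv[THEN has_field_derivative_imp_has_derivative])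
qed

section \<open>The self-interaction kernel\<close>

definition kernel1 :: "complex \<Rightarrow> (complex \<Rightarrow> complex) \<Rightarrow> complex \<Rightarrow> complex \<Rightarrow> complex" where
  "kernel1 \<eta> f w t = (let A = t - w; B = f t - f w in
     (A * cnj B - cnj A * B) / (A * (A + \<eta> * B)) * (circle_deriv f t - B / A))"

text \<open>The kernel depends on f only through difference quotients and f', whose differences are
  controlled by the L^2 distance. At t = w both sides are 0 by division by 0.\<close>

lemma kernel1_eq:
  "kernel1 \<eta> f w t = (cnj (f t - f w) / (t - w) - cnj (t - w) / (t - w) * ((f t - f w) / (t - w)))
     * (1 / (1 + \<eta> * ((f t - f w) / (t - w)))) * (circle_deriv f t - (f t - f w) / (t - w))"
proof (cases "t = w")
  case False
  define A B where "A = t - w" and "B = f t - f w"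
  have A: "A \<noteq> 0" using False by (simp add: A_def)
  have "A * (A + \<eta> * B) = A * A * (1 + \<eta> * (B / A))" using A by (simp add: field_simps)
  moreover have "A * cnj B - cnj A * B = A * A * (cnj B / A - cnj A / A * (B / A))" using A by (simp add: field_simps)
  ultimately have "(A * cnj B - cnj A * B) / (A * (A + \<eta> * B)) = (A * A * (cnj B / A - cnj A / A * (B / A))) / (A * A * (1 + \<eta> * (B / A)))"
    by (simp only:)
  also have "\<dots> = (cnj B / A - cnj A / A * (B / A)) * (1 / (1 + \<eta> * (B / A)))" using A by simp
  finally show ?thesis unfolding kernel1_def Let_def A_def[symmetric] B_def[symmetric] by simp
qed (simp add: kernel1_def)

lemma norm_mult_diff_le:
  fixes a b :: complex
  assumes "norm (a - a') \<le> \<alpha>" "norm b \<le> B" "norm a' \<le> A" "norm (b - b') \<le> \<beta>"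
  shows "norm (a * b - a' * b') \<le> \<alpha> * B + A * \<beta>"
proof -
  have "a * b - a' * b' = (a - a') * b + a' * (b - b')" by (simp add: algebra_simps)
  then have "norm (a * b - a' * b') \<le> norm (a - a') * norm b + norm a' * norm (b - b')"
    by (simp only:) (intro norm_triangle_le add_mono norm_mult_ineq)
  also have "\<dots> \<le> \<alpha> * B + A * \<beta>"
    using assms order_trans[OF norm_ge_zero assms(1)] order_trans[OF norm_ge_zero assms(3)]
    by (intro add_mono mult_mono) auto
  finally show ?thesis .
qed

lemma inverse_1_plus:
  fixes x :: complex
  assumes "norm \<eta> \<le> 1/8" "norm x \<le> 2"
  shows "norm (1 / (1 + \<eta> * x)) \<le> 2" "1 + \<eta> * x \<noteq> 0"
proof -
  have "norm (\<eta> * x) \<le> 1/8 * 2" unfolding norm_mult using assms by (intro mult_mono) auto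
  then have "1 / 2 \<le> norm (1 + \<eta> * x)" using norm_triangle_ineq2[of 1 "- (\<eta> * x)"] by simp
  then show "1 + \<eta> * x \<noteq> 0" by auto
  have "1 / norm (1 + \<eta> * x) \<le> 1 / (1 / 2)" using \<open>1 / 2 \<le> _\<close> by (intro divide_left_mono mult_pos_pos) auto
  then show "norm (1 / (1 + \<eta> * x)) \<le> 2" by (simp add: norm_divide)
qed

text \<open>x and y stand for B / A and cnj B / A. The three factors are bounded by 4, 2 and 3, and
  they vary by at most 2 D, D / 2 and D + \<delta>; so 26 D + 8 \<delta> is (4 D + 2 D) * 3 + 8 * (D
  + \<delta>).\<close>

lemma kernel_algebra:
  fixes x y \<alpha> g \<eta> x' y' g' :: complex
  assumes x: "norm x \<le> 2" "norm y \<le> 2" "norm g \<le> 1" and \<alpha>: "norm \<alpha> \<le> 1" and \<eta>: "norm \<eta> \<le> 1/8"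
    and x': "norm x' \<le> 2" "norm y' \<le> 2" "norm g' \<le> 1"
    and D: "norm (x - x') \<le> D" "norm (y - y') \<le> D" and \<delta>: "norm (g - g') \<le> \<delta>"
  shows "norm ((y - \<alpha> * x) * (1 / (1 + \<eta> * x)) * (g - x)) \<le> 8 * norm (g - x)"
    and "norm ((y - \<alpha> * x) * (1 / (1 + \<eta> * x)) * (g - x)) \<le> 24"
    and "norm ((y - \<alpha> * x) * (1 / (1 + \<eta> * x)) * (g - x) - (y' - \<alpha> * x') * (1 / (1 + \<eta> * x')) * (g' - x'))
      \<le> 26 * D + 8 * \<delta>"
proof -
  have \<alpha>x: "norm (\<alpha> * z) \<le> c" if "norm z \<le> c" for z c
    using mult_mono[OF \<alpha> that] that by (simp add: norm_mult)
  have P: "norm (y - \<alpha> * x) \<le> 4" "norm (y' - \<alpha> * x') \<le> 4"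
    using norm_triangle_ineq4[of y "\<alpha> * x"] norm_triangle_ineq4[of y' "\<alpha> * x'"] x x' \<alpha>x[OF x(1)] \<alpha>x[OF x'(1)] by simp_all
  have "(y - \<alpha> * x) - (y' - \<alpha> * x') = (y - y') - \<alpha> * (x - x')" by (simp add: algebra_simps)
  then have "norm ((y - \<alpha> * x) - (y' - \<alpha> * x')) \<le> norm (y - y') + norm (\<alpha> * (x - x'))"
    by (simp only: norm_triangle_ineq4)
  then have Pd: "norm ((y - \<alpha> * x) - (y' - \<alpha> * x')) \<le> 2 * D"
    using D(2) \<alpha>x[OF D(1)] by linarith
  note I = inverse_1_plus[OF \<eta> x(1)] and i' = inverse_1_plus[OF \<eta> x'(1)]
  have "1 / (1 + \<eta> * x) - 1 / (1 + \<eta> * x') = \<eta> * (x' - x) * ((1 / (1 + \<eta> * x)) * (1 / (1 + \<eta> * x')))"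
    using I(2) i'(2) by (simp add: field_simps)
  then have "norm (1 / (1 + \<eta> * x) - 1 / (1 + \<eta> * x')) = norm \<eta> * norm (x' - x) * (norm (1 / (1 + \<eta> * x)) * norm (1 / (1 + \<eta> * x')))"
    by (simp only: norm_mult)
  also have "\<dots> \<le> (1/8 * D) * (2 * 2)"
    using \<eta> D(1) I(1) i'(1) order_trans[OF norm_ge_zero D(1)] by (intro mult_mono) (auto simp: norm_minus_commute)
  finally have Id: "norm (1 / (1 + \<eta> * x) - 1 / (1 + \<eta> * x')) \<le> D / 2" by simp
  have PI: "norm ((y - \<alpha> * x) * (1 / (1 + \<eta> * x))) \<le> 4 * 2" "norm ((y' - \<alpha> * x') * (1 / (1 + \<eta> * x'))) \<le> 4 * 2"
    unfolding norm_mult using P I(1) i'(1) by (intro mult_mono; simp)+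
  have PId: "norm ((y - \<alpha> * x) * (1 / (1 + \<eta> * x)) - (y' - \<alpha> * x') * (1 / (1 + \<eta> * x'))) \<le> 2 * D * 2 + 4 * (D / 2)"
    by (rule norm_mult_diff_le[OF Pd I(1) P(2) Id])
  have Q: "norm (g - x) \<le> 3" using norm_triangle_ineq4[of g x] x by simp
  have Qd: "norm ((g - x) - (g' - x')) \<le> \<delta> + D"
    using norm_triangle_ineq4[of "g - g'" "x - x'"] D(1) \<delta> by (simp add: algebra_simps)
  show *: "norm ((y - \<alpha> * x) * (1 / (1 + \<eta> * x)) * (g - x)) \<le> 8 * norm (g - x)"
    unfolding norm_mult[of _ "g - x"] using PI(1) by (intro mult_right_mono) auto
  then show "norm ((y - \<alpha> * x) * (1 / (1 + \<eta> * x)) * (g - x)) \<le> 24" using Q by linarith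
  show "norm ((y - \<alpha> * x) * (1 / (1 + \<eta> * x)) * (g - x) - (y' - \<alpha> * x') * (1 / (1 + \<eta> * x')) * (g' - x')) \<le> 26 * D + 8 * \<delta>"
    using norm_mult_diff_le[OF PId Q PI(2) Qd] by simp
qed

lemma norm_cnj_quot: "norm (cnj A / A) \<le> 1" for A :: complex
  by (cases "A = 0") (simp_all add: norm_divide)

lemma admissible_quot:
  assumes "admissible f" "w \<in> circ" "t \<in> circ"
  shows "norm ((f t - f w) / (t - w)) \<le> 2" "norm (cnj (f t - f w) / (t - w)) \<le> 2"
proof -
  obtain a where "neg_series f (circle_deriv f) a" using assms by (auto simp: admissible_def)
  then interpret neg_series f "circle_deriv f" a .
  show 1: "norm ((f t - f w) / (t - w)) \<le> 2"
    using assms by (intro quotient_sup) (auto simp: admissible_def)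
  then show "norm (cnj (f t - f w) / (t - w)) \<le> 2" by (simp only: norm_divide complex_mod_cnj)
qed

lemma kernel1_bound:
  assumes "admissible f" "w \<in> circ" "t \<in> circ" "norm \<eta> \<le> 1/8"
  shows "norm (kernel1 \<eta> f w t) \<le> 8 * norm (circle_deriv f t - (f t - f w) / (t - w))" "norm (kernel1 \<eta> f w t) \<le> 24"
proof -
  have "norm (circle_deriv f t) \<le> 1" using assms by (simp add: admissible_def)
  note K = kernel_algebra(1,2)[OF admissible_quot[OF assms(1-3)] this norm_cnj_quot assms(4) admissible_quot[OF assms(1-3)] this order_refl
    order_trans[OF _ order_refl] order_refl]
  show "norm (kernel1 \<eta> f w t) \<le> 8 * norm (circle_deriv f t - (f t - f w) / (t - w))" "norm (kernel1 \<eta> f w t) \<le> 24"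
    unfolding kernel1_eq by (rule K; simp)+
qed

text \<open>At t = w the kernel tends to its value 0, since it is bounded by 8 |f'(t) - (f(t) -
  f(w)) / (t - w)|.\<close>

lemma kernel1_continuous:
  assumes f: "admissible f" and w: "w \<in> circ" and \<eta>: "norm \<eta> \<le> 1/8"
  shows "continuous_on circ (kernel1 \<eta> f w)"
  unfolding continuous_on_def
proof
  obtain a where "neg_series f (circle_deriv f) a" using f by (auto simp: admissible_def)
  then interpret neg_series f "circle_deriv f" a .
  fix t0 :: complex assume t0: "t0 \<in> circ"
  have cf: "(f \<longlongrightarrow> f t0) (at t0 within circ)" "(circle_deriv f \<longlongrightarrow> circle_deriv f t0) (at t0 within circ)"
    using admissible_cont[OF f] t0 by (auto simp: continuous_on_def)
  show "(kernel1 \<eta> f w \<longlongrightarrow> kernel1 \<eta> f w t0) (at t0 within circ)"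
  proof (cases "t0 = w")
    case True
    have q: "((\<lambda>t. (f t - f w) / (t - w)) \<longlongrightarrow> circle_deriv f w) (at w within circ)"
      using deriv[OF w] by (simp add: has_field_derivative_iff)
    have "((\<lambda>t. 8 * norm (circle_deriv f t - (f t - f w) / (t - w))) \<longlongrightarrow> 8 * norm (circle_deriv f w - circle_deriv f w)) (at w within circ)"
      using cf(2) unfolding True by (intro tendsto_intros q)
    then have "((\<lambda>t. 8 * norm (circle_deriv f t - (f t - f w) / (t - w))) \<longlongrightarrow> 0) (at w within circ)" by simp
    moreover have "\<forall>\<^sub>F t in at w within circ. norm (kernel1 \<eta> f w t) \<le> 8 * norm (circle_deriv f t - (f t - f w) / (t - w))"
      unfolding eventually_at_topological using kernel1_bound(1)[OF f w _ \<eta>] by blast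
    ultimately have "(kernel1 \<eta> f w \<longlongrightarrow> 0) (at w within circ)" by (rule Lim_null_comparison[rotated])
    then show ?thesis using True by (simp add: kernel1_def)
  next
    case False
    have "1 + \<eta> * ((f t0 - f w) / (t0 - w)) \<noteq> 0" by (rule inverse_1_plus(2)[OF \<eta> admissible_quot(1)[OF f w t0]])
    then show ?thesis
      unfolding kernel1_eq using False by (intro tendsto_intros cf) auto
  qed
qed

lemma circle_mean_diff:
  assumes "continuous_on circ g" "continuous_on circ h"
  shows "circle_mean g - circle_mean h = circle_mean (\<lambda>t. g t - h t)"
proof -
  have "g contour_integrable_on circlepath 0 1" "h contour_integrable_on circlepath 0 1"
    by (rule contour_integrable_continuous_circlepath, use assms in simp)+
  then show ?thesis by (simp add: circle_mean_def contour_integral_diff diff_divide_distrib)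
qed

lemma pi_bounds: "3 \<le> pi" "pi \<le> 4"
  using pi_approx by simp_all

text \<open>The difference quotient of f - h is dominated by the integrable \<open>sing\<close>
  times the L^2 distance, and f' - h' is integrated directly; hence no derivative is lost in spite
  of the singular kernel.\<close>

lemma kernel1_mean_diff:
  assumes f: "admissible f" and h: "admissible h" and w: "w \<in> circ" and \<eta>: "norm \<eta> \<le> 1/8"
  shows "norm (circle_mean (kernel1 \<eta> f w) - circle_mean (kernel1 \<eta> h w)) \<le> 108 * deriv_dist f h"
proof -
  obtain a where a: "neg_series (\<lambda>w. f w - h w) (deriv_diff f h) a" using admissible_diff[OF f h] by blast
  then interpret q: neg_series "\<lambda>w. f w - h w" "deriv_diff f h" a .
  note L0 = deriv_dist_nonneg[OF f h]
  obtain \<phi> where \<phi>: "\<phi> \<in> {0..2*pi}" "w = cis \<phi>" using circ_cis[OF w] .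
  obtain s where s: "(sing has_integral s) {0..2*pi}" "0 \<le> s" "s \<le> 12" using sing_integral .
  have c: "continuous_on {0..2*pi} (\<lambda>\<theta>. norm (deriv_diff f h (cis (\<phi> + \<theta>))))"
    by (intro continuous_intros continuous_on_compose2[OF q.cont']) auto
  define i where "i = integral {0..2*pi} (\<lambda>\<theta>. norm (deriv_diff f h (cis (\<phi> + \<theta>))))"
  have i: "((\<lambda>\<theta>. norm (deriv_diff f h (cis (\<phi> + \<theta>)))) has_integral i) {0..2*pi}"
    unfolding i_def by (intro integrable_integral integrable_continuous_real c)
  have i3: "i \<le> 3 * deriv_dist f h"
  proof -
    have "i \<le> sqrt (2 * pi) * deriv_dist f h"
      using l1_le_l2[OF q.cont' \<phi>(1), of 0 "2 * pi"] by (simp add: i_def deriv_dist_def)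
    also have "\<dots> \<le> 3 * deriv_dist f h" using L0 sqrt_2pi_le by (intro mult_right_mono) auto
    finally show ?thesis .
  qed
  have B: "((\<lambda>\<theta>. 26 * (2 * deriv_dist f h) * sing \<theta> + 8 * norm (deriv_diff f h (cis (\<phi> + \<theta>)))) has_integral
      (26 * (2 * deriv_dist f h) * s + 8 * i)) {0..2*pi}"
    by (intro has_integral_add has_integral_mult_right s i)
  have kd: "norm (kernel1 \<eta> f w t - kernel1 \<eta> h w t) \<le> 26 * norm ((f t - h t - (f w - h w)) / (t - w)) + 8 * norm (deriv_diff f h t)"
    if t: "t \<in> circ" for t
    unfolding kernel1_eq
  proof (rule kernel_algebra(3)[OF admissible_quot[OF f w t] _ norm_cnj_quot \<eta> admissible_quot[OF h w t]])
    show "norm (circle_deriv f t) \<le> 1" "norm (circle_deriv h t) \<le> 1" using f h t by (auto simp: admissible_def)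
    have "(f t - f w) / (t - w) - (h t - h w) / (t - w) = (f t - h t - (f w - h w)) / (t - w)"
      by (simp add: diff_divide_distrib)
    then show "norm ((f t - f w) / (t - w) - (h t - h w) / (t - w)) \<le> norm ((f t - h t - (f w - h w)) / (t - w))"
      by (simp only: order_refl)
    have "cnj (f t - f w) / (t - w) - cnj (h t - h w) / (t - w) = cnj (f t - h t - (f w - h w)) / (t - w)"
      by (simp add: diff_divide_distrib)
    then show "norm (cnj (f t - f w) / (t - w) - cnj (h t - h w) / (t - w)) \<le> norm ((f t - h t - (f w - h w)) / (t - w))"
      by (simp only: norm_divide complex_mod_cnj order_refl)
    show "norm (circle_deriv f t - circle_deriv h t) \<le> norm (deriv_diff f h t)" by (simp add: deriv_diff_def)
  qed
  have "norm (circle_mean (kernel1 \<eta> f w) - circle_mean (kernel1 \<eta> h w)) \<le> (26 * (2 * deriv_dist f h) * s + 8 * i) / (2 * pi)"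
    unfolding circle_mean_diff[OF kernel1_continuous[OF f w \<eta>] kernel1_continuous[OF h w \<eta>]]
  proof (rule norm_circle_mean_le_integral[OF _ \<phi>(1) B])
    show "continuous_on circ (\<lambda>t. kernel1 \<eta> f w t - kernel1 \<eta> h w t)"
      by (intro continuous_intros kernel1_continuous f h w \<eta>)
    fix \<theta> assume \<theta>: "\<theta> \<in> {0..2*pi}"
    have "cis (\<phi> + \<theta>) \<in> circ" by simp
    from kd[OF this] q.quotient_l2[OF \<phi>(1) \<theta>]
    show "norm (kernel1 \<eta> f w (cis (\<phi> + \<theta>)) - kernel1 \<eta> h w (cis (\<phi> + \<theta>)))
        \<le> 26 * (2 * deriv_dist f h) * sing \<theta> + 8 * norm (deriv_diff f h (cis (\<phi> + \<theta>)))"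
      by (simp add: \<phi>(2) deriv_dist_def)
  qed
  \<comment> \<open>648 = 26 * 2 * 12 + 8 * 3, with the integral of \<open>sing\<close> at most 12
    and the L^1 norm at most 3 times the L^2 norm; dividing by 2 pi >= 6 leaves 108.\<close>
  also have "\<dots> \<le> 648 * deriv_dist f h / (2 * pi)"
  proof (rule divide_right_mono)
    have "deriv_dist f h * s \<le> deriv_dist f h * 12" using L0 s by (intro mult_left_mono) auto
    then show "26 * (2 * deriv_dist f h) * s + 8 * i \<le> 648 * deriv_dist f h" using i3 by simp
  qed (use pi_bounds in auto)
  also have "\<dots> \<le> 648 * deriv_dist f h / 6" using L0 pi_bounds by (intro divide_left_mono) auto
  finally show ?thesis by simp
qed

lemma kernel1_mean_bound:
  assumes "admissible f" "w \<in> circ" "norm \<eta> \<le> 1/8"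
  shows "norm (circle_mean (kernel1 \<eta> f w)) \<le> 24"
  using assms by (intro norm_circle_mean_le kernel1_continuous kernel1_bound) auto

section \<open>The interaction kernel\<close>

definition den2 :: "real \<Rightarrow> real \<Rightarrow> real \<Rightarrow> real \<Rightarrow> (complex \<Rightarrow> complex) \<Rightarrow> (complex \<Rightarrow> complex) \<Rightarrow> complex \<Rightarrow> complex \<Rightarrow> complex" where
  "den2 d \<epsilon> bj bk fj fk w t = of_real \<epsilon> * (of_real bk * t + of_real bj * w)
      + of_real \<epsilon> ^ 2 * (of_real bk ^ 2 * fk t + of_real bj ^ 2 * fj w) - of_real d"
definition num2 :: "real \<Rightarrow> real \<Rightarrow> (complex \<Rightarrow> complex) \<Rightarrow> complex \<Rightarrow> complex" where
  "num2 \<epsilon> bk fk t = (cnj t + of_real \<epsilon> * of_real bk * cnj (fk t)) * (1 + of_real \<epsilon> * of_real bk * circle_deriv fk t)"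
definition kernel2 :: "real \<Rightarrow> real \<Rightarrow> real \<Rightarrow> real \<Rightarrow> (complex \<Rightarrow> complex) \<Rightarrow> (complex \<Rightarrow> complex) \<Rightarrow> complex \<Rightarrow> complex \<Rightarrow> complex" where
  "kernel2 d \<epsilon> bj bk fj fk w t = num2 \<epsilon> bk fk t / den2 d \<epsilon> bj bk fj fk w t"

text \<open>\<open>\<sigma>\<close> is the one small quantity: it dominates |epsilon| bj and
  |epsilon| bk, and \<open>\<sigma>\<close> <= d / 8 keeps the denominator away from 0.\<close>

context
  fixes d \<epsilon> bj bk \<sigma> :: real
  assumes d: "0 < d" and b: "0 < bj" "0 < bk" and \<sigma>: "\<sigma> = \<bar>\<epsilon>\<bar> * (bj + bk)" "\<sigma> \<le> 1/8" "\<sigma> \<le> d/8"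
begin

lemma eta_bounds: "norm (of_real \<epsilon> * of_real bj :: complex) \<le> \<sigma>" "norm (of_real \<epsilon> * of_real bk :: complex) \<le> \<sigma>" "0 \<le> \<sigma>"
  "norm (of_real \<epsilon> * of_real bj :: complex) + norm (of_real \<epsilon> * of_real bk :: complex) = \<sigma>"
  using b by (auto simp: \<sigma>(1) norm_mult distrib_left)

lemma den2_bounds:
  assumes "admissible fj" "admissible fk" "w \<in> circ" "t \<in> circ"
  shows "norm (den2 d \<epsilon> bj bk fj fk w t + of_real d) \<le> 2 * \<sigma>"
    "d / 2 \<le> norm (den2 d \<epsilon> bj bk fj fk w t)" "norm (den2 d \<epsilon> bj bk fj fk w t) \<le> 2 * d"
proof -
  define x y :: complex where "x = of_real \<epsilon> * of_real bk" and "y = of_real \<epsilon> * of_real bj"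
  have xy: "norm x \<le> \<sigma>" "norm y \<le> \<sigma>" "norm y + norm x = \<sigma>" using eta_bounds by (simp_all add: x_def y_def)
  have n: "norm (fk t) \<le> 1" "norm (fj w) \<le> 1" "norm t = 1" "norm w = 1" using assms by (auto simp: admissible_def)
  have e: "den2 d \<epsilon> bj bk fj fk w t + of_real d = x * (t + x * fk t) + y * (w + y * fj w)"
    by (simp add: den2_def x_def y_def algebra_simps power2_eq_square)
  have u: "norm (u + v * g) \<le> 2" if "norm u = 1" "norm v \<le> \<sigma>" "norm g \<le> 1" for u v g :: complex
  proof -
    have "norm v * norm g \<le> 1/8 * 1" using that \<sigma>(2) by (intro mult_mono) auto
    then show ?thesis using norm_triangle_ineq[of u "v * g"] that by (simp add: norm_mult)
  qed
  have "norm (x * (t + x * fk t) + y * (w + y * fj w)) \<le> norm x * 2 + norm y * 2"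
    by (rule order_trans[OF norm_triangle_ineq], unfold norm_mult)
       (intro add_mono mult_left_mono u n xy norm_ge_zero)
  also have "\<dots> = 2 * \<sigma>" using xy(3) by simp
  finally show 1: "norm (den2 d \<epsilon> bj bk fj fk w t + of_real d) \<le> 2 * \<sigma>" by (simp only: e)
  have nd: "norm (of_real d :: complex) = d" using d by simp
  show "d / 2 \<le> norm (den2 d \<epsilon> bj bk fj fk w t)"
    using norm_triangle_ineq4[of "den2 d \<epsilon> bj bk fj fk w t + of_real d" "den2 d \<epsilon> bj bk fj fk w t"] 1 \<sigma>(3) d nd by simp
  show "norm (den2 d \<epsilon> bj bk fj fk w t) \<le> 2 * d"
    using norm_triangle_ineq4[of "den2 d \<epsilon> bj bk fj fk w t + of_real d" "of_real d"] 1 \<sigma>(3) d nd by simp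
qed

lemma num2_bounds:
  assumes "admissible fk" "t \<in> circ"
  shows "norm (num2 \<epsilon> bk fk t - cnj t) \<le> 3 * \<sigma>" "norm (num2 \<epsilon> bk fk t) \<le> 2"
proof -
  define x :: complex where "x = of_real \<epsilon> * of_real bk"
  have x: "norm x \<le> \<sigma>" using eta_bounds by (simp add: x_def)
  have n: "norm (fk t) \<le> 1" "norm (circle_deriv fk t) \<le> 1" "norm t = 1" using assms by (auto simp: admissible_def)
  have "num2 \<epsilon> bk fk t - cnj t = x * cnj (fk t) + (cnj t + x * cnj (fk t)) * (x * circle_deriv fk t)"
    by (simp add: num2_def x_def algebra_simps)
  moreover have xf: "norm (x * g) \<le> \<sigma>" if "norm g \<le> 1" for g
    using mult_mono[OF x that] eta_bounds(3) by (simp add: norm_mult)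
  have "norm (cnj t + x * cnj (fk t)) \<le> 2"
    using norm_triangle_ineq[of "cnj t" "x * cnj (fk t)"] xf[of "cnj (fk t)"] n \<sigma>(2) by simp
  then have "norm ((cnj t + x * cnj (fk t)) * (x * circle_deriv fk t)) \<le> 2 * \<sigma>"
    unfolding norm_mult[of "cnj t + x * cnj (fk t)"] using xf[OF n(2)] by (intro mult_mono) auto
  ultimately show 1: "norm (num2 \<epsilon> bk fk t - cnj t) \<le> 3 * \<sigma>"
    using norm_triangle_ineq[of "x * cnj (fk t)" "(cnj t + x * cnj (fk t)) * (x * circle_deriv fk t)"]
      xf[of "cnj (fk t)"] n by simp
  show "norm (num2 \<epsilon> bk fk t) \<le> 2"
    using norm_triangle_ineq[of "num2 \<epsilon> bk fk t - cnj t" "cnj t"] 1 \<sigma>(2) n by simp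
qed

lemma kernel2_continuous:
  assumes "admissible fj" "admissible fk" "w \<in> circ"
  shows "continuous_on circ (kernel2 d \<epsilon> bj bk fj fk w)"
proof -
  have "den2 d \<epsilon> bj bk fj fk w t \<noteq> 0" if "t \<in> circ" for t
    using den2_bounds(2)[OF assms that] d by auto
  moreover have "continuous_on circ (den2 d \<epsilon> bj bk fj fk w)" "continuous_on circ (num2 \<epsilon> bk fk)"
    unfolding den2_def num2_def by (intro continuous_intros admissible_cont assms)+
  ultimately show ?thesis unfolding kernel2_def by (intro continuous_on_divide) auto
qed

lemma circle_mean_cnj: "circle_mean (\<lambda>t. c * cnj t) = c"
proof -
  have "circle_mean (\<lambda>t. c * cnj t) = circle_mean (\<lambda>t. c * t powi (- 1))"
    by (rule circle_mean_cong) (simp add: cnj_circ power_int_minus)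
  then show ?thesis using circle_mean_powi[of c "- 1"] by simp
qed

text \<open>At parameter 0 the kernel is - cnj t / d, with mean -1 / d. The constant is (3 \<sigma>
  d + 2 \<sigma>) / (d^2 / 2), from the deviations 3 \<sigma> of the numerator and 2 \<sigma> of the
  denominator.\<close>

lemma kernel2_mean:
  assumes "admissible fj" "admissible fk" "w \<in> circ"
  shows "norm (circle_mean (kernel2 d \<epsilon> bj bk fj fk w) + of_real (1 / d)) \<le> (6 / d + 4 / d\<^sup>2) * \<sigma>"
proof -
  have "circle_mean (kernel2 d \<epsilon> bj bk fj fk w) + of_real (1 / d)
      = circle_mean (\<lambda>t. kernel2 d \<epsilon> bj bk fj fk w t - (- of_real (1 / d)) * cnj t)"
  proof -
    have cc: "continuous_on circ (\<lambda>t. (- of_real (1 / d)) * cnj t)" by (intro continuous_intros)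
    show ?thesis
      unfolding circle_mean_diff[OF kernel2_continuous[OF assms] cc, symmetric] circle_mean_cnj by simp
  qed
  also have "norm \<dots> \<le> (6 / d + 4 / d\<^sup>2) * \<sigma>"
  proof (rule norm_circle_mean_le)
    show "continuous_on circ (\<lambda>t. kernel2 d \<epsilon> bj bk fj fk w t - (- of_real (1 / d)) * cnj t)"
      by (intro continuous_intros kernel2_continuous assms)
    show "0 \<le> (6 / d + 4 / d\<^sup>2) * \<sigma>" using d eta_bounds(3) by simp
    fix t :: complex assume t: "t \<in> circ"
    define N D where "N = num2 \<epsilon> bk fk t" and "D = den2 d \<epsilon> bj bk fj fk w t"
    have D: "norm (D + of_real d) \<le> 2 * \<sigma>" "d / 2 \<le> norm D" "D \<noteq> 0"
      using den2_bounds[OF assms t] d by (auto simp: D_def)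
    have N: "norm (N - cnj t) \<le> 3 * \<sigma>" using num2_bounds[OF assms(2) t] by (simp add: N_def)
    have "N / D - (- of_real (1 / d)) * cnj t = ((N - cnj t) * of_real d + cnj t * (D + of_real d)) / (of_real d * D)"
      using D d by (simp add: field_simps)
    also have "norm \<dots> \<le> (3 * \<sigma> * d + 1 * (2 * \<sigma>)) / (d * (d / 2))"
      unfolding norm_divide
    proof (rule frac_le)
      show "norm ((N - cnj t) * of_real d + cnj t * (D + of_real d)) \<le> 3 * \<sigma> * d + 1 * (2 * \<sigma>)"
        by (rule order_trans[OF norm_triangle_ineq], unfold norm_mult)
           (use N D d t eta_bounds(3) in \<open>intro add_mono mult_mono; simp\<close>)
      show "d * (d / 2) \<le> norm (of_real d * D)" unfolding norm_mult using D d by (intro mult_mono) auto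
    qed (use d eta_bounds(3) in auto)
    also have "\<dots> = (6 / d + 4 / d\<^sup>2) * \<sigma>" using d by (simp add: field_simps power2_eq_square)
    finally show "norm (kernel2 d \<epsilon> bj bk fj fk w t - (- of_real (1 / d)) * cnj t) \<le> (6 / d + 4 / d\<^sup>2) * \<sigma>"
      by (simp only: kernel2_def N_def D_def)
  qed
  finally show ?thesis .
qed

lemma sup_diff_le:
  assumes "admissible f" "admissible h" "t \<in> circ"
  shows "norm (f t - h t) \<le> 3 * deriv_dist f h"
proof -
  obtain a where "neg_series (\<lambda>w. f w - h w) (deriv_diff f h) a" using admissible_diff[OF assms(1,2)] by blast
  then interpret q: neg_series "\<lambda>w. f w - h w" "deriv_diff f h" a .
  show ?thesis using q.sup_le_l2[OF assms(3)] by (simp add: deriv_dist_def)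
qed

text \<open>The factor 3 lost in comparing L^1 with L^2 is recovered from the 1 / (2 pi) of the
  mean.\<close>

lemma mean_l1:
  assumes f: "admissible f" "admissible h" and B: "0 \<le> c" and g: "continuous_on circ g"
    and le: "\<And>t. t \<in> circ \<Longrightarrow> norm (g t) \<le> k + c * norm (deriv_diff f h t)"
  shows "norm (circle_mean g) \<le> k + c * deriv_dist f h"
proof -
  obtain a where "neg_series (\<lambda>w. f w - h w) (deriv_diff f h) a" using admissible_diff[OF f] by blast
  then interpret q: neg_series "\<lambda>w. f w - h w" "deriv_diff f h" a .
  obtain i where i: "((\<lambda>\<theta>. norm (deriv_diff f h (cis \<theta>))) has_integral i) {0..2*pi}" "0 \<le> i" "i \<le> 3 * deriv_dist f h"
    using l1_le[OF q.cont'] unfolding deriv_dist_def .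
  have k: "((\<lambda>\<theta>. k) has_integral k * (2 * pi)) {0..2*pi}"
    using has_integral_const_real[of k 0 "2 * pi"] by (simp add: mult.commute)
  have "norm (circle_mean g) \<le> (k * (2 * pi) + c * i) / (2 * pi)"
    by (rule norm_circle_mean_le_integral[OF g _ has_integral_add[OF k has_integral_mult_right[OF i(1)]], of 0])
       (use le in auto)
  also have "\<dots> = k + c * (i / (2 * pi))" using pi_bounds by (simp add: field_simps)
  also have "i / (2 * pi) \<le> i / 3" using i pi_bounds by (intro divide_left_mono) auto
  then have "c * (i / (2 * pi)) \<le> c * deriv_dist f h" using i B by (intro mult_left_mono) auto
  finally show ?thesis by simp
qed

text \<open>The difference of fk' is controlled only in L^2, so it stays pointwise until
  \<open>mean_l1\<close> integrates it; the differences of fj and fk are uniformly at most 3 times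
  the L^2 distances. 64 / d is 48 / d + 16 / d.\<close>

lemma kernel2_mean_diff:
  assumes f: "admissible fj" "admissible fk" and h: "admissible hj" "admissible hk" and w: "w \<in> circ"
  shows "norm (circle_mean (kernel2 d \<epsilon> bj bk fj fk w) - circle_mean (kernel2 d \<epsilon> bj bk hj hk w))
    \<le> \<sigma> * (64 / d + 24 / d\<^sup>2) * (deriv_dist fj hj + deriv_dist fk hk)"
proof -
  define Lj Lk where "Lj = deriv_dist fj hj" and "Lk = deriv_dist fk hk"
  have L: "0 \<le> Lj" "0 \<le> Lk" using deriv_dist_nonneg f h by (auto simp: Lj_def Lk_def)
  define x y :: complex where "x = of_real \<epsilon> * of_real bk" and "y = of_real \<epsilon> * of_real bj"
  have xy: "norm x \<le> \<sigma>" "norm y \<le> \<sigma>" "0 \<le> \<sigma>" using eta_bounds by (simp_all add: x_def y_def)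
  have xs: "norm (x * z) \<le> \<sigma> * c" "norm (y * z) \<le> \<sigma> * c" if "norm z \<le> c" for z c
    unfolding norm_mult using xy that by (auto intro!: mult_mono)
  have x1: "norm (x * z) \<le> 1" "norm (y * z) \<le> 1" if "norm z \<le> 1" for z
    using xs[OF that] \<sigma>(2) by linarith+
  have pt: "norm (kernel2 d \<epsilon> bj bk fj fk w t - kernel2 d \<epsilon> bj bk hj hk w t)
      \<le> \<sigma> * (48 / d * Lk + 24 / d\<^sup>2 * (Lj + Lk)) + \<sigma> * (16 / d) * norm (deriv_diff fk hk t)" if t: "t \<in> circ" for t
  proof -
    define g where "g = norm (deriv_diff fk hk t)"
    have n: "norm (fk t) \<le> 1" "norm (circle_deriv fk t) \<le> 1" "norm (hk t) \<le> 1" "norm t = 1"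
      using f h t by (auto simp: admissible_def)
    define N N' D D' where "N = num2 \<epsilon> bk fk t" and "N' = num2 \<epsilon> bk hk t"
      and "D = den2 d \<epsilon> bj bk fj fk w t" and "D' = den2 d \<epsilon> bj bk hj hk w t"
    have D: "d / 2 \<le> norm D" "d / 2 \<le> norm D'" "norm D' \<le> 2 * d" "D \<noteq> 0" "D' \<noteq> 0"
      using den2_bounds(2)[OF f w t] den2_bounds(2,3)[OF h w t] d by (auto simp: D_def D'_def)
    have "D - D' = x * (x * (fk t - hk t)) + y * (y * (fj w - hj w))"
      by (simp add: D_def D'_def den2_def x_def y_def algebra_simps power2_eq_square)
    moreover have "norm (x * (fk t - hk t)) \<le> 3 * Lk" "norm (y * (fj w - hj w)) \<le> 3 * Lj"
    proof -
      have "\<sigma> * (3 * Lk) \<le> 1 * (3 * Lk)" "\<sigma> * (3 * Lj) \<le> 1 * (3 * Lj)"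
        using L \<sigma>(2) by (intro mult_right_mono; simp)+
      then show "norm (x * (fk t - hk t)) \<le> 3 * Lk" "norm (y * (fj w - hj w)) \<le> 3 * Lj"
        using xs(1)[OF sup_diff_le[OF f(2) h(2) t]] xs(2)[OF sup_diff_le[OF f(1) h(1) w]] by (simp_all add: Lj_def Lk_def)
    qed
    ultimately have Dd: "norm (D - D') \<le> \<sigma> * (3 * Lk) + \<sigma> * (3 * Lj)"
      using norm_triangle_ineq[of "x * (x * (fk t - hk t))" "y * (y * (fj w - hj w))"] xs(1) xs(2)
      by (smt (verit, best))
    have "norm (N - N') \<le> (\<sigma> * (3 * Lk)) * 2 + 2 * (\<sigma> * g)"
      unfolding N_def N'_def num2_def x_def[symmetric]
    proof (rule norm_mult_diff_le)
      have "cnj t + x * cnj (fk t) - (cnj t + x * cnj (hk t)) = x * cnj (fk t - hk t)" by (simp add: algebra_simps)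
      then show "norm (cnj t + x * cnj (fk t) - (cnj t + x * cnj (hk t))) \<le> \<sigma> * (3 * Lk)"
        using xs(1)[of "cnj (fk t - hk t)" "3 * Lk"] sup_diff_le[OF f(2) h(2) t] by (simp only: complex_mod_cnj Lk_def)
      show "norm (1 + x * circle_deriv fk t) \<le> 2" using norm_triangle_ineq[of 1 "x * circle_deriv fk t"] x1(1)[OF n(2)] by simp
      show "norm (cnj t + x * cnj (hk t)) \<le> 2" using norm_triangle_ineq[of "cnj t" "x * cnj (hk t)"] x1(1)[of "cnj (hk t)"] n by simp
      have "1 + x * circle_deriv fk t - (1 + x * circle_deriv hk t) = x * deriv_diff fk hk t" by (simp add: deriv_diff_def algebra_simps)
      then show "norm (1 + x * circle_deriv fk t - (1 + x * circle_deriv hk t)) \<le> \<sigma> * g"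
        using xs(1)[of "deriv_diff fk hk t" g] by (simp add: g_def)
    qed
    then have Nd: "norm (N - N') \<le> \<sigma> * (6 * Lk + 2 * g)" by (simp add: algebra_simps)
    have N': "norm N' \<le> 2" using num2_bounds(2)[OF h(2) t] by (simp add: N'_def)
    have "N / D - N' / D' = ((N - N') * D' - N' * (D - D')) / (D * D')" using D by (simp add: field_simps)
    also have "norm \<dots> \<le> (\<sigma> * (6 * Lk + 2 * g) * (2 * d) + 2 * (\<sigma> * (3 * Lk) + \<sigma> * (3 * Lj))) / (d / 2 * (d / 2))"
      unfolding norm_divide
    proof (rule frac_le)
      have g0: "0 \<le> g" by (simp add: g_def)
      show "norm ((N - N') * D' - N' * (D - D')) \<le> \<sigma> * (6 * Lk + 2 * g) * (2 * d) + 2 * (\<sigma> * (3 * Lk) + \<sigma> * (3 * Lj))"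
        by (rule order_trans[OF norm_triangle_ineq4], unfold norm_mult)
           (use Nd D N' Dd xy(3) L g0 in \<open>intro add_mono mult_mono; simp\<close>)
      show "d / 2 * (d / 2) \<le> norm (D * D')" unfolding norm_mult using D d by (intro mult_mono) auto
      show "0 \<le> \<sigma> * (6 * Lk + 2 * g) * (2 * d) + 2 * (\<sigma> * (3 * Lk) + \<sigma> * (3 * Lj))"
        using xy(3) L g0 d by simp
    qed (use d in auto)
    also have "\<dots> = \<sigma> * (48 / d * Lk + 24 / d\<^sup>2 * (Lj + Lk)) + \<sigma> * (16 / d) * g"
      using d by (simp add: field_simps power2_eq_square)
    finally show ?thesis by (simp only: kernel2_def N_def D_def N'_def D'_def g_def)
  qed
  have "norm (circle_mean (kernel2 d \<epsilon> bj bk fj fk w) - circle_mean (kernel2 d \<epsilon> bj bk hj hk w))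
      \<le> \<sigma> * (48 / d * Lk + 24 / d\<^sup>2 * (Lj + Lk)) + \<sigma> * (16 / d) * Lk"
    unfolding circle_mean_diff[OF kernel2_continuous[OF f w] kernel2_continuous[OF h w]] Lk_def
    by (rule mean_l1[OF f(2) h(2)])
       (use pt xy d in \<open>auto intro!: continuous_intros kernel2_continuous f h w simp: Lk_def\<close>)
  also have "\<dots> \<le> \<sigma> * (64 / d + 24 / d\<^sup>2) * (Lj + Lk)"
  proof -
    define c c2 where "c = 1 / d" and "c2 = 1 / d\<^sup>2"
    have e: "48 / d = 48 * c" "64 / d = 64 * c" "16 / d = 16 * c" "24 / d\<^sup>2 = 24 * c2" by (simp_all add: c_def c2_def)
    have "0 \<le> \<sigma> * c * Lj" using xy(3) d L by (simp add: c_def)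
    then show ?thesis unfolding e by (simp add: algebra_simps)
  qed
  finally show ?thesis by (simp add: Lj_def Lk_def)
qed

end

(* What is left of F once (2 U - gk / d) w - gj f', its value at parameter 0, is removed. *)
definition remainder :: "real \<Rightarrow> real \<Rightarrow> real \<Rightarrow> real \<Rightarrow> real \<Rightarrow> real \<Rightarrow> real
    \<Rightarrow> (complex \<Rightarrow> complex) \<Rightarrow> (complex \<Rightarrow> complex) \<Rightarrow> complex \<Rightarrow> complex" where
  "remainder d \<epsilon> U bj bk gj gk fj fk w = (let \<eta> = of_real \<epsilon> * of_real bj in
     of_real U * (2 * w * (\<eta> * circle_deriv fj w))
     + of_real gj * (\<eta> * (w * ((1 + \<eta> * circle_deriv fj w) * circle_mean (kernel1 \<eta> fj w))))
     + of_real gk * (w * ((1 + \<eta> * circle_deriv fj w) * circle_mean (kernel2 d \<epsilon> bj bk fj fk w) + of_real (1 / d))))"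

lemma F_component_expand:
  "F_component d \<epsilon> U bj bk gj gk fj fk w =
     Im (of_real (2 * U - gk / d) * w - of_real gj * circle_deriv fj w + remainder d \<epsilon> U bj bk gj gk fj fk w)"
proof -
  define \<eta> :: complex where "\<eta> = of_real \<epsilon> * of_real bj"
  have 1: "circle_mean (\<lambda>t. let A = t - w; B = fj t - fj w in
             (A * cnj B - cnj A * B) / (A * (A + of_real \<epsilon> * of_real bj * B)) * (circle_deriv fj t - B / A))
      = circle_mean (kernel1 \<eta> fj w)"
    unfolding kernel1_def \<eta>_def by simp
  have 2: "circle_mean (\<lambda>t. (cnj t + of_real \<epsilon> * of_real bk * cnj (fk t)) * (1 + of_real \<epsilon> * of_real bk * circle_deriv fk t)
             / (of_real \<epsilon> * (of_real bk * t + of_real bj * w)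
                + of_real \<epsilon> ^ 2 * (of_real bk ^ 2 * fk t + of_real bj ^ 2 * fj w) - of_real d))
      = circle_mean (kernel2 d \<epsilon> bj bk fj fk w)"
    unfolding kernel2_def num2_def den2_def by simp
  define T M where "T = circle_mean (kernel1 \<eta> fj w)" and "M = circle_mean (kernel2 d \<epsilon> bj bk fj fk w)"
  show ?thesis
    unfolding F_component_def 1 2
    unfolding remainder_def Let_def \<eta>_def[symmetric] T_def[symmetric] M_def[symmetric]
    by (intro arg_cong[where f = Im]) (simp add: algebra_simps)
qed

lemma remainder_linear:
  "remainder d \<epsilon> U bj bk gj gk fj fk w - remainder d \<epsilon> U' bj bk gj' gk' fj fk w
    = remainder d \<epsilon> (U - U') bj bk (gj - gj') (gk - gk') fj fk w"
  unfolding remainder_def Let_def by (simp add: algebra_simps)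

text \<open>27 = (9/8) * 24 bounds the self-interaction term and exceeds the 2 of the U term; the
  other summands bound the interaction mean, by \<open>kernel2_mean\<close> and
  \<open>mean2_bound\<close>. In \<open>remainder_lip_const\<close>, 216 = 2 * 108 comes from
  \<open>kernel1_mean_diff\<close> and the last summand from
  \<open>kernel2_mean_diff\<close>.\<close>

definition remainder_const :: "real \<Rightarrow> real" where "remainder_const d = 27 + (6 / d + 4 / d\<^sup>2) + (7 / d + 4 / d\<^sup>2)"
definition remainder_lip_const :: "real \<Rightarrow> real" where "remainder_lip_const d = 216 + (7 / d + 4 / d\<^sup>2) + 2 * (64 / d + 24 / d\<^sup>2)"

lemma remainder_const_pos: "0 < d \<Longrightarrow> 0 < remainder_const d" "0 < d \<Longrightarrow> 0 < remainder_lip_const d"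
  by (simp_all add: remainder_const_def remainder_lip_const_def add_pos_pos)

context
  fixes d \<epsilon> bj bk \<sigma> :: real
  assumes d: "0 < d" and b: "0 < bj" "0 < bk" and \<sigma>: "\<sigma> = \<bar>\<epsilon>\<bar> * (bj + bk)" "\<sigma> \<le> 1/8" "\<sigma> \<le> d/8"
begin

lemma mean2_bound:
  assumes "admissible fj" "admissible fk" "w \<in> circ"
  shows "norm (circle_mean (kernel2 d \<epsilon> bj bk fj fk w)) \<le> 7 / d + 4 / d\<^sup>2"
proof -
  have "norm (circle_mean (kernel2 d \<epsilon> bj bk fj fk w))
      \<le> norm (circle_mean (kernel2 d \<epsilon> bj bk fj fk w) + of_real (1 / d)) + norm (of_real (1 / d) :: complex)"
    using norm_triangle_ineq4[of "circle_mean (kernel2 d \<epsilon> bj bk fj fk w) + of_real (1 / d)" "of_real (1 / d)"] by simp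
  also have "norm (of_real (1 / d) :: complex) = 1 / d" using d by (simp only: norm_of_real) simp
  also have "norm (circle_mean (kernel2 d \<epsilon> bj bk fj fk w) + of_real (1 / d)) \<le> (6 / d + 4 / d\<^sup>2) * \<sigma>"
    by (rule kernel2_mean[OF d b \<sigma> assms])
  also have "(6 / d + 4 / d\<^sup>2) * \<sigma> \<le> (6 / d + 4 / d\<^sup>2) * 1" using d \<sigma>(2) by (intro mult_left_mono) auto
  finally show ?thesis by simp
qed

lemma remainder_bound:
  assumes f: "admissible fj" "admissible fk" and w: "w \<in> circ"
  shows "norm (remainder d \<epsilon> U bj bk gj gk fj fk w) \<le> \<sigma> * remainder_const d * (\<bar>U\<bar> + \<bar>gj\<bar> + \<bar>gk\<bar>)"
proof -
  define \<eta> :: complex where "\<eta> = of_real \<epsilon> * of_real bj"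
  have \<eta>: "norm \<eta> \<le> \<sigma>" "0 \<le> \<sigma>" using eta_bounds[OF d b \<sigma>] by (simp_all add: \<eta>_def)
  have \<eta>8: "norm \<eta> \<le> 1/8" using \<eta> \<sigma>(2) by simp
  define g T M where "g = circle_deriv fj w" and "T = circle_mean (kernel1 \<eta> fj w)"
    and "M = circle_mean (kernel2 d \<epsilon> bj bk fj fk w)"
  have g: "norm g \<le> 1" "norm w = 1" using f w by (auto simp: admissible_def g_def)
  have \<eta>g: "norm (\<eta> * g) \<le> \<sigma>" using mult_mono[OF \<eta>(1) g(1)] \<eta>(2) by (simp add: norm_mult)
  have p: "norm (1 + \<eta> * g) \<le> 9/8" using norm_triangle_ineq[of 1 "\<eta> * g"] \<eta>g \<sigma>(2) by simp
  have T: "norm T \<le> 24" unfolding T_def by (rule kernel1_mean_bound[OF f(1) w \<eta>8])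
  have M: "norm M \<le> 7 / d + 4 / d\<^sup>2" "norm (M + of_real (1 / d)) \<le> (6 / d + 4 / d\<^sup>2) * \<sigma>"
    unfolding M_def by (rule mean2_bound[OF f w], rule kernel2_mean[OF d b \<sigma> f w])
  have 1: "norm (2 * w * (\<eta> * g)) \<le> 2 * \<sigma>" using \<eta>g g(2) by (simp add: norm_mult)
  have "norm ((1 + \<eta> * g) * T) \<le> 9/8 * 24" unfolding norm_mult using p T by (intro mult_mono) auto
  then have 2: "norm (\<eta> * (w * ((1 + \<eta> * g) * T))) \<le> \<sigma> * (1 * 27)"
    unfolding norm_mult[of \<eta>] norm_mult[of w] using \<eta> g(2) by (intro mult_mono) auto
  have e: "(1 + \<eta> * g) * M + of_real (1 / d) = (M + of_real (1 / d)) + \<eta> * g * M" by (simp add: algebra_simps)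
  have t: "norm (\<eta> * g * M) \<le> \<sigma> * (7 / d + 4 / d\<^sup>2)"
    unfolding norm_mult[of _ M] using \<eta>g M(1) \<eta>(2) by (intro mult_mono) auto
  have "norm ((1 + \<eta> * g) * M + of_real (1 / d)) \<le> (6 / d + 4 / d\<^sup>2) * \<sigma> + \<sigma> * (7 / d + 4 / d\<^sup>2)"
    unfolding e by (rule order_trans[OF norm_triangle_ineq add_mono[OF M(2) t]])
  then have 3: "norm (w * ((1 + \<eta> * g) * M + of_real (1 / d))) \<le> \<sigma> * ((6 / d + 4 / d\<^sup>2) + (7 / d + 4 / d\<^sup>2))"
    unfolding norm_mult[of w] g(2) by (simp only: mult_1 mult.commute[of _ \<sigma>] distrib_left[of \<sigma> "6 / d + 4 / d\<^sup>2"])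
  have C: "2 \<le> remainder_const d" "27 \<le> remainder_const d" "(6 / d + 4 / d\<^sup>2) + (7 / d + 4 / d\<^sup>2) \<le> remainder_const d"
    using d by (simp_all add: remainder_const_def)
  have s: "\<sigma> * x \<le> \<sigma> * remainder_const d" if "x \<le> remainder_const d" for x using that \<eta>(2) by (intro mult_left_mono)
  have "norm (remainder d \<epsilon> U bj bk gj gk fj fk w) \<le> \<bar>U\<bar> * (\<sigma> * remainder_const d) + \<bar>gj\<bar> * (\<sigma> * remainder_const d) + \<bar>gk\<bar> * (\<sigma> * remainder_const d)"
    unfolding remainder_def Let_def \<eta>_def[symmetric] g_def[symmetric] T_def[symmetric] M_def[symmetric]
    by (intro order_trans[OF norm_triangle_ineq] add_mono)
       (unfold norm_mult[of "of_real _"] norm_of_real,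
        use 1 2 3 s[OF C(1)] s[OF C(2)] s[OF C(3)] in \<open>auto intro!: mult_left_mono\<close>)
  then show ?thesis by (simp add: algebra_simps)
qed

lemma remainder_diff:
  assumes f: "admissible fj" "admissible fk" and h: "admissible hj" "admissible hk" and w: "w \<in> circ"
  shows "norm (remainder d \<epsilon> U bj bk gj gk fj fk w - remainder d \<epsilon> U bj bk gj gk hj hk w)
    \<le> \<sigma> * remainder_lip_const d * (\<bar>U\<bar> + \<bar>gj\<bar> + \<bar>gk\<bar>) * (norm (deriv_diff fj hj w) + (deriv_dist fj hj + deriv_dist fk hk))"
proof -
  define \<eta> :: complex where "\<eta> = of_real \<epsilon> * of_real bj"
  have \<eta>: "norm \<eta> \<le> \<sigma>" "0 \<le> \<sigma>" using eta_bounds[OF d b \<sigma>] by (simp_all add: \<eta>_def)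
  have \<eta>8: "norm \<eta> \<le> 1/8" using \<eta> \<sigma>(2) by simp
  define L where "L = deriv_dist fj hj + deriv_dist fk hk"
  have L: "0 \<le> deriv_dist fj hj" "0 \<le> deriv_dist fk hk" "0 \<le> L" using deriv_dist_nonneg f h by (auto simp: L_def)
  define g T M where "g = circle_deriv fj w" and "T = circle_mean (kernel1 \<eta> fj w)"
    and "M = circle_mean (kernel2 d \<epsilon> bj bk fj fk w)"
  define g' T' M' where "g' = circle_deriv hj w" and "T' = circle_mean (kernel1 \<eta> hj w)"
    and "M' = circle_mean (kernel2 d \<epsilon> bj bk hj hk w)"
  define x where "x = norm (deriv_diff fj hj w)"
  have x0: "0 \<le> x" by (simp add: x_def)
  have g: "norm g' \<le> 1" "norm w = 1" using h w by (auto simp: admissible_def g'_def)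
  have gg: "norm (g - g') = x" by (simp add: g_def g'_def x_def deriv_diff_def)
  have \<eta>gg: "norm (\<eta> * g - \<eta> * g') \<le> \<sigma> * x"
    unfolding right_diff_distrib[symmetric] norm_mult gg using \<eta> x0 by (intro mult_right_mono)
  have "norm (\<eta> * g') \<le> \<sigma>" using mult_mono[OF \<eta>(1) g(1)] \<eta>(2) by (simp add: norm_mult)
  then have p: "norm (1 + \<eta> * g') \<le> 2" using norm_triangle_ineq[of 1 "\<eta> * g'"] \<sigma>(2) by simp
  have pp: "norm (1 + \<eta> * g - (1 + \<eta> * g')) \<le> \<sigma> * x" using \<eta>gg by simp
  have T: "norm T \<le> 24" "norm (T - T') \<le> 108 * deriv_dist fj hj"
    unfolding T_def T'_def by (rule kernel1_mean_bound[OF f(1) w \<eta>8], rule kernel1_mean_diff[OF f(1) h(1) w \<eta>8])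
  have M: "norm M \<le> 7 / d + 4 / d\<^sup>2" "norm (M - M') \<le> \<sigma> * (64 / d + 24 / d\<^sup>2) * L"
    unfolding M_def M'_def L_def by (rule mean2_bound[OF f w], rule kernel2_mean_diff[OF d b \<sigma> f h w])
  have e1: "norm (2 * w * (\<eta> * g) - 2 * w * (\<eta> * g')) \<le> 2 * (\<sigma> * x)"
    unfolding right_diff_distrib[symmetric, of "2 * w"] norm_mult[of "2 * w"] using \<eta>gg g(2) by (simp add: norm_mult)
  have "norm ((1 + \<eta> * g) * T - (1 + \<eta> * g') * T') \<le> \<sigma> * x * 24 + 2 * (108 * deriv_dist fj hj)"
    by (rule norm_mult_diff_le[OF pp T(1) p T(2)])
  also have "\<sigma> * x \<le> 1 * x" using \<sigma>(2) x0 by (intro mult_right_mono) auto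
  finally have "norm ((1 + \<eta> * g) * T - (1 + \<eta> * g') * T') \<le> 216 * (x + L)" using L x0 by (simp add: L_def)
  then have e2: "norm (\<eta> * (w * ((1 + \<eta> * g) * T)) - \<eta> * (w * ((1 + \<eta> * g') * T'))) \<le> \<sigma> * (1 * (216 * (x + L)))"
    unfolding right_diff_distrib[symmetric, of \<eta>] right_diff_distrib[symmetric, of w] norm_mult[of \<eta>] norm_mult[of w]
    using \<eta> g(2) by (intro mult_mono) auto
  have "norm ((1 + \<eta> * g) * M - (1 + \<eta> * g') * M') \<le> \<sigma> * x * (7 / d + 4 / d\<^sup>2) + 2 * (\<sigma> * (64 / d + 24 / d\<^sup>2) * L)"
    by (rule norm_mult_diff_le[OF pp M(1) p M(2)])
  also have "\<dots> = \<sigma> * ((7 / d + 4 / d\<^sup>2) * x + 2 * (64 / d + 24 / d\<^sup>2) * L)" by (simp only: distrib_left mult_ac)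
  also have "\<dots> \<le> \<sigma> * (remainder_lip_const d * (x + L))"
  proof (intro mult_left_mono \<eta>(2))
    have p: "0 < 7 / d + 4 / d\<^sup>2" "0 < 2 * (64 / d + 24 / d\<^sup>2)" using d by (simp_all add: add_pos_pos)
    have c: "7 / d + 4 / d\<^sup>2 \<le> remainder_lip_const d" "2 * (64 / d + 24 / d\<^sup>2) \<le> remainder_lip_const d"
      unfolding atomize_conj remainder_lip_const_def using p by (intro conjI; linarith)
    have "(7 / d + 4 / d\<^sup>2) * x \<le> remainder_lip_const d * x" "2 * (64 / d + 24 / d\<^sup>2) * L \<le> remainder_lip_const d * L"
      using x0 L(3) c by (intro mult_right_mono; simp)+
    then show "(7 / d + 4 / d\<^sup>2) * x + 2 * (64 / d + 24 / d\<^sup>2) * L \<le> remainder_lip_const d * (x + L)" by (simp add: distrib_left)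
  qed
  finally have e3: "norm (w * ((1 + \<eta> * g) * M + of_real (1 / d)) - w * ((1 + \<eta> * g') * M' + of_real (1 / d))) \<le> \<sigma> * (remainder_lip_const d * (x + L))"
    unfolding right_diff_distrib[symmetric, of w] norm_mult[of w] using g(2) by simp
  have xL: "2 * (\<sigma> * x) \<le> \<sigma> * (remainder_lip_const d * (x + L))" "\<sigma> * (1 * (216 * (x + L))) \<le> \<sigma> * (remainder_lip_const d * (x + L))"
  proof -
    have c: "2 \<le> remainder_lip_const d" "216 \<le> remainder_lip_const d" using d by (simp_all add: remainder_lip_const_def)
    have "2 * x \<le> remainder_lip_const d * (x + L)" using c x0 L(3) by (intro mult_mono) auto
    from mult_left_mono[OF this \<eta>(2)] show "2 * (\<sigma> * x) \<le> \<sigma> * (remainder_lip_const d * (x + L))" by simp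
    show "\<sigma> * (1 * (216 * (x + L))) \<le> \<sigma> * (remainder_lip_const d * (x + L))"
    proof (rule mult_left_mono[OF _ \<eta>(2)])
      show "1 * (216 * (x + L)) \<le> remainder_lip_const d * (x + L)" unfolding mult_1 using c(2) x0 L(3) by (intro mult_right_mono) auto
    qed
  qed
  have eq: "remainder d \<epsilon> U bj bk gj gk fj fk w - remainder d \<epsilon> U bj bk gj gk hj hk w
      = of_real U * (2 * w * (\<eta> * g) - 2 * w * (\<eta> * g'))
      + of_real gj * (\<eta> * (w * ((1 + \<eta> * g) * T)) - \<eta> * (w * ((1 + \<eta> * g') * T')))
      + of_real gk * (w * ((1 + \<eta> * g) * M + of_real (1 / d)) - w * ((1 + \<eta> * g') * M' + of_real (1 / d)))"
    unfolding remainder_def Let_def \<eta>_def[symmetric] g_def[symmetric] T_def[symmetric] M_def[symmetric]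
      g'_def[symmetric] T'_def[symmetric] M'_def[symmetric]
    by (simp only: right_diff_distrib) simp
  have "norm (remainder d \<epsilon> U bj bk gj gk fj fk w - remainder d \<epsilon> U bj bk gj gk hj hk w)
      \<le> \<bar>U\<bar> * (\<sigma> * (remainder_lip_const d * (x + L))) + \<bar>gj\<bar> * (\<sigma> * (remainder_lip_const d * (x + L))) + \<bar>gk\<bar> * (\<sigma> * (remainder_lip_const d * (x + L)))"
    unfolding eq
    by (intro order_trans[OF norm_triangle_ineq] add_mono)
       (unfold norm_mult[of "of_real _"] norm_of_real,
        use order_trans[OF e1 xL(1)] order_trans[OF e2 xL(2)] e3 in \<open>auto intro!: mult_left_mono\<close>)
  then show ?thesis by (simp add: x_def L_def algebra_simps)
qed

end

section \<open>Projection onto the first mode, and the L^2 estimate\<close>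

lemma sin_square_integral: "((\<lambda>\<theta>. sin \<theta> * sin \<theta>) has_integral pi) {0..2*pi}"
proof -
  have "((\<lambda>\<theta>. sin \<theta> * sin \<theta>) has_integral ((2*pi) - sin (2*pi) * cos (2*pi)) / 2 - (0 - sin 0 * cos 0) / 2) {0..2*pi}"
  proof (rule fundamental_theorem_of_calculus)
    fix x :: real
    have "((\<lambda>x. (x - sin x * cos x) / 2) has_real_derivative sin x * sin x) (at x within {0..2*pi})"
    proof -
      have "sin x * sin x = (1 - (cos x * cos x + sin x * (- sin x))) / 2"
        using sin_cos_squared_add3[of x] by (simp add: algebra_simps)
      then show ?thesis by (auto intro!: derivative_eq_intros)
    qed
    then show "((\<lambda>x. (x - sin x * cos x) / 2) has_vector_derivative sin x * sin x) (at x within {0..2*pi})"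
      by (simp add: has_real_derivative_iff_has_vector_derivative)
  qed simp
  then show ?thesis by simp
qed

text \<open>Integrating against sin removes G and leaves c pi.\<close>

lemma mode_bound:
  assumes G: "((\<lambda>\<theta>. Im (G (cis \<theta>)) * sin \<theta>) has_integral 0) {0..2*pi}"
    and \<beta>: "(\<beta> has_integral I) {0..2*pi}"
    and le: "\<And>\<theta>. \<bar>Im (of_real c * cis \<theta> - G (cis \<theta>))\<bar> \<le> \<beta> \<theta>"
  shows "\<bar>c\<bar> * pi \<le> I"
proof -
  have "((\<lambda>\<theta>. c * (sin \<theta> * sin \<theta>) - Im (G (cis \<theta>)) * sin \<theta>) has_integral c * pi - 0) {0..2*pi}"
    by (intro has_integral_diff has_integral_mult_right sin_square_integral G)
  moreover have "c * (sin \<theta> * sin \<theta>) - Im (G (cis \<theta>)) * sin \<theta> = Im (of_real c * cis \<theta> - G (cis \<theta>)) * sin \<theta>" for \<theta>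
    by (simp add: algebra_simps)
  ultimately have I: "((\<lambda>\<theta>. Im (of_real c * cis \<theta> - G (cis \<theta>)) * sin \<theta>) has_integral c * pi) {0..2*pi}" by simp
  have "norm (integral {0..2*pi} (\<lambda>\<theta>. Im (of_real c * cis \<theta> - G (cis \<theta>)) * sin \<theta>)) \<le> integral {0..2*pi} \<beta>"
  proof (rule integral_norm_bound_integral[OF has_integral_integrable[OF I] has_integral_integrable[OF \<beta>]])
    fix \<theta>
    have "\<bar>Im (of_real c * cis \<theta> - G (cis \<theta>))\<bar> * \<bar>sin \<theta>\<bar> \<le> \<beta> \<theta> * 1"
      using le[of \<theta>] order_trans[OF abs_ge_zero le[of \<theta>]] by (intro mult_mono) auto
    then show "norm (Im (of_real c * cis \<theta> - G (cis \<theta>)) * sin \<theta>) \<le> \<beta> \<theta>" by (simp only: real_norm_def abs_mult mult_1_right)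
  qed
  then show ?thesis using integral_unique[OF I] integral_unique[OF \<beta>] by (simp add: abs_mult)
qed

lemma admissible_Im_sin:
  assumes "admissible f"
  shows "((\<lambda>\<theta>. Im (circle_deriv f (cis \<theta>)) * sin \<theta>) has_integral 0) {0..2*pi}"
  using assms neg_series.Im_deriv_sin unfolding admissible_def by blast

lemma admissible_diff_facts:
  assumes "admissible f" "admissible h"
  shows "((\<lambda>\<theta>. Im (deriv_diff f h (cis \<theta>)) * sin \<theta>) has_integral 0) {0..2*pi}"
    "((\<lambda>\<theta>. (Im (deriv_diff f h (cis \<theta>)))\<^sup>2) has_integral (deriv_dist f h)\<^sup>2 / 2) {0..2*pi}"
    "((\<lambda>\<theta>. (norm (deriv_diff f h (cis \<theta>)))\<^sup>2) has_integral (deriv_dist f h)\<^sup>2) {0..2*pi}"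
proof -
  obtain a where "neg_series (\<lambda>w. f w - h w) (deriv_diff f h) a" using admissible_diff[OF assms] by blast
  then interpret q: neg_series "\<lambda>w. f w - h w" "deriv_diff f h" a .
  have "(deriv_dist f h)\<^sup>2 = l2sq (deriv_diff f h)" using l2sq_integrable(2)[OF q.cont'] by (simp add: deriv_dist_def)
  then show "((\<lambda>\<theta>. (Im (deriv_diff f h (cis \<theta>)))\<^sup>2) has_integral (deriv_dist f h)\<^sup>2 / 2) {0..2*pi}"
    "((\<lambda>\<theta>. (norm (deriv_diff f h (cis \<theta>)))\<^sup>2) has_integral (deriv_dist f h)\<^sup>2) {0..2*pi}"
    using q.Im_deriv_l2 l2sq_integrable(1)[OF q.cont'] by simp_all
  show "((\<lambda>\<theta>. Im (deriv_diff f h (cis \<theta>)) * sin \<theta>) has_integral 0) {0..2*pi}" by (rule q.Im_deriv_sin)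
qed

lemma const_integral: "((\<lambda>\<theta>. k) has_integral k * (2 * pi)) {0..2*pi}" for k :: real
  using has_integral_const_real[of k 0 "2 * pi"] by (simp add: mult.commute)

lemma admissible_l1:
  assumes "admissible f" "admissible h"
  obtains i where "((\<lambda>\<theta>. norm (deriv_diff f h (cis \<theta>))) has_integral i) {0..2*pi}" "0 \<le> i" "i \<le> 3 * deriv_dist f h"
proof -
  obtain a where "neg_series (\<lambda>w. f w - h w) (deriv_diff f h) a" using admissible_diff[OF assms] by blast
  then interpret q: neg_series "\<lambda>w. f w - h w" "deriv_diff f h" a .
  show thesis using l1_le[OF q.cont'] that unfolding deriv_dist_def by metis
qed

text \<open>The L^1 norm of the derivative difference is at most 3 N <= pi N, so after division by
  pi it contributes K N, next to 2 K N and 2 M from the constants.\<close>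

lemma first_mode_estimate:
  assumes f: "admissible f" and h: "admissible h" and K: "0 \<le> K" "0 \<le> N" "0 \<le> M" "deriv_dist f h \<le> N"
    and G: "((\<lambda>\<theta>. Im (G (cis \<theta>)) * sin \<theta>) has_integral 0) {0..2*pi}"
    and le: "\<And>w. w \<in> circ \<Longrightarrow> \<bar>Im (of_real c * w - G w)\<bar> \<le> K * (norm (deriv_diff f h w) + N) + M"
  shows "\<bar>c\<bar> \<le> 3 * K * N + 2 * M"
proof -
  obtain i where i: "((\<lambda>\<theta>. norm (deriv_diff f h (cis \<theta>))) has_integral i) {0..2*pi}" "0 \<le> i" "i \<le> 3 * deriv_dist f h"
    using admissible_l1[OF f h] .
  have "\<bar>c\<bar> * pi \<le> K * (i + N * (2 * pi)) + M * (2 * pi)"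
    by (rule mode_bound[OF G, of "\<lambda>\<theta>. K * (norm (deriv_diff f h (cis \<theta>)) + N) + M"])
       (intro has_integral_add has_integral_mult_right i const_integral, rule le, simp)
  also have "\<dots> \<le> K * (pi * N + N * (2 * pi)) + M * (2 * pi)"
  proof (intro add_right_mono mult_left_mono K)
    have "3 * N \<le> pi * N" using pi_bounds K by (intro mult_right_mono) auto
    then show "i \<le> pi * N" using i(3) K(4) by linarith
  qed
  also have "\<dots> = (3 * K * N + 2 * M) * pi" by (simp add: algebra_simps)
  finally show ?thesis using pi_gt_zero by simp
qed

text \<open>The pointwise bound is squared and integrated. On the left the imaginary part carries
  half of the squared distance; this gives dist^2 / 8 <= 18 K^2 N^2, where 18 = 2 + 16 and 4 pi <=
  16, and 144 = 12^2.\<close>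

lemma deriv_dist_estimate:
  assumes f: "admissible f" and h: "admissible h" and K: "0 \<le> K" "deriv_dist f h \<le> N" and g: "1 / 2 \<le> g"
    and le: "\<And>w. w \<in> circ \<Longrightarrow> \<bar>g * Im (deriv_diff f h w)\<bar> \<le> K * (norm (deriv_diff f h w) + N)"
  shows "deriv_dist f h \<le> 12 * K * N"
proof -
  note F = admissible_diff_facts[OF f h]
  have L: "0 \<le> deriv_dist f h" by (rule deriv_dist_nonneg[OF f h])
  have pt: "(1/4) * (Im (deriv_diff f h w))\<^sup>2 \<le> K\<^sup>2 * (2 * (norm (deriv_diff f h w))\<^sup>2 + 2 * N\<^sup>2)" if "w \<in> circ" for w
  proof -
    have "1 / 2 * \<bar>Im (deriv_diff f h w)\<bar> \<le> \<bar>g * Im (deriv_diff f h w)\<bar>"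
      unfolding abs_mult using g by (intro mult_right_mono) auto
    then have "1 / 2 * \<bar>Im (deriv_diff f h w)\<bar> \<le> K * (norm (deriv_diff f h w) + N)" using le[OF that] by linarith
    then have "(1 / 2 * \<bar>Im (deriv_diff f h w)\<bar>)\<^sup>2 \<le> (K * (norm (deriv_diff f h w) + N))\<^sup>2" by (intro power_mono) auto
    also have "\<dots> = K\<^sup>2 * (norm (deriv_diff f h w) + N)\<^sup>2" by (simp add: power_mult_distrib)
    also have "(norm (deriv_diff f h w) + N)\<^sup>2 \<le> 2 * (norm (deriv_diff f h w))\<^sup>2 + 2 * N\<^sup>2"
      using sum_squares_bound[of "norm (deriv_diff f h w)" N] by (simp add: power2_eq_square algebra_simps)
    finally show ?thesis by (simp add: power_mult_distrib power_divide mult_left_mono)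
  qed
  have "((\<lambda>\<theta>. (1/4) * (Im (deriv_diff f h (cis \<theta>)))\<^sup>2) has_integral (1/4) * ((deriv_dist f h)\<^sup>2 / 2)) {0..2*pi}"
    by (intro has_integral_mult_right F)
  moreover have "((\<lambda>\<theta>. K\<^sup>2 * (2 * (norm (deriv_diff f h (cis \<theta>)))\<^sup>2 + 2 * N\<^sup>2)) has_integral
     K\<^sup>2 * (2 * (deriv_dist f h)\<^sup>2 + 2 * N\<^sup>2 * (2 * pi))) {0..2*pi}"
    by (intro has_integral_mult_right has_integral_add F const_integral)
  ultimately have "(1/4) * ((deriv_dist f h)\<^sup>2 / 2) \<le> K\<^sup>2 * (2 * (deriv_dist f h)\<^sup>2 + 2 * N\<^sup>2 * (2 * pi))"
    by (rule has_integral_le) (rule pt, simp)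
  also have "\<dots> \<le> K\<^sup>2 * (2 * N\<^sup>2 + 16 * N\<^sup>2)"
  proof (intro mult_left_mono add_mono)
    show "(deriv_dist f h)\<^sup>2 \<le> N\<^sup>2" using L K by (intro power_mono)
    have "2 * N\<^sup>2 * (2 * pi) \<le> 2 * N\<^sup>2 * 8" using pi_bounds by (intro mult_left_mono) auto
    then show "2 * N\<^sup>2 * (2 * pi) \<le> 16 * N\<^sup>2" by simp
  qed auto
  finally have "(deriv_dist f h)\<^sup>2 \<le> (12 * K * N)\<^sup>2" by (simp add: power_mult_distrib)
  then show ?thesis by (rule power2_le_imp_le) (use K L in auto)
qed

subsection \<open>Uniqueness for a fixed parameter\<close>

context
  fixes d \<epsilon> bj bk \<sigma> :: real
  assumes d: "0 < d" and b: "0 < bj" "0 < bk" and \<sigma>: "\<sigma> = \<bar>\<epsilon>\<bar> * (bj + bk)" "\<sigma> \<le> 1/8" "\<sigma> \<le> d/8"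
begin

text \<open>Testing the equation with sin removes gj fj', which starts at mode 2, so 2 U - gk / d is
  left against the remainder alone.\<close>

lemma first_mode_bound:
  assumes f: "admissible fj" "admissible fk"
    and F: "\<And>w. w \<in> circ \<Longrightarrow> F_component d \<epsilon> U bj bk gj gk fj fk w = 0"
  shows "\<bar>2 * U - gk / d\<bar> \<le> 2 * (\<sigma> * remainder_const d * (\<bar>U\<bar> + \<bar>gj\<bar> + \<bar>gk\<bar>))"
proof -
  define B where "B = \<sigma> * remainder_const d * (\<bar>U\<bar> + \<bar>gj\<bar> + \<bar>gk\<bar>)"
  have "\<bar>2 * U - gk / d\<bar> * pi \<le> B * (2 * pi)"
  proof (rule mode_bound[where G = "\<lambda>w. of_real gj * circle_deriv fj w" and \<beta> = "\<lambda>_. B"])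
    show "((\<lambda>\<theta>. Im (of_real gj * circle_deriv fj (cis \<theta>)) * sin \<theta>) has_integral 0) {0..2 * pi}"
      using has_integral_mult_right[OF admissible_Im_sin[OF f(1)], of gj] by (simp add: mult.assoc)
    show "((\<lambda>_. B) has_integral B * (2 * pi)) {0..2 * pi}" by (rule const_integral)
    fix \<theta>
    have w: "cis \<theta> \<in> circ" by simp
    have "Im (of_real (2 * U - gk / d) * cis \<theta> - of_real gj * circle_deriv fj (cis \<theta>))
        = - Im (remainder d \<epsilon> U bj bk gj gk fj fk (cis \<theta>))"
      using F[OF w] unfolding F_component_expand by simp
    then show "\<bar>Im (of_real (2 * U - gk / d) * cis \<theta> - of_real gj * circle_deriv fj (cis \<theta>))\<bar> \<le> B"
      using order_trans[OF abs_Im_le_cmod remainder_bound[OF d b \<sigma> f w]] by (simp add: B_def)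
  qed
  then have "\<bar>2 * U - gk / d\<bar> * pi \<le> (2 * B) * pi" by (simp only: mult_ac)
  then show ?thesis using pi_gt_zero by (simp only: mult_le_cancel_right_pos B_def)
qed

text \<open>The remainders are compared in two stages: \<open>P\<close> measures the change of the
  functions at fixed constants, \<open>Q\<close> the change of the constants at fixed functions. The
  first mode bounds the coefficient of w; inserting that bound back yields the pointwise bound on Im
  (fj' - hj').\<close>

lemma mode_difference:
  assumes f: "admissible fj" "admissible fk" and h: "admissible hj" "admissible hk"
    and F: "\<And>w. w \<in> circ \<Longrightarrow> F_component d \<epsilon> U bj bk gj gk fj fk w = 0"
    and H: "\<And>w. w \<in> circ \<Longrightarrow> F_component d \<epsilon> V bj bk kj kk hj hk w = 0"
    and P: "P = \<sigma> * remainder_lip_const d * (\<bar>U\<bar> + \<bar>gj\<bar> + \<bar>gk\<bar>)"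
    and Q: "Q = \<sigma> * remainder_const d * (\<bar>U - V\<bar> + \<bar>gj - kj\<bar> + \<bar>gk - kk\<bar>)"
    and L: "L = deriv_dist fj hj + deriv_dist fk hk"
  shows "\<bar>2 * (U - V) - (gk - kk) / d\<bar> \<le> 3 * P * L + 2 * Q"
    and "\<And>w. w \<in> circ \<Longrightarrow>
      \<bar>gj * Im (deriv_diff fj hj w)\<bar> \<le> P * (norm (deriv_diff fj hj w) + L) + 3 * P * L + 3 * Q + \<bar>gj - kj\<bar>"
proof -
  define c where "c = 2 * (U - V) - (gk - kk) / d"
  define G where "G w = of_real gj * deriv_diff fj hj w + of_real (gj - kj) * circle_deriv hj w" for w
  have \<sigma>0: "0 \<le> \<sigma>" using \<sigma>(1) b by simp
  have PQ: "0 \<le> P" "0 \<le> Q" using \<sigma>0 remainder_const_pos[OF d] by (simp_all add: P Q)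
  have L0: "0 \<le> L" "deriv_dist fj hj \<le> L" using deriv_dist_nonneg f h by (auto simp: L)
  have le: "\<bar>Im (of_real c * w - G w)\<bar> \<le> P * (norm (deriv_diff fj hj w) + L) + Q" if w: "w \<in> circ" for w
  proof -
    define x y z where "x = remainder d \<epsilon> U bj bk gj gk fj fk w" and "y = remainder d \<epsilon> U bj bk gj gk hj hk w"
      and "z = remainder d \<epsilon> V bj bk kj kk hj hk w"
    have "norm (x - y) \<le> P * (norm (deriv_diff fj hj w) + L)"
      unfolding x_def y_def P L by (rule remainder_diff[OF d b \<sigma> f h w])
    moreover have "norm (y - z) \<le> Q"
      unfolding y_def z_def remainder_linear Q by (rule remainder_bound[OF d b \<sigma> h w])
    ultimately have "norm (x - z) \<le> P * (norm (deriv_diff fj hj w) + L) + Q"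
      using norm_triangle_ineq[of "x - y" "y - z"] by simp
    then have n: "\<bar>Im (x - z)\<bar> \<le> P * (norm (deriv_diff fj hj w) + L) + Q" using abs_Im_le_cmod[of "x - z"] by linarith
    have "Im (of_real (2 * U - gk / d) * w - of_real gj * circle_deriv fj w + x) = 0"
      "Im (of_real (2 * V - kk / d) * w - of_real kj * circle_deriv hj w + z) = 0"
      using F[OF w] H[OF w] unfolding F_component_expand x_def z_def by simp_all
    then have "Im ((of_real (2 * U - gk / d) * w - of_real gj * circle_deriv fj w)
        - (of_real (2 * V - kk / d) * w - of_real kj * circle_deriv hj w)) = - Im (x - z)" by simp
    moreover have "(of_real (2 * U - gk / d) * w - of_real gj * circle_deriv fj w)
        - (of_real (2 * V - kk / d) * w - of_real kj * circle_deriv hj w) = of_real c * w - G w"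
    proof -
      have c: "c = (2 * U - gk / d) - (2 * V - kk / d)" by (simp add: c_def diff_divide_distrib)
      show ?thesis unfolding c G_def deriv_diff_def of_real_diff by (simp add: algebra_simps del: of_real_divide)
    qed
    ultimately have "Im (of_real c * w - G w) = - Im (x - z)" by metis
    then show ?thesis using n by (simp only: abs_minus_cancel)
  qed
  have "((\<lambda>\<theta>. gj * (Im (deriv_diff fj hj (cis \<theta>)) * sin \<theta>) + (gj - kj) * (Im (circle_deriv hj (cis \<theta>)) * sin \<theta>))
      has_integral gj * 0 + (gj - kj) * 0) {0..2*pi}"
    by (intro has_integral_add has_integral_mult_right admissible_diff_facts f h admissible_Im_sin)
  moreover have "gj * (Im (deriv_diff fj hj (cis \<theta>)) * sin \<theta>) + (gj - kj) * (Im (circle_deriv hj (cis \<theta>)) * sin \<theta>)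
      = Im (G (cis \<theta>)) * sin \<theta>" for \<theta>
    by (simp add: G_def algebra_simps)
  ultimately have G: "((\<lambda>\<theta>. Im (G (cis \<theta>)) * sin \<theta>) has_integral 0) {0..2*pi}" by simp
  show c: "\<bar>2 * (U - V) - (gk - kk) / d\<bar> \<le> 3 * P * L + 2 * Q"
    using first_mode_estimate[OF f(1) h(1) PQ(1) L0(1) PQ(2) L0(2) G le] by (simp only: c_def)
  fix w :: complex assume w: "w \<in> circ"
  have "norm (circle_deriv hj w) \<le> 1" using h(1) w by (auto simp: admissible_def)
  then have "\<bar>(gj - kj) * Im (circle_deriv hj w)\<bar> \<le> \<bar>gj - kj\<bar> * 1"
    using abs_Im_le_cmod[of "circle_deriv hj w"] unfolding abs_mult by (intro mult_left_mono) auto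
  moreover have "\<bar>c * Im w\<bar> \<le> \<bar>c\<bar> * 1"
    using abs_Im_le_cmod[of w] w unfolding abs_mult by (intro mult_left_mono) auto
  moreover have "Im (of_real c * w - G w) = c * Im w - gj * Im (deriv_diff fj hj w) - (gj - kj) * Im (circle_deriv hj w)"
    by (simp add: G_def)
  moreover have "\<bar>t\<bar> \<le> A + B + 3 * Q + r"
    if "\<bar>p\<bar> \<le> r * 1" "\<bar>q\<bar> \<le> \<bar>c\<bar> * 1" "s = q - t - p" "\<bar>s\<bar> \<le> A + Q" "\<bar>c\<bar> \<le> B + 2 * Q"
    for p q r s t A B using that by linarith
  ultimately show "\<bar>gj * Im (deriv_diff fj hj w)\<bar> \<le> P * (norm (deriv_diff fj hj w) + L) + 3 * P * L + 3 * Q + \<bar>gj - kj\<bar>"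
    using le[OF w] c[folded c_def] by blast
qed

end

text \<open>\<open>s1\<close> absorbs the remainder in the a priori bound and removes the distance
  of the constants from its own estimate; \<open>s2\<close> keeps gamma_2 above 1/2;
  \<open>s3\<close> makes the final inequality for the derivatives contract by 1/2.\<close>

context
  fixes d \<epsilon> b1 b2 \<sigma> :: real
  assumes d: "0 < d" and b: "0 < b1" "0 < b2" and \<sigma>: "\<sigma> = \<bar>\<epsilon>\<bar> * (b1 + b2)" "\<sigma> \<le> 1/8" "\<sigma> \<le> d/8"
    and s1: "\<sigma> * (remainder_const d * (1 + 4 * d)) \<le> 1/2" and s2: "\<sigma> * (4 * d * remainder_const d * (4 + 1 / d)) \<le> 1/2"
    and s3: "\<sigma> * (24 * (13 + 36 * d) * remainder_lip_const d * (4 + 1 / d)) \<le> 1/2"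
begin

lemma swapped: "\<sigma> = \<bar>\<epsilon>\<bar> * (b2 + b1)"
  using \<sigma>(1) by (simp add: add.commute)

text \<open>The remainder is proportional to S = |U| + 1 + |g|, which is not bounded beforehand. The
  first modes give S <= 2 + 1 / (2 d) + S / 2, hence 4 + 1 / d. The bound g >= 1/2 makes the leading
  term of the second equation control f_2'.\<close>

lemma a_priori:
  assumes f: "admissible f1" "admissible f2" and F: "F_zero d b1 b2 1 \<epsilon> U g (f1, f2)"
  shows "\<bar>U\<bar> + 1 + \<bar>g\<bar> \<le> 4 + 1 / d" "1 / 2 \<le> g"
proof -
  define S E where "S = \<bar>U\<bar> + 1 + \<bar>g\<bar>" and "E = \<sigma> * remainder_const d * S"
  have \<sigma>0: "0 \<le> \<sigma>" using \<sigma>(1) b by simp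
  have E0: "0 \<le> E" using \<sigma>0 remainder_const_pos[OF d] by (simp add: E_def S_def)
  have 1: "\<bar>2 * U - g / d\<bar> \<le> 2 * E"
    unfolding E_def S_def using first_mode_bound[OF d b \<sigma> f, of U 1 g] F by (simp add: F_zero_def F1_def)
  have 2: "\<bar>2 * U - 1 / d\<bar> \<le> 2 * E"
    unfolding E_def S_def using first_mode_bound[OF d b(2,1) swapped \<sigma>(2,3) f(2,1), of U g 1] F
    by (simp add: F_zero_def F2_def add_ac)
  have "\<bar>g / d - 1 / d\<bar> \<le> 4 * E" using 1 2 by linarith
  then have "\<bar>g - 1\<bar> / d \<le> 4 * E" using d by (simp add: diff_divide_distrib[symmetric])
  then have g: "\<bar>g - 1\<bar> \<le> 4 * d * E" using d by (simp add: divide_le_eq mult_ac)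
  define v where "v = 1 / d"
  have v0: "0 < v" using d by (simp add: v_def)
  have U: "\<bar>U\<bar> \<le> v / 2 + E" using 2 v0 unfolding v_def[symmetric] by linarith
  have "E + 4 * d * E = \<sigma> * (remainder_const d * (1 + 4 * d)) * S" by (simp add: E_def algebra_simps)
  also have "\<dots> \<le> 1/2 * S" using s1 by (intro mult_right_mono) (auto simp: S_def)
  finally have "S \<le> 2 + v / 2 + S / 2" using g U unfolding S_def by linarith
  then have "S \<le> 4 + v" by linarith
  then show S: "\<bar>U\<bar> + 1 + \<bar>g\<bar> \<le> 4 + 1 / d" by (simp only: S_def v_def)
  have "4 * d * E = \<sigma> * (4 * d * remainder_const d) * S" by (simp add: E_def)
  also have "\<dots> \<le> \<sigma> * (4 * d * remainder_const d) * (4 + 1 / d)"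
    using S \<sigma>0 d remainder_const_pos[OF d] by (intro mult_left_mono) (auto simp: S_def)
  also have "\<dots> \<le> 1/2" using s2 by (simp only: mult.assoc)
  finally show "1/2 \<le> g" using g by linarith
qed

text \<open>The first modes bound the distance D of the constants by a small multiple of the
  distance L of the derivatives; inserted into the two equations this yields L <= L / 2.\<close>

lemma solutions_agree:
  assumes f: "admissible f1" "admissible f2" and F: "F_zero d b1 b2 1 \<epsilon> U g (f1, f2)"
    and h: "admissible h1" "admissible h2" and H: "F_zero d b1 b2 1 \<epsilon> V k (h1, h2)"
  shows "U = V" "g = k" "\<And>w. w \<in> circ \<Longrightarrow> f1 w = h1 w \<and> f2 w = h2 w"
proof -
  define P Q L E where "P = \<sigma> * remainder_lip_const d * (\<bar>U\<bar> + 1 + \<bar>g\<bar>)" and "Q = \<sigma> * remainder_const d * (\<bar>U - V\<bar> + \<bar>g - k\<bar>)"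
    and "L = deriv_dist f1 h1 + deriv_dist f2 h2" and "E = 3 * P * L + 2 * Q"
  define D where "D = \<bar>U - V\<bar> + \<bar>g - k\<bar>"
  note ap = a_priori[OF f F]
  have \<sigma>0: "0 \<le> \<sigma>" using \<sigma>(1) b by simp
  note C = remainder_const_pos[OF d]
  have L0: "0 \<le> deriv_dist f1 h1" "0 \<le> deriv_dist f2 h2" "0 \<le> L" using deriv_dist_nonneg f h by (auto simp: L_def)
  have P0: "0 \<le> P" and PS: "P \<le> \<sigma> * remainder_lip_const d * (4 + 1 / d)" unfolding P_def using \<sigma>0 C ap by (auto intro!: mult_left_mono)
  have D0: "0 \<le> D" by (simp add: D_def)
  have F': "F_component d \<epsilon> U b1 b2 1 g f1 f2 w = 0" "F_component d \<epsilon> U b2 b1 g 1 f2 f1 w = 0"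
    and H': "F_component d \<epsilon> V b1 b2 1 k h1 h2 w = 0" "F_component d \<epsilon> V b2 b1 k 1 h2 h1 w = 0"
    if "w \<in> circ" for w
    using F H that by (auto simp: F_zero_def F1_def F2_def)
  have e: "P = \<sigma> * remainder_lip_const d * (\<bar>U\<bar> + \<bar>1\<bar> + \<bar>g\<bar>)" "P = \<sigma> * remainder_lip_const d * (\<bar>U\<bar> + \<bar>g\<bar> + \<bar>1\<bar>)"
    "Q = \<sigma> * remainder_const d * (\<bar>U - V\<bar> + \<bar>1 - 1\<bar> + \<bar>g - k\<bar>)" "Q = \<sigma> * remainder_const d * (\<bar>U - V\<bar> + \<bar>g - k\<bar> + \<bar>1 - 1\<bar>)"
    "L = deriv_dist f2 h2 + deriv_dist f1 h1"
    by (simp_all add: P_def Q_def L_def)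
  note m1 = mode_difference[OF d b \<sigma> f h F'(1) H'(1) e(1,3) L_def]
  note m2 = mode_difference[OF d b(2,1) swapped \<sigma>(2,3) f(2,1) h(2,1) F'(2) H'(2) e(2,4,5)]
  have b1: "\<bar>2 * (U - V) - (g - k) / d\<bar> \<le> E" and b2: "\<bar>2 * (U - V)\<bar> \<le> E" using m1(1) m2(1) by (simp_all add: E_def)
  have ab: "\<bar>b\<bar> \<le> 2 * E" if "\<bar>a - b\<bar> \<le> E" "\<bar>a\<bar> \<le> E" for a b using that by linarith
  have UV: "\<bar>U - V\<bar> \<le> E / 2" using b2 unfolding abs_mult by simp
  have "\<bar>(g - k) / d\<bar> \<le> 2 * E" by (rule ab[OF b1 b2])
  then have gk: "\<bar>g - k\<bar> \<le> 2 * d * E" using d by (simp add: divide_le_eq mult_ac)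
  have "\<sigma> * remainder_const d * (1 + 4 * d) \<le> 1/2" using s1 by (simp only: mult.assoc)
  then have QD: "Q * (1 + 4 * d) \<le> 1/2 * D" "Q \<le> 1/2 * D"
  proof -
    assume a: "\<sigma> * remainder_const d * (1 + 4 * d) \<le> 1/2"
    have "Q * (1 + 4 * d) = \<sigma> * remainder_const d * (1 + 4 * d) * D" by (simp add: Q_def D_def)
    also have "\<dots> \<le> 1/2 * D" using a D0 by (rule mult_right_mono)
    finally show 1: "Q * (1 + 4 * d) \<le> 1/2 * D" .
    have "0 \<le> Q * (4 * d)" using \<sigma>0 C d by (simp add: Q_def)
    then show "Q \<le> 1/2 * D" using 1 by (simp add: distrib_left)
  qed
  \<comment> \<open>E / 2 comes from U - V by the second equation, 2 d E from g - k by comparing the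
    two equations.\<close>
  have "D \<le> E / 2 + 2 * d * E" using UV gk by (simp add: D_def)
  also have "\<dots> = (1/2 + 2 * d) * (3 * P * L) + Q * (1 + 4 * d)" by (simp add: E_def algebra_simps)
  finally have "D \<le> 2 * ((1/2 + 2 * d) * (3 * P * L))" using QD(1) by linarith
  also have "\<dots> = (3 + 12 * d) * P * L" by (simp add: algebra_simps)
  finally have DL: "D \<le> (3 + 12 * d) * P * L" .
  \<comment> \<open>13 + 36 d = 1 + 3 + 3 (3 + 12 d): the two terms with P, and 3 Q + y <= 3 D
    estimated by \<open>DL\<close>.\<close>
  define K where "K = (13 + 36 * d) * P"
  have K0: "0 \<le> K" using d P0 by (simp add: K_def)
  have K: "P * (x + L) + 3 * P * L + 3 * Q + y \<le> K * (x + L)" if "0 \<le> x" "y \<le> D" for x y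
  proof -
    have "P * (x + L) + 3 * P * L + 3 * Q + y \<le> P * (x + L) + 3 * (P * L) + 3 * ((3 + 12 * d) * P * L)"
      using QD(2) DL that D0 by simp
    also have "P * L \<le> P * (x + L)" using P0 that by (intro mult_left_mono) auto
    also have "(3 + 12 * d) * P * L \<le> (3 + 12 * d) * P * (x + L)" using P0 d that by (intro mult_left_mono) auto
    finally show ?thesis by (simp add: K_def algebra_simps)
  qed
  have "deriv_dist f1 h1 \<le> 12 * K * L"
  proof (rule deriv_dist_estimate[OF f(1) h(1) K0, where g = 1])
    show "\<bar>1 * Im (deriv_diff f1 h1 w)\<bar> \<le> K * (norm (deriv_diff f1 h1 w) + L)" if "w \<in> circ" for w
      using m1(2)[OF _ _ that] K[of "norm (deriv_diff f1 h1 w)" "\<bar>1 - 1\<bar>"] D0 by simp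
  qed (use L0 in \<open>auto simp: L_def\<close>)
  moreover have "deriv_dist f2 h2 \<le> 12 * K * L"
  proof (rule deriv_dist_estimate[OF f(2) h(2) K0 _ ap(2)])
    show "\<bar>g * Im (deriv_diff f2 h2 w)\<bar> \<le> K * (norm (deriv_diff f2 h2 w) + L)" if "w \<in> circ" for w
      using m2(2)[OF _ _ that] K[of "norm (deriv_diff f2 h2 w)" "\<bar>g - k\<bar>"] by (simp add: D_def)
  qed (use L0 in \<open>auto simp: L_def\<close>)
  ultimately have "L \<le> 24 * K * L" by (simp add: L_def)
  also have "24 * K * L \<le> 1/2 * L"
  proof (rule mult_right_mono[OF _ L0(3)])
    have "24 * K \<le> 24 * ((13 + 36 * d) * (\<sigma> * remainder_lip_const d * (4 + 1 / d)))"
      unfolding K_def using d PS by (intro mult_left_mono) auto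
    also have "\<dots> = \<sigma> * (24 * (13 + 36 * d) * remainder_lip_const d * (4 + 1 / d))" by (simp only: mult_ac)
    finally show "24 * K \<le> 1/2" using s3 by linarith
  qed
  finally have "L = 0" using L0(3) by simp
  then have "D = 0" and z: "deriv_dist f1 h1 = 0" "deriv_dist f2 h2 = 0" using DL D0 L0 by (simp_all add: L_def)
  then show "U = V" "g = k" by (simp_all add: D_def)
  show "f1 w = h1 w \<and> f2 w = h2 w" if "w \<in> circ" for w
    using sup_diff_le[OF d b \<sigma> f(1) h(1) that] sup_diff_le[OF d b \<sigma> f(2) h(2) that] z by simp
qed

end

lemma solution_unique:
  assumes d: "0 < d" and b: "0 < b1" "0 < b2"
  obtains e where "0 < e" and "\<And>\<epsilon> U g f1 f2 V k h1 h2. \<lbrakk>\<bar>\<epsilon>\<bar> \<le> e; admissible f1; admissible f2; admissible h1; admissible h2;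
      F_zero d b1 b2 1 \<epsilon> U g (f1, f2); F_zero d b1 b2 1 \<epsilon> V k (h1, h2)\<rbrakk>
    \<Longrightarrow> U = V \<and> g = k \<and> (\<forall>w\<in>circ. f1 w = h1 w \<and> f2 w = h2 w)"
proof -
  define c1 c2 c3 where "c1 = remainder_const d * (1 + 4 * d)" and "c2 = 4 * d * remainder_const d * (4 + 1 / d)"
    and "c3 = 24 * (13 + 36 * d) * remainder_lip_const d * (4 + 1 / d)"
  have c: "0 < c1" "0 < c2" "0 < c3" unfolding c1_def c2_def c3_def
    using d remainder_const_pos[OF d] by (intro mult_pos_pos add_pos_pos; simp)+
  define s where "s = Min {1/8, d/8, 1 / (2 * c1), 1 / (2 * c2), 1 / (2 * c3)}"
  have s: "0 < s" using d c by (simp add: s_def)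
  have le: "s \<le> 1/8" "s \<le> d/8" "s \<le> 1 / (2 * c1)" "s \<le> 1 / (2 * c2)" "s \<le> 1 / (2 * c3)"
    by (simp_all add: s_def)
  show thesis
  proof (rule that[of "s / (b1 + b2)"])
    show "0 < s / (b1 + b2)" using s b by simp
    fix \<epsilon> U g f1 f2 V k h1 h2
    assume e: "\<bar>\<epsilon>\<bar> \<le> s / (b1 + b2)" and f: "admissible f1" "admissible f2" and h: "admissible h1" "admissible h2"
      and F: "F_zero d b1 b2 1 \<epsilon> U g (f1, f2)" "F_zero d b1 b2 1 \<epsilon> V k (h1, h2)"
    define \<sigma> where "\<sigma> = \<bar>\<epsilon>\<bar> * (b1 + b2)"
    have \<sigma>: "\<sigma> \<le> s" using e b by (simp add: \<sigma>_def le_divide_eq)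
    have *: "\<sigma> * c \<le> 1/2" if "s \<le> 1 / (2 * c)" "0 < c" for c
    proof -
      have "\<sigma> \<le> 1 / (2 * c)" using \<sigma> that(1) by linarith
      then show ?thesis using that(2) by (simp add: le_divide_eq mult_ac)
    qed
    have "\<sigma> \<le> 1/8" "\<sigma> \<le> d/8" using \<sigma> le by linarith+
    note A = d b \<sigma>_def this *[OF le(3) c(1), unfolded c1_def] *[OF le(4) c(2), unfolded c2_def]
      *[OF le(5) c(3), unfolded c3_def] f F(1) h F(2)
    show "U = V \<and> g = k \<and> (\<forall>w\<in>circ. f1 w = h1 w \<and> f2 w = h2 w)"
      using solutions_agree[OF A] by blast
  qed
qed

subsection \<open>Reflection\<close>

text \<open>Negation is half a turn, a shift of the parametrization; the sign is that of d(-t) = -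
  dt.\<close>

lemma circle_mean_reflect: "circle_mean (\<lambda>t. h (- t)) = - circle_mean h"
proof -
  have "(uminus \<circ> circlepath 0 1) x = shiftpath (1/2) (circlepath 0 1) x" for x
  proof -
    have "exp (2 * of_real pi * \<i> * of_real (1 / 2 + x)) = - exp (2 * of_real pi * \<i> * of_real x)"
      by (simp add: exp_add distrib_left)
    moreover have "exp (2 * of_real pi * \<i> * of_real (1 / 2 + x - 1)) = - exp (2 * of_real pi * \<i> * of_real x)"
      by (simp add: exp_add exp_diff distrib_left right_diff_distrib)
    ultimately show ?thesis by (simp add: shiftpath_def circlepath)
  qed
  then have "uminus \<circ> circlepath 0 1 = shiftpath (1/2) (circlepath 0 (1::real))" by (rule ext)
  then have "- contour_integral (circlepath 0 1) (\<lambda>t. h (- t)) = contour_integral (circlepath 0 1) h"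
    using contour_integral_negatepath[of "circlepath 0 1" h]
      contour_integral_shiftpath[of "circlepath 0 1" "1/2" h] by simp
  then have "contour_integral (circlepath 0 1) (\<lambda>t. h (- t)) = - contour_integral (circlepath 0 1) h"
    by (metis minus_minus)
  then show ?thesis by (simp add: circle_mean_def)
qed

lemma reflect_deriv:
  assumes "(f has_field_derivative D) (at (- w) within circ)"
  shows "((\<lambda>w. f (- w)) has_field_derivative - D) (at w within circ)"
proof -
  have i: "uminus ` circ = circ"
  proof (intro equalityI subsetI)
    show "x \<in> uminus ` circ" if "x \<in> circ" for x :: complex
      using that by (intro image_eqI[of _ _ "- x"]) auto
  qed auto
  have "((f \<circ> uminus) has_field_derivative D * - 1) (at w within circ)"
    by (rule DERIV_image_chain) (use assms in \<open>auto simp: i intro!: derivative_eq_intros\<close>)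
  then show ?thesis by (simp add: comp_def)
qed

lemma circle_deriv_reflect:
  assumes "f field_differentiable (at (- w) within circ)" "w \<in> circ"
  shows "circle_deriv (\<lambda>w. f (- w)) w = - circle_deriv f (- w)"
proof -
  obtain D where D: "(f has_field_derivative D) (at (- w) within circ)"
    using assms(1) by (auto simp: field_differentiable_def)
  have "circle_deriv f (- w) = D" by (rule circle_deriv_eq[OF D]) (use assms(2) in simp)
  moreover have "circle_deriv (\<lambda>w. f (- w)) w = - D" by (rule circle_deriv_eq[OF reflect_deriv[OF D] assms(2)])
  ultimately show ?thesis by simp
qed

lemma sup_norm_reflect:
  assumes "\<And>w. w \<in> circ \<Longrightarrow> norm (g w) = norm (f (- w))"
  shows "sup_norm g = sup_norm f"
proof -
  have "(\<lambda>w. norm (g w)) ` circ = (\<lambda>w. norm (f w)) ` circ"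
  proof (intro equalityI subsetI)
    fix x assume "x \<in> (\<lambda>w. norm (g w)) ` circ"
    then obtain w where w: "w \<in> circ" "x = norm (g w)" by blast
    then show "x \<in> (\<lambda>w. norm (f w)) ` circ" using assms by (intro image_eqI[of _ _ "- w"]) auto
  next
    fix x assume "x \<in> (\<lambda>w. norm (f w)) ` circ"
    then obtain w where w: "w \<in> circ" "x = norm (f w)" by blast
    then show "x \<in> (\<lambda>w. norm (g w)) ` circ" using assms[of "- w"] by (intro image_eqI[of _ _ "- w"]) auto
  qed
  then show ?thesis by (simp add: sup_norm_def)
qed

lemma holder_quotients_reflect:
  assumes "\<And>x y. x \<in> circ \<Longrightarrow> y \<in> circ \<Longrightarrow> norm (g x - g y) = norm (f (- x) - f (- y))"
  shows "holder_quotients \<alpha> g = holder_quotients \<alpha> f"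
proof -
  have n: "norm (- x - - y) = norm (x - y)" for x y :: complex by (simp add: norm_minus_commute)
  show ?thesis
  proof (intro equalityI subsetI)
    fix q assume "q \<in> holder_quotients \<alpha> g"
    then obtain x y where q: "q = norm (g x - g y) / norm (x - y) powr \<alpha>" "x \<in> circ" "y \<in> circ" "x \<noteq> y"
      unfolding holder_quotients_def by blast
    then have "q = norm (f (- x) - f (- y)) / norm (- x - - y) powr \<alpha>" using assms n by simp
    moreover have "- x \<in> circ" "- y \<in> circ" "- x \<noteq> - y" using q by auto
    ultimately show "q \<in> holder_quotients \<alpha> f" unfolding holder_quotients_def by blast
  next
    fix q assume "q \<in> holder_quotients \<alpha> f"
    then obtain x y where q: "q = norm (f x - f y) / norm (x - y) powr \<alpha>" "x \<in> circ" "y \<in> circ" "x \<noteq> y"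
      unfolding holder_quotients_def by blast
    then have "q = norm (g (- x) - g (- y)) / norm (- x - - y) powr \<alpha>" using assms[of "- x" "- y"] n by simp
    moreover have "- x \<in> circ" "- y \<in> circ" "- x \<noteq> - y" using q by auto
    ultimately show "q \<in> holder_quotients \<alpha> g" unfolding holder_quotients_def by blast
  qed
qed

lemma X_component_reflect:
  assumes f: "f \<in> X_component \<alpha>"
  shows "(\<lambda>w. f (- w)) \<in> X_component \<alpha>" "holder1_norm \<alpha> (\<lambda>w. f (- w)) = holder1_norm \<alpha> f"
    "\<And>w. w \<in> circ \<Longrightarrow> circle_deriv (\<lambda>w. f (- w)) w = - circle_deriv f (- w)"
proof -
  define g where "g w = f (- w)" for w
  from f obtain A where fd: "\<And>w. w \<in> circ \<Longrightarrow> f field_differentiable (at w within circ)"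
    and fh: "circle_deriv f \<in> holder_space \<alpha>"
    and A: "\<And>w. w \<in> circ \<Longrightarrow> (\<lambda>n. of_real (A (Suc n)) * cnj w ^ Suc n) sums f w"
    unfolding X_component_def holder1_space_def by blast
  show d: "circle_deriv (\<lambda>w. f (- w)) w = - circle_deriv f (- w)" if "w \<in> circ" for w
    by (rule circle_deriv_reflect[OF fd that]) (use that in simp)
  then have d': "circle_deriv g w = - circle_deriv f (- w)" if "w \<in> circ" for w using that by (simp add: g_def[abs_def])
  have q: "holder_quotients \<alpha> (circle_deriv g) = holder_quotients \<alpha> (circle_deriv f)"
    by (rule holder_quotients_reflect) (simp add: d' norm_minus_commute)
  have c: "continuous_on circ (\<lambda>w. - circle_deriv f (- w))"
    by (rule continuous_on_minus, rule continuous_on_compose2[of circ "circle_deriv f" circ uminus])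
       (use fh in \<open>auto simp: holder_space_def intro: continuous_intros\<close>)
  have "continuous_on circ (circle_deriv g)" by (rule iffD2[OF continuous_on_cong[OF refl d'] c])
  then have h: "circle_deriv g \<in> holder_space \<alpha>" using fh q by (simp add: holder_space_def)
  have fg: "g field_differentiable (at w within circ)" if "w \<in> circ" for w
  proof -
    have "- w \<in> circ" using that by simp
    then obtain D where "(f has_field_derivative D) (at (- w) within circ)"
      using fd[of "- w"] unfolding field_differentiable_def by blast
    then show ?thesis using reflect_deriv[of f D w] unfolding g_def field_differentiable_def by blast
  qed
  have s: "(\<lambda>n. of_real ((- 1) ^ Suc n * A (Suc n)) * cnj w ^ Suc n) sums g w" if "w \<in> circ" for w
  proof -
    have e: "of_real (A (Suc n)) * cnj (- w) ^ Suc n = of_real ((- 1) ^ Suc n * A (Suc n)) * cnj w ^ Suc n" for n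
      unfolding complex_cnj_minus power_minus[of "cnj w"] by simp
    have "- w \<in> circ" using that by simp
    from A[OF this] show ?thesis unfolding e g_def .
  qed
  show "(\<lambda>w. f (- w)) \<in> X_component \<alpha>"
    unfolding g_def[abs_def, symmetric] X_component_def holder1_space_def
    using fg h s by (auto intro!: exI[of _ "\<lambda>n. (- 1) ^ n * A n"])
  have "sup_norm g = sup_norm f" by (rule sup_norm_reflect) (simp add: g_def)
  moreover have "sup_norm (circle_deriv g) = sup_norm (circle_deriv f)" by (rule sup_norm_reflect) (simp add: d')
  ultimately show "holder1_norm \<alpha> (\<lambda>w. f (- w)) = holder1_norm \<alpha> f"
    unfolding g_def[abs_def, symmetric] holder1_norm_def holder_norm_def q by simp
qed

text \<open>Reversing epsilon, w and t together leaves epsilon f', epsilon t and epsilon w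
  unchanged, as the derivative of the reflected function changes sign. The first mean changes sign
  along with its factor epsilon, the second mean is unchanged, and the factor w makes each term
  odd.\<close>

lemma F_component_reflect:
  assumes fj: "fj \<in> X_component \<alpha>" and fk: "fk \<in> X_component \<alpha>" and w: "w \<in> circ"
  shows "F_component d (- \<epsilon>) U bj bk gj gk (\<lambda>w. fj (- w)) (\<lambda>w. fk (- w)) w
    = - F_component d \<epsilon> U bj bk gj gk fj fk (- w)"
proof -
  define K where "K t = (let A = t - (- w); B = fj t - fj (- w) in
    (A * cnj B - cnj A * B) / (A * (A + of_real \<epsilon> * of_real bj * B)) * (circle_deriv fj t - B / A))" for t
  define M where "M t = (cnj t + of_real \<epsilon> * of_real bk * cnj (fk t)) * (1 + of_real \<epsilon> * of_real bk * circle_deriv fk t)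
    / (of_real \<epsilon> * (of_real bk * t + of_real bj * (- w))
       + of_real \<epsilon> ^ 2 * (of_real bk ^ 2 * fk t + of_real bj ^ 2 * fj (- w)) - of_real d)" for t
  have K: "circle_mean (\<lambda>t. let A = t - w; B = fj (- t) - fj (- w) in
     (A * cnj B - cnj A * B) / (A * (A + of_real (- \<epsilon>) * of_real bj * B))
       * (circle_deriv (\<lambda>w. fj (- w)) t - B / A)) = - circle_mean K" (is "circle_mean ?K = _")
  proof -
    have "?K t = K (- t)" if "t \<in> circ" for t
    proof -
      define A B where "A = - t - (- w)" and "B = fj (- t) - fj (- w)"
      have A: "t - w = - A" by (simp add: A_def)
      have 1: "- A * (- A + of_real (- \<epsilon>) * of_real bj * B) = A * (A + of_real \<epsilon> * of_real bj * B)"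
        by (simp add: algebra_simps)
      have 2: "- circle_deriv fj (- t) - B / - A = - (circle_deriv fj (- t) - B / A)" by simp
      have 3: "- A * cnj B - cnj (- A) * B = - (A * cnj B - cnj A * B)" by simp
      show ?thesis
        unfolding K_def Let_def X_component_reflect(3)[OF fj that] A A_def[symmetric] B_def[symmetric] 1 2 3
        by (simp only: minus_divide_left[symmetric] minus_mult_minus)
    qed
    then show ?thesis using circle_mean_cong[of ?K "\<lambda>t. K (- t)"] circle_mean_reflect[of K] by simp
  qed
  have M: "circle_mean (\<lambda>t. (cnj t + of_real (- \<epsilon>) * of_real bk * cnj (fk (- t)))
       * (1 + of_real (- \<epsilon>) * of_real bk * circle_deriv (\<lambda>w. fk (- w)) t)
     / (of_real (- \<epsilon>) * (of_real bk * t + of_real bj * w)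
        + of_real (- \<epsilon>) ^ 2 * (of_real bk ^ 2 * fk (- t) + of_real bj ^ 2 * fj (- w))
        - of_real d)) = circle_mean M" (is "circle_mean ?M = _")
  proof -
    have "?M t = - M (- t)" if "t \<in> circ" for t
    proof -
      have "cnj t + of_real (- \<epsilon>) * of_real bk * cnj (fk (- t)) = - (cnj (- t) + of_real \<epsilon> * of_real bk * cnj (fk (- t)))"
        by simp
      moreover have "of_real (- \<epsilon>) * (of_real bk * t + of_real bj * w)
        = of_real \<epsilon> * (of_real bk * (- t) + of_real bj * (- w))" by (simp add: algebra_simps)
      moreover have "of_real (- \<epsilon>) ^ 2 = (of_real \<epsilon> ^ 2 :: complex)" by simp
      moreover have "of_real (- \<epsilon>) * of_real bk * - circle_deriv fk (- t) = of_real \<epsilon> * of_real bk * circle_deriv fk (- t)" by simp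
      ultimately show ?thesis
        unfolding M_def X_component_reflect(3)[OF fk that] by (simp only: mult_minus_left minus_divide_left)
    qed
    then have "circle_mean ?M = circle_mean (\<lambda>t. (\<lambda>t. - M t) (- t))" by (intro circle_mean_cong) simp
    also have "\<dots> = - circle_mean (\<lambda>t. - M t)" by (rule circle_mean_reflect)
    also have "circle_mean (\<lambda>t. - M t) = - circle_mean M" by (simp add: circle_mean_def contour_integral_neg)
    finally show ?thesis by simp
  qed
  show ?thesis
    unfolding F_component_def K M X_component_reflect(3)[OF fj w]
    unfolding K_def[symmetric] M_def[symmetric] by (simp add: algebra_simps)
qed

lemma F_zero_reflect:
  assumes f: "(f1, f2) \<in> X_unit_ball \<alpha>" and F: "F_zero d b1 b2 g1 \<epsilon> U g2 (f1, f2)"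
  shows "(\<lambda>w. f1 (- w), \<lambda>w. f2 (- w)) \<in> X_unit_ball \<alpha>"
    "F_zero d b1 b2 g1 (- \<epsilon>) U g2 (\<lambda>w. f1 (- w), \<lambda>w. f2 (- w))"
proof -
  have f12: "f1 \<in> X_component \<alpha>" "f2 \<in> X_component \<alpha>" using f by (auto simp: X_unit_ball_def X_space_def)
  note r1 = X_component_reflect[OF f12(1)] and r2 = X_component_reflect[OF f12(2)]
  show "(\<lambda>w. f1 (- w), \<lambda>w. f2 (- w)) \<in> X_unit_ball \<alpha>"
    using f r1(1,2) r2(1,2) by (simp add: X_unit_ball_def X_space_def X_norm_def)
  show "F_zero d b1 b2 g1 (- \<epsilon>) U g2 (\<lambda>w. f1 (- w), \<lambda>w. f2 (- w))"
    unfolding F_zero_def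
  proof
    fix w :: complex assume w: "w \<in> circ"
    then have "- w \<in> circ" by simp
    then have "F1 d b1 b2 g1 \<epsilon> U g2 (f1, f2) (- w) = 0 \<and> F2 d b1 b2 g1 \<epsilon> U g2 (f1, f2) (- w) = 0"
      using F unfolding F_zero_def by blast
    then show "F1 d b1 b2 g1 (- \<epsilon>) U g2 (\<lambda>w. f1 (- w), \<lambda>w. f2 (- w)) w = 0 \<and>
        F2 d b1 b2 g1 (- \<epsilon>) U g2 (\<lambda>w. f1 (- w), \<lambda>w. f2 (- w)) w = 0"
      using F_component_reflect[OF f12 w] F_component_reflect[OF f12(2,1) w] by (simp add: F1_def F2_def)
  qed
qed

subsection \<open>Strict convexity\<close>

text \<open>With c the convex combination, the defect of power m + 1 is c times that of power m plus
  t (1 - t) (b - a) (a^m - b^m); and m^2 + m <= (m + 1)^2.\<close>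

lemma convexity_defect_power:
  fixes a b :: complex
  assumes a: "norm a \<le> 1" and b: "norm b \<le> 1" and t: "0 \<le> t" "t \<le> 1"
  shows "norm (((1 - t) *\<^sub>R a + t *\<^sub>R b) ^ m - ((1 - t) *\<^sub>R a ^ m + t *\<^sub>R b ^ m))
    \<le> (real m)\<^sup>2 * (t * (1 - t) * (norm (a - b))\<^sup>2)"
proof (induction m)
  case (Suc m)
  define c E D where "c = (1 - t) *\<^sub>R a + t *\<^sub>R b" and "E = c ^ m - ((1 - t) *\<^sub>R a ^ m + t *\<^sub>R b ^ m)"
    and "D = t * (1 - t) * (norm (a - b))\<^sup>2"
  have D: "0 \<le> D" using t by (simp add: D_def)
  have "norm c \<le> (1 - t) * norm a + t * norm b"
    unfolding c_def using t by (intro order_trans[OF norm_triangle_ineq]) simp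
  also have "\<dots> \<le> (1 - t) * 1 + t * 1" using a b t by (intro add_mono mult_left_mono) auto
  finally have c: "norm c \<le> 1" by simp
  have "c ^ Suc m - ((1 - t) *\<^sub>R a ^ Suc m + t *\<^sub>R b ^ Suc m)
      = c * E + (t * (1 - t)) *\<^sub>R ((b - a) * (a ^ m - b ^ m))"
    unfolding E_def c_def by (simp add: scaleR_conv_of_real algebra_simps)
  moreover have "norm (c * E) \<le> 1 * ((real m)\<^sup>2 * D)"
    unfolding norm_mult using c Suc.IH by (intro mult_mono) (auto simp: E_def c_def D_def)
  moreover have "norm ((t * (1 - t)) *\<^sub>R ((b - a) * (a ^ m - b ^ m))) \<le> real m * D"
  proof -
    have "norm (a ^ m - b ^ m) \<le> real m * norm (a - b)" by (rule norm_power_diff[OF a b])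
    then have "norm (b - a) * norm (a ^ m - b ^ m) \<le> norm (a - b) * (real m * norm (a - b))"
      unfolding norm_minus_commute[of b a] by (intro mult_left_mono) auto
    then have "t * (1 - t) * (norm (b - a) * norm (a ^ m - b ^ m)) \<le> t * (1 - t) * (norm (a - b) * (real m * norm (a - b)))"
      using t by (intro mult_left_mono) auto
    also have "\<dots> = real m * D" by (simp add: D_def power2_eq_square)
    finally show ?thesis using t by (simp add: norm_mult)
  qed
  ultimately have "norm (c ^ Suc m - ((1 - t) *\<^sub>R a ^ Suc m + t *\<^sub>R b ^ Suc m)) \<le> (real m)\<^sup>2 * D + real m * D"
    using norm_triangle_ineq[of "c * E" "(t * (1 - t)) *\<^sub>R ((b - a) * (a ^ m - b ^ m))"] by simp
  also have "\<dots> \<le> (real (Suc m))\<^sup>2 * D"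
    using D by (simp add: power2_eq_square algebra_simps)
  finally show ?case by (simp only: c_def D_def)
qed simp

text \<open>For the squared norm the gain is exactly t (1 - t) |a - b|^2 = 2 r; the root is taken by
  1 - 2 r <= (1 - r)^2.\<close>

lemma norm_convex_combination:
  fixes a b :: "'a::real_inner"
  assumes a: "norm a \<le> 1" and b: "norm b \<le> 1" and t: "0 \<le> t" "t \<le> 1"
  shows "norm ((1 - t) *\<^sub>R a + t *\<^sub>R b) \<le> 1 - t * (1 - t) * (norm (a - b))\<^sup>2 / 2"
proof -
  define r where "r = t * (1 - t) * (norm (a - b))\<^sup>2 / 2"
  have "(norm ((1 - t) *\<^sub>R a + t *\<^sub>R b))\<^sup>2 = (1 - t) * (norm a)\<^sup>2 + t * (norm b)\<^sup>2 - t * (1 - t) * (norm (a - b))\<^sup>2"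
    unfolding power2_norm_eq_inner
    by (simp add: inner_simps inner_commute[of b a] algebra_simps)
  also have "t * (1 - t) * (norm (a - b))\<^sup>2 = 2 * r" by (simp add: r_def)
  also have "(1 - t) * (norm a)\<^sup>2 + t * (norm b)\<^sup>2 - 2 * r \<le> (1 - t) * 1 + t * 1 - 2 * r"
    using a b t by (intro diff_right_mono add_mono mult_left_mono) (auto simp: power_le_one)
  finally have n: "(norm ((1 - t) *\<^sub>R a + t *\<^sub>R b))\<^sup>2 \<le> 1 - 2 * r" by simp
  also have "\<dots> \<le> (1 - r)\<^sup>2" by (simp add: power2_eq_square algebra_simps)
  finally have "(norm ((1 - t) *\<^sub>R a + t *\<^sub>R b))\<^sup>2 \<le> (1 - r)\<^sup>2" .
  moreover have "0 \<le> 1 - r" using order_trans[OF zero_le_power2 n] by simp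
  ultimately show ?thesis unfolding r_def by (rule power2_le_imp_le)
qed

lemma encloses_strictly_convex_perturbation:
  fixes G :: "complex \<Rightarrow> complex"
  assumes lip: "\<And>x y. \<lbrakk>norm x \<le> 1; norm y \<le> 1\<rbrakk> \<Longrightarrow> norm (G x - G y) \<le> 1/8 * norm (x - y)"
    and mid: "\<And>a b t. \<lbrakk>norm a \<le> 1; norm b \<le> 1; 0 \<le> t; t \<le> 1\<rbrakk> \<Longrightarrow>
      norm (G ((1 - t) *\<^sub>R a + t *\<^sub>R b) - ((1 - t) *\<^sub>R G a + t *\<^sub>R G b)) \<le> 1/8 * (t * (1 - t) * (norm (a - b))\<^sup>2)"
  shows "encloses_strictly_convex (\<lambda>z. z + G z)"
proof -
  define \<Phi> where "\<Phi> z = z + G z" for z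
  define C where "C = \<Phi> ` cball 0 1"
  have "continuous_on (cball 0 1) G"
  proof (rule lipschitz_on_continuous_on[of "1/8"], rule lipschitz_onI)
    show "dist (G x) (G y) \<le> 1/8 * dist x y" if "x \<in> cball 0 1" "y \<in> cball 0 1" for x y
      using lip[of x y] that by (simp add: dist_norm)
  qed simp
  then have cont: "continuous_on (cball 0 1) \<Phi>" unfolding \<Phi>_def by (intro continuous_intros)
  have inj: "inj_on \<Phi> (cball 0 1)"
  proof (rule inj_onI)
    fix x y assume "x \<in> cball 0 1" "y \<in> cball 0 1" and e: "\<Phi> x = \<Phi> y"
    then have "norm (G x - G y) \<le> 1/8 * norm (x - y)" by (intro lip) auto
    moreover have "x - y = - (G x - G y)" using e by (simp add: \<Phi>_def algebra_simps)
    then have "norm (x - y) = norm (G x - G y)" by (metis norm_minus_cancel)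
    ultimately show "x = y" by simp
  qed
  have seg: "(1 - t) *\<^sub>R \<Phi> a + t *\<^sub>R \<Phi> b \<in> \<Phi> ` ball 0 1"
    if ab: "norm a \<le> 1" "norm b \<le> 1" "a \<noteq> b" and t: "0 < t" "t < 1" for a b t
  proof -
    define c p r where "c = (1 - t) *\<^sub>R a + t *\<^sub>R b" and "p = (1 - t) *\<^sub>R \<Phi> a + t *\<^sub>R \<Phi> b"
      and "r = t * (1 - t) * (norm (a - b))\<^sup>2 / 2"
    have r: "0 < r" using ab t by (simp add: r_def)
    have c: "norm c \<le> 1 - r" unfolding c_def r_def by (rule norm_convex_combination) (use ab t in auto)
    have sub: "norm z < 1" if "z \<in> cball c (r / 2)" for z
      using that c r norm_triangle_ineq[of c "z - c"] by (simp add: dist_norm norm_minus_commute)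
    have cb: "norm c \<le> 1" using c r by simp
    have "p - c - G c = - (G c - ((1 - t) *\<^sub>R G a + t *\<^sub>R G b))"
      by (simp add: p_def c_def \<Phi>_def algebra_simps)
    then have pc: "norm (p - c - G c) \<le> r / 4"
      using mid[of a b t] ab t by (simp only: norm_minus_cancel c_def r_def) simp
    \<comment> \<open>A preimage of p solves z = p - G z. By \<open>mid\<close>, p - G c is within r
      / 4 of c, and G varies from its value at c by at most r / 16 on the ball of radius r / 2; that
      ball lies in the open disc, so the map contracts it into itself.\<close>
    have "\<exists>!z\<in>cball c (r / 2). p - G z = z"
    proof (rule Banach_fix[of _ "1/8"])
      show "complete (cball c (r / 2))" by (simp add: complete_eq_closed)
      show "cball c (r / 2) \<noteq> {}" using r by simp
      show "(\<lambda>z. p - G z) ` cball c (r / 2) \<subseteq> cball c (r / 2)"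
      proof (intro image_subsetI)
        fix z assume z: "z \<in> cball c (r / 2)"
        then have zc: "norm (c - z) \<le> r / 2" by (simp add: dist_norm)
        have "norm (G c - G z) \<le> 1/8 * norm (c - z)" using sub[OF z] cb by (intro lip) auto
        then have "norm (G c - G z) \<le> r / 16" using zc by linarith
        have e: "p - G z - c = (p - c - G c) + (G c - G z)" by simp
        have "norm (p - G z - c) \<le> r / 2"
          unfolding e using norm_triangle_ineq[of "p - c - G c" "G c - G z"] pc r \<open>norm (G c - G z) \<le> r / 16\<close> by linarith
        then show "p - G z \<in> cball c (r / 2)" by (simp add: dist_norm norm_minus_commute)
      qed
      show "dist (p - G x) (p - G y) \<le> 1/8 * dist x y" if "x \<in> cball c (r / 2)" "y \<in> cball c (r / 2)" for x y
        using lip[of y x] sub[OF that(1)] sub[OF that(2)] by (simp add: dist_norm norm_minus_commute)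
    qed auto
    then obtain z where z: "z \<in> cball c (r / 2)" "p - G z = z" by blast
    then have "\<Phi> z = p" by (simp add: \<Phi>_def algebra_simps)
    then show ?thesis using sub[OF z(1)] unfolding p_def by (intro image_eqI[of _ _ z]) auto
  qed
  have seg': "open_segment x y \<subseteq> \<Phi> ` ball 0 1" if "x \<in> C" "y \<in> C" "x \<noteq> y" for x y
  proof
    fix p assume "p \<in> open_segment x y"
    then obtain t where t: "0 < t" "t < 1" "p = (1 - t) *\<^sub>R x + t *\<^sub>R y" by (auto simp: in_segment)
    obtain a b where ab: "norm a \<le> 1" "norm b \<le> 1" "x = \<Phi> a" "y = \<Phi> b" using \<open>x \<in> C\<close> \<open>y \<in> C\<close> by (auto simp: C_def)
    moreover have "a \<noteq> b" using ab \<open>x \<noteq> y\<close> by auto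
    ultimately show "p \<in> \<Phi> ` ball 0 1" using seg[of a b t] t by simp
  qed
  have bC: "\<Phi> ` ball 0 1 \<subseteq> C" unfolding C_def by (intro image_mono ball_subset_cball)
  have "convex C" unfolding convex_contains_open_segment
  proof (intro ballI)
    fix x y assume "x \<in> C" "y \<in> C"
    then show "open_segment x y \<subseteq> C" using seg'[of x y] bC by (cases "x = y") auto
  qed
  have C: "compact C" unfolding C_def by (intro compact_continuous_image cont compact_cball)
  have o: "open (\<Phi> ` ball 0 1)"
    by (rule invariance_of_domain)
       (use continuous_on_subset[OF cont] inj_on_subset[OF inj] in auto)
  \<comment> \<open>Invariance of domain is used in both directions; applied to the inverse, it
    keeps images of boundary points out of the interior.\<close>
  have int: "interior C = \<Phi> ` ball 0 1"
  proof
    show "\<Phi> ` ball 0 1 \<subseteq> interior C" by (rule interior_maximal[OF bC o])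
    define g where "g = inv_into (cball 0 1) \<Phi>"
    have g: "g (\<Phi> x) = x" if "x \<in> cball 0 1" for x unfolding g_def by (rule inv_into_f_f[OF inj that])
    have gc: "continuous_on C g" unfolding C_def by (rule continuous_on_inv[OF cont compact_cball]) (use g in blast)
    have gi: "inj_on g C" unfolding C_def by (rule inj_onI) (use g in auto)
    have og: "open (g ` interior C)"
      by (rule invariance_of_domain[OF continuous_on_subset[OF gc interior_subset] open_interior inj_on_subset[OF gi interior_subset]])
    have "g ` C \<subseteq> cball 0 1" unfolding C_def using g by auto
    then have "g ` interior C \<subseteq> cball 0 1" using interior_subset[of C] by blast
    from interior_maximal[OF this og] have gb: "g ` interior C \<subseteq> ball 0 1" by (simp only: interior_cball)
    show "interior C \<subseteq> \<Phi> ` ball 0 1"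
    proof
      fix p assume p: "p \<in> interior C"
      then obtain x where x: "x \<in> cball 0 1" "p = \<Phi> x" using interior_subset[of C] by (auto simp: C_def)
      then have "x \<in> ball 0 1" using gb p g[OF x(1)] by (metis image_subset_iff)
      then show "p \<in> \<Phi> ` ball 0 1" using x by blast
    qed
  qed
  have "frontier C = C - \<Phi> ` ball 0 1"
    using compact_imp_closed[OF C] by (simp add: frontier_def int)
  also have "\<dots> = \<Phi> ` (cball 0 1 - ball 0 1)"
    unfolding C_def by (rule inj_on_image_set_diff[OF inj, symmetric]) auto
  also have "cball 0 1 - ball 0 1 = circ" by auto
  \<comment> \<open>For a bounded convex set the inside of the frontier is the interior.\<close>
  finally have ins: "inside (\<Phi> ` circ) = \<Phi> ` ball 0 1"
    using inside_frontier_eq_interior[OF compact_imp_bounded[OF C] \<open>convex C\<close>] int by simp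
  have "strictly_convex (inside (\<Phi> ` circ))"
    unfolding strictly_convex_def ins
  proof (intro ballI impI)
    fix x y assume xy: "x \<in> closure (\<Phi> ` ball 0 1)" "y \<in> closure (\<Phi> ` ball 0 1)" "x \<noteq> y"
    have "closure (\<Phi> ` ball 0 1) \<subseteq> C" by (rule closure_minimal[OF bC compact_imp_closed[OF C]])
    then show "open_segment x y \<subseteq> interior (\<Phi> ` ball 0 1)"
      using seg'[of x y] xy interior_open[OF o] by auto
  qed
  moreover have "circ \<subseteq> cball 0 1" by auto
  ultimately have "encloses_strictly_convex \<Phi>"
    unfolding encloses_strictly_convex_def using continuous_on_subset[OF cont] inj_on_subset[OF inj] by blast
  then show ?thesis by (simp add: \<Phi>_def[abs_def])
qed

lemma encloses_strictly_convex_cong: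
  assumes "\<And>z. z \<in> circ \<Longrightarrow> f z = g z" "encloses_strictly_convex f"
  shows "encloses_strictly_convex g"
proof -
  have "f ` circ = g ` circ" using assms(1) by (intro image_cong) auto
  then show ?thesis
    using assms continuous_on_cong[of circ circ f g] inj_on_cong[of circ f g]
    by (simp only: encloses_strictly_convex_def)
qed

text \<open>Powers of cnj z, unlike those of 1 / z, stay bounded in the disc. The extension is
  antiholomorphic, but only its Lipschitz constant and its convexity defect matter.\<close>

definition disc_ext :: "time_ser \<Rightarrow> complex \<Rightarrow> complex" where
  "disc_ext y z = synth (\<lambda>n. (1 / real (Suc n)) *\<^sub>R cnj z ^ Suc n) y"

lemma wbounded_disc_ext:
  assumes "norm z \<le> 1"
  shows "wbounded (\<lambda>n. (1 / real (Suc n)) *\<^sub>R cnj z ^ Suc n)"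
proof (rule wboundedI[of _ 1])
  fix n
  have "1 / real (Suc n) * norm z ^ Suc n \<le> 1 * 1" using assms by (intro mult_mono power_le_one) auto
  moreover have "norm ((1 / real (Suc n)) *\<^sub>R cnj z ^ Suc n) = 1 / real (Suc n) * norm z ^ Suc n"
    unfolding norm_scaleR norm_power complex_mod_cnj by simp
  ultimately show "norm ((1 / real (Suc n)) *\<^sub>R cnj z ^ Suc n) \<le> 1 * wt n"
    using wt_ge_1[of n] by linarith
qed

lemma pser_eq_disc_ext:
  assumes "w \<in> circ"
  shows "pser y w = disc_ext y w"
proof -
  have "(\<lambda>n. entry y n *\<^sub>R ((1 / real (Suc n)) *\<^sub>R cnj w ^ Suc n)) sums disc_ext y w"
    unfolding disc_ext_def by (rule has_sum_imp_sums[OF synth_has_sum[OF wbounded_disc_ext]]) (use assms in simp)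
  moreover have "entry y n *\<^sub>R ((1 / real (Suc n)) *\<^sub>R cnj w ^ Suc n) = of_real (entry y n / real (Suc n)) * cnj w ^ Suc n" for n
    by (simp add: scaleR_conv_of_real del: of_nat_Suc power_Suc)
  ultimately show ?thesis using sums_unique2[OF pser_sums[OF assms]] by simp
qed

lemma disc_ext_lipschitz:
  assumes x: "norm x \<le> 1" and z: "norm z \<le> 1"
  shows "norm (disc_ext y x - disc_ext y z) \<le> norm (x - z) * norm y"
  unfolding disc_ext_def synth_lincomb[OF wbounded_disc_ext[OF x] wbounded_disc_ext[OF z], symmetric]
proof (rule norm_synth)
  fix n
  have "norm (cnj x ^ Suc n - cnj z ^ Suc n) \<le> real (Suc n) * norm (cnj x - cnj z)"
    by (rule norm_power_diff) (use x z in auto)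
  also have "norm (cnj x - cnj z) = norm (x - z)" by (simp flip: complex_cnj_diff)
  finally have "norm ((1 / real (Suc n)) *\<^sub>R (cnj x ^ Suc n - cnj z ^ Suc n)) \<le> norm (x - z)"
    by (simp add: divide_le_eq mult.commute del: power_Suc of_nat_Suc)
  also have "\<dots> \<le> norm (x - z) * wt n" using mult_left_mono[OF wt_ge_1[of n] norm_ge_zero[of "x - z"]] by simp
  finally show "norm ((1 / real (Suc n)) *\<^sub>R cnj x ^ Suc n - (1 / real (Suc n)) *\<^sub>R cnj z ^ Suc n) \<le> norm (x - z) * wt n"
    by (simp only: scaleR_right_diff_distrib)
qed

text \<open>Power n + 1 has a defect with factor (n + 1)^2; one factor is cancelled by the
  normalization 1 / (n + 1), the other is absorbed by the weight 2^n.\<close>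

lemma disc_ext_defect:
  assumes a: "norm a \<le> 1" and b: "norm b \<le> 1" and t: "0 \<le> t" "t \<le> 1"
  shows "norm (disc_ext y ((1 - t) *\<^sub>R a + t *\<^sub>R b) - ((1 - t) *\<^sub>R disc_ext y a + t *\<^sub>R disc_ext y b))
    \<le> t * (1 - t) * (norm (a - b))\<^sup>2 * norm y"
proof -
  define c where "c = (1 - t) *\<^sub>R a + t *\<^sub>R b"
  define u where "u z n = (1 / real (Suc n)) *\<^sub>R cnj z ^ Suc n" for z n
  define D where "D = t * (1 - t) * (norm (a - b))\<^sup>2"
  have D: "0 \<le> D" using t by (simp add: D_def)
  have "0 \<le> t * (1 - t) * (norm (a - b))\<^sup>2" using t by simp
  then have "norm c \<le> 1" using norm_convex_combination[OF a b t] by (simp add: c_def)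
  then have s: "((\<lambda>n. entry y n *\<^sub>R u z n) has_sum disc_ext y z) UNIV" if "z \<in> {a, b, c}" for z
    unfolding disc_ext_def u_def using that a b by (intro synth_has_sum wbounded_disc_ext) auto
  have "((\<lambda>n. entry y n *\<^sub>R u c n + (- 1) *\<^sub>R ((1 - t) *\<^sub>R (entry y n *\<^sub>R u a n) + t *\<^sub>R (entry y n *\<^sub>R u b n)))
      has_sum (disc_ext y c + (- 1) *\<^sub>R ((1 - t) *\<^sub>R disc_ext y a + t *\<^sub>R disc_ext y b))) UNIV"
    by (intro has_sum_add has_sum_scaleR s) auto
  moreover have "entry y n *\<^sub>R u c n + (- 1) *\<^sub>R ((1 - t) *\<^sub>R (entry y n *\<^sub>R u a n) + t *\<^sub>R (entry y n *\<^sub>R u b n))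
      = entry y n *\<^sub>R (u c n - ((1 - t) *\<^sub>R u a n + t *\<^sub>R u b n))" for n
    by (simp add: algebra_simps)
  moreover have "x + (- 1) *\<^sub>R v = x - v" for x v :: complex by simp
  ultimately have e: "synth (\<lambda>n. u c n - ((1 - t) *\<^sub>R u a n + t *\<^sub>R u b n)) y
      = disc_ext y c - ((1 - t) *\<^sub>R disc_ext y a + t *\<^sub>R disc_ext y b)"
    by (intro synth_eqI) (simp only:)
  show ?thesis
    unfolding c_def[symmetric] e[symmetric] D_def[symmetric]
  proof (rule norm_synth)
    fix n
    have cn: "cnj c = (1 - t) *\<^sub>R cnj a + t *\<^sub>R cnj b" by (simp add: c_def)
    have "u c n - ((1 - t) *\<^sub>R u a n + t *\<^sub>R u b n)
        = (1 / real (Suc n)) *\<^sub>R (cnj c ^ Suc n - ((1 - t) *\<^sub>R cnj a ^ Suc n + t *\<^sub>R cnj b ^ Suc n))"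
      by (simp add: u_def scaleR_right_diff_distrib scaleR_add_right del: power_Suc of_nat_Suc)
    moreover have "norm (cnj c ^ Suc n - ((1 - t) *\<^sub>R cnj a ^ Suc n + t *\<^sub>R cnj b ^ Suc n)) \<le> (real (Suc n))\<^sup>2 * D"
      unfolding cn D_def using convexity_defect_power[of "cnj a" "cnj b" t "Suc n"] a b t
      by (simp flip: complex_cnj_diff del: power_Suc of_nat_Suc)
    ultimately have "norm (u c n - ((1 - t) *\<^sub>R u a n + t *\<^sub>R u b n)) \<le> real (Suc n) * D"
      by (simp add: divide_le_eq power2_eq_square mult_ac del: power_Suc of_nat_Suc)
    also have "real (Suc n) \<le> 2 ^ n"
    proof (induction n)
      case (Suc n)
      have "1 \<le> (2::real) ^ n" by simp
      then show ?case using Suc.IH by simp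
    qed simp
    then have "real (Suc n) * D \<le> D * wt n"
      using D by (simp add: wt_nat_def mult.commute mult_left_mono del: of_nat_Suc)
    finally show "norm (u c n - ((1 - t) *\<^sub>R u a n + t *\<^sub>R u b n)) \<le> D * wt n" .
  qed
qed

lemma encloses_strictly_convex_pser:
  assumes small: "\<bar>\<epsilon> * b\<bar> * norm y \<le> 1/8"
  shows "encloses_strictly_convex (boundary_map \<epsilon> b (pser y))"
proof (rule encloses_strictly_convex_cong)
  define G where "G z = (\<epsilon> * b) *\<^sub>R disc_ext y z" for z
  show "z + G z = boundary_map \<epsilon> b (pser y) z" if "z \<in> circ" for z
    by (simp add: G_def boundary_map_def pser_eq_disc_ext[OF that] scaleR_conv_of_real)
  show "encloses_strictly_convex (\<lambda>z. z + G z)"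
  proof (rule encloses_strictly_convex_perturbation)
    fix x z :: complex assume "norm x \<le> 1" "norm z \<le> 1"
    from mult_left_mono[OF disc_ext_lipschitz[OF this, of y] abs_ge_zero[of "\<epsilon> * b"]]
    have "norm (G x - G z) \<le> (\<bar>\<epsilon> * b\<bar> * norm y) * norm (x - z)"
      unfolding G_def scaleR_right_diff_distrib[symmetric] norm_scaleR by (simp only: mult_ac)
    also have "\<dots> \<le> 1/8 * norm (x - z)" using small by (intro mult_right_mono) auto
    finally show "norm (G x - G z) \<le> 1/8 * norm (x - z)" .
  next
    fix a c :: complex and t :: real assume *: "norm a \<le> 1" "norm c \<le> 1" "0 \<le> t" "t \<le> 1"
    have e: "G ((1 - t) *\<^sub>R a + t *\<^sub>R c) - ((1 - t) *\<^sub>R G a + t *\<^sub>R G c)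
      = (\<epsilon> * b) *\<^sub>R (disc_ext y ((1 - t) *\<^sub>R a + t *\<^sub>R c) - ((1 - t) *\<^sub>R disc_ext y a + t *\<^sub>R disc_ext y c))"
      by (simp add: G_def algebra_simps)
    from mult_left_mono[OF disc_ext_defect[OF *, of y] abs_ge_zero[of "\<epsilon> * b"]]
    have "norm (G ((1 - t) *\<^sub>R a + t *\<^sub>R c) - ((1 - t) *\<^sub>R G a + t *\<^sub>R G c))
      \<le> (\<bar>\<epsilon> * b\<bar> * norm y) * (t * (1 - t) * (norm (a - c))\<^sup>2)"
      unfolding e norm_scaleR by (simp only: mult_ac)
    also have "\<dots> \<le> 1/8 * (t * (1 - t) * (norm (a - c))\<^sup>2)" using small * by (intro mult_right_mono) auto
    finally show "norm (G ((1 - t) *\<^sub>R a + t *\<^sub>R c) - ((1 - t) *\<^sub>R G a + t *\<^sub>R G c))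
      \<le> 1/8 * (t * (1 - t) * (norm (a - c))\<^sup>2)" .
  qed
qed

section \<open>Assembly of the branch, its uniqueness and its convexity\<close>

lemma C1_real_on_mult_left:
  assumes "C1_real_on I u"
  shows "C1_real_on I (\<lambda>x. c * u x)"
proof -
  obtain u' where u: "\<forall>s\<in>I. (u has_real_derivative u' s) (at s within I)" "continuous_on I u'"
    using assms unfolding C1_real_on_def by blast
  have "\<forall>s\<in>I. ((\<lambda>x. c * u x) has_real_derivative c * u' s) (at s within I)"
    using u(1) by (auto intro: DERIV_cmult)
  moreover have "continuous_on I (\<lambda>s. c * u' s)" by (intro continuous_intros u)
  ultimately show ?thesis unfolding C1_real_on_def by (intro exI[of _ "\<lambda>s. c * u' s"] conjI)
qed

lemma X_unit_ball_admissible: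
  assumes "f \<in> X_unit_ball \<alpha>"
  shows "admissible (fst f)" "admissible (snd f)"
  using assms admissible_X_component[of _ \<alpha>] by (auto simp: X_unit_ball_def X_space_def X_norm_def)

text \<open>The fixed point argument only places the branch near the base point; its exact value at
  parameter 0 is found by comparing it with this explicit solution.\<close>

lemma F_zero_at_0:
  assumes d: "0 < d" and b: "0 < b1" "0 < b2"
  shows "admissible (\<lambda>_. 0)" "F_zero d b1 b2 1 0 (1 / (2 * d)) 1 (\<lambda>_. 0, \<lambda>_. 0)"
proof -
  have p0: "pser 0 = (\<lambda>_. 0)" using pser_linear(2)[of 0 0] by (auto simp: fun_eq_iff)
  \<comment> \<open>\<open>admissible\<close> does not mention the Hoelder exponent, so any exponent
    in (0, 1) serves here.\<close>
  have "ppair 0 \<in> X_space (1/2)" "X_norm (1/2) (ppair 0) \<le> 6 * norm (0 :: time_ser \<times> time_ser)"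
    by (rule ppair_X; simp)+
  then have "ppair 0 \<in> X_unit_ball (1/2)" by (simp add: X_unit_ball_def)
  then show admissible: "admissible (\<lambda>_. 0)" using X_unit_ball_admissible(1)[of "ppair 0"] by (simp add: ppair_def p0)
  have "F_component d 0 (1 / (2 * d)) bj bk 1 1 (\<lambda>_. 0) (\<lambda>_. 0) w = 0"
    if "0 < bj" "0 < bk" "w \<in> circ" for bj bk w
  proof -
    have "norm (remainder d 0 (1 / (2 * d)) bj bk 1 1 (\<lambda>_. 0) (\<lambda>_. 0) w) \<le> 0"
      using remainder_bound[OF d that(1,2) _ _ _ admissible admissible that(3), of 0 0] d by simp
    moreover have "circle_deriv (\<lambda>_. 0) w = 0" by (rule circle_deriv_eq[OF _ that(3)]) simp
    ultimately show ?thesis using d unfolding F_component_expand by simp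
  qed
  then show "F_zero d b1 b2 1 0 (1 / (2 * d)) 1 (\<lambda>_. 0, \<lambda>_. 0)"
    using b by (simp add: F_zero_def F1_def F2_def)
qed

text \<open>If gamma_1 = 0, then U = gamma_2 = 0 solves F = 0 with every pair (f_1, f_2), and any
  C^1 curve in the ball that vanishes at parameter 0 is a branch. This is why uniqueness carries the
  proviso \<open>\<gamma>1 \<noteq> 0\<close>.\<close>

theorem proposition4p2:
  fixes \<alpha> b1 b2 d \<gamma>1 :: real
  assumes "0 < \<alpha>" and "\<alpha> < 1" and "0 < b1" and "0 < b2" and "b1 + b2 < d"
  shows "\<exists>\<epsilon>0. 0 < \<epsilon>0 \<and> \<epsilon>0 < 1/2 \<and>
    (\<exists>U \<gamma>2 f.
       solution_branch \<alpha> d b1 b2 \<gamma>1 {-\<epsilon>0..\<epsilon>0} U \<gamma>2 f \<and>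
       (\<gamma>1 \<noteq> 0 \<longrightarrow> (\<forall>V \<delta>2 h. solution_branch \<alpha> d b1 b2 \<gamma>1 {-\<epsilon>0..\<epsilon>0} V \<delta>2 h \<longrightarrow>
          (\<forall>\<epsilon>\<in>{-\<epsilon>0..\<epsilon>0}. V \<epsilon> = U \<epsilon> \<and> \<delta>2 \<epsilon> = \<gamma>2 \<epsilon> \<and>
             (\<forall>w\<in>circ. fst (h \<epsilon>) w = fst (f \<epsilon>) w \<and> snd (h \<epsilon>) w = snd (f \<epsilon>) w)))) \<and>
       (\<forall>\<epsilon>\<in>{-\<epsilon>0..\<epsilon>0} - {0}.
          encloses_strictly_convex (boundary_map \<epsilon> b1 (fst (f \<epsilon>))) \<and>
          encloses_strictly_convex (boundary_map \<epsilon> b2 (snd (f \<epsilon>))))) \<and>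
    (\<forall>\<epsilon> U \<gamma>2 f1 f2. -1/2 < \<epsilon> \<and> \<epsilon> < 1/2 \<and> (f1, f2) \<in> X_unit_ball \<alpha> \<and>
       F_zero d b1 b2 \<gamma>1 \<epsilon> U \<gamma>2 (f1, f2) \<longrightarrow>
       (\<lambda>w. f1 (- w), \<lambda>w. f2 (- w)) \<in> X_unit_ball \<alpha> \<and>
       F_zero d b1 b2 \<gamma>1 (- \<epsilon>) U \<gamma>2 (\<lambda>w. f1 (- w), \<lambda>w. f2 (- w)))"
proof -
  \<comment> \<open>1/8 will bound the branch: times the factor 6 of \<open>ppair_X\<close> it is
    below 1, and it is the smallness that convexity requires once |epsilon| b_j <= 1.\<close>
  have d: "0 < d" "d \<noteq> 0" and eighth: "(0::real) < 1/8" using assms by auto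
  obtain e U G z z' where e: "0 < e"
    and smooth: "\<And>I. I \<subseteq> {-e..e} \<Longrightarrow> C1_real_on I U" "\<And>I. I \<subseteq> {-e..e} \<Longrightarrow> C1_real_on I G"
    and z: "\<And>I x. I \<subseteq> {-e..e} \<Longrightarrow> x \<in> I \<Longrightarrow> (z has_vector_derivative z' x) (at x within I)"
      "\<And>I. I \<subseteq> {-e..e} \<Longrightarrow> continuous_on I z'"
    and small: "\<And>x. \<bar>x\<bar> \<le> e \<Longrightarrow> norm (z x) \<le> 1/8"
    and F: "\<And>x. \<bar>x\<bar> \<le> e \<Longrightarrow> F_zero d b1 b2 1 x (U x) (G x) (ppair (z x))"
  proof (rule analytic_branch[OF d(2) eighth, of b1 b2], goal_cases)
    case (1 e U G z z')
    show ?case by (rule that) (fact 1)+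
  qed
  obtain u where u: "0 < u" and unique: "\<And>\<epsilon> U g f1 f2 V k h1 h2.
      \<lbrakk>\<bar>\<epsilon>\<bar> \<le> u; admissible f1; admissible f2; admissible h1; admissible h2;
        F_zero d b1 b2 1 \<epsilon> U g (f1, f2); F_zero d b1 b2 1 \<epsilon> V k (h1, h2)\<rbrakk>
      \<Longrightarrow> U = V \<and> g = k \<and> (\<forall>w\<in>circ. f1 w = h1 w \<and> f2 w = h2 w)"
  proof (rule solution_unique[OF d(1) assms(3,4)], goal_cases)
    case (1 u)
    show ?case by (rule that) (fact 1)+
  qed
  \<comment> \<open>1/4 keeps the parameter below 1/2, and 1 / (b1 + b2) gives |epsilon| b_j <= 1
    for the convexity estimate.\<close>
  define \<epsilon>0 where "\<epsilon>0 = Min {e, u, 1/4, 1 / (b1 + b2)}"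
  define f where "f x = ppair (z x)" for x
  have \<epsilon>0: "0 < \<epsilon>0" "\<epsilon>0 < 1/2" using e u assms by (auto simp: \<epsilon>0_def)
  have le: "\<epsilon>0 \<le> e" "\<epsilon>0 \<le> u" "\<epsilon>0 \<le> 1 / (b1 + b2)" by (simp_all add: \<epsilon>0_def)
  then have I: "{-\<epsilon>0..\<epsilon>0} \<subseteq> {-e..e}" by auto
  have ball: "f x \<in> X_unit_ball \<alpha>" if "\<bar>x\<bar> \<le> \<epsilon>0" for x
  proof -
    have "norm (z x) \<le> 1/8" using small le that by auto
    then show ?thesis using ppair_X[OF assms(1,2), of "z x"] by (simp add: f_def X_unit_ball_def)
  qed
  have Ff: "F_zero d b1 b2 1 x (U x) (G x) (fst (f x), snd (f x))" if "\<bar>x\<bar> \<le> \<epsilon>0" for x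
    using F[of x] le that by (simp add: f_def)
  note adm_f = X_unit_ball_admissible[OF ball]
  \<comment> \<open>Uniqueness at parameter 0 against the trivial solution.\<close>
  have at0: "U 0 = 1 / (2 * d) \<and> G 0 = 1 \<and> (\<forall>w\<in>circ. fst (f 0) w = 0 \<and> snd (f 0) w = 0)"
    using unique[OF _ adm_f(1) adm_f(2) F_zero_at_0(1)[OF d(1) assms(3,4)] F_zero_at_0(1)[OF d(1) assms(3,4)]
        Ff F_zero_at_0(2)[OF d(1) assms(3,4)]] u \<epsilon>0 by simp
  have branch: "solution_branch \<alpha> d b1 b2 \<gamma>1 {-\<epsilon>0..\<epsilon>0} (\<lambda>x. \<gamma>1 * U x) (\<lambda>x. \<gamma>1 * G x) f"
    unfolding solution_branch_def
  proof (intro conjI ballI)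
    show "C1_real_on {-\<epsilon>0..\<epsilon>0} (\<lambda>x. \<gamma>1 * U x)" "C1_real_on {-\<epsilon>0..\<epsilon>0} (\<lambda>x. \<gamma>1 * G x)"
      by (intro C1_real_on_mult_left smooth I)+
    show "C1_X_on \<alpha> {-\<epsilon>0..\<epsilon>0} f"
      unfolding f_def[abs_def] by (rule C1_X_on_ppair[OF assms(1,2) z(1)[OF I] z(2)[OF I]])
    show "f x \<in> X_unit_ball \<alpha>" if "x \<in> {-\<epsilon>0..\<epsilon>0}" for x using ball that by auto
    show "F_zero d b1 b2 \<gamma>1 x (\<gamma>1 * U x) (\<gamma>1 * G x) (f x)" if "x \<in> {-\<epsilon>0..\<epsilon>0}" for x
      using F_zero_scale[OF Ff, of x \<gamma>1] that by (simp add: abs_le_iff)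
  qed (use at0 in auto)
  have uniq: "V x = \<gamma>1 * U x \<and> \<delta>2 x = \<gamma>1 * G x \<and> (\<forall>w\<in>circ. fst (h x) w = fst (f x) w \<and> snd (h x) w = snd (f x) w)"
    if "\<gamma>1 \<noteq> 0" and S: "solution_branch \<alpha> d b1 b2 \<gamma>1 {-\<epsilon>0..\<epsilon>0} V \<delta>2 h" and x: "x \<in> {-\<epsilon>0..\<epsilon>0}" for V \<delta>2 h x
  proof -
    have x': "\<bar>x\<bar> \<le> \<epsilon>0" "\<bar>x\<bar> \<le> u" using x le by auto
    have "h x \<in> X_unit_ball \<alpha>" and H: "F_zero d b1 b2 \<gamma>1 x (V x) (\<delta>2 x) (h x)"
      using S x unfolding solution_branch_def by blast+
    note adm_h = X_unit_ball_admissible[OF \<open>h x \<in> X_unit_ball \<alpha>\<close>]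
    have "F_zero d b1 b2 1 x (1 / \<gamma>1 * V x) (1 / \<gamma>1 * \<delta>2 x) (fst (h x), snd (h x))"
      using F_zero_scale[OF H, of "1 / \<gamma>1"] \<open>\<gamma>1 \<noteq> 0\<close> by simp
    from unique[OF x'(2) adm_h adm_f[OF x'(1) ] this Ff[OF x'(1)]]
    show ?thesis using \<open>\<gamma>1 \<noteq> 0\<close> by (auto simp: field_simps)
  qed
  have conv: "encloses_strictly_convex (boundary_map x b1 (fst (f x)))"
    "encloses_strictly_convex (boundary_map x b2 (snd (f x)))" if "\<bar>x\<bar> \<le> \<epsilon>0" for x
  proof -
    have "\<bar>x\<bar> \<le> 1 / (b1 + b2)" using that le by linarith
    then have "\<bar>x\<bar> * (b1 + b2) \<le> 1" using assms by (simp add: le_divide_eq)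
    moreover have "0 \<le> \<bar>x\<bar> * b1" "0 \<le> \<bar>x\<bar> * b2" using assms by simp_all
    ultimately have "\<bar>x\<bar> * b1 \<le> 1" "\<bar>x\<bar> * b2 \<le> 1" by (simp_all add: distrib_left del: zero_le_mult_iff)
    then have xb: "\<bar>x * b1\<bar> \<le> 1" "\<bar>x * b2\<bar> \<le> 1" using assms by (simp_all add: abs_mult)
    have "norm (z x) \<le> 1/8" using small le that by auto
    then have zx: "norm (fst (z x)) \<le> 1/8" "norm (snd (z x)) \<le> 1/8"
      using norm_fst_le[of "fst (z x)" "snd (z x)"] norm_snd_le[of "snd (z x)" "fst (z x)"] by simp_all
    have "\<bar>x * b1\<bar> * norm (fst (z x)) \<le> 1 * (1/8)" "\<bar>x * b2\<bar> * norm (snd (z x)) \<le> 1 * (1/8)"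
      by (rule mult_mono; use xb zx in simp)+
    then show "encloses_strictly_convex (boundary_map x b1 (fst (f x)))"
      "encloses_strictly_convex (boundary_map x b2 (snd (f x)))"
      unfolding f_def ppair_def by (simp_all add: encloses_strictly_convex_pser)
  qed
  show ?thesis
  proof (intro exI[of _ \<epsilon>0] conjI \<epsilon>0)
    show "\<exists>U \<gamma>2 f. solution_branch \<alpha> d b1 b2 \<gamma>1 {-\<epsilon>0..\<epsilon>0} U \<gamma>2 f \<and>
       (\<gamma>1 \<noteq> 0 \<longrightarrow> (\<forall>V \<delta>2 h. solution_branch \<alpha> d b1 b2 \<gamma>1 {-\<epsilon>0..\<epsilon>0} V \<delta>2 h \<longrightarrow>
          (\<forall>\<epsilon>\<in>{-\<epsilon>0..\<epsilon>0}. V \<epsilon> = U \<epsilon> \<and> \<delta>2 \<epsilon> = \<gamma>2 \<epsilon> \<and>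
             (\<forall>w\<in>circ. fst (h \<epsilon>) w = fst (f \<epsilon>) w \<and> snd (h \<epsilon>) w = snd (f \<epsilon>) w)))) \<and>
       (\<forall>\<epsilon>\<in>{-\<epsilon>0..\<epsilon>0} - {0}.
          encloses_strictly_convex (boundary_map \<epsilon> b1 (fst (f \<epsilon>))) \<and>
          encloses_strictly_convex (boundary_map \<epsilon> b2 (snd (f \<epsilon>))))"
      by (intro exI[of _ "\<lambda>x. \<gamma>1 * U x"] exI[of _ "\<lambda>x. \<gamma>1 * G x"] exI[of _ f] conjI branch impI allI ballI)
         (use uniq conv in \<open>auto simp: abs_le_iff\<close>)
    show "\<forall>\<epsilon> U \<gamma>2 f1 f2. -1/2 < \<epsilon> \<and> \<epsilon> < 1/2 \<and> (f1, f2) \<in> X_unit_ball \<alpha> \<and>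
       F_zero d b1 b2 \<gamma>1 \<epsilon> U \<gamma>2 (f1, f2) \<longrightarrow>
       (\<lambda>w. f1 (- w), \<lambda>w. f2 (- w)) \<in> X_unit_ball \<alpha> \<and>
       F_zero d b1 b2 \<gamma>1 (- \<epsilon>) U \<gamma>2 (\<lambda>w. f1 (- w), \<lambda>w. f2 (- w))"
      using F_zero_reflect by blast
  qed
qed

end
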